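(* Let $R$ be a regular Noetherian domain of characteristic $2$. Let $P$ be a bounded complex of finitely generated free $R$-modules or, more generally, a differential $R$-module admitting a finite projective flag. If $H(P)\neq 0$, then $$\operatorname{rank}_R(P)\ \ge\ 2^{\operatorname{codim}_R H(P)}.$$
   Context: A differential $R$-module is an $R$-module $P$ with an $R$-linear endomorphism $d_P$ such that $d_P^2=0$; no grading is assumed. Its homology is $H(P)=\ker d_P/\operatorname{im} d_P$. A (finite) projective flag on $P$ is a finite filtration $0=P^0\subset P^1\subset\cdots\subset P^r=P$ by direct summands (as $R$-modules) whose subquotients $P^i/P^{i-1}$ are finitely generated projective and such that $d_P(P^i)\subseteq P^{i-1}$ for all $i$. Then the underlying module of $P$ is finitely generated projective, and $\operatorname{rank}_R(P)$ denotes its rank (constant because $R$ is a domain). A bounded complex $P_\bullet$ of finitely generated free modules is regarded as the differential module $\bigoplus_i P_i$ with the induced differential, so that $\operatorname{rank}_R(P)=\sum_i\operatorname{rank}_R P_i$ and $H(P)=\bigoplus_i H_i(P_\bullet)$. For a nonzero finitely generated $R$-module $N$, $\operatorname{codim}_R N=\min\{\operatorname{ht}\mathfrak q : \mathfrak q\in\operatorname{Supp}_R N\}$. *)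

theory Defs
  imports "HOL-Algebra.Algebra" "HOL-Library.Extended_Nat"
begin

section \<open>Modules\<close>

text \<open>
  A module record extends a ring record. Its fields \<open>mult\<close> and \<open>one\<close> carry no information
  (the locale \<^locale>\<open>module\<close> ignores them), so the constructions below leave them undefined.
\<close>

definition module_iso ::
    "('a, 'm) ring_scheme \<Rightarrow> ('a, 'b, 'n) module_scheme \<Rightarrow> ('a, 'c, 'k) module_scheme \<Rightarrow> ('b \<Rightarrow> 'c) \<Rightarrow> bool"
  where "module_iso R M N f \<longleftrightarrow>
    bij_betw f (carrier M) (carrier N) \<and>
    (\<forall>x\<in>carrier M. \<forall>y\<in>carrier M. f (x \<oplus>\<^bsub>M\<^esub> y) = f x \<oplus>\<^bsub>N\<^esub> f y) \<and>
    (\<forall>r\<in>carrier R. \<forall>x\<in>carrier M. f (r \<odot>\<^bsub>M\<^esub> x) = r \<odot>\<^bsub>N\<^esub> f x)"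

definition quot_module ::
    "('a, 'b, 'n) module_scheme \<Rightarrow> 'b set \<Rightarrow> ('a, 'b set) module"
  where "quot_module M N =
    \<lparr>carrier = a_rcosets\<^bsub>M\<^esub> N, monoid.mult = undefined, one = undefined,
     ring.zero = N, add = set_add M,
     smult = (\<lambda>r C. \<Union>x\<in>C. N +>\<^bsub>M\<^esub> (r \<odot>\<^bsub>M\<^esub> x))\<rparr>"

definition direct_summand ::
    "('a, 'm) ring_scheme \<Rightarrow> ('a, 'b, 'n) module_scheme \<Rightarrow> 'b set \<Rightarrow> bool"
  where "direct_summand R M A \<longleftrightarrow> submodule A R M \<and>
    (\<exists>B. submodule B R M \<and> A <+>\<^bsub>M\<^esub> B = carrier M \<and> A \<inter> B = {\<zero>\<^bsub>M\<^esub>})"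

definition power_module :: "('a, 'm) ring_scheme \<Rightarrow> nat \<Rightarrow> ('a, nat \<Rightarrow> 'a) module"
  where "power_module R n =
    \<lparr>carrier = {..<n} \<rightarrow>\<^sub>E carrier R, monoid.mult = undefined, one = undefined,
     ring.zero = (\<lambda>i\<in>{..<n}. \<zero>\<^bsub>R\<^esub>),
     add = (\<lambda>f g. \<lambda>i\<in>{..<n}. f i \<oplus>\<^bsub>R\<^esub> g i),
     smult = (\<lambda>r f. \<lambda>i\<in>{..<n}. r \<otimes>\<^bsub>R\<^esub> f i)\<rparr>"

definition fg_projective :: "('a, 'm) ring_scheme \<Rightarrow> ('a, 'b, 'n) module_scheme \<Rightarrow> bool"
  where "fg_projective R M \<longleftrightarrow>
    (\<exists>n A f. direct_summand R (power_module R n) A \<and>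
             module_iso R M ((power_module R n)\<lparr>carrier := A\<rparr>) f)"

definition free_of_rank :: "('a, 'm) ring_scheme \<Rightarrow> ('a, 'b, 'n) module_scheme \<Rightarrow> nat \<Rightarrow> bool"
  where "free_of_rank R M n \<longleftrightarrow>
    (\<exists>b \<in> {..<n} \<rightarrow> carrier M. \<forall>x\<in>carrier M.
       \<exists>!c. c \<in> {..<n} \<rightarrow>\<^sub>E carrier R \<and> x = (\<Oplus>\<^bsub>M\<^esub>i\<in>{..<n}. c i \<odot>\<^bsub>M\<^esub> b i))"


section \<open>Localization at a prime\<close>

text \<open>
  The fraction \<open>m/s\<close> is the class of all pairs \<open>(m', s')\<close> for which some \<open>u\<close> outside \<open>q\<close>
  satisfies \<open>u s' m = u s m'\<close>. Operations on classes are unions over representatives; all the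
  sets in such a union coincide.
\<close>

definition loc_frac ::
    "('a, 'm) ring_scheme \<Rightarrow> 'a set \<Rightarrow> ('a, 'b, 'n) module_scheme \<Rightarrow> 'b \<Rightarrow> 'a \<Rightarrow> ('b \<times> 'a) set"
  where "loc_frac R q M m s =
    {(m', s') \<in> carrier M \<times> (carrier R - q).
       \<exists>u \<in> carrier R - q. u \<odot>\<^bsub>M\<^esub> (s' \<odot>\<^bsub>M\<^esub> m) = u \<odot>\<^bsub>M\<^esub> (s \<odot>\<^bsub>M\<^esub> m')}"

definition module_at ::
    "('a, 'm) ring_scheme \<Rightarrow> 'a set \<Rightarrow> ('a, 'b, 'n) module_scheme \<Rightarrow>
     (('a \<times> 'a) set, ('b \<times> 'a) set) module"
  where "module_at R q M =
    \<lparr>carrier = {loc_frac R q M m s |m s. m \<in> carrier M \<and> s \<in> carrier R - q},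
     monoid.mult = undefined, one = undefined,
     ring.zero = loc_frac R q M \<zero>\<^bsub>M\<^esub> \<one>\<^bsub>R\<^esub>,
     add = (\<lambda>U V. \<Union>(m, s)\<in>U. \<Union>(n, t)\<in>V.
              loc_frac R q M (t \<odot>\<^bsub>M\<^esub> m \<oplus>\<^bsub>M\<^esub> s \<odot>\<^bsub>M\<^esub> n) (s \<otimes>\<^bsub>R\<^esub> t)),
     smult = (\<lambda>U V. \<Union>(a, s)\<in>U. \<Union>(n, t)\<in>V. loc_frac R q M (a \<odot>\<^bsub>M\<^esub> n) (s \<otimes>\<^bsub>R\<^esub> t))\<rparr>"

definition self_module :: "('a, 'm) ring_scheme \<Rightarrow> ('a, 'a) module"
  where "self_module R =
    \<lparr>carrier = carrier R, monoid.mult = monoid.mult R, one = \<one>\<^bsub>R\<^esub>, ring.zero = \<zero>\<^bsub>R\<^esub>,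
     add = add R, smult = monoid.mult R\<rparr>"

text \<open>The elements of the ring \<open>R\<^sub>q\<close> are those of the localization at \<open>q\<close> of the module \<open>R\<close>.\<close>

definition ring_at :: "('a, 'm) ring_scheme \<Rightarrow> 'a set \<Rightarrow> ('a \<times> 'a) set ring"
  where "ring_at R q = (let L = module_at R q (self_module R) in
    \<lparr>carrier = carrier L, monoid.mult = smult L, one = loc_frac R q (self_module R) \<one>\<^bsub>R\<^esub> \<one>\<^bsub>R\<^esub>,
     ring.zero = ring.zero L, add = add L\<rparr>)"


section \<open>Height, dimension, regularity\<close>

definition prime_chain :: "('a, 'm) ring_scheme \<Rightarrow> (nat \<Rightarrow> 'a set) \<Rightarrow> nat \<Rightarrow> bool"
  where "prime_chain R c n \<longleftrightarrow> (\<forall>i\<le>n. primeideal (c i) R) \<and> (\<forall>i<n. c i \<subset> c (Suc i))"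

definition height :: "('a, 'm) ring_scheme \<Rightarrow> 'a set \<Rightarrow> enat"
  where "height R q = Sup {enat n |n. \<exists>c. prime_chain R c n \<and> c n = q}"

definition krull_dim :: "('a, 'm) ring_scheme \<Rightarrow> enat"
  where "krull_dim R = Sup {enat n |n. \<exists>c. prime_chain R c n}"

definition regular_local_ring :: "('a, 'm) ring_scheme \<Rightarrow> bool"
  where "regular_local_ring A \<longleftrightarrow> cring A \<and> noetherian_ring A \<and>
    (\<exists>\<mm>. (\<forall>I. maximalideal I A \<longleftrightarrow> I = \<mm>) \<and>
         (\<exists>S \<subseteq> carrier A. finite S \<and> enat (card S) = krull_dim A \<and> Idl\<^bsub>A\<^esub> S = \<mm>))"

definition regular_ring :: "('a, 'm) ring_scheme \<Rightarrow> bool"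
  where "regular_ring R \<longleftrightarrow> cring R \<and> noetherian_ring R \<and>
    (\<forall>q. primeideal q R \<longrightarrow> regular_local_ring (ring_at R q))"

text \<open>\<^const>\<open>group.ord\<close> is \<open>0\<close> on elements of infinite order.\<close>

definition ring_char :: "('a, 'm) ring_scheme \<Rightarrow> nat"
  where "ring_char R = group.ord (add_monoid R) \<one>\<^bsub>R\<^esub>"


section \<open>Support, codimension, rank\<close>

definition module_support :: "('a, 'm) ring_scheme \<Rightarrow> ('a, 'b, 'n) module_scheme \<Rightarrow> 'a set set"
  where "module_support R M =
    {q. primeideal q R \<and> carrier (module_at R q M) \<noteq> {\<zero>\<^bsub>module_at R q M\<^esub>}}"

definition codim :: "('a, 'm) ring_scheme \<Rightarrow> ('a, 'b, 'n) module_scheme \<Rightarrow> enat"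
  where "codim R M = (INF q\<in>module_support R M. height R q)"

text \<open>The common rank of the free modules \<open>M\<^sub>q\<close>, for \<open>M\<close> finitely generated projective of constant rank.\<close>

definition module_rank :: "('a, 'm) ring_scheme \<Rightarrow> ('a, 'b, 'n) module_scheme \<Rightarrow> nat"
  where "module_rank R M =
    (THE n. \<forall>q. primeideal q R \<longrightarrow> free_of_rank (ring_at R q) (module_at R q M) n)"


section \<open>Differential modules\<close>

definition differential_module ::
    "('a, 'm) ring_scheme \<Rightarrow> ('a, 'b, 'n) module_scheme \<Rightarrow> ('b \<Rightarrow> 'b) \<Rightarrow> bool"
  where "differential_module R P d \<longleftrightarrow> module R P \<and> d \<in> carrier P \<rightarrow> carrier P \<and>
    (\<forall>x\<in>carrier P. \<forall>y\<in>carrier P. d (x \<oplus>\<^bsub>P\<^esub> y) = d x \<oplus>\<^bsub>P\<^esub> d y) \<and>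
    (\<forall>r\<in>carrier R. \<forall>x\<in>carrier P. d (r \<odot>\<^bsub>P\<^esub> x) = r \<odot>\<^bsub>P\<^esub> d x) \<and>
    (\<forall>x\<in>carrier P. d (d x) = \<zero>\<^bsub>P\<^esub>)"

definition homology :: "('a, 'b, 'n) module_scheme \<Rightarrow> ('b \<Rightarrow> 'b) \<Rightarrow> ('a, 'b set) module"
  where "homology P d =
    quot_module (P\<lparr>carrier := {x \<in> carrier P. d x = \<zero>\<^bsub>P\<^esub>}\<rparr>) (d ` carrier P)"

definition has_projective_flag ::
    "('a, 'm) ring_scheme \<Rightarrow> ('a, 'b, 'n) module_scheme \<Rightarrow> ('b \<Rightarrow> 'b) \<Rightarrow> bool"
  where "has_projective_flag R P d \<longleftrightarrow>
    (\<exists>(r::nat) F. F 0 = {\<zero>\<^bsub>P\<^esub>} \<and> F r = carrier P \<and>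
       (\<forall>i\<le>r. direct_summand R P (F i)) \<and>
       (\<forall>i<r. F i \<subseteq> F (Suc i) \<and>
              fg_projective R (quot_module (P\<lparr>carrier := F (Suc i)\<rparr>) (F i)) \<and>
              d ` F (Suc i) \<subseteq> F i))"

text \<open>
  \<open>P\<close> is the total differential module of a bounded complex of finitely generated free modules:
  \<open>P\<close> is the direct sum of its submodules \<open>Q i\<close>, and \<open>d\<close> restricts to maps from \<open>Q i\<close> to \<open>Q (i - 1)\<close>.
\<close>

definition is_bounded_free_complex ::
    "('a, 'm) ring_scheme \<Rightarrow> ('a, 'b, 'n) module_scheme \<Rightarrow> ('b \<Rightarrow> 'b) \<Rightarrow> bool"
  where "is_bounded_free_complex R P d \<longleftrightarrow>
    (\<exists>(a::int) b Q.
       (\<forall>i. submodule (Q i) R P \<and> (\<exists>n. free_of_rank R (P\<lparr>carrier := Q i\<rparr>) n)) \<and>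
       (\<forall>i. i \<notin> {a..b} \<longrightarrow> Q i = {\<zero>\<^bsub>P\<^esub>}) \<and>
       (\<forall>x\<in>carrier P. \<exists>!y. y \<in> (\<Pi>\<^sub>E i\<in>{a..b}. Q i) \<and> x = (\<Oplus>\<^bsub>P\<^esub>i\<in>{a..b}. y i)) \<and>
       (\<forall>i. d ` Q i \<subseteq> Q (i - 1)))"

end

theory Submission
  imports Defs "HOL-Library.Function_Algebras" "HOL-Library.Poly_Mapping" "HOL-Library.Z2"
begin

text \<open>
  Let \<open>q\<close> in the support of \<open>H(P)\<close> have minimal height \<open>c\<close>, and localize at \<open>q\<close>. Then \<open>H(P)\<close> has finite
  length \<open>h > 0\<close>. By regularity \<open>q\<close> is generated by \<open>c\<close> elements, so \<open>R/q\<^bsup>[2^i]\<^esup>\<close>, the quotient by the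
  ideal generated by the \<open>2\<^sup>i\<close>-th powers, has length at most \<open>2\<^sup>c\<^sup>i\<close>. A chain of \<open>c + 1\<close> primes ending at \<open>q\<close>
  forces growth of this order, and since the lengths are submultiplicative, equality holds. Hence
  Frobenius is flat and multiplies lengths by \<open>2\<^sup>c\<close>; in particular the Frobenius twist of \<open>H(P)\<close> has
  length \<open>2\<^sup>c h\<close>.

  The module \<open>P\<close> becomes free of rank \<open>n\<close>, with \<open>d\<close> given by a strictly triangular matrix. Let \<open>\<tau>\<close> be the
  swap on \<open>P \<otimes> P\<close>. In characteristic 2, \<open>d \<otimes> 1 + 1 \<otimes> d + t (1 + \<tau>)\<close> is a differential on
  \<open>(P \<otimes> P)[t]/t\<^sup>N\<close>. Filtering by powers of \<open>t\<close> and by the flag on the second factor shows that its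
  homology has length at most \<open>N n h\<close>. On the other hand the classes of \<open>z \<otimes> z\<close>, for cycles \<open>z\<close> of \<open>P\<close>,
  span a copy of the Frobenius twist of \<open>H(P)\<close> in all but boundedly many powers of \<open>t\<close>, which
  contributes length at least \<open>(N - \<kappa>) 2\<^sup>c h\<close> with \<open>\<kappa>\<close> independent of \<open>N\<close>. Letting \<open>N\<close> grow gives
  \<open>n \<ge> 2\<^sup>c\<close>.
\<close>

section \<open>Saturated submodules and length\<close>

text \<open>The map from z to z \<otimes> z is semilinear over squaring and additive up to (1 +
  \<tau>)(z \<otimes> z'), which becomes a boundary once it is multiplied by t. This is what the
  variable t is for: it lets a Frobenius twist live inside a complex that costs only n copies of the
  homology per power of t. Truncation at t^N keeps all lengths finite but spoils both ends. At the
  top a bounding chain can leak past t^N; triangularity allows the leak to be pushed back through at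
  most 2n powers. At the bottom t^0 is left out, since no term with a factor t arrives there. Hence
  \<kappa> = 2n + 1.

  Flatness of Frobenius is extracted from a count: exact multiplication of lengths forces the kernel
  of a matrix to commute with Frobenius modulo submodules of finite colength, and the Artin-Rees
  lemma together with Krull's intersection theorem removes the finite colength. Flatness is what
  turns a symmetric cycle with vanishing diagonal back into relations between cycles of P.\<close>

definition is_ideal :: "'t::comm_ring_1 set \<Rightarrow> bool"
  where "is_ideal I \<longleftrightarrow> 0 \<in> I \<and> (\<forall>a\<in>I. \<forall>b\<in>I. a + b \<in> I) \<and> (\<forall>r. \<forall>a\<in>I. r * a \<in> I)"

definition is_prime :: "'t::comm_ring_1 set \<Rightarrow> bool"
  where "is_prime p \<longleftrightarrow> is_ideal p \<and> 1 \<notin> p \<and> (\<forall>a b. a * b \<in> p \<longrightarrow> a \<in> p \<or> b \<in> p)"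

text \<open>
  Localization at \<open>Q\<close> is replaced by saturation: the submodules of a localized module \<open>M\<^sub>Q\<close>
  correspond to the submodules of \<open>M\<close> that absorb division by elements outside \<open>Q\<close>.
\<close>

definition lsub :: "'t::comm_ring_1 set \<Rightarrow> ('t \<Rightarrow> 'v::ab_group_add \<Rightarrow> 'v) \<Rightarrow> 'v set \<Rightarrow> bool"
  where "lsub Q s N \<longleftrightarrow> 0 \<in> N \<and> (\<forall>x\<in>N. \<forall>y\<in>N. x + y \<in> N) \<and> (\<forall>c. \<forall>x\<in>N. s c x \<in> N) \<and>
    (\<forall>u v. u \<notin> Q \<longrightarrow> s u v \<in> N \<longrightarrow> v \<in> N)"

text \<open>The saturation of \<open>N + L\<close>, the counterpart of a sum of localized
  submodules; a plain sum of saturated submodules need not be saturated.\<close>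

definition lsum :: "'t::comm_ring_1 set \<Rightarrow> ('t \<Rightarrow> 'v::ab_group_add \<Rightarrow> 'v) \<Rightarrow> 'v set \<Rightarrow> 'v set \<Rightarrow> 'v set"
  where "lsum Q s N L = {v. \<exists>u x y. u \<notin> Q \<and> x \<in> N \<and> y \<in> L \<and> s u v = x + y}"

text \<open>The saturated submodule generated by \<open>E\<close>. As an intersection it gives
  containments by checking generators alone.\<close>

definition lhull :: "'t::comm_ring_1 set \<Rightarrow> ('t \<Rightarrow> 'v::ab_group_add \<Rightarrow> 'v) \<Rightarrow> 'v set \<Rightarrow> 'v set"
  where "lhull Q s E = {v. \<forall>N. lsub Q s N \<longrightarrow> E \<subseteq> N \<longrightarrow> v \<in> N}"

definition chn :: "'t::comm_ring_1 set \<Rightarrow> ('t \<Rightarrow> 'v::ab_group_add \<Rightarrow> 'v) \<Rightarrow> 'v set \<Rightarrow> 'v set \<Rightarrow> nat \<Rightarrow> bool"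
  where "chn Q s V U k \<longleftrightarrow> (\<exists>W. (\<forall>i\<le>k. lsub Q s (W i) \<and> V \<subseteq> W i \<and> W i \<subseteq> U) \<and> (\<forall>i<k. W i \<subset> W (Suc i)))"

text \<open>The length of the localization of \<open>U/V\<close> at \<open>Q\<close>. Chains are not
  asked to start at \<open>V\<close> or to end at \<open>U\<close>, so monotonicity in both
  arguments is immediate.\<close>

definition len :: "'t::comm_ring_1 set \<Rightarrow> ('t \<Rightarrow> 'v::ab_group_add \<Rightarrow> 'v) \<Rightarrow> 'v set \<Rightarrow> 'v set \<Rightarrow> enat"
  where "len Q s V U = Sup {enat k |k. chn Q s V U k}"

lemma is_primeD:
  assumes "is_prime p"
  shows "0 \<in> p" "a \<in> p \<Longrightarrow> b \<in> p \<Longrightarrow> a + b \<in> p" "a \<in> p \<Longrightarrow> r * a \<in> p" "a \<in> p \<Longrightarrow> a * r \<in> p"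
    "1 \<notin> p" "a \<notin> p \<Longrightarrow> b \<notin> p \<Longrightarrow> a * b \<notin> p" "a \<in> p \<Longrightarrow> - a \<in> p" "a \<notin> p \<Longrightarrow> a ^ k \<notin> p"
    "a \<notin> p \<Longrightarrow> b \<in> p \<Longrightarrow> a - b \<notin> p"
proof -
  note d = assms[unfolded is_prime_def is_ideal_def]
  show m: "\<And>r a. a \<in> p \<Longrightarrow> r * a \<in> p" using d by blast
  then show "\<And>r a. a \<in> p \<Longrightarrow> a * r \<in> p" by (metis mult.commute)
  show "0 \<in> p" "1 \<notin> p" using d by blast+
  show pl: "\<And>a b. a \<in> p \<Longrightarrow> b \<in> p \<Longrightarrow> a + b \<in> p" using d by blast
  show nm: "\<And>a b. a \<notin> p \<Longrightarrow> b \<notin> p \<Longrightarrow> a * b \<notin> p" using d by blast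
  show "\<And>a. a \<in> p \<Longrightarrow> - a \<in> p" using m[of _ "-1"] by simp
  show "a \<notin> p \<Longrightarrow> a ^ k \<notin> p" by (induction k) (use d nm in simp_all)
  show "a \<notin> p \<Longrightarrow> b \<in> p \<Longrightarrow> a - b \<notin> p" using pl[of "a - b" b] by auto
qed

lemma lsubD:
  assumes "lsub Q s N"
  shows "0 \<in> N" "x \<in> N \<Longrightarrow> y \<in> N \<Longrightarrow> x + y \<in> N" "x \<in> N \<Longrightarrow> s c x \<in> N"
    "u \<notin> Q \<Longrightarrow> s u v \<in> N \<Longrightarrow> v \<in> N"
  using assms unfolding lsub_def by blast+

lemma lsubI:
  assumes "0 \<in> N" "\<And>x y. x \<in> N \<Longrightarrow> y \<in> N \<Longrightarrow> x + y \<in> N" "\<And>c x. x \<in> N \<Longrightarrow> s c x \<in> N"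
    "\<And>u v. u \<notin> Q \<Longrightarrow> s u v \<in> N \<Longrightarrow> v \<in> N"
  shows "lsub Q s N"
  using assms unfolding lsub_def by blast

lemma lsub_Int: "lsub Q s N \<Longrightarrow> lsub Q s L \<Longrightarrow> lsub Q s (N \<inter> L)"
  unfolding lsub_def by blast

lemma lsub_UNIV: "lsub Q s UNIV"
  unfolding lsub_def by blast

lemma lsub_lhull: "lsub Q s (lhull Q s E)"
proof (rule lsubI)
  show "0 \<in> lhull Q s E" unfolding lhull_def using lsubD(1) by blast
  show "x + y \<in> lhull Q s E" if "x \<in> lhull Q s E" "y \<in> lhull Q s E" for x y
    using that lsubD(2) unfolding lhull_def by blast
  show "s c x \<in> lhull Q s E" if "x \<in> lhull Q s E" for c x
    using that lsubD(3) unfolding lhull_def by blast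
  show "v \<in> lhull Q s E" if "u \<notin> Q" "s u v \<in> lhull Q s E" for u v
    using that(2) lsubD(4)[OF _ that(1)] unfolding lhull_def by blast
qed

lemma lhull_superset: "E \<subseteq> lhull Q s E"
  unfolding lhull_def by blast

lemma lhull_least: "lsub Q s N \<Longrightarrow> E \<subseteq> N \<Longrightarrow> lhull Q s E \<subseteq> N"
  unfolding lhull_def by blast

lemma lhull_mono: "E \<subseteq> Y \<Longrightarrow> lhull Q s E \<subseteq> lhull Q s Y"
  unfolding lhull_def by blast

lemma lsub_antimono: "p \<subseteq> Q \<Longrightarrow> lsub p s N \<Longrightarrow> lsub Q s N"
  unfolding lsub_def by blast

lemma lsumI: "u \<notin> Q \<Longrightarrow> x \<in> N \<Longrightarrow> y \<in> L \<Longrightarrow> s u v = x + y \<Longrightarrow> v \<in> lsum Q s N L"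
  unfolding lsum_def by blast

lemma lsumE:
  assumes "v \<in> lsum Q s N L"
  obtains u x y where "u \<notin> Q" "x \<in> N" "y \<in> L" "s u v = x + y"
  using assms unfolding lsum_def by blast

lemma enat_leI: "(\<And>k. enat k \<le> x \<Longrightarrow> enat k \<le> y) \<Longrightarrow> x \<le> (y::enat)"
proof (rule ccontr)
  assume h: "\<And>k. enat k \<le> x \<Longrightarrow> enat k \<le> y" and n: "\<not> x \<le> y"
  then obtain n where y: "y = enat n" by (cases y) auto
  then have "enat (Suc n) \<le> x" using n by (simp add: Suc_ile_eq)
  from h[OF this] show False using y by simp
qed

lemma enat_step: "a + 1 \<le> a' \<Longrightarrow> b \<le> b' \<Longrightarrow> a + b + 1 \<le> a' + (b'::enat)"
  by (cases a; cases a'; cases b; cases b') (auto simp: one_enat_def)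

section \<open>Saturated sums, chains and additivity of length\<close>

locale lmod = Modules.module s for s :: "'t::comm_ring_1 \<Rightarrow> 'v::ab_group_add \<Rightarrow> 'v" +
  fixes Q :: "'t set"
  assumes Q: "is_prime Q"
begin

lemma lsub_minus: "lsub Q s N \<Longrightarrow> x \<in> N \<Longrightarrow> - x \<in> N"
  by (metis lsubD(3) scale_minus_left scale_one)

lemma lsub_diff: "lsub Q s N \<Longrightarrow> x \<in> N \<Longrightarrow> y \<in> N \<Longrightarrow> x - y \<in> N"
  by (metis diff_conv_add_uminus lsubD(2) lsub_minus)

lemma Qmult: "u \<notin> Q \<Longrightarrow> v \<notin> Q \<Longrightarrow> u * v \<notin> Q" and Q1: "1 \<notin> Q"
  using is_primeD[OF Q] by blast+

text \<open>Stated for plain submodules because it is applied to cyclic submodules and to ranges of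
  linear maps, which are rarely saturated. The product of the two denominators gives closure under
  addition.\<close>

lemma lsub_lsum:
  assumes N: "0 \<in> N" "\<And>x y. x \<in> N \<Longrightarrow> y \<in> N \<Longrightarrow> x + y \<in> N" "\<And>c x. x \<in> N \<Longrightarrow> s c x \<in> N"
    and L: "0 \<in> L" "\<And>x y. x \<in> L \<Longrightarrow> y \<in> L \<Longrightarrow> x + y \<in> L" "\<And>c x. x \<in> L \<Longrightarrow> s c x \<in> L"
  shows "lsub Q s (lsum Q s N L)"
proof (rule lsubI)
  show "0 \<in> lsum Q s N L" unfolding lsum_def using N(1) L(1) Q1 by force
next
  fix a b assume "a \<in> lsum Q s N L" "b \<in> lsum Q s N L"
  then obtain u x y u' x' y' where h: "u \<notin> Q" "x \<in> N" "y \<in> L" "s u a = x + y"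
    "u' \<notin> Q" "x' \<in> N" "y' \<in> L" "s u' b = x' + y'" unfolding lsum_def by blast
  have "s (u * u') (a + b) = s u' (s u a) + s u (s u' b)"
    by (simp add: scale_right_distrib mult.commute)
  also have "\<dots> = (s u' x + s u x') + (s u' y + s u y')"
    using h by (simp add: scale_right_distrib algebra_simps)
  finally have "s (u * u') (a + b) = (s u' x + s u x') + (s u' y + s u y')" .
  then show "a + b \<in> lsum Q s N L"
    using lsumI[OF Qmult[OF h(1,5)] N(2)[OF N(3)[OF h(2)] N(3)[OF h(6)]] L(2)[OF L(3)[OF h(3)] L(3)[OF h(7)]]]
    by blast
next
  fix c a assume "a \<in> lsum Q s N L"
  then obtain u x y where h: "u \<notin> Q" "x \<in> N" "y \<in> L" "s u a = x + y" unfolding lsum_def by blast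
  have "s u (s c a) = s c (s u a)" by (simp add: mult.commute)
  also have "\<dots> = s c x + s c y" using h by (simp add: scale_right_distrib)
  finally show "s c a \<in> lsum Q s N L" by (rule lsumI[OF h(1) N(3)[OF h(2)] L(3)[OF h(3)]])
next
  fix u' a assume "u' \<notin> Q" "s u' a \<in> lsum Q s N L"
  then obtain u x y where h: "u \<notin> Q" "x \<in> N" "y \<in> L" "s u (s u' a) = x + y" unfolding lsum_def by blast
  then show "a \<in> lsum Q s N L" unfolding lsum_def using Qmult[OF h(1) \<open>u' \<notin> Q\<close>] by auto
qed

lemma lsub_lsum':
  assumes N: "lsub Q s N" and L: "lsub Q s L"
  shows "lsub Q s (lsum Q s N L)"
  by (rule lsub_lsum[OF lsubD(1-3)[OF N] lsubD(1-3)[OF L]])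

lemma lsum_upper1: "0 \<in> L \<Longrightarrow> N \<subseteq> lsum Q s N L"
proof
  fix x assume "0 \<in> L" "x \<in> N"
  then have "s 1 x = x + 0" by simp
  then show "x \<in> lsum Q s N L" unfolding lsum_def using Q1 \<open>0 \<in> L\<close> \<open>x \<in> N\<close> by blast
qed

lemma lsum_upper2: "0 \<in> N \<Longrightarrow> L \<subseteq> lsum Q s N L"
proof
  fix x assume "0 \<in> N" "x \<in> L"
  then have "s 1 x = 0 + x" by simp
  then show "x \<in> lsum Q s N L" unfolding lsum_def using Q1 \<open>0 \<in> N\<close> \<open>x \<in> L\<close> by blast
qed

lemma lsum_least: "lsub Q s M \<Longrightarrow> N \<subseteq> M \<Longrightarrow> L \<subseteq> M \<Longrightarrow> lsum Q s N L \<subseteq> M"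
  unfolding lsum_def
proof
  fix v assume "lsub Q s M" "N \<subseteq> M" "L \<subseteq> M" "v \<in> {v. \<exists>u x y. u \<notin> Q \<and> x \<in> N \<and> y \<in> L \<and> s u v = x + y}"
  then obtain u x y where "u \<notin> Q" "x \<in> M" "y \<in> M" "s u v = x + y" by blast
  then show "v \<in> M" using lsubD(2,4)[OF \<open>lsub Q s M\<close>] by metis
qed

lemma lsum_mono: "N \<subseteq> N' \<Longrightarrow> L \<subseteq> L' \<Longrightarrow> lsum Q s N L \<subseteq> lsum Q s N' L'"
  unfolding lsum_def by blast

lemma lsub_lsum_cyc:
  assumes "lsub Q s N" shows "lsub Q s (lsum Q s N (range (\<lambda>r. s r a)))"
proof (rule lsub_lsum[OF lsubD(1-3)[OF assms]])
  show "0 \<in> range (\<lambda>r. s r a)" by (metis rangeI scale_zero_left)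
  show "x + y \<in> range (\<lambda>r. s r a)" if "x \<in> range (\<lambda>r. s r a)" "y \<in> range (\<lambda>r. s r a)" for x y
    using that by (auto simp flip: scale_left_distrib)
  show "s c x \<in> range (\<lambda>r. s r a)" if "x \<in> range (\<lambda>r. s r a)" for c x using that by auto
qed

lemma lsum_cyc_mem: "0 \<in> N \<Longrightarrow> a \<in> lsum Q s N (range (\<lambda>r. s r a))"
  by (metis lsum_upper2 rangeI scale_one subsetD)

lemma chn_0: "lsub Q s V \<Longrightarrow> V \<subseteq> U \<Longrightarrow> chn Q s V U 0"
  unfolding chn_def by (rule exI[of _ "\<lambda>_. V"]) simp

lemma chn_le: "chn Q s V U k \<Longrightarrow> j \<le> k \<Longrightarrow> chn Q s V U j"
  unfolding chn_def by (elim exE, rule_tac x=W in exI) auto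

text \<open>Chains can be shortened, so the attained lengths form an initial segment, and every
  finite lower bound on the supremum comes from an actual chain.\<close>

lemma len_ge_iff:
  assumes "lsub Q s V" "V \<subseteq> U"
  shows "enat k \<le> len Q s V U \<longleftrightarrow> chn Q s V U k"
proof
  assume "chn Q s V U k"
  then show "enat k \<le> len Q s V U" unfolding len_def by (intro Sup_upper) blast
next
  assume le: "enat k \<le> len Q s V U"
  show "chn Q s V U k"
  proof (rule ccontr)
    assume n: "\<not> chn Q s V U k"
    then have k: "k \<noteq> 0" using chn_0[OF assms] by metis
    have "j \<le> k - 1" if "chn Q s V U j" for j
      using chn_le[OF that, of k] n by (cases "k \<le> j") auto
    then have "len Q s V U \<le> enat (k - 1)" unfolding len_def
      by (intro Sup_least) auto
    then have "enat k \<le> enat (k - 1)" using le by (rule order_trans[rotated])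
    then show False using k by simp
  qed
qed

lemma chn_extend:
  assumes "chn Q s V E k" "lsub Q s Y" "E \<subset> Y" "V \<subseteq> Y"
  shows "chn Q s V Y (Suc k)"
proof -
  obtain W where W: "\<And>i. i \<le> k \<Longrightarrow> lsub Q s (W i) \<and> V \<subseteq> W i \<and> W i \<subseteq> E" "\<And>i. i < k \<Longrightarrow> W i \<subset> W (Suc i)"
    using assms(1) unfolding chn_def by blast
  let ?W = "\<lambda>i. if i \<le> k then W i else Y"
  have "lsub Q s (?W i) \<and> V \<subseteq> ?W i \<and> ?W i \<subseteq> Y" for i
    using W(1)[of i] assms by (cases "i \<le> k") auto
  moreover have "?W i \<subset> ?W (Suc i)" if "i < Suc k" for i
  proof (cases "i < k")
    case True then show ?thesis using W(2)[of i] by simp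
  next
    case False then have "i = k" using that by simp
    then show ?thesis using W(1)[of k] assms(3) by auto
  qed
  ultimately show ?thesis unfolding chn_def by (intro exI[of _ ?W]) blast
qed

lemma chn_mono: "chn Q s V U k \<Longrightarrow> V' \<subseteq> V \<Longrightarrow> U \<subseteq> U' \<Longrightarrow> chn Q s V' U' k"
  unfolding chn_def by (elim exE, rule_tac x=W in exI) blast

lemma len_mono: "V' \<subseteq> V \<Longrightarrow> U \<subseteq> U' \<Longrightarrow> len Q s V U \<le> len Q s V' U'"
  unfolding len_def by (rule Sup_subset_mono) (use chn_mono in blast)

lemma len_self [simp]: "lsub Q s V \<Longrightarrow> len Q s V V = 0"
proof -
  assume V: "lsub Q s V"
  have "\<not> chn Q s V V (Suc 0)" unfolding chn_def by (auto simp: le_Suc_eq)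
  then have "\<not> enat (Suc 0) \<le> len Q s V V" using len_ge_iff[OF V order_refl, of "Suc 0"] by simp
  then show ?thesis by (cases "len Q s V V") (auto simp: zero_enat_def)
qed

lemma len_strict:
  assumes V: "lsub Q s V" "V \<subseteq> E" and Y: "lsub Q s Y" "E \<subset> Y"
  shows "len Q s V E + 1 \<le> len Q s V Y"
proof (rule enat_leI)
  fix k assume k: "enat k \<le> len Q s V E + 1"
  have VY: "V \<subseteq> Y" using assms by blast
  show "enat k \<le> len Q s V Y"
  proof (cases k)
    case 0 then show ?thesis by (simp flip: zero_enat_def)
  next
    case (Suc j)
    then have "enat j \<le> len Q s V E" using k
      by (metis add.commute eSuc_enat eSuc_ile_mono plus_1_eSuc(1))
    then have "chn Q s V E j" using len_ge_iff[OF V] by simp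
    then have "chn Q s V Y k" using chn_extend[OF _ Y VY] Suc by simp
    then show ?thesis using len_ge_iff[OF V(1) VY] by simp
  qed
qed

text \<open>A chain from \<open>V\<close> to \<open>U\<close> is split at \<open>M\<close>:
  \<open>W i \<inter> M\<close> and \<open>W i + M\<close> both grow weakly and cannot both stay
  constant in a strict step. Conversely, two chains are concatenated. Working with all chains
  instead of composition series covers infinite lengths.\<close>

lemma len_add:
  assumes V: "lsub Q s V" and M: "lsub Q s M" and U: "lsub Q s U" and VM: "V \<subseteq> M" and MU: "M \<subseteq> U"
  shows "len Q s V U = len Q s V M + len Q s M U"
proof (rule antisym)
  show "len Q s V U \<le> len Q s V M + len Q s M U"
  proof (rule enat_leI)
    fix k assume "enat k \<le> len Q s V U"
    then have "chn Q s V U k" using len_ge_iff V VM MU by blast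
    then obtain W where W: "\<And>i. i \<le> k \<Longrightarrow> lsub Q s (W i) \<and> V \<subseteq> W i \<and> W i \<subseteq> U" "\<And>i. i < k \<Longrightarrow> W i \<subset> W (Suc i)"
      unfolding chn_def by blast
    have "i \<le> k \<Longrightarrow> enat i \<le> len Q s V (W i \<inter> M) + len Q s M (lsum Q s (W i) M)" for i
    proof (induction i)
      case 0 then show ?case by (simp flip: zero_enat_def)
    next
      case (Suc i)
      let ?A = "\<lambda>i. W i \<inter> M" and ?B = "\<lambda>i. lsum Q s (W i) M"
      have i: "W i \<subset> W (Suc i)" "lsub Q s (W i)" "lsub Q s (W (Suc i))" "V \<subseteq> W i"
        using W[of i] W(1)[of "Suc i"] Suc.prems by auto
      have A: "lsub Q s (?A (Suc i))" "lsub Q s (?A i)" "V \<subseteq> ?A i" "?A i \<subseteq> ?A (Suc i)"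
        using lsub_Int[OF i(3) M] lsub_Int[OF i(2) M] i VM by auto
      have B: "lsub Q s (?B (Suc i))" "lsub Q s (?B i)" "M \<subseteq> ?B i" "?B i \<subseteq> ?B (Suc i)"
        using lsub_lsum'[OF i(3) M] lsub_lsum'[OF i(2) M] lsum_upper2[OF lsubD(1)[OF i(2)]]
          lsum_mono[OF psubset_imp_subset[OF i(1)] order_refl] by auto
      have "?A i \<subset> ?A (Suc i) \<or> ?B i \<subset> ?B (Suc i)"
      proof (rule ccontr)
        assume "\<not> ?thesis"
        then have e: "?A i = ?A (Suc i)" "?B i = ?B (Suc i)" using A B by blast+
        \<comment> \<open>Modular law: \<open>w\<close> is a difference of elements of
          \<open>W (Suc i)\<close> and lies in \<open>M\<close>, hence in
          \<open>W i\<close>.\<close>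
        have "y \<in> W i" if y: "y \<in> W (Suc i)" for y
        proof -
          have "y \<in> ?B i" using y e lsum_upper1[OF lsubD(1)[OF M]] by blast
          then obtain u x w where h: "u \<notin> Q" "x \<in> W i" "w \<in> M" "s u y = x + w" unfolding lsum_def by blast
          have "w = s u y - x" using h by simp
          then have "w \<in> W (Suc i)" using lsub_diff[OF i(3)] lsubD(3)[OF i(3) y] h i(1) by blast
          then have "w \<in> W i" using h e by blast
          then have "s u y \<in> W i" using h lsubD(2)[OF i(2)] by simp
          then show ?thesis using h lsubD(4)[OF i(2)] by blast
        qed
        then show False using i(1) by blast
      qed
      then have "len Q s V (?A i) + len Q s M (?B i) + 1 \<le> len Q s V (?A (Suc i)) + len Q s M (?B (Suc i))"
      proof
        assume "?A i \<subset> ?A (Suc i)"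
        from len_strict[OF V A(3,1) this] show ?thesis
          by (rule enat_step) (rule len_mono[OF order_refl B(4), of M])
      next
        assume "?B i \<subset> ?B (Suc i)"
        from len_strict[OF M B(3,1) this]
        have "len Q s M (?B i) + 1 \<le> len Q s M (?B (Suc i))" .
        from enat_step[OF this len_mono[OF order_refl A(4), of V]] show ?thesis
          by (simp only: add.commute)
      qed
      moreover have "enat i + 1 \<le> len Q s V (?A i) + len Q s M (?B i) + 1"
        using Suc by (simp add: add_right_mono)
      ultimately have "enat i + 1 \<le> len Q s V (?A (Suc i)) + len Q s M (?B (Suc i))"
        by (rule order_trans[rotated])
      then show ?case by (simp add: one_enat_def)
    qed
    from this[of k] have "enat k \<le> len Q s V (W k \<inter> M) + len Q s M (lsum Q s (W k) M)" by simp
    also have "\<dots> \<le> len Q s V M + len Q s M U"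
      by (intro add_mono len_mono order_refl lsum_least U) (use W(1)[of k] MU in auto)
    finally show "enat k \<le> \<dots>" .
  qed
next
  show "len Q s V M + len Q s M U \<le> len Q s V U"
  proof -
    have VU: "V \<subseteq> U" using VM MU by blast
    have main: "chn Q s V U (a + b)" if ca: "chn Q s V M a" and cb: "chn Q s M U b" for a b
    proof -
      obtain W where W: "\<And>i. i \<le> b \<Longrightarrow> lsub Q s (W i) \<and> M \<subseteq> W i \<and> W i \<subseteq> U" "\<And>i. i < b \<Longrightarrow> W i \<subset> W (Suc i)"
        using cb unfolding chn_def by blast
      have "i \<le> b \<Longrightarrow> chn Q s V (W i) (a + i)" for i
      proof (induction i)
        case 0 then show ?case using chn_mono[OF ca order_refl] W(1)[of 0] by simp
      next
        case (Suc i)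
        then show ?case using chn_extend[of V "W i" "a + i" "W (Suc i)"] W(1)[of "Suc i"] W(2)[of i] VM by auto
      qed
      from this[of b] show ?thesis using chn_mono[OF _ order_refl] W(1)[of b] by blast
    qed
    show ?thesis
    proof (cases "len Q s V U")
      case (enat c)
      have fin1: "len Q s V M \<le> enat c" and fin2: "len Q s M U \<le> enat c"
        using len_mono[OF order_refl MU, of V] len_mono[OF VM order_refl, of U] enat by auto
      obtain a b where ab: "len Q s V M = enat a" "len Q s M U = enat b"
        using fin1 fin2 by (metis enat_ile)
      have "chn Q s V M a" "chn Q s M U b"
        using len_ge_iff[OF V VM, of a] len_ge_iff[OF M MU, of b] ab by auto
      from main[OF this] have "enat (a + b) \<le> len Q s V U" using len_ge_iff[OF V VU] by blast
      then show ?thesis using ab by simp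
    qed simp
  qed
qed

lemma len_eqD:
  assumes "lsub Q s V" "lsub Q s V'" "lsub Q s U" "V \<subseteq> V'" "V' \<subseteq> U"
    "len Q s V U \<le> len Q s V' U" "len Q s V' U \<noteq> \<infinity>"
  shows "V = V'"
proof (rule ccontr)
  assume "V \<noteq> V'"
  then have "V \<subset> V'" using assms by blast
  from len_strict[OF assms(1) order_refl assms(2) this] have "1 \<le> len Q s V V'" using assms by simp
  moreover have "len Q s V U = len Q s V V' + len Q s V' U" by (rule len_add) (use assms in auto)
  ultimately show False using assms(6,7)
    by (cases "len Q s V V'"; cases "len Q s V' U") (auto simp: one_enat_def)
qed

end

text \<open>The graph of a linear map and its converse are the relations \<open>\<Gamma>\<close> that occur most.\<close>

lemma len_rel:
  fixes s :: "'t::comm_ring_1 \<Rightarrow> 'v::ab_group_add \<Rightarrow> 'v" and s' :: "'t \<Rightarrow> 'w::ab_group_add \<Rightarrow> 'w"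
  assumes m: "lmod s Q" and m': "lmod s' Q"
    and V: "lsub Q s V" and V': "lsub Q s' V'" and U': "lsub Q s' U'" and VU: "V \<subseteq> U" "V' \<subseteq> U'"
    and G0: "\<Gamma> 0 0"
    and Gp: "\<And>z w z' w'. \<Gamma> z w \<Longrightarrow> \<Gamma> z' w' \<Longrightarrow> \<Gamma> (z + z') (w + w')"
    and Gs: "\<And>c z w. \<Gamma> z w \<Longrightarrow> \<Gamma> (s c z) (s' c w)"
    and dom: "\<And>z. z \<in> U \<Longrightarrow> \<exists>u w. u \<notin> Q \<and> w \<in> U' \<and> \<Gamma> (s u z) w"
    and ker: "\<And>z w. \<Gamma> z w \<Longrightarrow> z \<in> U \<Longrightarrow> w \<in> V' \<Longrightarrow> z \<in> V"
  shows "len Q s V U \<le> len Q s' V' U'"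
proof (rule enat_leI)
  interpret M: lmod s Q by fact
  interpret M': lmod s' Q by fact
  fix k assume "enat k \<le> len Q s V U"
  then have "chn Q s V U k" using M.len_ge_iff V VU by blast
  then obtain W where W: "\<And>i. i \<le> k \<Longrightarrow> lsub Q s (W i) \<and> V \<subseteq> W i \<and> W i \<subseteq> U" "\<And>i. i < k \<Longrightarrow> W i \<subset> W (Suc i)"
    unfolding chn_def by blast
  define I where "I N = {w \<in> U'. \<exists>z\<in>N. \<Gamma> z w}" for N
  \<comment> \<open>The image of \<open>N\<close> under \<Gamma>, enlarged by \<open>V'\<close>. A
    strict step stays strict: \<open>dom\<close> supplies a partner for a new element, and if that
    partner came from the smaller member, \<open>ker\<close> would put the difference into
    \<open>V\<close>.\<close>
  define F where "F N = lsum Q s' (I N) V'" for N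
  have F: "lsub Q s' (F N)" if N: "lsub Q s N" for N unfolding F_def
  proof (rule M'.lsub_lsum[OF _ _ _ lsubD(1-3)[OF V']])
    show "0 \<in> I N" unfolding I_def using G0 lsubD(1)[OF N] lsubD(1)[OF U'] by blast
    show "x + y \<in> I N" if "x \<in> I N" "y \<in> I N" for x y
      using that Gp lsubD(2)[OF N] lsubD(2)[OF U'] unfolding I_def by blast
    show "s' c x \<in> I N" if "x \<in> I N" for c x
      using that Gs lsubD(3)[OF N] lsubD(3)[OF U'] unfolding I_def by blast
  qed
  have strict: "F (W i) \<subset> F (W (Suc i))" if i: "i < k" for i
  proof (rule psubsetI)
    show "F (W i) \<subseteq> F (W (Suc i))" unfolding F_def
      by (rule M'.lsum_mono) (use W(2)[OF i] in \<open>auto simp: I_def\<close>)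
    have li: "lsub Q s (W i)" "lsub Q s (W (Suc i))" "W (Suc i) \<subseteq> U" "V \<subseteq> W i"
      using W(1)[of i] W(1)[of "Suc i"] i by auto
    obtain z where z: "z \<in> W (Suc i)" "z \<notin> W i" using W(2)[OF i] by blast
    then have "z \<in> U" using li by blast
    from dom[OF this] obtain u w where uw: "u \<notin> Q" "w \<in> U'" "\<Gamma> (s u z) w" by blast
    have "s u z \<in> W (Suc i)" using z lsubD(3)[OF li(2)] by blast
    then have "w \<in> I (W (Suc i))" using uw unfolding I_def by blast
    then have "w \<in> F (W (Suc i))" unfolding F_def using M'.lsum_upper1[OF lsubD(1)[OF V']] by blast
    moreover have "w \<notin> F (W i)"
    proof
      assume "w \<in> F (W i)"
      then obtain u' w1 v' z1 where h: "u' \<notin> Q" "w1 \<in> U'" "z1 \<in> W i" "\<Gamma> z1 w1" "v' \<in> V'" "s' u' w = w1 + v'"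
        unfolding F_def lsum_def I_def by blast
      have "\<Gamma> (s u' (s u z) + s (-1) z1) (s' u' w + s' (-1) w1)"
        using Gp Gs uw(3) h(4) by blast
      moreover have "s' u' w + s' (-1) w1 = v'" using h(6) by simp
      moreover have "z1 \<in> W (Suc i)" using h(3) W(2)[OF i] by blast
      then have "s u' (s u z) + s (-1) z1 \<in> W (Suc i)"
        using lsubD(2,3)[OF li(2)] z(1) by blast
      ultimately have "s u' (s u z) + s (-1) z1 \<in> V" using ker h(5) li(3) by (metis subsetD)
      then have "(s u' (s u z) + s (-1) z1) + z1 \<in> W i" using li(4) h(3) lsubD(2)[OF li(1)] by blast
      then have "s u' (s u z) \<in> W i" by simp
      then show False using z(2) h(1) uw(1) lsubD(4)[OF li(1)] by blast
    qed
    ultimately show "F (W i) \<noteq> F (W (Suc i))" by blast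
  qed
  have "chn Q s' V' U' k" unfolding chn_def
  proof (rule exI[of _ "\<lambda>i. F (W i)"], intro conjI allI impI)
    fix i assume "i \<le> k"
    then have li: "lsub Q s (W i)" using W by blast
    then show "lsub Q s' (F (W i))" by (rule F)
    have "0 \<in> I (W i)" unfolding I_def using G0 lsubD(1)[OF li] lsubD(1)[OF U'] by blast
    then show "V' \<subseteq> F (W i)" unfolding F_def by (rule M'.lsum_upper2)
    show "F (W i) \<subseteq> U'" unfolding F_def using U' VU(2) by (rule_tac M'.lsum_least) (auto simp: I_def)
  qed (rule strict)
  then show "enat k \<le> len Q s' V' U'" using M'.len_ge_iff V' VU(2) by blast
qed

section \<open>Chain conditions and growth along a chain of primes\<close>

definition acc :: "'v set set \<Rightarrow> bool"
  where "acc \<F> \<longleftrightarrow> (\<forall>f. (\<forall>i::nat. f i \<in> \<F> \<and> f i \<subseteq> f (Suc i)) \<longrightarrow> (\<exists>m. \<forall>i\<ge>m. f i = f m))"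

lemma accD: "acc \<F> \<Longrightarrow> (\<And>i. f i \<in> \<F>) \<Longrightarrow> (\<And>i. f i \<subseteq> f (Suc i)) \<Longrightarrow> \<exists>m. \<forall>i\<ge>m. f i = f m"
  unfolding acc_def by blast

lemma acc_max:
  assumes "acc \<F>" "\<G> \<subseteq> \<F>" "\<G> \<noteq> {}"
  shows "\<exists>M\<in>\<G>. \<forall>N\<in>\<G>. M \<subseteq> N \<longrightarrow> N = M"
proof (rule ccontr)
  assume "\<not> ?thesis"
  then have n: "\<exists>N\<in>\<G>. M \<subset> N" if "M \<in> \<G>" for M using that by blast
  define nx where "nx M = (SOME N. N \<in> \<G> \<and> M \<subset> N)" for M
  have nx: "nx M \<in> \<G> \<and> M \<subset> nx M" if "M \<in> \<G>" for M
    unfolding nx_def by (rule someI_ex) (use n[OF that] in blast)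
  obtain M0 where M0: "M0 \<in> \<G>" using assms(3) by blast
  define f where "f i = (nx ^^ i) M0" for i
  have f: "f i \<in> \<G>" for i by (induction i) (use M0 nx in \<open>auto simp: f_def\<close>)
  have s: "f i \<subset> f (Suc i)" for i using nx[OF f[of i]] by (simp add: f_def)
  obtain m where m: "\<forall>i\<ge>m. f i = f m" using accD[OF assms(1), of f] f assms(2) s by blast
  have "f (Suc m) = f m" by (rule m[rule_format]) simp
  then show False using s[of m] by simp
qed

lemma acc_subset: "acc \<F> \<Longrightarrow> \<G> \<subseteq> \<F> \<Longrightarrow> acc \<G>"
  unfolding acc_def by blast

lemma acc_union:
  assumes "acc \<F>" "\<And>i::nat. f i \<in> \<F>" "\<And>i. f i \<subseteq> f (Suc i)"
  obtains m where "(\<Union>i. f i) = f m"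
proof -
  obtain m where m: "\<forall>i\<ge>m. f i = f m" using accD[OF assms(1), of f] assms(2,3) by blast
  have "f i \<subseteq> f m" for i
  proof (cases "i \<ge> m")
    case True
    then show ?thesis using m[rule_format, of i] by (simp only: order_refl)
  next
    case False
    then show ?thesis using lift_Suc_mono_le[of f i m] assms(3) by simp
  qed
  then show thesis using that by blast
qed

lemma lmod_mult: "is_prime Q \<Longrightarrow> lmod ((*) :: 't \<Rightarrow> 't \<Rightarrow> 't::comm_ring_1) Q"
  unfolding lmod_def lmod_axioms_def Modules.module_def by (simp add: algebra_simps)

definition fsc :: "'t::comm_ring_1 \<Rightarrow> ('i \<Rightarrow> 't) \<Rightarrow> 'i \<Rightarrow> 't"
  where "fsc c f = (\<lambda>i. c * f i)"

lemma lmod_fsc: "is_prime Q \<Longrightarrow> lmod (fsc :: 't::comm_ring_1 \<Rightarrow> ('i \<Rightarrow> 't) \<Rightarrow> _) Q"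
  unfolding lmod_def lmod_axioms_def Modules.module_def by (simp add: fsc_def fun_eq_iff algebra_simps)

lemma lsub_ideal: "lsub Q (*) I \<Longrightarrow> is_ideal I"
  unfolding lsub_def is_ideal_def by blast

lemma is_idealD:
  assumes "is_ideal I"
  shows "0 \<in> I" "a \<in> I \<Longrightarrow> b \<in> I \<Longrightarrow> a + b \<in> I" "a \<in> I \<Longrightarrow> r * a \<in> I" "a \<in> I \<Longrightarrow> a * r \<in> I"
    "a \<in> I \<Longrightarrow> b \<in> I \<Longrightarrow> a - b \<in> I" "a \<in> I \<Longrightarrow> - a \<in> I" "a \<in> I \<Longrightarrow> k > 0 \<Longrightarrow> a ^ k \<in> I"
proof -
  note d = assms[unfolded is_ideal_def]
  show m: "\<And>r a. a \<in> I \<Longrightarrow> r * a \<in> I" using d by blast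
  then show m': "\<And>r a. a \<in> I \<Longrightarrow> a * r \<in> I" by (metis mult.commute)
  show "0 \<in> I" using d by blast
  show p: "\<And>a b. a \<in> I \<Longrightarrow> b \<in> I \<Longrightarrow> a + b \<in> I" using d by blast
  show mi: "\<And>a. a \<in> I \<Longrightarrow> - a \<in> I" using m[of _ "-1"] by simp
  show "\<And>a b. a \<in> I \<Longrightarrow> b \<in> I \<Longrightarrow> a - b \<in> I" using p mi by (metis diff_conv_add_uminus)
  show "\<And>a. a \<in> I \<Longrightarrow> k > 0 \<Longrightarrow> a ^ k \<in> I" using m' by (cases k) auto
qed

lemma is_ideal_sum: "is_ideal I \<Longrightarrow> (\<And>i. i \<in> A \<Longrightarrow> f i \<in> I) \<Longrightarrow> sum f A \<in> I"
  by (induction A rule: infinite_finite_induct) (auto intro: is_idealD)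

lemma prime_lsub: "is_prime p \<Longrightarrow> p \<subseteq> Q \<Longrightarrow> lsub Q (*) p"
proof (rule lsubI)
  assume p: "is_prime p" "p \<subseteq> Q"
  note d = is_primeD[OF p(1)]
  show "0 \<in> p" by (rule d)
  show "\<And>x y. x \<in> p \<Longrightarrow> y \<in> p \<Longrightarrow> x + y \<in> p" by (rule d)
  show "\<And>c x. x \<in> p \<Longrightarrow> c * x \<in> p" by (rule d)
  show "v \<in> p" if "u \<notin> Q" "u * v \<in> p" for u v using d(6)[of u v] that p(2) by blast
qed

lemma freshman:
  assumes "(1::'t::comm_ring_1) + 1 = 0"
  shows "(a + b) ^ 2 ^ j = a ^ 2 ^ j + (b::'t) ^ 2 ^ j"
proof (induction j)
  case (Suc j)
  have two: "y + y = 0" for y :: 't using assms by (metis distrib_left mult.right_neutral mult_zero_right)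
  have sq: "y ^ 2 ^ Suc j = (y ^ 2 ^ j) ^ 2" for y :: 't by (simp only: power_Suc2 power_mult)
  have "(a + b) ^ 2 ^ Suc j = ((a + b) ^ 2 ^ j) ^ 2" by (rule sq)
  also have "\<dots> = (a ^ 2 ^ j + b ^ 2 ^ j) ^ 2" using Suc by simp
  also have "\<dots> = (a ^ 2 ^ j) ^ 2 + (b ^ 2 ^ j) ^ 2 + (a ^ 2 ^ j * b ^ 2 ^ j + a ^ 2 ^ j * b ^ 2 ^ j)"
    by (simp add: power2_eq_square algebra_simps)
  finally show ?case by (simp only: two sq add_0_right)
qed simp

section \<open>Iterated lengths, Nakayama's lemma and radicals\<close>

context lmod
begin

lemma len_iter:
  assumes "\<And>i. i \<le> L \<Longrightarrow> lsub Q s (D i)" "\<And>i. i < L \<Longrightarrow> D i \<subseteq> D (Suc i)"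
    "\<And>i. i < L \<Longrightarrow> x \<le> len Q s (D i) (D (Suc i))"
  shows "of_nat L * x \<le> len Q s (D 0) (D L)"
  using assms
proof (induction L)
  case (Suc L)
  note Suc_prems = Suc.prems(2)
  have D: "lsub Q s (D i)" if "i \<le> Suc L" for i using Suc.prems(1) that by simp
  have "i \<le> L \<Longrightarrow> D 0 \<subseteq> D i" for i
  proof (induction i)
    case (Suc i) then show ?case using Suc.prems(1) Suc_prems[of i] by fastforce
  qed simp
  then have m: "D 0 \<subseteq> D L" by simp
  have "of_nat (Suc L) * x = of_nat L * x + x" by (simp add: algebra_simps)
  also have "\<dots> \<le> len Q s (D 0) (D L) + len Q s (D L) (D (Suc L))"
    by (intro add_mono Suc) (use Suc.prems in auto)
  also have "\<dots> = len Q s (D 0) (D (Suc L))"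
    by (rule len_add[symmetric]) (use D m Suc.prems(2) in auto)
  finally show ?case .
qed simp

lemma len_iter_le:
  assumes "\<And>i. i \<le> L \<Longrightarrow> lsub Q s (D i)" "\<And>i. i < L \<Longrightarrow> D i \<subseteq> D (Suc i)"
    "\<And>i. i < L \<Longrightarrow> len Q s (D i) (D (Suc i)) \<le> x"
  shows "len Q s (D 0) (D L) \<le> of_nat L * x"
  using assms
proof (induction L)
  case (Suc L)
  note Suc_prems = Suc.prems(2)
  have D: "lsub Q s (D i)" if "i \<le> Suc L" for i using Suc.prems(1) that by simp
  have "i \<le> L \<Longrightarrow> D 0 \<subseteq> D i" for i
  proof (induction i)
    case (Suc i) then show ?case using Suc.prems(1) Suc_prems[of i] by fastforce
  qed simp
  then have m: "D 0 \<subseteq> D L" by simp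
  have "len Q s (D 0) (D (Suc L)) = len Q s (D 0) (D L) + len Q s (D L) (D (Suc L))"
    by (rule len_add) (use D m Suc.prems(2) in auto)
  also have "\<dots> \<le> of_nat L * x + x"
    by (intro add_mono Suc) (use Suc.prems in auto)
  also have "\<dots> = of_nat (Suc L) * x" by (simp add: algebra_simps)
  finally show ?case .
qed simp

text \<open>This replaces Nakayama's lemma: a maximal proper submodule of \<open>J\<close> containing \<open>J'\<close> also contains
  \<open>Q J\<close>.\<close>

lemma maxsub:
  assumes acc: "acc {N. lsub Q s N \<and> Z \<subseteq> N}" and J: "lsub Q s J" "lsub Q s J'" "J' \<subset> J" "Z \<subseteq> J'"
  obtains W a where "lsub Q s W" "J' \<subseteq> W" "W \<subset> J" "a \<in> J" "a \<notin> W"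
    "J \<subseteq> lsum Q s W (range (\<lambda>r. s r a))" "\<And>t y. t \<in> Q \<Longrightarrow> y \<in> J \<Longrightarrow> s t y \<in> W"
proof -
  let ?G = "{N. lsub Q s N \<and> J' \<subseteq> N \<and> N \<subset> J}"
  have "?G \<subseteq> {N. lsub Q s N \<and> Z \<subseteq> N}" "?G \<noteq> {}" using J by auto
  from acc_max[OF acc this] obtain W where W: "W \<in> ?G"
    and mx: "\<forall>N\<in>?G. W \<subseteq> N \<longrightarrow> N = W" by blast
  from W have lW: "lsub Q s W" and JW: "J' \<subseteq> W" "W \<subset> J" by auto
  have full: "J \<subseteq> lsum Q s W (range (\<lambda>r. s r b))" if b: "b \<in> J" "b \<notin> W" for b
  proof (rule ccontr)
    let ?N = "lsum Q s W (range (\<lambda>r. s r b))"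
    assume n: "\<not> J \<subseteq> ?N"
    have l: "lsub Q s ?N" by (rule lsub_lsum_cyc[OF lW])
    have WN: "W \<subseteq> ?N" by (rule lsum_upper1) (metis rangeI scale_zero_left)
    have "?N \<subseteq> J" by (rule lsum_least[OF J(1)]) (use JW b lsubD(3)[OF J(1)] in auto)
    then have "?N = W" using mx l WN n JW \<open>?N \<subseteq> J\<close> by blast
    then show False using lsum_cyc_mem[OF lsubD(1)[OF lW], of b] b(2) by simp
  qed
  obtain a where a: "a \<in> J" "a \<notin> W" using JW by blast
  \<comment> \<open>Nakayama: if \<open>s t a\<close> were outside \<open>W\<close>, then
    \<open>a\<close> would lie in \<open>W + R t a\<close>, and \<open>u - r * t\<close> is
    invertible at \<open>Q\<close>.\<close>
  have Qa: "s t a \<in> W" if t: "t \<in> Q" for t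
  proof (rule ccontr)
    assume n: "s t a \<notin> W"
    have "a \<in> lsum Q s W (range (\<lambda>r. s r (s t a)))"
      using full[OF lsubD(3)[OF J(1) a(1)] n] a(1) by blast
    then obtain u w y where h: "u \<notin> Q" "w \<in> W" "y \<in> range (\<lambda>r. s r (s t a))" "s u a = w + y" by (rule lsumE)
    then obtain r where "s u a = w + s (r * t) a" by auto
    then have "s (u - r * t) a = w" by (simp add: scale_left_diff_distrib)
    moreover have "u - r * t \<notin> Q" using is_primeD(9)[OF Q h(1)] is_primeD(3)[OF Q t] by blast
    ultimately show False using lsubD(4)[OF lW] h(2) a(2) by blast
  qed
  have "s t y \<in> W" if t: "t \<in> Q" and y: "y \<in> J" for t y
  proof -
    have "y \<in> lsum Q s W (range (\<lambda>r. s r a))" using full[OF a] y by blast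
    then obtain u w v where h: "u \<notin> Q" "w \<in> W" "v \<in> range (\<lambda>r. s r a)" "s u y = w + v" by (rule lsumE)
    then obtain r where r: "s u y = w + s r a" by auto
    have "s u (s t y) = s t (s u y)" by (simp add: mult.commute)
    also have "\<dots> = s t w + s r (s t a)" by (simp add: r scale_right_distrib mult.commute)
    finally have "s u (s t y) = s t w + s r (s t a)" .
    also have "\<dots> \<in> W" using lsubD(2)[OF lW lsubD(3)[OF lW h(2)] lsubD(3)[OF lW Qa[OF t]]] .
    finally show ?thesis using lsubD(4)[OF lW h(1)] by blast
  qed
  then show thesis using that[OF lW JW a full[OF a]] by blast
qed

end

text \<open>Among the saturated ideals that contain \<open>I\<close> but no power of
  \<open>t\<close>, a maximal one is prime; by \<open>only\<close> it equals \<open>Q\<close>, which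
  contains \<open>t\<close>.\<close>

lemma radical:
  assumes acc: "acc {I. is_ideal I \<and> K \<subseteq> I}" and Q: "is_prime Q" and I: "lsub Q (*) I" "K \<subseteq> I"
    and only: "\<And>p. is_prime p \<Longrightarrow> I \<subseteq> p \<Longrightarrow> p \<subseteq> Q \<Longrightarrow> p = Q" and t: "t \<in> Q"
  shows "\<exists>k. t ^ k \<in> I"
proof (rule ccontr)
  assume n: "\<nexists>k. t ^ k \<in> I"
  interpret lmod "(*)" Q using lmod_mult[OF Q] .
  note scale_scale[simp del]
  let ?G = "{N. lsub Q (*) N \<and> I \<subseteq> N \<and> (\<forall>k. t ^ k \<notin> N)}"
  have "?G \<subseteq> {I. is_ideal I \<and> K \<subseteq> I}" "?G \<noteq> {}" using I n lsub_ideal by auto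
  from acc_max[OF acc this] obtain p where p: "p \<in> ?G"
    and mx: "\<forall>N\<in>?G. p \<subseteq> N \<longrightarrow> N = p" by blast
  from p have lp: "lsub Q (*) p" and Ip: "I \<subseteq> p" and tp: "\<And>k. t ^ k \<notin> p" by auto
  have 1: "1 \<notin> p" using tp[of 0] by simp
  have pQ: "p \<subseteq> Q"
  proof
    fix a assume "a \<in> p"
    then show "a \<in> Q" using lsubD(4)[OF lp, of a 1] 1 by auto
  qed
  have big: "\<exists>u k r w. u \<notin> Q \<and> w \<in> p \<and> u * t ^ k = w + r * a" if a: "a \<notin> p" for a
  proof -
    let ?N = "lsum Q (*) p (range (\<lambda>r. r * a))"
    have "p \<subseteq> ?N" by (rule lsum_upper1, rule range_eqI[of _ _ 0]) simp
    moreover have "a \<in> ?N" by (rule lsum_cyc_mem[OF lsubD(1)[OF lp]])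
    ultimately have "?N \<notin> ?G" using mx a by blast
    then obtain k where "t ^ k \<in> ?N" using lsub_lsum_cyc[OF lp, of a] \<open>p \<subseteq> ?N\<close> Ip by blast
    then show ?thesis by (rule lsumE) blast
  qed
  have "is_prime p" unfolding is_prime_def
  proof (intro conjI allI impI)
    show "is_ideal p" by (rule lsub_ideal[OF lp])
    fix a b assume ab: "a * b \<in> p"
    show "a \<in> p \<or> b \<in> p"
    proof (rule ccontr)
      assume "\<not> ?thesis"
      then have ab': "a \<notin> p" "b \<notin> p" by auto
      obtain u k r w where h1: "u \<notin> Q" "w \<in> p" "u * t ^ k = w + r * a"
        using big[OF ab'(1)] by blast
      obtain u' k' r' w' where h2: "u' \<notin> Q" "w' \<in> p" "u' * t ^ k' = w' + r' * b"
        using big[OF ab'(2)] by blast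
      note h = h1 h2 and id = is_idealD[OF lsub_ideal[OF lp]]
      have "(u * u') * t ^ (k + k') = (u * t ^ k) * (u' * t ^ k')" 
        unfolding power_add by (simp only: ac_simps)
      also have "\<dots> = (w + r * a) * (w' + r' * b)" by (simp only: h)
      also have "\<dots> = w' * (w + r * a) + (r' * b) * w + (r * r') * (a * b)" by (simp add: algebra_simps)
      also have "\<dots> \<in> p" by (intro id(2) id(4)[OF h(5)] id(3)[OF h(2)] id(3)[OF ab])
      finally show False using lsubD(4)[OF lp Qmult[OF h(1,4)]] tp by blast
    qed
  qed (use 1 in auto)
  then have "p = Q" using only Ip pQ by blast
  then show False using tp[of 1] t by simp
qed

text \<open>In characteristic 2 the elements whose \<open>2^j\<close>-th power lies in
  \<open>I\<close> form an ideal, and these ideals increase with \<open>j\<close>. They become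
  stationary, so one exponent serves all of \<open>Q\<close>.\<close>

lemma radical_uniform:
  assumes c2: "(1::'t::comm_ring_1) + 1 = 0"
    and acc: "acc {I. is_ideal I \<and> K \<subseteq> I}" and Q: "is_prime Q" and I: "lsub Q (*) I" "K \<subseteq> I"
    and only: "\<And>p. is_prime p \<Longrightarrow> I \<subseteq> p \<Longrightarrow> p \<subseteq> Q \<Longrightarrow> p = (Q :: 't set)"
  shows "\<exists>j. \<forall>t\<in>Q. t ^ 2 ^ j \<in> I"
proof -
  note id = is_idealD[OF lsub_ideal[OF I(1)]]
  define f where "f j = {t. t ^ 2 ^ j \<in> I}" for j :: nat
  have up: "t ^ i \<in> I \<Longrightarrow> i \<le> k \<Longrightarrow> t ^ k \<in> I" for t i k
    by (metis id(4) le_add_diff_inverse power_add)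
  have 1: "f j \<in> {I. is_ideal I \<and> K \<subseteq> I}" for j
    unfolding f_def is_ideal_def using id I(2)
    by (auto simp: freshman[OF c2] power_mult_distrib zero_power)
  have 2: "f j \<subseteq> f (Suc j)" for j unfolding f_def using up by (auto simp: Suc_le_eq)
  obtain m where m: "(\<Union>i. f i) = f m" using acc_union[OF acc, of f] 1 2 by blast
  have "t \<in> (\<Union>i. f i)" if t: "t \<in> Q" for t
  proof -
    obtain k where "t ^ k \<in> I" using radical[OF acc Q I only t] by blast
    then have "t ^ 2 ^ k \<in> I" by (rule up) (simp add: less_imp_le)
    then show ?thesis unfolding f_def by blast
  qed
  then show ?thesis using m unfolding f_def by blast
qed

text \<open>A lower bound of order \<open>2^(e * n)\<close> for the length at \<open>p\<close> of
  the ring modulo the Frobenius power of \<open>p\<close> of order \<open>2^e\<close>. The shift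
  \<open>j\<close> absorbs constants, and \<open>V\<close> may be any ideal containing the shifted
  Frobenius power, so that the bound can be carried from one prime of a chain to the next.\<close>

definition growth :: "'t::comm_ring_1 set \<Rightarrow> 't set \<Rightarrow> nat \<Rightarrow> bool"
  where "growth K p n \<longleftrightarrow> (\<exists>j. \<forall>e. \<exists>V. lsub p (*) V \<and> K \<subseteq> V \<and> (\<forall>t\<in>p. t ^ 2 ^ (e + j) \<in> V) \<and>
     enat (2 ^ (e * n)) \<le> len p (*) V UNIV)"

lemma growth_0:
  assumes "is_prime p" "K \<subseteq> p"
  shows "growth K p 0"
proof -
  interpret lmod "(*)" p using lmod_mult[OF assms(1)] .
  have l: "lsub p (*) p" by (rule prime_lsub) (use assms in auto)
  have "p \<subset> UNIV" using Q1 by blast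
  from len_strict[OF l order_refl lsub_UNIV this] have "1 \<le> len p (*) p UNIV" using l by simp
  moreover have "t ^ 2 ^ e \<in> p" if "t \<in> p" for t e
    using is_idealD(7)[OF lsub_ideal[OF l] that] by simp
  ultimately show ?thesis unfolding growth_def using l assms(2)
    by (intro exI[of _ 0] allI exI[of _ p]) (auto simp: one_enat_def)
qed

text \<open>Take \<open>x\<close> in \<open>q\<close> outside \<open>p\<close> and
  \<open>m = 2^(e + j)\<close>. Each strict step in a chain of ideals saturated at \<open>p\<close>
  becomes a step of length at least \<open>m\<close> at \<open>q\<close> once \<open>x^m\<close> is
  added to both ends. The chain for \<open>p\<close> has \<open>2^(e * n)\<close> steps, so one more
  factor \<open>2^e\<close> is gained.\<close>

lemma growth_Suc:
  assumes c2: "(1::'t::comm_ring_1) + 1 = 0"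
    and acc: "acc {I. is_ideal I \<and> K \<subseteq> I}" and g: "growth K p n"
    and p: "is_prime p" and q: "is_prime q" and K: "K \<subseteq> p" and pq: "p \<subset> q"
    and adj: "\<And>p'. is_prime p' \<Longrightarrow> p \<subset> p' \<Longrightarrow> p' \<subseteq> q \<Longrightarrow> p' = (q :: 't set)"
  shows "growth K q (Suc n)"
proof -
  interpret P: lmod "(*)" p using lmod_mult[OF p] .
  interpret lmod "(*)" q using lmod_mult[OF q] .
  note scale_scale[simp del] P.scale_scale[simp del]
  obtain x where x: "x \<in> q" "x \<notin> p" using pq by blast
  have xp: "x ^ k \<notin> p" for k using is_primeD(8)[OF p x(2)] .
  let ?c = "\<lambda>a::'t. range (\<lambda>r. r * a)"
  have c0: "0 \<in> ?c a" for a by (rule range_eqI[of _ _ 0]) simp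
  have lp: "lsub q (*) p" by (rule prime_lsub[OF p]) (use pq in auto)
  define I where "I = lsum q (*) p (?c x)"
  have lI: "lsub q (*) I" unfolding I_def by (rule lsub_lsum_cyc[OF lp])
  have pI: "p \<subseteq> I" unfolding I_def by (rule lsum_upper1[OF c0])
  have xI: "x \<in> I" unfolding I_def by (rule lsum_cyc_mem[OF lsubD(1)[OF lp]])
  \<comment> \<open>No prime lies strictly between \<open>p\<close> and \<open>q\<close>, so at
    \<open>q\<close> the radical of \<open>p + (x)\<close> is \<open>q\<close>; the exponent
    \<open>j'\<close> is an additional shift.\<close>
  obtain j' where j': "\<And>t. t \<in> q \<Longrightarrow> t ^ 2 ^ j' \<in> I"
  proof -
    have "p' = q" if "is_prime p'" "I \<subseteq> p'" "p' \<subseteq> q" for p'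
      using adj[OF that(1) _ that(3)] that(2) pI xI x(2) by blast
    then have "\<exists>j. \<forall>t\<in>q. t ^ 2 ^ j \<in> I"
      using K pI by (intro radical_uniform[OF c2 acc q lI]) auto
    then show thesis using that by blast
  qed
  obtain j where j: "\<And>e. \<exists>V. lsub p (*) V \<and> K \<subseteq> V \<and> (\<forall>t\<in>p. t ^ 2 ^ (e + j) \<in> V) \<and>
     enat (2 ^ (e * n)) \<le> len p (*) V UNIV" using g unfolding growth_def by blast
  show ?thesis unfolding growth_def
  proof (intro exI[of _ "j + j'"] allI)
    fix e
    obtain V where V: "lsub p (*) V" "K \<subseteq> V" "\<And>t. t \<in> p \<Longrightarrow> t ^ 2 ^ (e + j) \<in> V"
      "enat (2 ^ (e * n)) \<le> len p (*) V UNIV" using j[of e] by blast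
    define m where "m = (2::nat) ^ (e + j)"
    define L where "L = (2::nat) ^ (e * n)"
    have "chn p (*) V UNIV L" using P.len_ge_iff[OF V(1) subset_UNIV] V(4) unfolding L_def by blast
    then obtain J where J: "\<And>i. i \<le> L \<Longrightarrow> lsub p (*) (J i)" "\<And>i. i \<le> L \<Longrightarrow> V \<subseteq> J i"
      "\<And>i. i < L \<Longrightarrow> J i \<subset> J (Suc i)" unfolding chn_def by blast
    have Jq: "lsub q (*) (J i)" if "i \<le> L" for i
      using lsub_antimono[OF psubset_imp_subset[OF pq] J(1)[OF that]] .
    define D where "D i = lsum q (*) (J i) (?c (x ^ m))" for i
    have lD: "lsub q (*) (D i)" if "i \<le> L" for i unfolding D_def by (rule lsub_lsum_cyc[OF Jq[OF that]])
    have JD: "J i \<subseteq> D i" for i unfolding D_def by (rule lsum_upper1[OF c0])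
    have xD: "r * x ^ m \<in> D i" if "i \<le> L" for r i unfolding D_def
      by (rule subsetD[OF lsum_upper2[OF lsubD(1)[OF Jq[OF that]]]]) (rule rangeI)
    have DD: "D i \<subseteq> D (Suc i)" if "i < L" for i unfolding D_def
      by (rule lsum_mono) (use J(3)[OF that] in auto)
    have step: "enat m \<le> len q (*) (D i) (D (Suc i))" if i: "i < L" for i
    proof -
      have i': "i \<le> L" "Suc i \<le> L" using i by auto
      note Ji = J(1)[OF i'(1)] J(1)[OF i'(2)] J(3)[OF i] Jq[OF i'(1)] Jq[OF i'(2)]
      \<comment> \<open>The ideals \<open>C k = J i + x^k J (Suc i) + (x^m)\<close>, for
        \<open>k\<close> from \<open>m\<close> down to 0, refine the step from \<open>D i\<close> to
        \<open>D (Suc i)\<close> into \<open>m\<close> pieces.\<close>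
      define B where "B k = lsum q (*) (J i) ((\<lambda>c. x ^ k * c) ` J (Suc i))" for k
      define C where "C k = lsum q (*) (B k) (?c (x ^ m))" for k
      have lB: "lsub q (*) (B k)" for k unfolding B_def
      proof (rule lsub_lsum[OF lsubD(1-3)[OF Ji(4)]])
        let ?S = "(\<lambda>c. x ^ k * c) ` J (Suc i)"
        show "0 \<in> ?S" using lsubD(1)[OF Ji(5)] by (force intro: image_eqI[of _ _ 0])
        show "a + b \<in> ?S" if "a \<in> ?S" "b \<in> ?S" for a b
          using that lsubD(2)[OF Ji(5)] by (auto simp flip: distrib_left)
        show "c * a \<in> ?S" if "a \<in> ?S" for c a
          using that lsubD(3)[OF Ji(5)] by (auto intro!: image_eqI[where x="c * _"] simp: mult.left_commute)
      qed
      have lC: "lsub q (*) (C k)" for k unfolding C_def by (rule lsub_lsum_cyc[OF lB])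
      have BC: "B k \<subseteq> C k" for k unfolding C_def by (rule lsum_upper1[OF c0])
      have JB: "J i \<subseteq> B k" for k unfolding B_def
        by (rule lsum_upper1) (use lsubD(1)[OF Ji(5)] in \<open>force intro: image_eqI[of _ _ 0]\<close>)
      have xB: "x ^ k * a \<in> B k" if "a \<in> J (Suc i)" for k a unfolding B_def
        by (rule subsetD[OF lsum_upper2[OF lsubD(1)[OF Ji(4)]]]) (rule imageI[OF that])
      have lo: "D i \<subseteq> C k" for k unfolding D_def C_def by (rule lsum_mono[OF JB order_refl])
      have hi: "C k \<subseteq> D (Suc i)" for k unfolding C_def
      proof (rule lsum_least)
        show l: "lsub q (*) (D (Suc i))" using lD i by simp
        show "B k \<subseteq> D (Suc i)" unfolding B_def
          by (rule lsum_least[OF l]) (use JD[of "Suc i"] Ji(3) lsubD(3)[OF Ji(5)] in auto)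
        show "?c (x ^ m) \<subseteq> D (Suc i)" using xD[of "Suc i"] i by auto
      qed
      have strict: "C (Suc k) \<subset> C k" if k: "k < m" for k
      proof (rule psubsetI)
        have "B (Suc k) \<subseteq> B k" unfolding B_def
          by (rule lsum_mono) (use lsubD(3)[OF Ji(5)] in \<open>auto simp: mult.assoc mult.left_commute[of x]\<close>)
        then show "C (Suc k) \<subseteq> C k" unfolding C_def by (rule lsum_mono) simp
        show "C (Suc k) \<noteq> C k"
        proof
          assume eq: "C (Suc k) = C k"
          \<comment> \<open>Since \<open>J i\<close> and \<open>J (Suc i)\<close> are saturated at
            \<open>p\<close> and \<open>x\<close> is not in \<open>p\<close>, powers of
            \<open>x\<close> can be cancelled modulo both. Equality of two consecutive pieces then
            puts \<open>J (Suc i)\<close> into \<open>J i + x J (Suc i)\<close> at \<open>q\<close>,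
            which \<open>maxsub\<close> excludes.\<close>
          have sub: "\<exists>u b c. u \<notin> q \<and> b \<in> J i \<and> c \<in> J (Suc i) \<and> u * a = b + x * c" if a: "a \<in> J (Suc i)" for a
          proof -
            have "x ^ k * a \<in> C (Suc k)" using xB[OF a] BC eq by blast
            then obtain u b' r where h: "u \<notin> q" "b' \<in> B (Suc k)" "u * (x ^ k * a) = b' + r * x ^ m"
              unfolding C_def by (rule lsumE) blast
            from h(2) obtain u' b c where h': "u' \<notin> q" "b \<in> J i" "c \<in> J (Suc i)" "u' * b' = b + x ^ Suc k * c"
              unfolding B_def by (rule lsumE) blast
            define y where "y = u' * u * a - x * c - x ^ (m - k) * (u' * r)"
            have xm: "x ^ m = x ^ k * x ^ (m - k)" using k by (simp flip: power_add)
            have "u' * (u * (x ^ k * a)) = u' * b' + u' * (r * x ^ m)" using h(3) by (simp add: algebra_simps)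
            also have "\<dots> = b + x ^ Suc k * c + u' * (r * x ^ m)" using h'(4) by simp
            finally have "x ^ k * y = b" unfolding y_def xm by (simp add: algebra_simps)
            then have y: "y \<in> J i" using lsubD(4)[OF Ji(1) xp] h'(2) by blast
            have "x ^ (m - k) * (u' * r) = u' * u * a - x * c - y" unfolding y_def by simp
            also have "\<dots> \<in> J (Suc i)"
              using is_idealD(3,5)[OF lsub_ideal[OF Ji(5)]] a h'(3) y Ji(3) by (simp add: psubset_eq subset_iff)
            finally have ur: "u' * r \<in> J (Suc i)" using lsubD(4)[OF Ji(2) xp] by blast
            define c' where "c' = c + x ^ (m - k - 1) * (u' * r)"
            have c': "c' \<in> J (Suc i)" unfolding c'_def
              using lsubD(2,3)[OF Ji(5)] h'(3) ur by blast
            have "m - k = Suc (m - k - 1)" using k by simp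
            then have "x ^ (m - k) = x * x ^ (m - k - 1)" by (metis power_Suc)
            then have "(u' * u) * a = y + x * c'" unfolding y_def c'_def by (simp add: algebra_simps)
            then show ?thesis using y c' Qmult[OF h'(1) h(1)] by blast
          qed
          have acc': "acc {N. lsub q (*) N \<and> K \<subseteq> N}"
            by (rule acc_subset[OF acc]) (use lsub_ideal in blast)
          have KJ: "K \<subseteq> J i" using V(2) J(2)[of i] i by auto
          obtain W a where W: "lsub q (*) W" "J i \<subseteq> W" "W \<subset> J (Suc i)"
            "\<And>t y. t \<in> q \<Longrightarrow> y \<in> J (Suc i) \<Longrightarrow> t * y \<in> W"
            by (rule maxsub[OF acc' Ji(5,4,3) KJ]) blast
          have "a \<in> W" if a: "a \<in> J (Suc i)" for a
          proof -
            obtain u b c where "u \<notin> q" "b \<in> J i" "c \<in> J (Suc i)" "u * a = b + x * c" using sub[OF a] by blast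
            then have "u * a \<in> W" using W lsubD(2)[OF W(1)] x(1) by (metis subsetD)
            then show ?thesis using lsubD(4)[OF W(1)] \<open>u \<notin> q\<close> by blast
          qed
          then show False using W(3) by blast
        qed
      qed
      have "C (m - k) \<subset> C (m - Suc k)" if "k < m" for k
        using strict[of "m - Suc k"] that by (simp add: Suc_diff_Suc)
      then have "chn q (*) (D i) (D (Suc i)) m" unfolding chn_def
        by (intro exI[of _ "\<lambda>k. C (m - k)"]) (use lC lo hi in auto)
      then show ?thesis using len_ge_iff[OF lD DD[OF i]] i by simp
    qed
    have "of_nat L * enat m \<le> len q (*) (D 0) (D L)" by (rule len_iter) (use lD DD step in auto)
    also have "\<dots> \<le> len q (*) (D 0) UNIV" by (rule len_mono) auto
    finally have "enat (L * m) \<le> len q (*) (D 0) UNIV" by (simp add: of_nat_eq_enat)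
    moreover have "(2::nat) ^ (e * Suc n) \<le> L * m" unfolding L_def m_def by (simp flip: power_add)
    ultimately have len: "enat (2 ^ (e * Suc n)) \<le> len q (*) (D 0) UNIV"
      by (meson enat_ord_simps(1) order_trans)
    \<comment> \<open>The \<open>m\<close>-th power of a relation
      \<open>u * t^(2^j') = w + r * x\<close> is again a relation, with \<open>w^m\<close> in
      \<open>V\<close> and the other term a multiple of \<open>x^m\<close>.\<close>
    have tD: "t ^ 2 ^ (e + (j + j')) \<in> D 0" if t: "t \<in> q" for t
    proof -
      from j'[OF t] obtain u w r where h: "u \<notin> q" "w \<in> p" "u * t ^ 2 ^ j' = w + r * x"
        unfolding I_def by (rule lsumE) blast
      have "u ^ m * t ^ 2 ^ (e + (j + j')) = (u * t ^ 2 ^ j') ^ m"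
        unfolding m_def by (simp add: power_mult_distrib power_add flip: power_mult) (simp add: algebra_simps)
      also have "\<dots> = w ^ m + r ^ m * x ^ m" unfolding h(3) m_def by (simp add: freshman[OF c2] power_mult_distrib)
      finally have e: "u ^ m * t ^ 2 ^ (e + (j + j')) = w ^ m + r ^ m * x ^ m" .
      have "w ^ m \<in> D 0" using V(3)[OF h(2)] J(2)[of 0] JD[of 0] unfolding m_def by auto
      then have "u ^ m * t ^ 2 ^ (e + (j + j')) \<in> D 0"
        unfolding e using xD[of 0] lsubD(2)[OF lD[of 0]] by blast
      then show ?thesis using lsubD(4)[OF lD[of 0]] is_primeD(8)[OF q h(1)] by blast
    qed
    show "\<exists>V. lsub q (*) V \<and> K \<subseteq> V \<and> (\<forall>t\<in>q. t ^ 2 ^ (e + (j + j')) \<in> V) \<and> enat (2 ^ (e * Suc n)) \<le> len q (*) V UNIV"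
      using lD[of 0] V(2) J(2)[of 0] JD[of 0] tD len by (intro exI[of _ "D 0"]) auto
  qed
qed

section \<open>Lengths of Frobenius pullbacks\<close>

text \<open>Vectors are functions on all natural numbers. Coordinates from \<open>n\<close> on are
  unrestricted, so the quotient by \<open>pw n K\<close> is the free module of rank \<open>n\<close>
  over the ring modulo \<open>K\<close>.\<close>

definition pw :: "nat \<Rightarrow> 't set \<Rightarrow> (nat \<Rightarrow> 't) set"
  where "pw n I = {f. \<forall>l<n. f l \<in> I}"

definition unitv :: "nat \<Rightarrow> nat \<Rightarrow> 't::comm_ring_1"
  where "unitv l = (\<lambda>i. if i = l then 1 else 0)"

definition fr :: "nat \<Rightarrow> (nat \<Rightarrow> 't::comm_ring_1) \<Rightarrow> nat \<Rightarrow> 't"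
  where "fr i f = (\<lambda>l. f l ^ 2 ^ i)"

definition mv :: "(nat \<Rightarrow> nat \<Rightarrow> 't::comm_ring_1) \<Rightarrow> nat \<Rightarrow> (nat \<Rightarrow> 't) \<Rightarrow> nat \<Rightarrow> 't"
  where "mv a n v = (\<lambda>i. \<Sum>j<n. a i j * v j)"

abbreviation sqm :: "(nat \<Rightarrow> nat \<Rightarrow> 't::comm_ring_1) \<Rightarrow> nat \<Rightarrow> nat \<Rightarrow> 't"
  where "sqm a \<equiv> (\<lambda>i j. (a i j) ^ 2)"

lemma pw_mono: "I \<subseteq> I' \<Longrightarrow> pw n I \<subseteq> pw n I'"
  unfolding pw_def by blast

lemma lsub_pw:
  assumes I: "lsub Q (*) I"
  shows "lsub Q fsc (pw n I)"
proof (rule lsubI)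
  show "v \<in> pw n I" if "u \<notin> Q" "fsc u v \<in> pw n I" for u v
    using that(2) lsubD(4)[OF I that(1)] unfolding pw_def fsc_def by blast
qed (use lsubD(1,2,3)[OF I] in \<open>auto simp: pw_def fsc_def\<close>)

lemma fr_fsc: "fr i (fsc c f) = fsc (c ^ 2 ^ i) (fr i f)"
  unfolding fr_def fsc_def by (simp add: power_mult_distrib)

lemma fr_unitv [simp]: "fr i (unitv l) = unitv l"
  unfolding fr_def unitv_def by (auto simp: zero_power)

lemma lsub_preimage:
  assumes D: "\<And>x y. D (x + y) = D x + D y" "\<And>c x. D (s c x) = s' c (D x)" "D 0 = 0" and N: "lsub Q s' N"
  shows "lsub Q s {x. D x \<in> N}"
proof (rule lsubI)
  show "v \<in> {x. D x \<in> N}" if "u \<notin> Q" "s u v \<in> {x. D x \<in> N}" for u v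
    using that(2) lsubD(4)[OF N that(1)] by (simp add: D)
qed (use lsubD(1,2,3)[OF N] in \<open>auto simp: D\<close>)

lemma lhullI: "x \<in> E \<Longrightarrow> x \<in> lhull Q s E"
  using lhull_superset by blast

text \<open>In the application \<open>K\<close> is the kernel of a presentation of the ring and
  \<open>Q\<close> the preimage of the prime. Regularity enters through the common value
  \<open>c\<close>: it bounds the number of generators in \<open>E\<close>, and it is the exponent
  of growth in \<open>gr\<close>.\<close>

locale frob_core =
  fixes K Q :: "'t::comm_ring_1 set" and c :: nat and E :: "'t set"
  assumes c2: "(1::'t) + 1 = 0" and lK: "lsub Q (*) K" and KQ: "K \<subseteq> Q" and pQ: "is_prime Q"
    and acc: "acc {I. is_ideal I \<and> K \<subseteq> I}"
    and E: "finite E" "card E \<le> c" "E \<subseteq> Q" "Q \<subseteq> lhull Q (*) (E \<union> K)"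
    and gr: "growth K Q c"
begin

lemmas VT = lmod_mult[OF pQ]
lemmas VF = lmod_fsc[OF pQ]
lemmas kid = is_idealD[OF lsub_ideal[OF lK]]
lemmas lsT = lsubD[where s="(*)" and Q=Q]
lemmas lsF = lsubD[where s=fsc and Q=Q]

text \<open>The Frobenius power of a submodule, as for ideals; \<open>pw n K\<close> is added
  because all submodules are considered modulo \<open>K\<close>.\<close>

definition frob :: "nat \<Rightarrow> nat \<Rightarrow> (nat \<Rightarrow> 't) set \<Rightarrow> (nat \<Rightarrow> 't) set"
  where "frob i n N = lhull Q fsc (fr i ` N \<union> pw n K)"

definition J :: "nat \<Rightarrow> 't set"
  where "J i = lhull Q (*) ((\<lambda>t. t ^ 2 ^ i) ` Q \<union> K)"

definition b :: "nat \<Rightarrow> enat"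
  where "b i = len Q (*) (J i) UNIV"

abbreviation G :: "nat \<Rightarrow> nat \<Rightarrow> (nat \<Rightarrow> 't) set"
  where "G n i \<equiv> pw n (J i)"

lemma two [simp]: "y + y = (0::'t)"
  using c2 by (metis distrib_left mult.right_neutral mult_zero_right)

lemma two' [simp]: "(2::'t) = 0"
  using c2 by (simp only: one_add_one)

lemma twoV [simp]: "y + y = (0::'i \<Rightarrow> 't)"
  by (rule ext) (simp only: plus_fun_apply zero_fun_apply two)

lemma minus_eq [simp]: "- y = (y::'t)"
  by (metis add_eq_0_iff two)

lemma diff_eq [simp]: "x - y = x + (y::'t)"
  by (metis diff_conv_add_uminus minus_eq)

lemma diff_eqV [simp]: "x - y = x + (y::'i \<Rightarrow> 't)"
  by (simp add: fun_eq_iff)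

lemma fr_add: "fr i (f + g) = fr i f + (fr i g :: nat \<Rightarrow> 't)"
  unfolding fr_def by (simp add: fun_eq_iff freshman[OF c2])

lemma sq_sum: "(\<Sum>i\<in>A. f i :: 't) ^ 2 = (\<Sum>i\<in>A. f i ^ 2)"
  by (induction A rule: infinite_finite_induct)
    (use freshman[OF c2, of _ _ 1] in \<open>simp_all\<close>)

lemma fr_mv: "fr 1 (mv a n v) = mv (sqm a) n (fr 1 (v :: nat \<Rightarrow> 't))"
  unfolding fr_def mv_def by (simp add: fun_eq_iff sq_sum power_mult_distrib)

lemma mv_add: "mv a n (v + w) = mv a n v + mv a n (w :: nat \<Rightarrow> 't)"
  unfolding mv_def by (simp add: fun_eq_iff distrib_left sum.distrib)

lemma mv_fsc: "mv a n (fsc r v) = fsc r (mv a n (v :: nat \<Rightarrow> 't))"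
  unfolding mv_def fsc_def by (simp add: fun_eq_iff sum_distrib_left mult.left_commute)

lemma mv_0: "mv a n 0 = (0 :: nat \<Rightarrow> 't)"
  unfolding mv_def by (simp add: fun_eq_iff)

lemma mv_O: "v \<in> pw n K \<Longrightarrow> mv a n v \<in> pw m K"
  unfolding mv_def pw_def using kid(3) by (auto intro!: is_ideal_sum[OF lsub_ideal[OF lK]])

lemma fsc_O: "r \<in> K \<Longrightarrow> fsc r v \<in> pw n K"
  unfolding pw_def fsc_def using kid(4) by simp

lemma lO: "lsub Q fsc (pw n K)"
  by (rule lsub_pw[OF lK])

lemma lmemI:
  assumes N: "lsub Q fsc N" "pw n K \<subseteq> N" and f: "\<And>l. l < n \<Longrightarrow> fsc (f l) (unitv l) \<in> N"
  shows "f \<in> N"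
proof -
  have "k \<le> n \<Longrightarrow> (\<lambda>l. if l < k then f l else 0) \<in> N" for k
  proof (induction k)
    case 0 then show ?case using lsF(1)[OF N(1)] by (simp add: zero_fun_def)
  next
    case (Suc k)
    then have "(\<lambda>l. if l < k then f l else 0) + fsc (f k) (unitv k) \<in> N"
      using lsF(2)[OF N(1) Suc.IH f[of k]] by simp
    moreover have "(\<lambda>l. if l < k then f l else 0) + fsc (f k) (unitv k) = (\<lambda>l. if l < Suc k then f l else 0)"
      by (auto simp: fun_eq_iff fsc_def unitv_def less_Suc_eq)
    ultimately show ?case by simp
  qed
  then have 1: "(\<lambda>l. if l < n then f l else 0) \<in> N" by simp
  have "(\<lambda>l. if l < n then 0 else f l) \<in> N" using N(2) kid(1) unfolding pw_def by auto
  from lsF(2)[OF N(1) 1 this] show ?thesis by (simp add: plus_fun_def if_distrib cong: if_cong)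
qed

text \<open>Induction on the rank: within an increasing chain a submodule is determined by the ideal
  of its values in coordinate \<open>n\<close> and by its members that vanish there, and both become
  stationary.\<close>

lemma accV: "acc {N. lsub Q fsc N \<and> pw n K \<subseteq> N}"
proof (induction n)
  case 0
  show ?case unfolding acc_def pw_def by auto
next
  case (Suc n)
  show ?case unfolding acc_def
  proof (intro allI impI)
    fix f :: "nat \<Rightarrow> (nat \<Rightarrow> 't) set"
    assume "\<forall>i. f i \<in> {N. lsub Q fsc N \<and> pw (Suc n) K \<subseteq> N} \<and> f i \<subseteq> f (Suc i)"
    then have f: "\<And>i. lsub Q fsc (f i)" "\<And>i. pw (Suc n) K \<subseteq> f i" "\<And>i. f i \<subseteq> f (Suc i)" by auto
    define R where "R i = {g. g(n := 0) \<in> f i}" for i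
    define L where "L i = (\<lambda>g. g n) ` f i" for i
    have u: "(g + h)(n := 0) = g(n := 0) + h(n := 0)" "(fsc r g)(n := 0) = fsc r (g(n := 0))"
      for g h :: "nat \<Rightarrow> 't" and r by (auto simp: fsc_def fun_eq_iff)
    have "lsub Q fsc (R i)" for i unfolding R_def
      by (rule lsub_preimage[where D="\<lambda>g. g(n := 0)", OF u(1) u(2) _ f(1)]) (auto simp: fun_eq_iff)
    moreover have "pw n K \<subseteq> R i" for i
      unfolding R_def using f(2)[of i] kid(1) unfolding pw_def by (auto simp: less_Suc_eq)
    moreover have "R i \<subseteq> R (Suc i)" for i unfolding R_def using f(3) by auto
    ultimately obtain m1 where m1: "\<forall>i\<ge>m1. R i = R m1" using accD[OF Suc.IH, of R] by auto
    have "is_ideal (L i)" for i unfolding is_ideal_def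
    proof (intro conjI ballI allI)
      show "0 \<in> L i" unfolding L_def by (rule image_eqI[of _ _ 0]) (use lsF(1)[OF f(1)] in auto)
      fix x r assume "x \<in> L i"
      then obtain g where g: "g \<in> f i" "x = g n" unfolding L_def by auto
      show "r * x \<in> L i" unfolding L_def
        by (rule image_eqI[of _ _ "fsc r g"]) (use g lsF(3)[OF f(1)] in \<open>auto simp: fsc_def\<close>)
      fix y assume "y \<in> L i"
      then obtain h where h: "h \<in> f i" "y = h n" unfolding L_def by auto
      show "x + y \<in> L i" unfolding L_def
        by (rule image_eqI[of _ _ "g + h"]) (use g h lsF(2)[OF f(1)] in auto)
    qed
    moreover have "K \<subseteq> L i" for i
    proof
      fix k assume "k \<in> K"
      then have "fsc k (unitv n) \<in> f i" using f(2) fsc_O by blast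
      then show "k \<in> L i" unfolding L_def by (rule image_eqI[rotated]) (simp add: fsc_def unitv_def)
    qed
    moreover have "L i \<subseteq> L (Suc i)" for i unfolding L_def using f(3) by auto
    ultimately obtain m2 where m2: "\<forall>i\<ge>m2. L i = L m2" using accD[OF acc, of L] by auto
    have "f i = f (max m1 m2)" if i: "i \<ge> max m1 m2" for i
    proof
      show "f (max m1 m2) \<subseteq> f i" by (rule lift_Suc_mono_le[of f]) (use f(3) i in auto)
      have RL: "R i = R (max m1 m2)" "L i = L (max m1 m2)"
        using m1[rule_format, of i] m1[rule_format, of "max m1 m2"] m2[rule_format, of i]
          m2[rule_format, of "max m1 m2"] i by auto
      show "f i \<subseteq> f (max m1 m2)"
      proof
        fix g assume g: "g \<in> f i"
        then have "g n \<in> L (max m1 m2)" using RL unfolding L_def by blast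
        then obtain h where h: "h \<in> f (max m1 m2)" "h n = g n" unfolding L_def by auto
        have "h \<in> f i" using h(1) \<open>f (max m1 m2) \<subseteq> f i\<close> by blast
        then have "g + h \<in> f i" using g lsF(2)[OF f(1)] by blast
        moreover have e: "(g + h)(n := 0) = g + h" using h(2) by (auto simp: fun_eq_iff)
        ultimately have "g + h \<in> R i" unfolding R_def by simp
        then have "g + h \<in> f (max m1 m2)" using RL e unfolding R_def by simp
        then have "(g + h) + h \<in> f (max m1 m2)" using lsF(2)[OF f(1)] h(1) by blast
        then show "g \<in> f (max m1 m2)" by (simp add: add.assoc)
      qed
    qed
    then show "\<exists>m. \<forall>i\<ge>m. f i = f m" by blast
  qed
qed

lemma lfrob: "lsub Q fsc (frob i n N)"
  unfolding frob_def by (rule lsub_lhull)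

lemma frob_mem: "v \<in> N \<Longrightarrow> fr i v \<in> frob i n N"
  unfolding frob_def by (rule lhullI) simp

lemma frob_O: "pw n K \<subseteq> frob i n N"
  unfolding frob_def by (rule subsetI, rule lhullI) simp

lemma frob_least: "lsub Q fsc M \<Longrightarrow> pw n K \<subseteq> M \<Longrightarrow> (\<And>v. v \<in> N \<Longrightarrow> fr i v \<in> M) \<Longrightarrow> frob i n N \<subseteq> M"
  unfolding frob_def by (rule lhull_least) auto

lemma frob_mono: "N \<subseteq> N' \<Longrightarrow> frob i n N \<subseteq> frob i n N'"
  unfolding frob_def by (rule lhull_mono) auto

lemma frob_UNIV: "frob i n UNIV = UNIV"
proof -
  have "f \<in> frob i n UNIV" for f
  proof (rule lmemI[OF lfrob frob_O])
    fix l show "fsc (f l) (unitv l) \<in> frob i n UNIV"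
      using lsF(3)[OF lfrob] frob_mem[of "unitv l" UNIV i n] by auto
  qed
  then show ?thesis by blast
qed

lemma lJ: "lsub Q (*) (J i)"
  unfolding J_def by (rule lsub_lhull)

lemma J_mem: "t \<in> Q \<Longrightarrow> t ^ 2 ^ i \<in> J i"
  unfolding J_def by (rule lhullI) simp

lemma J_K: "K \<subseteq> J i"
  unfolding J_def by (rule subsetI, rule lhullI) simp

lemma J_least: "lsub Q (*) M \<Longrightarrow> K \<subseteq> M \<Longrightarrow> (\<And>t. t \<in> Q \<Longrightarrow> t ^ 2 ^ i \<in> M) \<Longrightarrow> J i \<subseteq> M"
  unfolding J_def by (rule lhull_least) auto

lemma lsub_powT:
  assumes M: "lsub Q (*) M"
  shows "lsub Q (*) {t. t ^ 2 ^ i \<in> M}"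
proof (rule lsubI)
  show "v \<in> {t. t ^ 2 ^ i \<in> M}" if "u \<notin> Q" "u * v \<in> {t. t ^ 2 ^ i \<in> M}" for u v
    using that(2) lsT(4)[OF M is_primeD(8)[OF pQ that(1)], of "2 ^ i"] by (simp add: power_mult_distrib)
qed (use lsT(1,2,3)[OF M] in \<open>auto simp: freshman[OF c2] power_mult_distrib zero_power\<close>)

lemma J_comp: "{t ^ 2 ^ j |t. t \<in> J i} \<subseteq> J (i + j)"
proof -
  have "J i \<subseteq> {t. t ^ 2 ^ j \<in> J (i + j)}"
  proof (rule J_least[OF lsub_powT[OF lJ]])
    show "K \<subseteq> {t. t ^ 2 ^ j \<in> J (i + j)}" using kid(7)[of _ "2 ^ j"] J_K by auto
    show "t ^ 2 ^ i \<in> {t. t ^ 2 ^ j \<in> J (i + j)}" if "t \<in> Q" for t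
      using J_mem[OF that, of "i + j"] by (simp add: power_add flip: power_mult)
  qed
  then show ?thesis by blast
qed

lemma frob_G: "frob j n (G n i) \<subseteq> G n (i + j)"
proof (rule frob_least[OF lsub_pw[OF lJ] pw_mono[OF J_K]])
  fix v assume "v \<in> G n i"
  then show "fr j v \<in> G n (i + j)" unfolding pw_def fr_def using J_comp[of j i] by auto
qed

text \<open>A maximal proper submodule \<open>W\<close> of \<open>N2\<close> above \<open>N1\<close>
  leaves a cyclic quotient killed by \<open>Q\<close>. Its Frobenius image is cyclic and killed by
  \<open>J i\<close>, so it has length at most \<open>b i\<close>; induction treats \<open>W\<close>
  over \<open>N1\<close>.\<close>

lemma frob_len:
  assumes "lsub Q fsc N1" "lsub Q fsc N2" "pw n K \<subseteq> N1" "N1 \<subseteq> N2" "len Q fsc N1 N2 = enat k"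
  shows "len Q fsc (frob i n N1) (frob i n N2) \<le> of_nat k * b i"
  using assms
proof (induction k arbitrary: N2 rule: less_induct)
  case (less k)
  note h = less.prems
  show ?case
  proof (cases "N1 = N2")
    case True then show ?thesis using lmod.len_self[OF VF lfrob] by simp
  next
    case False
    then have "N1 \<subset> N2" using h by blast
    from lmod.maxsub[OF VF accV[of n] h(2,1) this h(3)]
    obtain W a where W: "lsub Q fsc W" "N1 \<subseteq> W" "W \<subset> N2" "a \<in> N2" "a \<notin> W"
      and full: "N2 \<subseteq> lsum Q fsc W (range (\<lambda>r. fsc r a))" and QW: "\<And>t y. t \<in> Q \<Longrightarrow> y \<in> N2 \<Longrightarrow> fsc t y \<in> W"
      by blast
    have "len Q fsc N1 W + 1 \<le> len Q fsc N1 N2"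
      by (rule lmod.len_strict[OF VF h(1) W(2) h(2) W(3)])
    then obtain k' where k': "len Q fsc N1 W = enat k'" "k' < k"
      using h(5) by (cases "len Q fsc N1 W") (auto simp: one_enat_def)
    have O: "pw n K \<subseteq> W" using h(3) W(2) by blast
    have IH: "len Q fsc (frob i n N1) (frob i n W) \<le> of_nat k' * b i"
      by (rule less.IH[OF k'(2) h(1) W(1) h(3) W(2) k'(1)])
    let ?W = "frob i n W" and ?a = "fr i a"
    have sub: "frob i n N2 \<subseteq> lsum Q fsc ?W (range (\<lambda>r. fsc r ?a))"
    proof (rule frob_least)
      show "lsub Q fsc (lsum Q fsc ?W (range (\<lambda>r. fsc r ?a)))" by (rule lmod.lsub_lsum_cyc[OF VF lfrob])
      have "?W \<subseteq> lsum Q fsc ?W (range (\<lambda>r. fsc r ?a))"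
        by (rule lmod.lsum_upper1[OF VF], rule range_eqI[of _ _ 0]) (simp add: fsc_def zero_fun_def)
      then show "pw n K \<subseteq> lsum Q fsc ?W (range (\<lambda>r. fsc r ?a))" using frob_O by blast
      fix v assume "v \<in> N2"
      then have "v \<in> lsum Q fsc W (range (\<lambda>r. fsc r a))" using full by blast
      then obtain u w r where e: "u \<notin> Q" "w \<in> W" "fsc u v = w + fsc r a" by (rule lsumE) blast
      have "fsc (u ^ 2 ^ i) (fr i v) = fr i w + fsc (r ^ 2 ^ i) ?a"
        using arg_cong[OF e(3), of "fr i"] by (simp add: fr_add fr_fsc)
      then show "fr i v \<in> lsum Q fsc ?W (range (\<lambda>r. fsc r ?a))"
        by (rule lsumI[OF is_primeD(8)[OF pQ e(1)] frob_mem[OF e(2)] rangeI])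
    qed
    have JW: "fsc w ?a \<in> ?W" if "w \<in> J i" for w
    proof -
      have "J i \<subseteq> {w. fsc w ?a \<in> ?W}"
      proof (rule J_least)
        show "lsub Q (*) {w. fsc w ?a \<in> ?W}"
          by (rule lsub_preimage[OF _ _ _ lfrob]) (auto simp: fsc_def fun_eq_iff algebra_simps)
        show "K \<subseteq> {w. fsc w ?a \<in> ?W}" using fsc_O frob_O by blast
        fix t assume "t \<in> Q"
        from frob_mem[OF QW[OF this W(4)], of i n] show "t ^ 2 ^ i \<in> {w. fsc w ?a \<in> ?W}"
          by (simp add: fr_fsc)
      qed
      then show ?thesis using that by blast
    qed
    \<comment> \<open>The relation says that \<open>z\<close> equals \<open>w\<close> times the
      generator \<open>?a\<close> modulo \<open>?W\<close>; in characteristic 2 the difference may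
      be written as a sum.\<close>
    have "len Q fsc ?W (frob i n N2) \<le> len Q (*) (J i) UNIV"
    proof (rule len_rel[OF VF VT lfrob lJ lsub_UNIV, where \<Gamma>="\<lambda>z w. z + fsc w ?a \<in> ?W"])
      show "?W \<subseteq> frob i n N2" by (rule frob_mono) (use W in blast)
      show "0 + fsc 0 ?a \<in> ?W" using lsF(1)[OF lfrob] by (simp add: fsc_def zero_fun_def)
      show "(z + z') + fsc (w + w') ?a \<in> ?W" if "z + fsc w ?a \<in> ?W" "z' + fsc w' ?a \<in> ?W" for z w z' w'
      proof -
        have "(z + z') + fsc (w + w') ?a = (z + fsc w ?a) + (z' + fsc w' ?a)"
          by (simp add: fsc_def fun_eq_iff algebra_simps)
        then show ?thesis by (rule ssubst) (rule lsF(2)[OF lfrob that])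
      qed
      show "fsc r z + fsc (r * w) ?a \<in> ?W" if "z + fsc w ?a \<in> ?W" for r z w
      proof -
        have "fsc r z + fsc (r * w) ?a = fsc r (z + fsc w ?a)"
          by (simp add: fsc_def fun_eq_iff algebra_simps)
        then show ?thesis by (rule ssubst) (rule lsF(3)[OF lfrob that])
      qed
      show "\<exists>u w. u \<notin> Q \<and> w \<in> UNIV \<and> fsc u z + fsc w ?a \<in> ?W" if "z \<in> frob i n N2" for z
      proof -
        have "z \<in> lsum Q fsc ?W (range (\<lambda>r. fsc r ?a))" using sub that by blast
        then obtain u w r where e: "u \<notin> Q" "w \<in> ?W" "fsc u z = w + fsc r ?a" by (rule lsumE) blast
        then show ?thesis by (intro exI[of _ u] exI[of _ r]) (simp add: add.assoc)
      qed
      show "z \<in> ?W" if "z + fsc w ?a \<in> ?W" "w \<in> J i" for z w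
        using lsF(2)[OF lfrob that(1) JW[OF that(2)]] by (simp add: add.assoc)
    qed auto
    then have "len Q fsc ?W (frob i n N2) \<le> b i" unfolding b_def .
    moreover have "len Q fsc (frob i n N1) (frob i n N2) = len Q fsc (frob i n N1) ?W + len Q fsc ?W (frob i n N2)"
      by (rule lmod.len_add[OF VF lfrob lfrob lfrob frob_mono frob_mono]) (use W in auto)
    ultimately have "len Q fsc (frob i n N1) (frob i n N2) \<le> of_nat k' * b i + b i"
      using IH by (simp add: add_mono)
    also have "\<dots> = of_nat (Suc k') * b i" by (simp add: algebra_simps)
    also have "\<dots> \<le> of_nat k * b i" using k'(2) by (intro mult_right_mono) (auto simp: of_nat_eq_enat)
    finally show ?thesis .
  qed
qed

lemma len_pw:
  assumes I: "lsub Q (*) I"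
  shows "len Q fsc (pw n I) UNIV = of_nat n * len Q (*) I UNIV"
proof (induction n)
  case 0
  have "pw 0 I = UNIV" unfolding pw_def by simp
  then show ?case using lmod.len_self[OF VF lsub_UNIV] by simp
next
  case (Suc n)
  have s: "pw (Suc n) I \<subseteq> pw n I" unfolding pw_def by auto
  have a: "len Q fsc (pw (Suc n) I) (pw n I) \<le> len Q (*) I UNIV"
    by (rule len_rel[OF VF VT lsub_pw[OF I] I lsub_UNIV s, where \<Gamma>="\<lambda>z w. w = z n"])
      (use is_primeD(5)[OF pQ] in \<open>auto simp: fsc_def pw_def less_Suc_eq\<close>)
  have "len Q (*) I UNIV \<le> len Q fsc (pw (Suc n) I) (pw n I)"
  proof (rule len_rel[OF VT VF I lsub_pw[OF I] lsub_pw[OF I] _ s, where \<Gamma>="\<lambda>z w. z = w n"])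
    show "\<exists>u w. u \<notin> Q \<and> w \<in> pw n I \<and> u * z = w n" for z
      using is_primeD(5)[OF pQ] lsT(1)[OF I]
      by (intro exI[of _ 1] exI[of _ "(\<lambda>_. 0)(n := z)"]) (auto simp: pw_def)
  qed (auto simp: fsc_def pw_def)
  with a have "len Q fsc (pw (Suc n) I) (pw n I) = len Q (*) I UNIV" by (rule antisym)
  moreover have "len Q fsc (pw (Suc n) I) UNIV = len Q fsc (pw (Suc n) I) (pw n I) + len Q fsc (pw n I) UNIV"
    by (rule lmod.len_add[OF VF lsub_pw[OF I] lsub_pw[OF I] lsub_UNIV s subset_UNIV])
  ultimately show ?case using Suc by (simp add: algebra_simps)
qed

text \<open>The Frobenius power of order \<open>2^j\<close> of \<open>J i\<close> lies in
  \<open>J (i + j)\<close>, so \<open>frob_len\<close> for the ring modulo \<open>J i\<close> gives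
  the bound.\<close>

lemma b_mult:
  assumes "b i = enat k" shows "b (i + j) \<le> of_nat k * b j"
proof -
  have bp: "len Q fsc (G 1 l) UNIV = b l" for l using len_pw[OF lJ, of 1] unfolding b_def by simp
  have "b (i + j) \<le> len Q fsc (frob j 1 (G 1 i)) UNIV"
    unfolding bp[symmetric] by (rule lmod.len_mono[OF VF frob_G order_refl])
  also have "\<dots> \<le> of_nat k * b j"
    using frob_len[OF lsub_pw[OF lJ] lsub_UNIV pw_mono[OF J_K] subset_UNIV, of 1 i k j] bp assms
    by (simp add: frob_UNIV)
  finally show ?thesis .
qed

lemma b_0: "b 0 \<le> 1" and b_pos: "b i \<ge> 1"
proof -
  have "J 0 = Q" unfolding J_def
    using lhull_superset[of "(\<lambda>t. t ^ 2 ^ 0) ` Q \<union> K" Q "(*)"] KQ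
      lhull_least[OF prime_lsub[OF pQ order_refl], of "(\<lambda>t. t ^ 2 ^ 0) ` Q \<union> K"] by auto
  \<comment> \<open>A saturated ideal strictly above \<open>Q\<close> contains an element outside
    \<open>Q\<close>, hence 1: at \<open>Q\<close> the quotient is a field.\<close>
  moreover have "len Q (*) Q UNIV \<le> 1"
  proof (rule enat_leI)
    fix k assume k: "enat k \<le> len Q (*) Q UNIV"
    have lQ: "lsub Q (*) Q" by (rule prime_lsub[OF pQ order_refl])
    show "enat k \<le> 1"
    proof (rule ccontr)
      assume "\<not> ?thesis"
      then have "2 \<le> k" by (simp add: one_enat_def)
      then have "chn Q (*) Q UNIV 2"
        using k lmod.len_ge_iff[OF VT lQ subset_UNIV] lmod.chn_le[OF VT] by blast
      then obtain W where W: "\<And>i. i \<le> 2 \<Longrightarrow> lsub Q (*) (W i) \<and> Q \<subseteq> W i" "\<And>i. i < 2 \<Longrightarrow> W i \<subset> W (Suc i)"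
        unfolding chn_def by blast
      have s: "W 0 \<subset> W 1" "W 1 \<subset> W 2" using W(2)[of 0] W(2)[of 1] by (auto simp: numeral_2_eq_2)
      then obtain x where x: "x \<in> W 1" "x \<notin> Q" using W(1)[of 0] by blast
      have l1: "lsub Q (*) (W 1)" using W(1)[of 1] by simp
      have "1 \<in> W 1" using lsT(4)[OF l1 x(2), of 1] x(1) by simp
      then have "y \<in> W 1" for y using lsT(3)[OF l1, of 1 y] by simp
      then show False using s by blast
    qed
  qed
  ultimately show "b 0 \<le> 1" unfolding b_def by simp
  have "J i \<subseteq> Q"
    using kid KQ is_idealD(7)[OF lsub_ideal[OF prime_lsub[OF pQ order_refl]]]
    by (intro J_least[OF prime_lsub[OF pQ order_refl]]) auto
  then have "J i \<subset> UNIV" using is_primeD(5)[OF pQ] by blast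
  from lmod.len_strict[OF VT lJ order_refl lsub_UNIV this] show "b i \<ge> 1"
    unfolding b_def using lmod.len_self[OF VT lJ] by simp
qed

text \<open>The generators in \<open>E\<close> are traded for their squares one at a time. A trade
  adds a quotient \<open>I/I'\<close> that is generated by \<open>x\<close> and killed by
  \<open>I\<close>, so the length at most doubles; it starts at no more than 1, for \<open>Q\<close>
  itself.\<close>

lemma b_1: "b 1 \<le> enat (2 ^ c)"
proof -
  define I where "I F = lhull Q (*) ((\<lambda>t. t ^ 2) ` F \<union> (E - F) \<union> K)" for F
  have lI: "lsub Q (*) (I F)" for F unfolding I_def by (rule lsub_lhull)
  have mem: "(\<lambda>t. t ^ 2) ` F \<union> (E - F) \<union> K \<subseteq> I F" for F unfolding I_def by (rule lhull_superset)
  have main: "len Q (*) (I F) UNIV \<le> enat (2 ^ card F)" if "finite F" "F \<subseteq> E" for F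
    using that
  proof (induction F rule: finite_induct)
    case empty
    have "J 0 \<subseteq> I {}"
      by (rule J_least[OF lI]) (use mem[of "{}"] E(4) in \<open>auto simp: I_def\<close>)
    then have "len Q (*) (I {}) UNIV \<le> b 0" unfolding b_def by (rule lmod.len_mono[OF VT _ order_refl])
    then show ?case using b_0 by (simp add: one_enat_def)
  next
    case (insert x F)
    let ?I = "I F" and ?I' = "I (insert x F)"
    have x: "x \<in> E" "x \<notin> F" using insert by auto
    have x2: "x * x \<in> ?I'" using mem[of "insert x F"] by (auto simp: power2_eq_square)
    have sub: "?I \<subseteq> lsum Q (*) ?I' (range (\<lambda>r. r * x))"
    proof -
      have a: "?I' \<subseteq> lsum Q (*) ?I' (range (\<lambda>r. r * x))"
        by (rule lmod.lsum_upper1[OF VT], rule range_eqI[of _ _ 0]) simp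
      have "x \<in> lsum Q (*) ?I' (range (\<lambda>r. r * x))"
        by (rule lmod.lsum_cyc_mem[OF VT lsT(1)[OF lI]])
      then show ?thesis using a mem[of "insert x F"] unfolding I_def[of F]
        by (intro lhull_least lmod.lsub_lsum_cyc[OF VT lI]) auto
    qed
    have xI: "x * t \<in> ?I'" if "t \<in> ?I" for t
    proof -
      have "lsub Q (*) {t. x * t \<in> ?I'}"
        by (rule lsub_preimage[OF _ _ _ lI]) (auto simp: algebra_simps)
      moreover have "y \<in> ?I' \<Longrightarrow> x * y \<in> ?I'" for y using lsT(3)[OF lI] .
      ultimately have "?I \<subseteq> {t. x * t \<in> ?I'}" unfolding I_def[of F]
        using mem[of "insert x F"] x2 by (intro lhull_least) auto
      then show ?thesis using that by blast
    qed
    have I'I: "?I' \<subseteq> ?I" unfolding I_def[of "insert x F"]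
    proof (rule lhull_least[OF lI])
      have "x \<in> ?I" using mem[of F] x by blast
      then have "x ^ 2 \<in> ?I" using lsT(3)[OF lI] by (simp add: power2_eq_square)
      then show "(\<lambda>t. t ^ 2) ` insert x F \<union> (E - insert x F) \<union> K \<subseteq> ?I" using mem[of F] by blast
    qed
    have "len Q (*) ?I' ?I \<le> len Q (*) ?I UNIV"
    proof (rule len_rel[OF VT VT lI lI lsub_UNIV I'I, where \<Gamma>="\<lambda>z w. z + w * x \<in> ?I'"])
      show "0 + 0 * x \<in> ?I'" using lsT(1)[OF lI] by simp
      show "(z + z') + (w + w') * x \<in> ?I'" if "z + w * x \<in> ?I'" "z' + w' * x \<in> ?I'" for z w z' w'
        using lsT(2)[OF lI that] by (simp add: algebra_simps)
      show "r * z + r * w * x \<in> ?I'" if "z + w * x \<in> ?I'" for r z w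
        using lsT(3)[OF lI that, of r] by (simp add: algebra_simps)
      show "\<exists>u w. u \<notin> Q \<and> w \<in> UNIV \<and> u * z + w * x \<in> ?I'" if "z \<in> ?I" for z
      proof -
        have "z \<in> lsum Q (*) ?I' (range (\<lambda>r. r * x))" using sub that by blast
        then obtain u w r where e: "u \<notin> Q" "w \<in> ?I'" "u * z = w + r * x" by (rule lsumE) blast
        then show ?thesis by (intro exI[of _ u] exI[of _ r]) (simp add: add.assoc)
      qed
      show "z \<in> ?I'" if "z + w * x \<in> ?I'" "w \<in> ?I" for z w
      proof -
        have "(z + w * x) + x * w \<in> ?I'" using lsT(2)[OF lI that(1) xI[OF that(2)]] .
        then show ?thesis by (simp add: add.assoc mult.commute)
      qed
    qed auto
    moreover have "len Q (*) ?I' UNIV = len Q (*) ?I' ?I + len Q (*) ?I UNIV"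
      by (rule lmod.len_add[OF VT lI lI lsub_UNIV I'I subset_UNIV])
    ultimately have "len Q (*) ?I' UNIV \<le> len Q (*) ?I UNIV + len Q (*) ?I UNIV"
      by (simp add: add_right_mono)
    also have "\<dots> \<le> enat (2 ^ card F) + enat (2 ^ card F)" using insert by (intro add_mono) auto
    finally show ?case using insert by (simp add: mult_2)
  qed
  have "I E \<subseteq> J 1" unfolding I_def
    by (rule lhull_least[OF lJ]) (use J_mem[of _ 1] E(3) J_K[of 1] in auto)
  then have "b 1 \<le> len Q (*) (I E) UNIV" unfolding b_def by (rule lmod.len_mono[OF VT _ order_refl])
  also have "\<dots> \<le> enat (2 ^ card E)" by (rule main) (use E in auto)
  also have "\<dots> \<le> enat (2 ^ c)" using E(2) by (simp add: power_increasing)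
  finally show ?thesis .
qed

lemma b_le: "b i \<le> enat (2 ^ (c * i))"
proof (induction i)
  case 0 then show ?case using b_0 by (simp add: one_enat_def)
next
  case (Suc i)
  then obtain k where k: "b i = enat k" "k \<le> 2 ^ (c * i)" by (metis enat_ile enat_ord_simps(1))
  have "b (Suc i) \<le> of_nat k * b 1" using b_mult[OF k(1), of 1] by simp
  also have "\<dots> \<le> enat k * enat (2 ^ c)" unfolding of_nat_eq_enat by (rule mult_left_mono[OF b_1]) simp
  also have "\<dots> \<le> enat (2 ^ (c * Suc i))" using k(2) by (simp add: power_add)
  finally show ?case .
qed

text \<open>The lengths \<open>b i\<close> are submultiplicative and at most \<open>2\<^sup>c\<^sup>i\<close>; a single strict inequality would
  contradict the growth of order \<open>2\<^sup>c\<^sup>i\<close>.\<close>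

lemma b_eq: "b i = enat (2 ^ (c * i))"
proof (rule ccontr)
  assume ne: "b i \<noteq> enat (2 ^ (c * i))"
  define \<beta> where "\<beta> i = the_enat (b i)" for i
  have \<beta>: "b i = enat (\<beta> i)" for i using b_le[of i] unfolding \<beta>_def by (cases "b i") auto
  obtain j where j: "\<And>e. \<exists>V. lsub Q (*) V \<and> K \<subseteq> V \<and> (\<forall>t\<in>Q. t ^ 2 ^ (e + j) \<in> V) \<and>
     enat (2 ^ (e * c)) \<le> len Q (*) V UNIV" using gr unfolding growth_def by blast
  have lo: "2 ^ (e * c) \<le> \<beta> (e + j)" for e
  proof -
    obtain V where V: "lsub Q (*) V" "K \<subseteq> V" "\<And>t. t \<in> Q \<Longrightarrow> t ^ 2 ^ (e + j) \<in> V"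
      "enat (2 ^ (e * c)) \<le> len Q (*) V UNIV" using j[of e] by blast
    have "J (e + j) \<subseteq> V" by (rule J_least) (use V in auto)
    then have "len Q (*) V UNIV \<le> b (e + j)" unfolding b_def by (rule lmod.len_mono[OF VT _ order_refl])
    then have "enat (2 ^ (e * c)) \<le> enat (\<beta> (e + j))" using V(4) \<beta> by (metis order_trans)
    then show ?thesis by simp
  qed
  define M where "M = (2::nat) ^ (c * i)"
  have lt: "\<beta> i < M" using ne b_le[of i] \<beta>[of i] unfolding M_def by simp
  have pos: "\<beta> i \<ge> 1" using b_pos[of i] \<beta>[of i] by (simp add: one_enat_def)
  have pw: "\<beta> (i * k) \<le> \<beta> i ^ k" for k
  proof (induction k)
    case 0 then show ?case using b_0 \<beta>[of 0] by (simp add: one_enat_def)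
  next
    case (Suc k)
    have "b (i * Suc k) \<le> of_nat (\<beta> i) * b (i * k)" using b_mult[OF \<beta>[of i], of "i * k"] by simp
    then have "\<beta> (i * Suc k) \<le> \<beta> i * \<beta> (i * k)" by (simp add: \<beta> of_nat_eq_enat)
    also have "\<dots> \<le> \<beta> i * \<beta> i ^ k" using Suc by simp
    finally show ?case by simp
  qed
  have i0: "i > 0" using lt pos unfolding M_def by (cases i) auto
  have key: "M ^ k \<le> 2 ^ (j * c) * \<beta> i ^ k" if "k \<ge> j" for k
  proof -
    have ik: "i * k \<ge> j" using that i0 by (metis less_eq_Suc_le mult_le_mono mult_1 One_nat_def)
    have "M ^ k = 2 ^ ((i * k - j) * c) * 2 ^ (j * c)"
      unfolding M_def power_add[symmetric] power_mult[symmetric] using ik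
      by (simp add: algebra_simps flip: distrib_right)
    also have "\<dots> \<le> \<beta> (i * k) * 2 ^ (j * c)" using lo[of "i * k - j"] ik by simp
    also have "\<dots> \<le> \<beta> i ^ k * 2 ^ (j * c)" using pw[of k] by simp
    finally show ?thesis by (simp add: mult.commute)
  qed
  define y where "y = real (\<beta> i)"
  define C where "C = real (2 ^ (j * c))"
  have y: "y \<ge> 1" using pos unfolding y_def by simp
  \<comment> \<open>Large enough for Bernoulli's inequality: \<open>1 + k/y\<close> is a lower bound
    of \<open>(1 + 1/y)^k\<close> and exceeds the constant \<open>C\<close>.\<close>
  obtain k where k: "k \<ge> j" "real k > C * y"
    by (metis reals_Archimedean2 less_le_trans linorder_le_cases of_nat_mono order_refl)
  have "(y + 1) ^ k \<le> real (M ^ k)" using lt unfolding y_def by (simp add: power_mono)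
  also have "\<dots> \<le> C * y ^ k" using key[OF k(1)] unfolding C_def y_def
    by (metis of_nat_mono of_nat_mult of_nat_power)
  finally have "(y + 1) ^ k \<le> C * y ^ k" .
  moreover have "(y + 1) ^ k = (1 + 1 / y) ^ k * y ^ k"
    using y by (simp add: power_mult_distrib[symmetric] field_simps)
  ultimately have "(1 + 1 / y) ^ k \<le> C" using y by simp
  moreover have "1 + real k * (1 / y) \<le> (1 + 1 / y) ^ k"
    using y by (intro Bernoulli_inequality) (simp add: order_trans[of _ 0])
  ultimately have "real k / y \<le> C" by simp
  then have "real k \<le> C * y" using y by (simp add: field_simps)
  then show False using k(2) by simp
qed

end

section \<open>Flatness of Frobenius\<close>

context frob_core
begin

text \<open>Up to elements outside \<open>Q\<close>, the quotient \<open>U/M\<close> is an image of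
  \<open>U'/V'\<close> under \<open>f\<close>. This is \<open>len_rel\<close> with \<open>z\<close>
  related to \<open>w\<close> when \<open>z\<close> and \<open>f w\<close> agree modulo
  \<open>M\<close>, again written as a sum.\<close>

lemma len_corr:
  fixes f :: "(nat \<Rightarrow> 't) \<Rightarrow> nat \<Rightarrow> 't"
  assumes M: "lsub Q fsc M" "M \<subseteq> U" and V': "lsub Q fsc V'" "lsub Q fsc U'" "V' \<subseteq> U'"
    and f: "\<And>x y. f (x + y) = f x + f y" "\<And>r x. f (fsc r x) = fsc r (f x)"
    and dom: "\<And>z. z \<in> U \<Longrightarrow> \<exists>u w. u \<notin> Q \<and> w \<in> U' \<and> fsc u z + f w \<in> M"
    and ker: "\<And>w. w \<in> V' \<Longrightarrow> f w \<in> M"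
  shows "len Q fsc M U \<le> len Q fsc V' U'"
proof (rule len_rel[OF VF VF M(1) V'(1,2) M(2) V'(3), where \<Gamma>="\<lambda>z w. z + f w \<in> M"])
  have "f 0 = 0" using f(2)[of 0 0] by (simp add: fsc_def zero_fun_def)
  then show "0 + f 0 \<in> M" using lsF(1)[OF M(1)] by simp
  show "(z + z') + f (w + w') \<in> M" if "z + f w \<in> M" "z' + f w' \<in> M" for z w z' w'
  proof -
    have "(z + z') + f (w + w') = (z + f w) + (z' + f w')" unfolding f by (simp only: add_ac)
    then show ?thesis by (rule ssubst) (rule lsF(2)[OF M(1) that])
  qed
  show "fsc r z + f (fsc r w) \<in> M" if "z + f w \<in> M" for r z w
  proof -
    have "fsc r z + f (fsc r w) = fsc r (z + f w)" unfolding f by (simp add: fsc_def fun_eq_iff algebra_simps)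
    then show ?thesis by (rule ssubst) (rule lsF(3)[OF M(1) that])
  qed
  show "z \<in> M" if "z + f w \<in> M" "w \<in> V'" for z w
    using lsF(2)[OF M(1) that(1) ker[OF that(2)]] by (simp add: add.assoc)
qed (use dom in auto)

lemma J_Suc: "J (Suc i) \<subseteq> J i"
proof (rule J_least[OF lJ J_K])
  fix t assume "t \<in> Q"
  then have "t ^ 2 ^ i * t ^ 2 ^ i \<in> J i" using lsT(3)[OF lJ J_mem] by blast
  then show "t ^ 2 ^ Suc i \<in> J i" by (simp add: mult_2 flip: power_add)
qed

lemma frob_lsum:
  assumes "lsub Q fsc N" "lsub Q fsc L"
  shows "frob i n (lsum Q fsc N L) \<subseteq> lsum Q fsc (frob i n N) (frob i n L)"
proof (rule frob_least[OF lmod.lsub_lsum'[OF VF lfrob lfrob]])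
  show "pw n K \<subseteq> lsum Q fsc (frob i n N) (frob i n L)"
    using frob_O lmod.lsum_upper1[OF VF lsF(1)[OF lfrob]] by blast
  fix v assume "v \<in> lsum Q fsc N L"
  then obtain u x y where e: "u \<notin> Q" "x \<in> N" "y \<in> L" "fsc u v = x + y" by (rule lsumE)
  have "fsc (u ^ 2 ^ i) (fr i v) = fr i x + fr i y"
    using arg_cong[OF e(4), of "fr i"] by (simp add: fr_add fr_fsc)
  then show "fr i v \<in> lsum Q fsc (frob i n N) (frob i n L)"
    by (rule lsumI[OF is_primeD(8)[OF pQ e(1)] frob_mem[OF e(2)] frob_mem[OF e(3)]])
qed

text \<open>A squeeze. From \<open>G n i\<close> to the whole module the length is known and grows
  by at least the factor \<open>2^c\<close>, because the Frobenius power of \<open>G n i\<close>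
  lies in \<open>G n (Suc i)\<close>. Each of the three pieces cut out by \<open>N1\<close> and
  \<open>N2\<close> grows by at most that factor, so each grows by exactly that factor.\<close>

lemma frob_len_eq:
  assumes N: "lsub Q fsc N1" "lsub Q fsc N2" "G n i \<subseteq> N1" "N1 \<subseteq> N2"
  shows "\<exists>k. len Q fsc N1 N2 = enat k \<and> len Q fsc (frob 1 n N1) (frob 1 n N2) = enat (2 ^ c * k)"
proof -
  have lG: "lsub Q fsc (G n i)" by (rule lsub_pw[OF lJ])
  have O: "pw n K \<subseteq> G n i" by (rule pw_mono[OF J_K])
  have tot: "len Q fsc (G n i) UNIV = len Q fsc (G n i) N1 + len Q fsc N1 N2 + len Q fsc N2 UNIV"
    using lmod.len_add[OF VF lG N(1) N(2) N(3,4)] lmod.len_add[OF VF lG N(2) lsub_UNIV _ subset_UNIV] N(3,4)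
    by simp
  have totv: "len Q fsc (G n l) UNIV = enat (n * 2 ^ (c * l))" for l
    using len_pw[OF lJ, of n l] b_eq[of l] unfolding b_def by (simp add: of_nat_eq_enat)
  obtain x y z where xyz: "len Q fsc (G n i) N1 = enat x" "len Q fsc N1 N2 = enat y" "len Q fsc N2 UNIV = enat z"
    "x + y + z = n * 2 ^ (c * i)"
    using tot unfolding totv
    by (cases "len Q fsc (G n i) N1"; cases "len Q fsc N1 N2"; cases "len Q fsc N2 UNIV") auto
  have b1: "b 1 = enat (2 ^ c)" using b_eq[of 1] by simp
  let ?F = "frob 1 n"
  have le: "len Q fsc (?F (G n i)) (?F N1) \<le> enat (x * 2 ^ c)" "len Q fsc (?F N1) (?F N2) \<le> enat (y * 2 ^ c)"
    "len Q fsc (?F N2) UNIV \<le> enat (z * 2 ^ c)"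
    using frob_len[OF lG N(1) O N(3) xyz(1), of 1] frob_len[OF N(1,2) _ N(4) xyz(2), of n 1]
      frob_len[OF N(2) lsub_UNIV _ subset_UNIV xyz(3), of n 1] O N(3,4) unfolding b1
    by (simp_all add: of_nat_eq_enat frob_UNIV)
  have "enat (n * 2 ^ (c * Suc i)) \<le> len Q fsc (?F (G n i)) UNIV"
    unfolding totv[symmetric] using frob_G[of 1 n i] by (intro lmod.len_mono[OF VF]) auto
  also have "\<dots> = len Q fsc (?F (G n i)) (?F N1) + len Q fsc (?F N1) (?F N2) + len Q fsc (?F N2) UNIV"
    using lmod.len_add[OF VF lfrob lfrob lfrob frob_mono[OF N(3), of 1 n] frob_mono[OF N(4), of 1 n]]
      lmod.len_add[OF VF lfrob lfrob lsub_UNIV frob_mono[OF order_trans[OF N(3,4)], of 1 n] subset_UNIV]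
    by simp
  finally have ge: "enat (n * 2 ^ (c * Suc i)) \<le> \<dots>" .
  obtain x' y' z' where xyz': "len Q fsc (?F (G n i)) (?F N1) = enat x'" "len Q fsc (?F N1) (?F N2) = enat y'"
    "len Q fsc (?F N2) UNIV = enat z'" "x' \<le> x * 2 ^ c" "y' \<le> y * 2 ^ c" "z' \<le> z * 2 ^ c"
    using le by (metis enat_ile enat_ord_simps(1))
  have "n * 2 ^ (c * Suc i) = (x + y + z) * 2 ^ c" unfolding xyz(4) by (simp add: power_add)
  also have "\<dots> = x * 2 ^ c + y * 2 ^ c + z * 2 ^ c" by (simp add: algebra_simps)
  finally have "x * 2 ^ c + y * 2 ^ c + z * 2 ^ c \<le> x' + y' + z'" using ge xyz' by simp
  then have "y' = 2 ^ c * y" using xyz'(4-6) by (simp add: mult.commute)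
  then show ?thesis using xyz(2) xyz'(2) by blast
qed

lemma mv_G: "v \<in> G n i \<Longrightarrow> mv a n v \<in> G m i"
  unfolding mv_def pw_def using is_idealD(3)[OF lsub_ideal[OF lJ]]
  by (auto intro!: is_ideal_sum[OF lsub_ideal[OF lJ]])

lemma lsub_mv: "lsub Q fsc N \<Longrightarrow> lsub Q fsc {v. mv a n v \<in> N}"
  by (rule lsub_preimage[where D="mv a n" and s=fsc and s'=fsc, OF mv_add mv_fsc mv_0])

lemma lsum_range_mv: "lsub Q fsc N \<Longrightarrow> lsub Q fsc (lsum Q fsc N (range (mv a n)))"
proof (rule lmod.lsub_lsum[OF VF])
  show "0 \<in> range (mv a n)" by (rule range_eqI[of _ _ 0]) (simp add: mv_0)
  show "x + y \<in> range (mv a n)" if "x \<in> range (mv a n)" "y \<in> range (mv a n)" for x y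
    using that by (auto simp flip: mv_add)
  show "fsc r x \<in> range (mv a n)" if "x \<in> range (mv a n)" for r x
    using that by (auto simp flip: mv_fsc)
qed (use lsF(1,2,3) in blast)+

text \<open>The colength of \<open>frob 1 n W\<close> is \<open>2^c\<close> times that of
  \<open>W\<close>, hence at most \<open>2^c\<close> times the length of the image of
  \<open>a\<close> modulo \<open>N\<close>, and therefore at most the colength of \<open>W'\<close>.
  As \<open>frob 1 n W\<close> lies in \<open>W'\<close> and the colengths are finite, the two
  coincide.\<close>

lemma colon:
  assumes N: "lsub Q fsc N" "G m i \<subseteq> N" and z: "mv (sqm a) n z \<in> frob 1 m N"
  shows "z \<in> frob 1 n {v. mv a n v \<in> N}"
proof -
  define W where "W = {v. mv a n v \<in> N}"
  define W' where "W' = {v. mv (sqm a) n v \<in> frob 1 m N}"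
  define Y where "Y = lsum Q fsc N (range (mv a n))"
  have lW: "lsub Q fsc W" and lW': "lsub Q fsc W'" unfolding W_def W'_def
    using lsub_mv[OF N(1)] lsub_mv[OF lfrob] by auto
  have lY: "lsub Q fsc Y" unfolding Y_def by (rule lsum_range_mv[OF N(1)])
  have NY: "N \<subseteq> Y" unfolding Y_def
    by (rule lmod.lsum_upper1[OF VF], rule range_eqI[of _ _ 0]) (simp add: mv_0)
  have GW: "G n i \<subseteq> W" unfolding W_def using mv_G N(2) by blast
  have O: "pw m K \<subseteq> frob 1 m N" by (rule frob_O)
  have WW: "frob 1 n W \<subseteq> W'"
  proof (rule frob_least[OF lW'])
    show "pw n K \<subseteq> W'" unfolding W'_def using mv_O[where m=m] O by blast
    fix v assume "v \<in> W"
    then have "mv a n v \<in> N" unfolding W_def by blast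
    from frob_mem[OF this, of 1 m] show "fr 1 v \<in> W'" unfolding W'_def mem_Collect_eq fr_mv .
  qed
  obtain k where k: "len Q fsc W UNIV = enat k" "len Q fsc (frob 1 n W) UNIV = enat (2 ^ c * k)"
    using frob_len_eq[OF lW lsub_UNIV GW subset_UNIV] by (auto simp: frob_UNIV)
  obtain l where l: "len Q fsc N Y = enat l" "len Q fsc (frob 1 m N) (frob 1 m Y) = enat (2 ^ c * l)"
    using frob_len_eq[OF N(1) lY N(2) NY] by auto
  have "len Q fsc W UNIV \<le> len Q fsc N Y"
  proof (rule len_rel[OF VF VF lW N(1) lY subset_UNIV NY, where \<Gamma>="\<lambda>z w. w = mv a n z"])
    show "\<exists>u w. u \<notin> Q \<and> w \<in> Y \<and> w = mv a n (fsc u z)" for z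
    proof (intro exI conjI)
      show "1 \<notin> Q" by (rule is_primeD(5)[OF pQ])
      show "mv a n (fsc 1 z) \<in> Y" unfolding Y_def
        by (rule subsetD[OF lmod.lsum_upper2[OF VF lsF(1)[OF N(1)]]]) (rule rangeI)
    qed simp
  qed (auto simp: mv_add mv_fsc mv_0 W_def)
  then have kl: "k \<le> l" using k l by simp
  define Y2 where "Y2 = lsum Q fsc (frob 1 m N) (range (mv (sqm a) n))"
  have lY2: "lsub Q fsc Y2" unfolding Y2_def by (rule lsum_range_mv[OF lfrob])
  have N2: "frob 1 m N \<subseteq> Y2" unfolding Y2_def
    by (rule lmod.lsum_upper1[OF VF], rule range_eqI[of _ _ 0]) (simp add: mv_0)
  have "frob 1 m Y \<subseteq> Y2"
  proof (rule frob_least[OF lY2])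
    show "pw m K \<subseteq> Y2" using N2 O by blast
    fix v assume "v \<in> Y"
    then obtain u x w where e: "u \<notin> Q" "x \<in> N" "fsc u v = x + mv a n w" unfolding Y_def by (rule lsumE) blast
    have "fsc (u ^ 2 ^ 1) (fr 1 v) = fr 1 x + mv (sqm a) n (fr 1 w)"
      using arg_cong[OF e(3), of "fr 1"] by (simp only: fr_add fr_fsc fr_mv)
    then show "fr 1 v \<in> Y2" unfolding Y2_def
      by (rule lsumI[OF is_primeD(8)[OF pQ e(1), of "2 ^ 1"] frob_mem[OF e(2), of 1 m]
            rangeI[of "mv (sqm a) n" "fr 1 w"]])
  qed
  then have "len Q fsc (frob 1 m N) (frob 1 m Y) \<le> len Q fsc (frob 1 m N) Y2"
    by (intro lmod.len_mono[OF VF]) auto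
  also have "\<dots> \<le> len Q fsc W' UNIV"
  proof (rule len_corr[OF lfrob N2 lW' lsub_UNIV subset_UNIV mv_add mv_fsc])
    fix z assume "z \<in> Y2"
    then obtain u x w where e: "u \<notin> Q" "x \<in> frob 1 m N" "fsc u z = x + mv (sqm a) n w"
      unfolding Y2_def by (rule lsumE) blast
    then show "\<exists>u w. u \<notin> Q \<and> w \<in> UNIV \<and> fsc u z + mv (sqm a) n w \<in> frob 1 m N"
      by (intro exI[of _ u] exI[of _ w]) (simp add: add.assoc)
  qed (simp add: W'_def)
  finally have "enat (2 ^ c * l) \<le> len Q fsc W' UNIV" using l by simp
  then have "len Q fsc (frob 1 n W) UNIV \<le> len Q fsc W' UNIV"
    unfolding k(2) using kl by (intro order_trans[OF _ \<open>enat (2 ^ c * l) \<le> _\<close>]) simp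
  moreover have "len Q fsc W' UNIV \<noteq> \<infinity>"
    using lmod.len_mono[OF VF WW order_refl, of UNIV] k(2) by (cases "len Q fsc W' UNIV") auto
  ultimately have "frob 1 n W = W'"
    by (intro lmod.len_eqD[OF VF lfrob lW' lsub_UNIV WW subset_UNIV])
  then show ?thesis using z unfolding W_def W'_def by blast
qed

text \<open>A weak Artin--Rees lemma: a submodule \<open>M\<close> maximal with \<open>M \<inter> Y = C\<close> contains a Frobenius power of
  the maximal ideal.\<close>

lemma artin_rees:
  assumes C: "lsub Q fsc C" and Y: "lsub Q fsc Y" and O: "pw n K \<subseteq> C" and CY: "C \<subseteq> Y"
    and tors: "\<And>t v. t \<in> Q \<Longrightarrow> v \<in> Y \<Longrightarrow> fsc (t ^ 2 ^ s) v \<in> C"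
  shows "\<exists>i. lsum Q fsc C (G n i) \<inter> Y \<subseteq> C"
proof -
  let ?G = "{M. lsub Q fsc M \<and> C \<subseteq> M \<and> M \<inter> Y = C}"
  have "?G \<subseteq> {N. lsub Q fsc N \<and> pw n K \<subseteq> N}" "?G \<noteq> {}" using C CY O by blast+
  from acc_max[OF accV this] obtain M where M: "M \<in> ?G" and mx: "\<forall>N\<in>?G. M \<subseteq> N \<longrightarrow> N = M" by blast
  from M have lM: "lsub Q fsc M" and CM: "C \<subseteq> M" and MY: "M \<inter> Y = C" by auto
  \<comment> \<open>The submodules \<open>f k\<close> of vectors carried into \<open>M\<close> by
    \<open>t^k\<close> become stationary at some \<open>k\<close>. For this \<open>k\<close> the
    submodule generated by \<open>M\<close> and all multiples of \<open>t^k\<close> still meets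
    \<open>Y\<close> in \<open>C\<close>, so by maximality it is \<open>M\<close>.\<close>
  have pow: "\<exists>k. \<forall>v. fsc (t ^ k) v \<in> M" if t: "t \<in> Q" for t
  proof -
    define f where "f k = {v. fsc (t ^ k) v \<in> M}" for k
    have lf: "lsub Q fsc (f k)" for k unfolding f_def
      by (rule lsub_preimage[OF _ _ _ lM]) (auto simp: fsc_def fun_eq_iff algebra_simps)
    have mem: "fsc r v \<in> M" if "v \<in> M" for r v using lsF(3)[OF lM that] .
    have "pw n K \<subseteq> f k" for k unfolding f_def using mem CM O by blast
    moreover have "f k \<subseteq> f (Suc k)" for k
    proof
      fix v assume "v \<in> f k"
      then have "fsc t (fsc (t ^ k) v) \<in> M" unfolding f_def using mem by blast
      then show "v \<in> f (Suc k)" unfolding f_def by (simp add: fsc_def mult.assoc)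
    qed
    ultimately obtain k where k: "\<forall>i\<ge>k. f i = f k" using accD[OF accV, of f n] lf by blast
    let ?R = "range (fsc (t ^ k))"
    let ?Y = "lsum Q fsc M ?R"
    have lY: "lsub Q fsc ?Y"
    proof (rule lmod.lsub_lsum[OF VF lsF(1-3)[OF lM]])
      show "0 \<in> ?R" by (rule range_eqI[of _ _ 0]) (simp add: fsc_def zero_fun_def)
      show "x + y \<in> ?R" if xy: "x \<in> ?R" "y \<in> ?R" for x y
      proof -
        obtain v w where "x = fsc (t ^ k) v" "y = fsc (t ^ k) w" using xy by blast
        then show ?thesis
          by (intro range_eqI[of _ _ "v + w"]) (simp add: fsc_def fun_eq_iff distrib_left)
      qed
      show "fsc r x \<in> ?R" if "x \<in> ?R" for r x
      proof -
        obtain v where "x = fsc (t ^ k) v" using \<open>x \<in> ?R\<close> by blast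
        then show ?thesis
          by (intro range_eqI[of _ _ "fsc r v"]) (simp add: fsc_def fun_eq_iff mult.left_commute)
      qed
    qed
    have MY': "M \<subseteq> ?Y"
      by (rule lmod.lsum_upper1[OF VF], rule range_eqI[of _ _ 0]) (simp add: fsc_def zero_fun_def)
    have "y \<in> C" if y: "y \<in> ?Y" "y \<in> Y" for y
    proof -
      from y(1) obtain u w v where e: "u \<notin> Q" "w \<in> M" "fsc u y = w + fsc (t ^ k) v" by (rule lsumE) blast
      have "fsc (t ^ 2 ^ s) (fsc u y) \<in> M" using tors[OF t lsF(3)[OF Y y(2)]] CM by blast
      then have "fsc (t ^ 2 ^ s) w + fsc (t ^ (k + 2 ^ s)) v \<in> M"
        unfolding e by (simp add: fsc_def plus_fun_def power_add algebra_simps)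
      from lsF(2)[OF lM mem[OF e(2), of "t ^ 2 ^ s"] this] have "fsc (t ^ (k + 2 ^ s)) v \<in> M"
        by (simp flip: add.assoc)
      then have "v \<in> f (k + 2 ^ s)" unfolding f_def by blast
      then have "v \<in> f k" using k[rule_format, of "k + 2 ^ s"] by simp
      then have "fsc u y \<in> M" unfolding e f_def using lsF(2)[OF lM e(2)] by blast
      then show ?thesis using lsF(4)[OF lM e(1)] y(2) MY by blast
    qed
    then have "?Y \<inter> Y = C" using MY' CM CY by auto
    then have "?Y \<in> ?G" using lY order_trans[OF CM MY'] by simp
    then have "?Y = M" using mx MY' by blast
    moreover have "?R \<subseteq> ?Y" by (rule lmod.lsum_upper2[OF VF lsF(1)[OF lM]])
    ultimately have "?R \<subseteq> M" by simp
    then show ?thesis by blast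
  qed
  then have "\<forall>t\<in>E. \<exists>k. \<forall>v. fsc (t ^ k) v \<in> M" using E(3) by blast
  then obtain k where k: "\<And>t v. t \<in> E \<Longrightarrow> fsc (t ^ k t) v \<in> M" by metis
  \<comment> \<open>Any \<open>i\<close> with \<open>2^i\<close> at least every exponent
    \<open>k t\<close> will do; the sum is one because \<open>i < 2^i\<close>.\<close>
  define i where "i = (\<Sum>t\<in>E. k t)"
  define A where "A = {t. \<forall>v. fsc t v \<in> M}"
  have lA: "lsub Q (*) A"
  proof (rule lsubI)
    show "0 \<in> A" unfolding A_def using lsF(1)[OF lM] by (simp add: fsc_def zero_fun_def)
    show "x + y \<in> A" if "x \<in> A" "y \<in> A" for x y
    proof -
      have "fsc (x + y) v = fsc x v + fsc y v" for v :: "nat \<Rightarrow> 't" by (simp add: fsc_def fun_eq_iff algebra_simps)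
      then show ?thesis using that lsF(2)[OF lM] unfolding A_def by simp
    qed
    show "r * x \<in> A" if "x \<in> A" for r x
    proof -
      have "fsc (r * x) v = fsc r (fsc x v)" for v :: "nat \<Rightarrow> 't" by (simp add: fsc_def mult.assoc)
      then show ?thesis using that lsF(3)[OF lM] unfolding A_def by simp
    qed
    show "x \<in> A" if "u \<notin> Q" "u * x \<in> A" for u x
    proof -
      have "fsc (u * x) v = fsc u (fsc x v)" for v :: "nat \<Rightarrow> 't" by (simp add: fsc_def mult.assoc)
      then show ?thesis using that(2) lsF(4)[OF lM that(1)] unfolding A_def by simp
    qed
  qed
  have KA: "K \<subseteq> A" unfolding A_def using fsc_O O CM by blast
  have "E \<union> K \<subseteq> {t. t ^ 2 ^ i \<in> A}"
  proof -
    have "t ^ 2 ^ i \<in> A" if t: "t \<in> E" for t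
    proof -
      have "k t \<le> i" unfolding i_def using E(1) t by (rule member_le_sum[rotated 2]) auto
      then have "k t \<le> 2 ^ i" using less_exp[of i] by linarith
      then have "t ^ 2 ^ i = t ^ (2 ^ i - k t) * t ^ k t" by (simp flip: power_add)
      moreover have "t ^ k t \<in> A" unfolding A_def using k[OF t] by blast
      ultimately show ?thesis using lsT(3)[OF lA] by simp
    qed
    moreover have "t ^ 2 ^ i \<in> A" if "t \<in> K" for t using kid(7)[OF that, of "2 ^ i"] KA by auto
    ultimately show ?thesis by blast
  qed
  then have "Q \<subseteq> {t. t ^ 2 ^ i \<in> A}" using E(4) lhull_least[OF lsub_powT[OF lA]] by blast
  then have JA: "J i \<subseteq> A" by (intro J_least[OF lA KA]) blast
  have "G n i \<subseteq> M"
  proof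
    fix f assume f: "f \<in> G n i"
    show "f \<in> M"
    proof (rule lmemI[OF lM])
      show "pw n K \<subseteq> M" using O CM by blast
      show "fsc (f l) (unitv l) \<in> M" if "l < n" for l
        using f that JA unfolding pw_def A_def by blast
    qed
  qed
  then have "lsum Q fsc C (G n i) \<subseteq> M" by (intro lmod.lsum_least[OF VF lM CM])
  then show ?thesis using MY by blast
qed

text \<open>Krull's intersection theorem from the Artin-Rees lemma with \<open>Y = N + R z\<close>
  and \<open>C = N + Q z\<close>: a \<open>z\<close> that lies in every \<open>N + G n i\<close>
  lies in \<open>C\<close>, and by Nakayama's argument then in \<open>N\<close>.\<close>

lemma krull:
  assumes N: "lsub Q fsc N" "pw n K \<subseteq> N" and z: "\<And>i. z \<in> lsum Q fsc N (G n (Suc i))"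
  shows "z \<in> N"
proof (rule ccontr)
  assume zN: "z \<notin> N"
  define Y where "Y = lsum Q fsc N (range (\<lambda>r. fsc r z))"
  define C where "C = lsum Q fsc N ((\<lambda>r. fsc r z) ` Q)"
  have lY: "lsub Q fsc Y" unfolding Y_def by (rule lmod.lsub_lsum_cyc[OF VF N(1)])
  have zY: "z \<in> Y" unfolding Y_def by (rule lmod.lsum_cyc_mem[OF VF lsF(1)[OF N(1)]])
  have q: "0 \<in> Q" "x \<in> Q \<Longrightarrow> y \<in> Q \<Longrightarrow> x + y \<in> Q" "x \<in> Q \<Longrightarrow> r * x \<in> Q" for x y r
    using is_primeD(1,2,3)[OF pQ] by blast+
  have f: "fsc x v + fsc y v = fsc (x + y) v" "fsc r (fsc x v) = fsc (r * x) v" "fsc 0 v = 0"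
    for x y r and v :: "nat \<Rightarrow> 't"
    by (simp_all add: fsc_def fun_eq_iff algebra_simps)
  have lC: "lsub Q fsc C" unfolding C_def
  proof (rule lmod.lsub_lsum[OF VF lsF(1-3)[OF N(1)]])
    show "0 \<in> (\<lambda>r. fsc r z) ` Q" by (rule image_eqI[of _ _ 0]) (use q f in auto)
    show "x + y \<in> (\<lambda>r. fsc r z) ` Q" if "x \<in> (\<lambda>r. fsc r z) ` Q" "y \<in> (\<lambda>r. fsc r z) ` Q" for x y
      using that q(2) by (auto simp: f)
    show "fsc r x \<in> (\<lambda>r. fsc r z) ` Q" if "x \<in> (\<lambda>r. fsc r z) ` Q" for r x
      using that q(3) by (auto simp: f)
  qed
  have NC: "N \<subseteq> C" unfolding C_def
    by (rule lmod.lsum_upper1[OF VF], rule image_eqI[of _ _ 0]) (use q f in auto)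
  have CY: "C \<subseteq> Y" unfolding C_def Y_def by (rule lmod.lsum_mono[OF VF]) auto
  have zC: "z \<notin> C"
  proof
    assume "z \<in> C"
    then obtain u w t where e: "u \<notin> Q" "w \<in> N" "t \<in> Q" "fsc u z = w + fsc t z"
      unfolding C_def by (rule lsumE) blast
    have "fsc (u - t) z = fsc u z + fsc t z" unfolding diff_eq f ..
    also have "\<dots> = w" unfolding e(4) by (simp add: add.assoc)
    finally have "fsc (u - t) z \<in> N" using e(2) by simp
    then show False using lsF(4)[OF N(1) is_primeD(9)[OF pQ e(1,3)]] zN by blast
  qed
  have "\<exists>i. lsum Q fsc C (G n i) \<inter> Y \<subseteq> C"
  proof (rule artin_rees[OF lC lY _ CY, of n 0])
    show "pw n K \<subseteq> C" using N(2) NC by blast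
    fix t v assume t: "t \<in> Q" and v: "v \<in> Y"
    from v obtain u w r where e: "u \<notin> Q" "w \<in> N" "fsc u v = w + fsc r z" unfolding Y_def by (rule lsumE) blast
    have "fsc u (fsc t v) = fsc t (fsc u v)" by (simp add: fsc_def mult.left_commute)
    also have "\<dots> = fsc t w + fsc (r * t) z" unfolding e(3) by (simp add: fsc_def fun_eq_iff algebra_simps)
    finally have "fsc u (fsc t v) = fsc t w + fsc (r * t) z" .
    then have "fsc t v \<in> C" unfolding C_def
      by (rule lsumI[OF e(1) lsF(3)[OF N(1) e(2)] imageI[OF q(3)[OF t]]])
    then show "fsc (t ^ 2 ^ 0) v \<in> C" by simp
  qed
  then obtain i where i: "lsum Q fsc C (G n i) \<inter> Y \<subseteq> C" by blast
  have "lsum Q fsc N (G n (Suc i)) \<subseteq> lsum Q fsc C (G n i)"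
    by (rule lmod.lsum_mono[OF VF NC pw_mono[OF J_Suc]])
  then show False using z[of i] zY i zC by blast
qed

text \<open>Flatness of Frobenius in equational form. Modulo \<open>G m i\<close> it is
  \<open>colon\<close>. By Artin-Rees for the image of \<open>a\<close>, a vector that
  \<open>a\<close> maps into \<open>G m i\<close> lies in the kernel plus \<open>G n s\<close>. So
  the claim holds up to \<open>G n (Suc s)\<close> for every \<open>s\<close>, and
  \<open>krull\<close> concludes.\<close>

lemma flat:
  assumes z: "mv (sqm a) n z \<in> pw m K"
  shows "z \<in> frob 1 n {v. mv a n v \<in> pw m K}"
proof (rule krull[OF lfrob frob_O])
  fix s
  define R where "R = {v. mv a n v \<in> pw m K}"
  have lR: "lsub Q fsc R" unfolding R_def by (rule lsub_mv[OF lO])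
  have lG: "lsub Q fsc (G l i)" for l i by (rule lsub_pw[OF lJ])
  define Y where "Y = lsum Q fsc (pw m K) (range (mv a n))"
  \<comment> \<open>The image of \<open>G n s\<close> under \<open>a\<close>. For \<open>t\<close>
    in \<open>Q\<close> it absorbs \<open>t^(2^s)\<close> times the image of \<open>a\<close>, which
    is the torsion condition of \<open>artin_rees\<close>.\<close>
  define C where "C = lsum Q fsc (pw m K) (mv a n ` G n s)"
  have lY: "lsub Q fsc Y" unfolding Y_def by (rule lsum_range_mv[OF lO])
  have lC: "lsub Q fsc C" unfolding C_def
  proof (rule lmod.lsub_lsum[OF VF lsF(1-3)[OF lO]])
    show "0 \<in> mv a n ` G n s" by (rule image_eqI[of _ _ 0]) (use lsF(1)[OF lG] in \<open>auto simp: mv_0\<close>)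
    show "x + y \<in> mv a n ` G n s" if "x \<in> mv a n ` G n s" "y \<in> mv a n ` G n s" for x y
      using that lsF(2)[OF lG] by (auto simp flip: mv_add)
    show "fsc r x \<in> mv a n ` G n s" if "x \<in> mv a n ` G n s" for r x
      using that lsF(3)[OF lG] by (auto simp flip: mv_fsc)
  qed
  have CY: "C \<subseteq> Y" unfolding C_def Y_def by (rule lmod.lsum_mono[OF VF]) auto
  have "\<exists>i. lsum Q fsc C (G m i) \<inter> Y \<subseteq> C"
  proof (rule artin_rees[OF lC lY _ CY, of m s])
    show "pw m K \<subseteq> C" unfolding C_def
      by (rule lmod.lsum_upper1[OF VF], rule image_eqI[of _ _ 0]) (use lsF(1)[OF lG] in \<open>auto simp: mv_0\<close>)
    fix t v assume t: "t \<in> Q" and v: "v \<in> Y"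
    from v obtain u w x where e: "u \<notin> Q" "w \<in> pw m K" "fsc u v = w + mv a n x" unfolding Y_def by (rule lsumE) blast
    let ?t = "t ^ 2 ^ s"
    have "fsc u (fsc ?t v) = fsc ?t (fsc u v)" by (simp add: fsc_def mult.left_commute)
    also have "\<dots> = fsc ?t w + mv a n (fsc ?t x)" unfolding e(3) mv_fsc by (simp add: fsc_def fun_eq_iff algebra_simps)
    finally have e2: "fsc u (fsc ?t v) = fsc ?t w + mv a n (fsc ?t x)" .
    have gx: "fsc ?t x \<in> G n s" using is_idealD(4)[OF lsub_ideal[OF lJ] J_mem[OF t]] by (simp add: pw_def fsc_def)
    from e2 show "fsc ?t v \<in> C" unfolding C_def
      by (rule lsumI[OF e(1) lsF(3)[OF lO e(2)] imageI[OF gx]])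
  qed
  then obtain i where i: "lsum Q fsc C (G m i) \<inter> Y \<subseteq> C" by blast
  have WR: "{v. mv a n v \<in> G m i} \<subseteq> lsum Q fsc R (G n s)"
  proof
    fix v assume v: "v \<in> {v. mv a n v \<in> G m i}"
    then have "mv a n v \<in> lsum Q fsc C (G m i)"
      using lmod.lsum_upper2[OF VF lsF(1)[OF lC]] by blast
    moreover have "mv a n v \<in> Y" unfolding Y_def
      by (rule subsetD[OF lmod.lsum_upper2[OF VF lsF(1)[OF lO]]]) (rule rangeI)
    ultimately have "mv a n v \<in> C" using i by blast
    then obtain u w g where e: "u \<notin> Q" "w \<in> pw m K" "g \<in> G n s" "fsc u (mv a n v) = w + mv a n g"
      unfolding C_def by (rule lsumE) blast
    have "mv a n (fsc u v + g) = w" unfolding mv_add mv_fsc e(4) by (simp add: add.assoc)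
    then have "fsc u v + g \<in> R" using e(2) unfolding R_def by simp
    moreover have "fsc u v = (fsc u v + g) + g" by (simp add: add.assoc)
    ultimately show "v \<in> lsum Q fsc R (G n s)" using lsumI[OF e(1) _ e(3)] by blast
  qed
  have "mv (sqm a) n z \<in> frob 1 m (G m i)" using z frob_O by blast
  then have "z \<in> frob 1 n {v. mv a n v \<in> G m i}" by (rule colon[OF lG order_refl])
  also have "\<dots> \<subseteq> frob 1 n (lsum Q fsc R (G n s))" by (rule frob_mono[OF WR])
  also have "\<dots> \<subseteq> lsum Q fsc (frob 1 n R) (frob 1 n (G n s))" by (rule frob_lsum[OF lR lG])
  also have "\<dots> \<subseteq> lsum Q fsc (frob 1 n R) (G n (Suc s))"
    using frob_G[of 1 n s] by (intro lmod.lsum_mono[OF VF]) auto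
  finally show "z \<in> lsum Q fsc (frob 1 n {v. mv a n v \<in> pw m K}) (G n (Suc s))" unfolding R_def .
qed

text \<open>\<open>frob_len_eq\<close> speaks about finite colength. Adding a deep
  \<open>G n i\<close> to \<open>B\<close> and \<open>Z\<close> leads to that case, and by
  Artin-Rees nothing of \<open>Z/B\<close> is lost. The exponent \<open>s\<close> expresses that
  \<open>Z/B\<close> is supported at \<open>Q\<close> alone.\<close>

lemma frob_ratio:
  assumes B: "lsub Q fsc B" and Z: "lsub Q fsc Z" and O: "pw n K \<subseteq> B" and BZ: "B \<subseteq> Z"
    and tors: "\<And>t v. t \<in> Q \<Longrightarrow> v \<in> Z \<Longrightarrow> fsc (t ^ 2 ^ s) v \<in> B"
  shows "\<exists>k. len Q fsc B Z = enat k \<and> enat (2 ^ c * k) \<le> len Q fsc (frob 1 n B) (frob 1 n Z)"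
proof -
  obtain i where i: "lsum Q fsc B (G n i) \<inter> Z \<subseteq> B" using artin_rees[OF B Z O BZ tors] by blast
  have lG: "lsub Q fsc (G n i)" by (rule lsub_pw[OF lJ])
  define B' where "B' = lsum Q fsc B (G n i)"
  define Z' where "Z' = lsum Q fsc Z (G n i)"
  have l: "lsub Q fsc B'" "lsub Q fsc Z'" unfolding B'_def Z'_def
    using lmod.lsub_lsum'[OF VF B lG] lmod.lsub_lsum'[OF VF Z lG] by auto
  have s: "B' \<subseteq> Z'" "G n i \<subseteq> B'" "Z \<subseteq> Z'" "B \<subseteq> B'" unfolding B'_def Z'_def
    using lmod.lsum_mono[OF VF BZ order_refl] lmod.lsum_upper2[OF VF lsF(1)[OF B]]
      lmod.lsum_upper1[OF VF lsF(1)[OF lG]] by auto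
  obtain k where k: "len Q fsc B' Z' = enat k" "len Q fsc (frob 1 n B') (frob 1 n Z') = enat (2 ^ c * k)"
    using frob_len_eq[OF l s(2,1)] by blast
  have "len Q fsc B Z \<le> len Q fsc B' Z'"
  proof (rule len_rel[OF VF VF B l BZ s(1), where \<Gamma>="\<lambda>z w. w = z"])
    show "\<exists>u w. u \<notin> Q \<and> w \<in> Z' \<and> w = fsc u z" if "z \<in> Z" for z
    proof (intro exI conjI)
      show "1 \<notin> Q" by (rule is_primeD(5)[OF pQ])
      show "fsc 1 z \<in> Z'" using that s(3) by (auto simp: fsc_def)
    qed simp
    show "z \<in> B" if "w = z" "z \<in> Z" "w \<in> B'" for z w using that i unfolding B'_def by blast
  qed auto
  then obtain k' where k': "len Q fsc B Z = enat k'" "k' \<le> k" unfolding k(1) by (metis enat_ile enat_ord_simps(1))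
  have "len Q fsc (frob 1 n B') (frob 1 n Z') \<le> len Q fsc (frob 1 n B) (frob 1 n Z)"
  proof (rule len_corr[where f="\<lambda>x. x", OF lfrob frob_mono[OF s(1)] lfrob lfrob frob_mono[OF BZ]])
    show "w \<in> frob 1 n B'" if "w \<in> frob 1 n B" for w using that frob_mono[OF s(4)] by blast
    fix z assume z: "z \<in> frob 1 n Z'"
    have "frob 1 n Z' \<subseteq> lsum Q fsc (frob 1 n Z) (frob 1 n (G n i))" unfolding Z'_def
      by (rule frob_lsum[OF Z lG])
    also have "\<dots> \<subseteq> lsum Q fsc (frob 1 n Z) (frob 1 n B')"
      by (rule lmod.lsum_mono[OF VF order_refl frob_mono[OF s(2)]])
    finally have "z \<in> lsum Q fsc (frob 1 n Z) (frob 1 n B')" using z by blast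
    then obtain u x y where e: "u \<notin> Q" "x \<in> frob 1 n Z" "y \<in> frob 1 n B'" "fsc u z = x + y" by (rule lsumE)
    have "fsc u z + x = y" unfolding e(4) by (simp add: add.commute[of x y] add.assoc)
    then show "\<exists>u w. u \<notin> Q \<and> w \<in> frob 1 n Z \<and> fsc u z + w \<in> frob 1 n B'" using e by blast
  qed auto
  then have "enat (2 ^ c * k) \<le> len Q fsc (frob 1 n B) (frob 1 n Z)" using k(2) by simp
  moreover have "enat (2 ^ c * k') \<le> enat (2 ^ c * k)" using k'(2) by simp
  ultimately show ?thesis using k'(1) by (meson order_trans)
qed

end

section \<open>The tensor square of a differential module\<close>

type_synonym 't mat = "nat \<Rightarrow> nat \<Rightarrow> 't"

text \<open>A matrix \<open>Y\<close> stands for the tensor \<open>\<Sum> Y j i (e\<^sub>i \<otimes> e\<^sub>j)\<close>, so that \<open>Y j\<close> is a column vector.\<close>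

definition msc :: "'t::comm_ring_1 \<Rightarrow> 't mat \<Rightarrow> 't mat"
  where "msc r Y = (\<lambda>j i. r * Y j i)"

text \<open>A sequence of matrices is a power series in \<open>t\<close>, with entry
  \<open>k\<close> as the coefficient of \<open>t^k\<close>.\<close>

definition ssc :: "'t::comm_ring_1 \<Rightarrow> (nat \<Rightarrow> 't mat) \<Rightarrow> nat \<Rightarrow> 't mat"
  where "ssc r f = (\<lambda>k. msc r (f k))"

lemma lmod_ssc: "is_prime Q \<Longrightarrow> lmod (ssc :: 't::comm_ring_1 \<Rightarrow> _) Q"
  unfolding lmod_def lmod_axioms_def Modules.module_def
  by (simp add: ssc_def msc_def fun_eq_iff algebra_simps)

text \<open>This is \<open>1 + \<tau>\<close>, whose square is zero in characteristic 2.\<close>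

definition sw :: "'t::comm_ring_1 mat \<Rightarrow> 't mat"
  where "sw Y = (\<lambda>j i. Y j i + Y i j)"

text \<open>This is \<open>d \<otimes> 1 + 1 \<otimes> d\<close>, without the usual sign.\<close>

definition D0 :: "'t::comm_ring_1 mat \<Rightarrow> nat \<Rightarrow> 't mat \<Rightarrow> 't mat"
  where "D0 a n Y = (\<lambda>j i. (\<Sum>l<n. a i l * Y j l) + (\<Sum>l<n. a j l * Y l i))"

lemma D0_add: "D0 a n (Y + Y') = D0 a n Y + D0 a n Y'"
  unfolding D0_def by (simp add: fun_eq_iff algebra_simps sum.distrib)

lemma D0_msc: "D0 a n (msc r Y) = msc r (D0 a n Y)"
  unfolding D0_def msc_def by (simp add: fun_eq_iff distrib_left sum_distrib_left mult.left_commute)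

lemma D0_0 [simp]: "D0 a n 0 = 0"
  unfolding D0_def by (simp add: fun_eq_iff)

lemma D0_sum: "D0 a n (\<lambda>j i. \<Sum>x\<in>A. f x j i) = (\<lambda>j i. \<Sum>x\<in>A. D0 a n (f x) j i)"
  unfolding D0_def by (simp add: fun_eq_iff sum_distrib_left sum.distrib sum.swap[of _ A])

lemma sw_add: "sw (Y + Y') = sw Y + sw Y'"
  unfolding sw_def by (simp add: fun_eq_iff algebra_simps)

lemma sw_msc: "sw (msc r Y) = msc r (sw Y)"
  unfolding sw_def msc_def by (simp add: fun_eq_iff algebra_simps)

lemma sw_0 [simp]: "sw 0 = 0"
  unfolding sw_def by (simp add: fun_eq_iff)

lemma D0_sw: "D0 a n (sw Y) = sw (D0 a n Y)"
  unfolding D0_def sw_def by (simp add: fun_eq_iff algebra_simps sum.distrib)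

lemma double_sum:
  fixes f :: "nat \<Rightarrow> nat \<Rightarrow> 'a::comm_ring_1"
  shows "(\<Sum>j<n. \<Sum>m<n. f j m) = (\<Sum>j<n. f j j) + (\<Sum>j<n. \<Sum>m<j. f j m + f m j)"
  by (induction n) (simp_all add: sum.distrib algebra_simps)

context frob_core
begin

lemmas VS = lmod_ssc[OF pQ]

lemma two_left: "y + (y + z) = (z::'t)"
  by (simp flip: add.assoc)

lemma twoM [simp]: "Y + Y = (0::'t mat)"
  by (intro ext) (simp only: plus_fun_apply zero_fun_apply two)

lemma two_leftM: "Y + (Y + Z) = (Z::'t mat)"
  by (simp flip: add.assoc)

lemmas acM = add.assoc add.commute[where 'a="'t mat"] add.left_commute[where 'a="'t mat"] twoM two_leftM
  add_0_right add_0_left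

definition OM :: "nat \<Rightarrow> 't mat set"
  where "OM n = {Y. \<forall>j<n. \<forall>i<n. Y j i \<in> K}"

lemma OM_add: "Y \<in> OM n \<Longrightarrow> Y' \<in> OM n \<Longrightarrow> Y + Y' \<in> OM n"
  unfolding OM_def using kid(2) by simp

lemma OM_0: "0 \<in> OM n"
  unfolding OM_def using kid(1) by simp

lemma OM_msc: "Y \<in> OM n \<Longrightarrow> msc r Y \<in> OM n"
  unfolding OM_def msc_def using kid(3) by simp

lemma OM_sat: "u \<notin> Q \<Longrightarrow> msc u Y \<in> OM n \<Longrightarrow> Y \<in> OM n"
  unfolding OM_def msc_def using lsT(4)[OF lK] by blast

lemma OM_sw: "Y \<in> OM n \<Longrightarrow> sw Y \<in> OM n"
  unfolding OM_def sw_def using kid(2) by simp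

lemma OM_D0: "Y \<in> OM n \<Longrightarrow> D0 a n Y \<in> OM n"
  unfolding OM_def D0_def using kid(2,3) by (auto intro!: is_ideal_sum[OF lsub_ideal[OF lK]] kid(2))

lemma sw_sw [simp]: "sw (sw Y) = (0::'t mat)"
  unfolding sw_def by (intro ext) (simp only: zero_fun_apply add.commute[of "Y _ _" "Y _ _"] two add_ac two_left)

end

text \<open>Entries on and below the diagonal can be chosen to be 0 in the presenting ring, so
  triangularity holds exactly, whereas the square of \<open>a\<close> vanishes only modulo
  \<open>K\<close>.\<close>

locale dmod = frob_core +
  fixes a :: "'a mat" and n :: nat
  assumes tri: "\<And>i j. j \<le> i \<Longrightarrow> a i j = 0"
    and sq0: "\<And>i j. i < n \<Longrightarrow> j < n \<Longrightarrow> (\<Sum>l<n. a i l * a l j) \<in> K"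
begin

abbreviation D where "D \<equiv> D0 a n"

definition Z :: "(nat \<Rightarrow> 'a) set" where "Z = {v. mv a n v \<in> pw n K}"

definition Bd :: "(nat \<Rightarrow> 'a) set" where "Bd = lsum Q fsc (pw n K) (range (mv a n))"

lemma lZ: "lsub Q fsc Z"
  unfolding Z_def by (rule lsub_mv[OF lO])

lemma lBd: "lsub Q fsc Bd"
  unfolding Bd_def by (rule lsum_range_mv[OF lO])

lemma O_Bd: "pw n K \<subseteq> Bd" unfolding Bd_def
  by (rule lmod.lsum_upper1[OF VF], rule range_eqI[of _ _ 0]) (simp add: mv_0)

lemma mv_Bd: "mv a n v \<in> Bd" unfolding Bd_def
  by (rule subsetD[OF lmod.lsum_upper2[OF VF lsF(1)[OF lO]]]) (rule rangeI)

lemma mv_mv: "mv a n (mv a n v) \<in> pw n K"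
proof -
  have e: "mv a n (mv a n v) i = (\<Sum>j<n. (\<Sum>l<n. a i l * a l j) * v j)" for i
    unfolding mv_def by (simp add: sum_distrib_left sum_distrib_right mult.assoc) (rule sum.swap)
  have "mv a n (mv a n v) i \<in> K" if "i < n" for i unfolding e
    by (rule is_ideal_sum[OF lsub_ideal[OF lK]], rule kid(4), rule sq0) (use that in auto)
  then show ?thesis unfolding pw_def by blast
qed

lemma BdZ: "Bd \<subseteq> Z"
  unfolding Bd_def
proof (rule lmod.lsum_least[OF VF lZ])
  show "pw n K \<subseteq> Z" unfolding Z_def using mv_O by blast
  show "range (mv a n) \<subseteq> Z" unfolding Z_def using mv_mv by blast
qed

text \<open>The columns of the squared matrix are Frobenius powers of the columns of
  \<open>a\<close>, which are boundaries.\<close>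

lemma mv2_frob: "mv (sqm a) n y \<in> frob 1 n Bd"
proof -
  have "y \<in> {y. mv (sqm a) n y \<in> frob 1 n Bd}"
  proof (rule lmemI[OF lsub_mv[OF lfrob]])
    show O: "pw n K \<subseteq> {y. mv (sqm a) n y \<in> frob 1 n Bd}"
      using mv_O[where m=n] frob_O[of n 1 Bd] by blast
    fix l
    have "mv (sqm a) n (fsc (y l) (unitv l)) = fsc (y l) (fr 1 (mv a n (unitv l)))"
      unfolding mv_fsc fr_mv fr_unitv ..
    then show "fsc (y l) (unitv l) \<in> {y. mv (sqm a) n y \<in> frob 1 n Bd}"
      using lsF(3)[OF lfrob frob_mem[OF mv_Bd]] by simp
  qed
  then show ?thesis by blast
qed

text \<open>The two mixed terms \<open>d \<otimes> d\<close> coincide and cancel in characteristic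
  2.\<close>

lemma DD: "D (D Y) \<in> OM n"
proof -
  have "D (D Y) j i \<in> K" if ij: "i < n" "j < n" for i j
  proof -
    have s1: "(\<Sum>l<n. a i l * (\<Sum>m<n. a l m * Y j m)) = (\<Sum>m<n. (\<Sum>l<n. a i l * a l m) * Y j m)"
      by (simp add: sum_distrib_left sum_distrib_right mult.assoc) (rule sum.swap)
    have s2: "(\<Sum>l<n. a j l * (\<Sum>m<n. a l m * Y m i)) = (\<Sum>m<n. (\<Sum>l<n. a j l * a l m) * Y m i)"
      by (simp add: sum_distrib_left sum_distrib_right mult.assoc) (rule sum.swap)
    have s3: "(\<Sum>l<n. a i l * (\<Sum>m<n. a j m * Y m l)) = (\<Sum>l<n. a j l * (\<Sum>m<n. a i m * Y l m))"
      by (simp add: sum_distrib_left mult.left_commute) (rule sum.swap)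
    have "D (D Y) j i = (\<Sum>l<n. a i l * (\<Sum>m<n. a l m * Y j m)) + (\<Sum>l<n. a i l * (\<Sum>m<n. a j m * Y m l)) +
      ((\<Sum>l<n. a j l * (\<Sum>m<n. a i m * Y l m)) + (\<Sum>l<n. a j l * (\<Sum>m<n. a l m * Y m i)))"
      unfolding D0_def by (simp add: distrib_left sum.distrib)
    also have "\<dots> = (\<Sum>m<n. (\<Sum>l<n. a i l * a l m) * Y j m) + (\<Sum>m<n. (\<Sum>l<n. a j l * a l m) * Y m i)"
      unfolding s1 s2 s3 by (simp only: add.assoc two_left)
    also have "\<dots> \<in> K"
      using ij by (intro kid(2) is_ideal_sum[OF lsub_ideal[OF lK]] kid(4) sq0) auto
    finally show ?thesis .
  qed
  then show ?thesis unfolding OM_def by blast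
qed

definition tens :: "(nat \<Rightarrow> 'a) \<Rightarrow> (nat \<Rightarrow> 'a) \<Rightarrow> 'a mat"
  where "tens v w = (\<lambda>j i. v i * w j)"

lemma D_tens: "D (tens v w) j i = mv a n v i * w j + v i * mv a n w j"
  unfolding D0_def tens_def mv_def by (simp add: sum_distrib_left sum_distrib_right algebra_simps)

lemma D_tens_Z: "v \<in> Z \<Longrightarrow> w \<in> Z \<Longrightarrow> D (tens v w) \<in> OM n"
  unfolding OM_def D_tens Z_def pw_def using kid(2,3,4) by simp

text \<open>The span of the squares \<open>v \<otimes> v\<close> of cycles. Modulo \<open>K\<close>
  they are killed by \<open>D\<close>, and \<open>1 + \<tau>\<close> kills them outright, so they
  are cycles of the large complex at every power of \<open>t\<close>.\<close>

definition Sig :: "'a mat set"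
  where "Sig = {W. \<exists>(r::nat) c v. (\<forall>k<r. v k \<in> Z) \<and> W = (\<lambda>j i. \<Sum>k<r. c k * (v k i * v k j))}"

lemma SigI: "(\<And>k. k < r \<Longrightarrow> v k \<in> Z) \<Longrightarrow> (\<lambda>j i. \<Sum>k<(r::nat). cf k * (v k i * v k j)) \<in> Sig"
  unfolding Sig_def by blast

lemma SigE:
  assumes "W \<in> Sig"
  obtains r v cf where "\<And>k. k < (r::nat) \<Longrightarrow> v k \<in> Z" "W = (\<lambda>j i. \<Sum>k<r. cf k * (v k i * v k j))"
  using assms unfolding Sig_def by blast

lemma Sig_0: "0 \<in> Sig"
  using SigI[of 0] by (simp add: zero_fun_def)

lemma Sig_tens: "v \<in> Z \<Longrightarrow> tens v v \<in> Sig"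
  using SigI[of 1 "\<lambda>_. v" "\<lambda>_. 1"] by (simp add: tens_def)

lemma Sig_msc: "W \<in> Sig \<Longrightarrow> msc u W \<in> Sig"
proof (elim SigE)
  fix r :: nat and cf v assume h: "\<And>k. k < r \<Longrightarrow> v k \<in> Z" "W = (\<lambda>j i. \<Sum>k<r. cf k * (v k i * v k j))"
  have "msc u W = (\<lambda>j i. \<Sum>k<r. (u * cf k) * (v k i * v k j))"
    unfolding h(2) msc_def by (simp add: sum_distrib_left mult.assoc)
  then show ?thesis using SigI[of r v "\<lambda>k. u * cf k"] h(1) by simp
qed

lemma Sig_add:
  assumes "W \<in> Sig" "W' \<in> Sig" shows "W + W' \<in> Sig"
proof -
  obtain r v cf where h: "\<And>k. k < (r::nat) \<Longrightarrow> v k \<in> Z" "W = (\<lambda>j i. \<Sum>k<r. cf k * (v k i * v k j))"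
    using assms(1) by (rule SigE) blast
  obtain r' v' c' where h': "\<And>k. k < (r'::nat) \<Longrightarrow> v' k \<in> Z" "W' = (\<lambda>j i. \<Sum>k<r'. c' k * (v' k i * v' k j))"
    using assms(2) by (rule SigE) blast
  let ?v = "\<lambda>k. if k < r then v k else v' (k - r)" and ?cf = "\<lambda>k. if k < r then cf k else c' (k - r)"
  have "(\<Sum>k<r + m. ?cf k * (?v k i * ?v k j)) = (\<Sum>k<r. cf k * (v k i * v k j)) + (\<Sum>k<m. c' k * (v' k i * v' k j))"
    for m i j by (induction m) (simp_all add: add.assoc)
  then have "W + W' = (\<lambda>j i. \<Sum>k<r + r'. ?cf k * (?v k i * ?v k j))"
    unfolding h(2) h'(2) by (simp add: fun_eq_iff)
  moreover have "(\<lambda>j i. \<Sum>k<r + r'. ?cf k * (?v k i * ?v k j)) \<in> Sig"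
    by (rule SigI) (use h(1) h'(1) in auto)
  ultimately show ?thesis by simp
qed

lemma Sig_D: "W \<in> Sig \<Longrightarrow> D W \<in> OM n"
proof (elim SigE)
  fix r :: nat and cf v assume h: "\<And>k. k < r \<Longrightarrow> v k \<in> Z" "W = (\<lambda>j i. \<Sum>k<r. cf k * (v k i * v k j))"
  have "W = (\<lambda>j i. \<Sum>k<r. (msc (cf k) (tens (v k) (v k))) j i)" unfolding h(2) msc_def tens_def ..
  then have "D W = (\<lambda>j i. \<Sum>k<r. msc (cf k) (D (tens (v k) (v k))) j i)" by (simp only: D0_sum D0_msc)
  moreover have "msc (cf k) (D (tens (v k) (v k))) \<in> OM n" if "k < r" for k
    using OM_msc[OF D_tens_Z[OF h(1)[OF that] h(1)[OF that]]] .
  ultimately show "D W \<in> OM n" unfolding OM_def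
    by (auto intro!: is_ideal_sum[OF lsub_ideal[OF lK]])
qed

lemma Sig_sw: "W \<in> Sig \<Longrightarrow> sw W = 0"
  by (elim SigE) (simp add: sw_def fun_eq_iff mult.commute)

text \<open>The diagonal annihilates the image of \<open>1 + \<tau>\<close> and sends
  \<open>v \<otimes> v\<close> to the vector of squares of \<open>v\<close>; on \<open>Sig\<close>
  it reads off an element of the Frobenius twist.\<close>

definition diagv :: "'a mat \<Rightarrow> nat \<Rightarrow> 'a" where "diagv W = (\<lambda>i. W i i)"

lemma diagv_add: "diagv (W + W') = diagv W + diagv W'"
  unfolding diagv_def by (simp add: fun_eq_iff)

lemma diagv_msc: "diagv (msc u W) = fsc u (diagv W)"
  unfolding diagv_def msc_def fsc_def ..

lemma diagv_sw: "diagv (sw W) = 0"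
  unfolding diagv_def sw_def by (simp add: fun_eq_iff)

lemma diagv_OM: "W \<in> OM n \<Longrightarrow> diagv W \<in> pw n K"
  unfolding diagv_def OM_def pw_def by simp

text \<open>It suffices to treat the Frobenius power of a single vector \<open>v\<close>, which is
  the diagonal of \<open>v \<otimes> v\<close>. With \<open>p = n\<close> this is surjectivity onto
  the twist of the cycles; smaller \<open>p\<close> serves \<open>topend\<close>, where the lift
  must not raise the weight.\<close>

lemma Sig_lift:
  assumes p: "p \<le> n" and z: "z \<in> frob 1 p {v. mv a p v \<in> pw n K}"
  shows "\<exists>u W. u \<notin> Q \<and> W \<in> Sig \<and> (\<forall>i<p. W i i + u * z i \<in> K) \<and> (\<forall>j i. p \<le> j \<or> p \<le> i \<longrightarrow> W j i = 0)"
proof -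
  define L where "L = {z. \<exists>u W. u \<notin> Q \<and> W \<in> Sig \<and> (\<forall>i<p. W i i + u * z i \<in> K) \<and> (\<forall>j i. p \<le> j \<or> p \<le> i \<longrightarrow> W j i = 0)}"
  have LI: "z \<in> L" if "u \<notin> Q" "W \<in> Sig" "\<And>i. i < p \<Longrightarrow> W i i + u * z i \<in> K" "\<And>j i. p \<le> j \<or> p \<le> i \<Longrightarrow> W j i = 0"
    for z u W using that unfolding L_def by blast
  have 1: "1 \<notin> Q" using is_primeD(5)[OF pQ] .
  have OL: "pw p K \<subseteq> L"
  proof
    fix z assume "z \<in> pw p K"
    then show "z \<in> L" by (intro LI[OF 1 Sig_0]) (auto simp: pw_def)
  qed
  have "lsub Q fsc L"
  proof (rule lsubI)
    show "0 \<in> L" using OL lsF(1)[OF lO] by blast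
    fix x assume "x \<in> L"
    then obtain u W where h: "u \<notin> Q" "W \<in> Sig" "\<And>i. i < p \<Longrightarrow> W i i + u * x i \<in> K" "\<And>j i. p \<le> j \<or> p \<le> i \<Longrightarrow> W j i = 0"
      unfolding L_def by blast
    show "fsc r x \<in> L" for r
    proof (rule LI[OF h(1) Sig_msc[OF h(2), of r]])
      fix i assume "i < p"
      from kid(3)[OF h(3)[OF this], of r] show "msc r W i i + u * fsc r x i \<in> K"
        by (simp add: msc_def fsc_def algebra_simps)
    qed (use h(4) in \<open>auto simp: msc_def\<close>)
    fix y assume "y \<in> L"
    then obtain u' W' where h': "u' \<notin> Q" "W' \<in> Sig" "\<And>i. i < p \<Longrightarrow> W' i i + u' * y i \<in> K" "\<And>j i. p \<le> j \<or> p \<le> i \<Longrightarrow> W' j i = 0"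
      unfolding L_def by blast
    show "x + y \<in> L"
    proof (rule LI[OF is_primeD(6)[OF pQ h(1) h'(1)] Sig_add[OF Sig_msc[OF h(2), of u'] Sig_msc[OF h'(2), of u]]])
      fix i assume i: "i < p"
      from kid(2)[OF kid(3)[OF h(3)[OF i], of u'] kid(3)[OF h'(3)[OF i], of u]]
      show "(msc u' W + msc u W') i i + u * u' * (x + y) i \<in> K"
        by (simp add: msc_def algebra_simps)
    qed (use h(4) h'(4) in \<open>auto simp: msc_def\<close>)
  next
    fix w x assume w: "w \<notin> Q" "fsc w x \<in> L"
    then obtain u W where h: "u \<notin> Q" "W \<in> Sig" "\<And>i. i < p \<Longrightarrow> W i i + u * fsc w x i \<in> K" "\<And>j i. p \<le> j \<or> p \<le> i \<Longrightarrow> W j i = 0"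
      unfolding L_def by blast
    show "x \<in> L"
      by (rule LI[OF is_primeD(6)[OF pQ h(1) w(1)] h(2)]) (use h(3,4) in \<open>auto simp: fsc_def mult.assoc\<close>)
  qed
  moreover have "fr 1 v \<in> L" if v: "v \<in> {v. mv a p v \<in> pw n K}" for v
  proof -
    \<comment> \<open>The vector is cut off from \<open>p\<close> on, so that its tensor square
      vanishes outside the leading block.\<close>
    define v' where "v' i = (if i < p then v i else 0)" for i
    have "mv a n v' = mv a p v"
    proof
      fix i
      show "mv a n v' i = mv a p v i" unfolding mv_def v'_def
        by (rule sum.mono_neutral_cong_right) (use p in auto)
    qed
    then have "v' \<in> Z" using v unfolding Z_def by simp
    show ?thesis
      by (rule LI[OF 1 Sig_tens[OF \<open>v' \<in> Z\<close>]])
        (auto simp: tens_def v'_def fr_def power2_eq_square kid(1))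
  qed
  ultimately have "frob 1 p {v. mv a p v \<in> pw n K} \<subseteq> L" using OL by (intro frob_least) auto
  then show ?thesis using z unfolding L_def by blast
qed

text \<open>Flatness enters here: relations among the \<open>v \<otimes> v\<close> on the diagonal come from relations among
  the \<open>v\<close>.\<close>

lemma Sig_sw_image:
  assumes W: "W \<in> Sig" and d: "diagv W \<in> pw n K"
  shows "\<exists>u \<Omega>. u \<notin> Q \<and> D \<Omega> \<in> OM n \<and> msc u W + sw \<Omega> \<in> OM n"
proof -
  obtain r v cf where v: "\<And>k. k < (r::nat) \<Longrightarrow> v k \<in> Z" and We: "W = (\<lambda>j i. \<Sum>k<r. cf k * (v k i * v k j))"
    using W by (rule SigE) blast
  define A where "A = (\<lambda>i k. v k i)"
  \<comment> \<open>The columns of \<open>A\<close> are the cycles \<open>v k\<close>. A diagonal in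
    \<open>K\<close> makes \<open>cf\<close> a relation between the squared columns, and flatness
    derives it from relations \<open>g\<close> between the columns themselves.\<close>
  have cf: "cf \<in> frob 1 r {g. mv A r g \<in> pw n K}"
  proof (rule flat)
    show "mv (sqm A) r cf \<in> pw n K" using d unfolding We diagv_def mv_def A_def pw_def
      by (simp add: power2_eq_square mult.commute)
  qed
  define F where "F g = (\<lambda>j i. \<Sum>k<r. g k * (v k i * v k j))" for g :: "nat \<Rightarrow> 'a"
  have Fa: "F (g + h) = F g + F h" for g h unfolding F_def by (simp add: fun_eq_iff distrib_right sum.distrib)
  have Fs: "F (fsc t g) = msc t (F g)" for t g unfolding F_def msc_def fsc_def by (simp add: sum_distrib_left mult.assoc)
  define L where "L = {g. \<exists>u \<Omega>. u \<notin> Q \<and> D \<Omega> \<in> OM n \<and> msc u (F g) + sw \<Omega> \<in> OM n}"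
  have LI: "g \<in> L" if "u \<notin> Q" "D \<Omega> \<in> OM n" "msc u (F g) + sw \<Omega> \<in> OM n" for g u \<Omega> using that unfolding L_def by blast
  have 1: "1 \<notin> Q" using is_primeD(5)[OF pQ] .
  have m1: "msc 1 Y = Y" for Y :: "'a mat" unfolding msc_def by simp
  have m2: "msc x (msc y Y) = msc (x * y) Y" for x y and Y :: "'a mat" unfolding msc_def by (simp add: mult.assoc)
  have m3: "msc x (Y + Y') = msc x Y + msc x Y'" for x and Y Y' :: "'a mat" unfolding msc_def by (simp add: fun_eq_iff distrib_left)
  have OL: "pw r K \<subseteq> L"
  proof
    fix g assume "g \<in> pw r K"
    then have "F g \<in> OM n" unfolding F_def OM_def pw_def
      by (auto intro!: is_ideal_sum[OF lsub_ideal[OF lK]] kid(4))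
    then show "g \<in> L" by (intro LI[OF 1, of 0]) (auto simp: m1 OM_0)
  qed
  have "lsub Q fsc L"
  proof (rule lsubI)
    show "0 \<in> L" using OL lsF(1)[OF lO] by blast
    fix g assume "g \<in> L"
    then obtain u \<Omega> where h: "u \<notin> Q" "D \<Omega> \<in> OM n" "msc u (F g) + sw \<Omega> \<in> OM n" unfolding L_def by blast
    show "fsc t g \<in> L" for t
    proof (rule LI[OF h(1), of "msc t \<Omega>"])
      show "D (msc t \<Omega>) \<in> OM n" using OM_msc[OF h(2)] by (simp add: D0_msc)
      show "msc u (F (fsc t g)) + sw (msc t \<Omega>) \<in> OM n"
        using OM_msc[OF h(3), of t] by (simp add: Fs sw_msc m2 m3 mult.commute)
    qed
    fix g' assume "g' \<in> L"
    then obtain u' \<Omega>' where h': "u' \<notin> Q" "D \<Omega>' \<in> OM n" "msc u' (F g') + sw \<Omega>' \<in> OM n" unfolding L_def by blast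
    show "g + g' \<in> L"
    proof (rule LI[OF is_primeD(6)[OF pQ h(1) h'(1)], of "msc u' \<Omega> + msc u \<Omega>'"])
      show "D (msc u' \<Omega> + msc u \<Omega>') \<in> OM n" using OM_add[OF OM_msc[OF h(2)] OM_msc[OF h'(2)]] by (simp add: D0_msc D0_add)
      show "msc (u * u') (F (g + g')) + sw (msc u' \<Omega> + msc u \<Omega>') \<in> OM n"
        using OM_add[OF OM_msc[OF h(3), of u'] OM_msc[OF h'(3), of u]]
        by (simp add: Fa sw_msc sw_add m2 m3 mult.commute add_ac)
    qed
  next
    fix w g assume w: "w \<notin> Q" "fsc w g \<in> L"
    then obtain u \<Omega> where h: "u \<notin> Q" "D \<Omega> \<in> OM n" "msc u (F (fsc w g)) + sw \<Omega> \<in> OM n" unfolding L_def by blast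
    then show "g \<in> L" by (intro LI[OF is_primeD(6)[OF pQ h(1) w(1)] h(2)]) (simp add: Fs m2)
  qed
  moreover have "fr 1 g \<in> L" if g: "g \<in> {g. mv A r g \<in> pw n K}" for g
  proof -
    define p where "p k = fsc (g k) (v k)" for k
    have p: "p k \<in> Z" if "k < r" for k unfolding p_def using lsF(3)[OF lZ v[OF that]] .
    \<comment> \<open>The sum of the vectors \<open>p k\<close> vanishes modulo \<open>K\<close>,
      hence so does its tensor square. The diagonal part of that square is
      \<open>F (fr 1 g)\<close>, and the mixed part is \<open>sw \<Omega>\<close>.\<close>
    define \<Omega> where "\<Omega> = (\<lambda>j i. \<Sum>k<r. \<Sum>l<k. tens (p k) (p l) j i)"
    have "D (\<lambda>j i. \<Sum>l<k. tens (p k) (p l) j i) \<in> OM n" if "k < r" for k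
      unfolding D0_sum using D_tens_Z[OF p p] that unfolding OM_def
      by (auto intro!: is_ideal_sum[OF lsub_ideal[OF lK]])
    then have "D \<Omega> \<in> OM n" unfolding \<Omega>_def D0_sum[where A="{..<r}"] unfolding OM_def
      by (auto intro!: is_ideal_sum[OF lsub_ideal[OF lK]])
    moreover have "msc 1 (F (fr 1 g)) + sw \<Omega> \<in> OM n"
    proof -
      have "(msc 1 (F (fr 1 g)) + sw \<Omega>) j i \<in> K" if ij: "i < n" "j < n" for i j
      proof -
        have "(\<Sum>k<r. p k i) \<in> K" using g ij unfolding mv_def A_def pw_def p_def fsc_def by (simp add: mult.commute)
        then have "(\<Sum>k<r. p k i) * (\<Sum>k<r. p k j) \<in> K" by (rule kid(4))
        also have "(\<Sum>k<r. p k i) * (\<Sum>k<r. p k j) = (\<Sum>k<r. \<Sum>l<r. p k i * p l j)" by (rule sum_product)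
        also have "\<dots> = (\<Sum>k<r. p k i * p k j) + (\<Sum>k<r. \<Sum>l<k. p k i * p l j + p l i * p k j)" by (rule double_sum)
        also have "\<dots> = (msc 1 (F (fr 1 g)) + sw \<Omega>) j i"
          unfolding m1 F_def sw_def \<Omega>_def tens_def p_def fsc_def fr_def
          by (simp add: sum.distrib power2_eq_square algebra_simps)
        finally show ?thesis .
      qed
      then show ?thesis unfolding OM_def by blast
    qed
    ultimately show ?thesis by (rule LI[OF 1])
  qed
  ultimately have "frob 1 r {g. mv A r g \<in> pw n K} \<subseteq> L" using OL by (intro frob_least) auto
  then have "cf \<in> L" using cf by blast
  moreover have "F cf = W" unfolding F_def We ..
  ultimately show ?thesis unfolding L_def by blast
qed

end

context frob_core
begin

lemma msc_0 [simp]: "msc r 0 = (0 :: 't mat)" unfolding msc_def by (simp add: fun_eq_iff)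
lemma msc_one [simp]: "msc 1 Y = (Y :: 't mat)" unfolding msc_def by simp
lemma msc_add: "msc r (Y + Y') = msc r Y + msc r (Y' :: 't mat)"
  unfolding msc_def by (simp add: fun_eq_iff distrib_left)
lemma msc_msc: "msc x (msc y Y) = msc (x * y) (Y :: 't mat)" unfolding msc_def by (simp add: mult.assoc)

definition upper :: "'t mat \<Rightarrow> 't mat"
  where "upper T = (\<lambda>j i. if i < j then T j i else 0)"

text \<open>An alternating matrix, symmetric with zero diagonal, is \<open>1 + \<tau>\<close> of its
  strict triangle. For a symmetric matrix the diagonal is the obstruction, which is why diagonals
  are followed throughout.\<close>

lemma sw_upper:
  assumes "sw T \<in> OM n" "\<And>i. i < n \<Longrightarrow> T i i \<in> K"
  shows "T + sw (upper T) \<in> OM n"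
proof -
  have "(T + sw (upper T)) j i \<in> K" if "i < n" "j < n" for i j
    using assms that kid(1) unfolding OM_def sw_def upper_def by (cases i j rule: linorder_cases) auto
  then show ?thesis unfolding OM_def by blast
qed

lemma OM_cong2: "Y = A + B \<Longrightarrow> A \<in> OM n \<Longrightarrow> B \<in> OM n \<Longrightarrow> Y \<in> OM n"
  using OM_add by blast

end

section \<open>Moving tensors along the powers of t\<close>

context dmod
begin

lemma diagv_0: "diagv 0 = 0"
  by (simp add: diagv_def fun_eq_iff)

text \<open>Let \<open>t\<close> be a formal variable. If \<open>\<Sum> W\<^sub>k t\<^sup>k\<close> with all \<open>W\<^sub>k\<close> spanned by tensors \<open>v \<otimes> v\<close>, \<open>v\<close> a cycle,
  bounds \<open>\<Sum> Y\<^sub>k t\<^sup>k\<close> under \<open>D + t (1 + \<tau>)\<close>, the top coefficient of \<open>Y\<close> can be removed at the cost of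
  changing the \<open>W\<^sub>k\<close> by terms with diagonal in the Frobenius twist of the boundaries.\<close>

lemma descent:
  assumes "\<And>k. W k \<in> Sig" "\<And>k. D (Y (Suc k)) + sw (Y k) + W (Suc k) \<in> OM n" "\<And>k. m < k \<Longrightarrow> Y k = 0"
  shows "diagv (W (Suc k)) \<in> frob 1 n Bd"
  using assms
proof (induction m arbitrary: Y W k)
  case (0 Y W k)
  have "Y (Suc k) = 0" by (rule 0(3)) simp
  then have "sw (Y k) + W (Suc k) \<in> OM n" using 0(2)[of k] by (simp only: D0_0 add_0_left)
  from diagv_OM[OF this] have "diagv (W (Suc k)) \<in> pw n K" by (simp add: diagv_add diagv_sw)
  then show ?case using frob_O by blast
next
  case (Suc m Y W k0)
  note Sg = Suc.prems(1) and eq = Suc.prems(2) and top = Suc.prems(3)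
  let ?M = "Suc m"
  have hi: "diagv (W (Suc k)) \<in> pw n K" if "?M \<le> k" for k
  proof -
    have "Y (Suc k) = 0" by (rule top) (use that in simp)
    then have "sw (Y k) + W (Suc k) \<in> OM n" using eq[of k] by (simp only: D0_0 add_0_left)
    from diagv_OM[OF this] show ?thesis by (simp add: diagv_add diagv_sw)
  qed
  obtain u \<Omega> where u: "u \<notin> Q" and Om: "D \<Omega> \<in> OM n" "msc u (W (Suc ?M)) + sw \<Omega> \<in> OM n"
    using Sig_sw_image[OF Sg hi[of ?M]] by auto
  \<comment> \<open>By the equation at \<open>Suc ?M\<close> and the choice of \<Omega>, the matrix
    \<open>S\<close> is symmetric modulo \<open>K\<close>. Its off-diagonal part \<open>T\<close> is
    \<open>sw U\<close> and is removed by the differential of \<open>U\<close>; the diagonal part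
    \<open>dg\<close> is not a value of \<open>sw\<close> and is treated next.\<close>
  define S where "S = msc u (Y ?M) + \<Omega>"
  define y where "y = diagv S"
  define dg where "dg = (\<lambda>j i. if i = j then y j else (0::'a))"
  \<comment> \<open>\<open>dg\<close> is the sum of \<open>y i (e i \<otimes> e i)\<close>. Its
    image under \<open>D\<close> is \<open>sw E1\<close>, where \<open>E1\<close> is the sum of
    \<open>y i (e i \<otimes> d (e i))\<close>; and \<open>D E1\<close> is \<open>B1\<close>, the
    sum of \<open>y i (d (e i) \<otimes> d (e i))\<close>, an element of \<open>Sig\<close> whose
    diagonal is a twisted boundary.\<close>
  define E1 where "E1 = (\<lambda>j i. if i < n then y i * a j i else (0::'a))"
  define B1 where "B1 = (\<lambda>j i. \<Sum>k<n. y k * (a i k * a j k))"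
  define T where "T = S + dg"
  define U where "U = upper T"
  have swE: "D dg + sw E1 \<in> OM n"
  proof -
    have "(D dg + sw E1) j i = 0" if "i < n" "j < n" for i j
      using that unfolding D0_def dg_def sw_def E1_def
      by (simp add: if_distrib[of "\<lambda>x. _ * x"] sum.delta sum.delta' mult.commute add_ac two_left cong: if_cong)
    then show ?thesis unfolding OM_def using kid(1) by simp
  qed
  have DE: "D E1 + B1 \<in> OM n"
  proof -
    have "(D E1 + B1) j i \<in> K" if ij: "i < n" "j < n" for i j
    proof -
      have "(\<Sum>l<n. a j l * E1 l i) = y i * (\<Sum>l<n. a j l * a l i)"
        using ij unfolding E1_def by (simp add: sum_distrib_left mult.left_commute)
      moreover have "(\<Sum>l<n. a i l * E1 j l) = B1 j i"
        unfolding E1_def B1_def by (intro sum.cong) (auto simp: algebra_simps)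
      ultimately have "(D E1 + B1) j i = y i * (\<Sum>l<n. a j l * a l i)"
        unfolding D0_def by (simp add: add_ac two_left)
      then show ?thesis using kid(3)[OF sq0[OF ij(2,1)]] by simp
    qed
    then show ?thesis unfolding OM_def by blast
  qed
  have colZ: "(\<lambda>i. a i k) \<in> Z" if "k < n" for k
    unfolding Z_def mv_def pw_def using sq0 that by auto
  have B1: "B1 \<in> Sig" unfolding B1_def by (rule SigI[where v="\<lambda>k i. a i k"]) (rule colZ)
  have dB1: "diagv B1 \<in> frob 1 n Bd"
  proof -
    have "diagv B1 = mv (sqm a) n y" unfolding diagv_def B1_def mv_def by (simp add: power2_eq_square mult.commute)
    then show ?thesis using mv2_frob by simp
  qed
  have swT: "sw T \<in> OM n"
  proof -
    have "Y (Suc ?M) = 0" by (rule top) simp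
    then have "sw (Y ?M) + W (Suc ?M) \<in> OM n" using eq[of ?M] by (simp only: D0_0 add_0_left)
    from OM_add[OF OM_msc[OF this, of u] Om(2)]
    have "msc u (sw (Y ?M)) + sw \<Omega> \<in> OM n" by (simp only: msc_add acM)
    moreover have "sw dg = 0" unfolding sw_def dg_def by (simp add: fun_eq_iff)
    ultimately show ?thesis unfolding T_def S_def by (simp add: sw_add sw_msc)
  qed
  have TU: "T + sw U \<in> OM n" unfolding U_def
    by (rule sw_upper[OF swT]) (simp add: T_def dg_def y_def diagv_def kid(1))
  \<comment> \<open>The top index drops from \<open>Suc m\<close> to \<open>m\<close>: its content
    moves to index \<open>m\<close> as \<open>E1 + D U\<close>, at the price of \<open>B1\<close> in
    \<open>W' m\<close>. Beyond \<open>Suc m\<close> the \<open>W'\<close> are reset to 0; those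
    indices are covered by \<open>hi\<close>.\<close>
  define Y' where "Y' k = (if k < m then msc u (Y k) else if k = m then msc u (Y m) + E1 + D U else 0)" for k
  define W' where "W' k = (if ?M < k then 0 else msc u (W k) + (if k = m then B1 else 0))" for k
  have S': "W' k \<in> Sig" for k unfolding W'_def using Sig_msc[OF Sg] B1 Sig_add Sig_0 by auto
  have T': "Y' k = 0" if "m < k" for k unfolding Y'_def using that by simp
  have eq': "D (Y' (Suc k)) + sw (Y' k) + W' (Suc k) \<in> OM n" for k
  proof -
    have e: "D (msc u (Y (Suc k))) + sw (msc u (Y k)) + msc u (W (Suc k)) \<in> OM n"
      using OM_msc[OF eq[of k], of u] by (simp only: msc_add D0_msc sw_msc)
    consider "?M \<le> k" | "k = m" | "Suc k = m" | "Suc k < m" by linarith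
    then show ?thesis
    proof cases
      case 1 then show ?thesis unfolding Y'_def W'_def by (simp add: OM_0)
    next
      case 2
      have a1: "sw (D U) + D T \<in> OM n"
        using OM_D0[OF TU, of a] by (simp only: D0_add D0_sw add.commute[of "D T"])
      have "D T = D (msc u (Y ?M)) + D \<Omega> + D dg" unfolding T_def S_def by (simp only: D0_add)
      then have "D (Y' (Suc k)) + sw (Y' k) + W' (Suc k) =
        (D (msc u (Y (Suc k))) + sw (msc u (Y k)) + msc u (W (Suc k))) + ((D dg + sw E1) + ((sw (D U) + D T) + D \<Omega>))"
        unfolding Y'_def W'_def using 2 by (simp add: sw_add acM)
      then show ?thesis by (rule OM_cong2[OF _ e OM_add[OF swE OM_add[OF a1 Om(1)]]])
    next
      case 3
      have "D (Y' (Suc k)) + sw (Y' k) + W' (Suc k) =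
        (D (msc u (Y (Suc k))) + sw (msc u (Y k)) + msc u (W (Suc k))) + ((D E1 + B1) + D (D U))"
        unfolding Y'_def W'_def using 3 by (auto simp add: D0_add acM)
      then show ?thesis by (rule OM_cong2[OF _ e OM_add[OF DE DD]])
    next
      case 4
      then show ?thesis using e unfolding Y'_def W'_def by simp
    qed
  qed
  have IH: "diagv (W' (Suc k)) \<in> frob 1 n Bd" for k by (rule Suc.IH[where Y=Y' and W=W']) (fact S' eq' T')+
  show ?case
  proof (cases "?M \<le> k0")
    case True then show ?thesis using hi frob_O by blast
  next
    case False
    have "fsc u (diagv (W (Suc k0))) + (if Suc k0 = m then diagv B1 else 0) = diagv (W' (Suc k0))"
      using False unfolding W'_def by (auto simp: diagv_add diagv_msc diagv_0)
    moreover have "(if Suc k0 = m then diagv B1 else 0) \<in> frob 1 n Bd" using dB1 lsF(1)[OF lfrob] by simp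
    ultimately have "(fsc u (diagv (W (Suc k0))) + (if Suc k0 = m then diagv B1 else 0)) + (if Suc k0 = m then diagv B1 else 0) \<in> frob 1 n Bd"
      using lsF(2)[OF lfrob] IH[of k0] by presburger
    then have "fsc u (diagv (W (Suc k0))) \<in> frob 1 n Bd" by (simp add: add.assoc)
    then show ?thesis by (rule lsF(4)[OF lfrob u])
  qed
qed

text \<open>Contract \<open>D R\<close> with row \<open>i\<close> of \<open>a\<close>. As
  \<open>a\<close> squares to zero, the quadratic form of \<open>R\<close> in that row remains, and
  for symmetric \<open>R\<close> its mixed terms cancel in pairs and leave the squares.\<close>

lemma sym_diag:
  assumes R: "sw R \<in> OM n" "D R \<in> OM n"
  shows "mv (sqm a) n (diagv R) \<in> pw n K"
proof -
  have "mv (sqm a) n (diagv R) i \<in> K" if i: "i < n" for i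
  proof -
    note S = is_ideal_sum[OF lsub_ideal[OF lK]]
    have "(\<Sum>j<n. a i j * D R j i) \<in> K" using R(2) i unfolding OM_def by (intro S kid(3)) auto
    moreover have "(\<Sum>j<n. a i j * D R j i) =
      (\<Sum>j<n. \<Sum>m<n. a i j * (a i m * R j m)) + (\<Sum>m<n. (\<Sum>j<n. a i j * a j m) * R m i)"
      unfolding D0_def by (simp add: distrib_left sum.distrib sum_distrib_left sum_distrib_right mult.assoc)
        (rule sum.swap)
    moreover have "(\<Sum>m<n. (\<Sum>j<n. a i j * a j m) * R m i) \<in> K"
      by (rule S, rule kid(4), rule sq0[OF i]) simp
    ultimately have 1: "(\<Sum>j<n. \<Sum>m<n. a i j * (a i m * R j m)) \<in> K"
      using kid(5)[of "(\<Sum>j<n. a i j * D R j i)" "(\<Sum>m<n. (\<Sum>j<n. a i j * a j m) * R m i)"]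
      by (simp add: add.assoc)
    have 2: "(\<Sum>j<n. \<Sum>m<n. a i j * (a i m * R j m)) =
      (\<Sum>j<n. a i j * (a i j * R j j)) + (\<Sum>j<n. \<Sum>m<j. a i j * (a i m * R j m) + a i m * (a i j * R m j))"
      by (rule double_sum)
    have 3: "(\<Sum>j<n. \<Sum>m<j. a i j * (a i m * R j m) + a i m * (a i j * R m j)) \<in> K"
    proof (intro S)
      fix j m assume "j \<in> {..<n}" "m \<in> {..<j}"
      then have "R j m + R m j \<in> K" using R(1) unfolding OM_def sw_def by auto
      from kid(3)[OF this, of "a i j * a i m"]
      show "a i j * (a i m * R j m) + a i m * (a i j * R m j) \<in> K" by (simp add: algebra_simps)
    qed
    have "(\<Sum>j<n. a i j * (a i j * R j j)) \<in> K"
      using kid(2)[OF 1[unfolded 2] 3] by (simp add: add.assoc)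
    then show ?thesis unfolding mv_def diagv_def by (simp add: power2_eq_square mult.assoc)
  qed
  then show ?thesis unfolding pw_def by blast
qed

text \<open>Every cycle for \<open>D + t (1 + \<tau>)\<close> concentrated in one power of \<open>t\<close> is homologous to a combination of
  tensors \<open>v \<otimes> v\<close> in lower powers. Since \<open>a\<close> is strictly triangular, \<open>D\<close> lowers the weight \<open>i + j\<close>, which
  makes the process stop.\<close>

lemma topend:
  assumes "\<And>j i. j < n \<Longrightarrow> i < n \<Longrightarrow> w \<le> j + i \<Longrightarrow> R j i \<in> K" "sw R \<in> OM n" "D R \<in> OM n"
  shows "\<exists>u U W. u \<notin> Q \<and> (\<forall>k. W k \<in> Sig) \<and> (\<forall>k\<ge>w. W k = 0) \<and>
    msc u R + W 0 + sw (U 0) \<in> OM n \<and> (\<forall>k. D (U k) + W (Suc k) + sw (U (Suc k)) \<in> OM n)"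
  using assms
proof (induction w arbitrary: R)
  case (0 R)
  have "R \<in> OM n" using 0(1) unfolding OM_def by simp
  then show ?case
    by (intro exI[of _ "1::'a"] exI[of _ "\<lambda>_. 0"]) (use is_primeD(5)[OF pQ] in \<open>simp only: Sig_0 OM_0 D0_0 sw_0 add_0_right msc_one simp_thms not_False_eq_True\<close>)
next
  case (Suc w R)
  note wt = Suc.prems(1) and sR = Suc.prems(2) and DR = Suc.prems(3)
  \<comment> \<open>The number of diagonal positions below \<open>n\<close> of weight at most
    \<open>w\<close>; from \<open>p\<close> on the diagonal of \<open>R\<close> already lies in
    \<open>K\<close>.\<close>
  define p where "p = min n ((w + 2) div 2)"
  have "l < (w + 2) div 2 \<longleftrightarrow> l + l < Suc w" for l by presburger
  then have p: "p \<le> n" "\<And>l. l < n \<Longrightarrow> (l < p \<longleftrightarrow> l + l < Suc w)" unfolding p_def by auto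
  have "mv (sqm a) p (diagv R) \<in> pw n K"
  proof -
    have "mv (sqm a) p (diagv R) i \<in> K" if i: "i < n" for i
    proof -
      have "{..<n} = {..<p} \<union> {p..<n}" using p(1) by auto
      then have e: "mv (sqm a) n (diagv R) i = mv (sqm a) p (diagv R) i + (\<Sum>l\<in>{p..<n}. (a i l) ^ 2 * diagv R l)"
        unfolding mv_def by (simp add: sum.union_disjoint ivl_disj_int)
      have "(\<Sum>l\<in>{p..<n}. (a i l) ^ 2 * diagv R l) \<in> K"
      proof (intro is_ideal_sum[OF lsub_ideal[OF lK]] kid(3))
        fix l assume "l \<in> {p..<n}"
        then show "diagv R l \<in> K" using wt[of l l] p(2)[of l] unfolding diagv_def by auto
      qed
      moreover have "mv (sqm a) n (diagv R) i \<in> K" using sym_diag[OF sR DR] i unfolding pw_def by blast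
      ultimately have "mv (sqm a) n (diagv R) i + (\<Sum>l\<in>{p..<n}. (a i l) ^ 2 * diagv R l) \<in> K"
        by (rule kid(2)[rotated])
      then show ?thesis unfolding e by (simp add: add.assoc)
    qed
    then show ?thesis unfolding pw_def by blast
  qed
  \<comment> \<open>By \<open>sym_diag\<close> and flatness the diagonal of \<open>R\<close> comes
    from the twist of the cycles, so squares of cycles cancel it and an alternating matrix
    remains.\<close>
  from Sig_lift[OF p(1) flat[OF this]] obtain u1 W0 where u1: "u1 \<notin> Q" and W0: "W0 \<in> Sig"
    "\<And>i. i < p \<Longrightarrow> W0 i i + u1 * diagv R i \<in> K" "\<And>j i. p \<le> j \<or> p \<le> i \<Longrightarrow> W0 j i = 0" by blast
  define T where "T = msc u1 R + W0"
  define U0 where "U0 = upper T"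
  have Twt: "T j i \<in> K" if "j < n" "i < n" "Suc w \<le> j + i" for j i
  proof -
    have "p \<le> j \<or> p \<le> i" using p(2)[of j] p(2)[of i] that by linarith
    then show ?thesis unfolding T_def using W0(3) kid(3)[OF wt[OF that]] by (simp add: msc_def)
  qed
  have swT: "sw T \<in> OM n" unfolding T_def using OM_msc[OF sR] Sig_sw[OF W0(1)] by (simp add: sw_add sw_msc)
  have dT: "T i i \<in> K" if "i < n" for i
  proof (cases "i < p")
    case True then show ?thesis using W0(2)[OF True] unfolding T_def msc_def diagv_def by (simp add: add.commute)
  next
    case False
    then show ?thesis using Twt[OF that that] p(2)[OF that] by simp
  qed
  have TU: "T + sw U0 \<in> OM n" unfolding U0_def by (rule sw_upper[OF swT dT])
  \<comment> \<open>Using \<open>U0\<close> as a bounding term trades \<open>R\<close> for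
    \<open>D U0\<close>, one power of \<open>t\<close> lower and of smaller weight.\<close>
  define R1 where "R1 = D U0"
  have DT: "D T \<in> OM n" unfolding T_def using OM_msc[OF DR] Sig_D[OF W0(1)] by (simp add: D0_add D0_msc OM_add)
  have sR1: "sw R1 \<in> OM n" unfolding R1_def
    using OM_add[OF OM_D0[OF TU, of a] DT] by (simp only: D0_add D0_sw acM)
  have DR1: "D R1 \<in> OM n" unfolding R1_def by (rule DD)
  have U0wt: "U0 j i \<in> K" if "j < n" "i < n" "Suc w \<le> j + i" for j i
    unfolding U0_def upper_def using Twt[OF that] kid(1) by simp
  have wt1: "R1 j i \<in> K" if ji: "j < n" "i < n" "w \<le> j + i" for j i
    unfolding R1_def D0_def
  proof (intro kid(2) is_ideal_sum[OF lsub_ideal[OF lK]])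
    fix l assume l: "l \<in> {..<n}"
    show "a i l * U0 j l \<in> K"
    proof (cases "l \<le> i")
      case True then show ?thesis using tri kid(1) by simp
    next
      case False then show ?thesis using U0wt[of j l] ji l by (intro kid(3)) auto
    qed
    show "a j l * U0 l i \<in> K"
    proof (cases "l \<le> j")
      case True then show ?thesis using tri kid(1) by simp
    next
      case False then show ?thesis using U0wt[of l i] ji l by (intro kid(3)) auto
    qed
  qed
  from Suc.IH[OF wt1 sR1 DR1] obtain u2 U' W' where IH: "u2 \<notin> Q" "\<And>k. W' k \<in> Sig" "\<And>k. w \<le> k \<Longrightarrow> W' k = 0"
    "msc u2 R1 + W' 0 + sw (U' 0) \<in> OM n" "\<And>k. D (U' k) + W' (Suc k) + sw (U' (Suc k)) \<in> OM n" by blast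
  define U where "U k = (case k of 0 \<Rightarrow> msc u2 U0 | Suc k \<Rightarrow> U' k)" for k
  define W where "W k = (case k of 0 \<Rightarrow> msc u2 W0 | Suc k \<Rightarrow> W' k)" for k
  have "W k \<in> Sig" for k unfolding W_def using Sig_msc[OF W0(1)] IH(2) by (cases k) auto
  moreover have "W k = 0" if "Suc w \<le> k" for k unfolding W_def using IH(3) that by (cases k) auto
  moreover have "msc (u2 * u1) R + W 0 + sw (U 0) \<in> OM n" unfolding W_def U_def
    using OM_msc[OF TU, of u2] unfolding T_def by (simp add: msc_add msc_msc sw_msc)
  moreover have "D (U k) + W (Suc k) + sw (U (Suc k)) \<in> OM n" for k
    unfolding W_def U_def using IH(4,5) by (cases k) (auto simp: R1_def D0_msc)
  ultimately show ?case using is_primeD(6)[OF pQ IH(1) u1] by blast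
qed

text \<open>Coefficient \<open>k\<close> of \<open>(D + t (1 + \<tau>)) f\<close>.\<close>

definition del :: "(nat \<Rightarrow> 'a mat) \<Rightarrow> nat \<Rightarrow> 'a mat"
  where "del f k = D (f k) + (case k of 0 \<Rightarrow> 0 | Suc k' \<Rightarrow> sw (f k'))"

lemma del_add: "del (f + g) = del f + del g"
  by (rule ext) (simp add: del_def D0_add sw_add add_ac split: nat.split)

lemma del_ssc: "del (ssc r f) = ssc r (del f)"
  by (rule ext) (simp add: del_def ssc_def D0_msc sw_msc msc_add split: nat.split)

lemma del_0: "del 0 = 0"
  by (rule ext) (simp add: del_def split: nat.split)

lemma twoS: "f + f = (0 :: nat \<Rightarrow> 'a mat)"
  by (rule ext) (simp only: plus_fun_apply zero_fun_apply twoM)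

lemma two_leftS: "f + (f + g) = (g :: nat \<Rightarrow> 'a mat)"
  by (simp only: twoS add_0_left flip: add.assoc)

text \<open>Zero modulo \<open>K\<close> and modulo \<open>t^N\<close>: coefficients from
  \<open>N\<close> on are unrestricted.\<close>

definition ON :: "nat \<Rightarrow> (nat \<Rightarrow> 'a mat) set"
  where "ON N = {f. \<forall>k<N. f k \<in> OM n}"

lemma lON: "lsub Q ssc (ON N)"
proof (rule lsubI)
  show "v \<in> ON N" if "u \<notin> Q" "ssc u v \<in> ON N" for u v
    using that(2) OM_sat[OF that(1)] unfolding ON_def ssc_def by blast
qed (use OM_0 OM_add OM_msc in \<open>auto simp: ON_def ssc_def\<close>)

lemma del_ON: "f \<in> ON N \<Longrightarrow> del f \<in> ON N"
  unfolding ON_def del_def using OM_D0 OM_sw OM_add by (auto split: nat.split simp: OM_add OM_D0 OM_sw)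

lemma del_del: "del (del f) \<in> ON N"
proof -
  have "del (del f) k \<in> OM n" for k
  proof (cases k)
    case 0 then show ?thesis using DD by (simp add: del_def)
  next
    case (Suc k')
    have "del (del f) k = D (D (f k))"
      unfolding Suc del_def by (simp add: D0_add D0_sw sw_add acM split: nat.split)
    then show ?thesis using DD by simp
  qed
  then show ?thesis unfolding ON_def by blast
qed

definition cyc :: "nat \<Rightarrow> (nat \<Rightarrow> 'a mat) set"
  where "cyc N = {f. del f \<in> ON N}"

definition bnd :: "nat \<Rightarrow> (nat \<Rightarrow> 'a mat) set"
  where "bnd N = lsum Q ssc (ON N) (range del)"

lemmas lsS = lsubD[where s=ssc and Q=Q]

lemma lcyc: "lsub Q ssc (cyc N)"
  unfolding cyc_def by (rule lsub_preimage[where D=del and s=ssc and s'=ssc, OF del_add del_ssc del_0 lON])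

lemma lbnd: "lsub Q ssc (bnd N)"
  unfolding bnd_def
proof (rule lmod.lsub_lsum[OF VS lsS(1-3)[OF lON]])
  show "0 \<in> range del" by (rule range_eqI[of _ _ 0]) (simp add: del_0)
  show "x + y \<in> range del" if "x \<in> range del" "y \<in> range del" for x y
    using that by (auto simp flip: del_add)
  show "ssc r x \<in> range del" if "x \<in> range del" for r x
    using that by (auto simp flip: del_ssc)
qed

lemma ON_bnd: "ON N \<subseteq> bnd N" unfolding bnd_def
  by (rule lmod.lsum_upper1[OF VS], rule range_eqI[of _ _ 0]) (simp add: del_0)

lemma del_bnd: "del f \<in> bnd N" unfolding bnd_def
  by (rule subsetD[OF lmod.lsum_upper2[OF VS lsS(1)[OF lON]]]) (rule rangeI)

lemma bnd_cyc: "bnd N \<subseteq> cyc N"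
  unfolding bnd_def
  by (rule lmod.lsum_least[OF VS lcyc]) (auto simp: cyc_def del_ON del_del)

text \<open>Truncation hides the coefficient \<open>R\<close> of \<open>t^N\<close> in the
  differential of \<open>Y\<close>. It is a symmetric cycle, so \<open>topend\<close> rewrites it by
  squares of cycles in powers above \<open>t^(N - 2 n)\<close>. After this correction the equations
  hold in all positive degrees, \<open>descent\<close> applies, and index \<open>q\<close> has only
  been multiplied by a unit.\<close>

lemma mainkey:
  assumes W: "\<And>k. W k \<in> Sig" "\<And>k. N \<le> k + 2 * n \<Longrightarrow> W k = 0" and n: "0 < n"
    and eq: "del Y + W \<in> ON N" and p: "0 < q" "q + 2 * n < N"
  shows "diagv (W q) \<in> frob 1 n Bd"
proof -
  obtain M where M: "N = Suc (Suc M)" using p by (cases N; cases "N - 1") auto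
  define R where "R = sw (Y (Suc M))"
  have eqk: "D (Y (Suc k)) + sw (Y k) + W (Suc k) \<in> OM n" if "k < Suc M" for k
    using eq that unfolding ON_def M del_def by auto
  have "D R \<in> OM n"
  proof -
    have "sw (D (Y (Suc M)) + sw (Y M) + W (Suc M)) \<in> OM n" by (rule OM_sw[OF eqk]) simp
    then show ?thesis unfolding R_def by (simp add: sw_add Sig_sw[OF W(1)] D0_sw)
  qed
  moreover have "sw R \<in> OM n" unfolding R_def by (simp add: OM_0)
  ultimately obtain u U V where u: "u \<notin> Q" and V: "\<And>k. V k \<in> Sig" "\<And>k. 2 * n \<le> k \<Longrightarrow> V k = 0"
    and t: "msc u R + V 0 + sw (U 0) \<in> OM n" "\<And>k. D (U k) + V (Suc k) + sw (U (Suc k)) \<in> OM n"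
    using topend[of "2 * n" R] by auto
  \<comment> \<open>The corrections run downwards: \<open>U 0\<close> is added at the last visible
    index \<open>N - 1\<close>, and \<open>V 0\<close> belongs to the hidden index
    \<open>N\<close>.\<close>
  define Y' where "Y' k = (if k < N then msc u (Y k) + U (Suc M - k) else 0)" for k
  define W' where "W' k = (if k < N then msc u (W k) + V (N - k) else if k = N then V 0 else 0)" for k
  have S': "W' k \<in> Sig" for k unfolding W'_def using Sig_add[OF Sig_msc[OF W(1)] V(1)] V(1) Sig_0 by auto
  have e': "D (Y' (Suc k)) + sw (Y' k) + W' (Suc k) \<in> OM n" for k
  proof -
    consider "k < Suc M" | "k = Suc M" | "Suc M < k" by linarith
    then show ?thesis
    proof cases
      case 1
      define q where "q = M - k"
      have q: "Suc M - k = Suc q" "N - Suc k = Suc q" "Suc M - Suc k = q" unfolding q_def M using 1 by auto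
      have "D (Y' (Suc k)) + sw (Y' k) + W' (Suc k) =
        msc u (D (Y (Suc k)) + sw (Y k) + W (Suc k)) + (D (U q) + V (Suc q) + sw (U (Suc q)))"
        using 1 unfolding Y'_def W'_def q by (simp add: M D0_add sw_add D0_msc sw_msc msc_add q add_ac)
      then show ?thesis by (rule OM_cong2[OF _ OM_msc[OF eqk[OF 1]] t(2)])
    next
      case 2
      have "D (Y' (Suc k)) + sw (Y' k) + W' (Suc k) = msc u R + V 0 + sw (U 0)"
        unfolding Y'_def W'_def R_def 2 by (simp add: M sw_add sw_msc add_ac)
      then show ?thesis using t(1) by simp
    next
      case 3 then show ?thesis unfolding Y'_def W'_def by (simp add: M OM_0)
    qed
  qed
  have "diagv (W' (Suc (q - 1))) \<in> frob 1 n Bd"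
    by (rule descent[where m=N and Y=Y', OF S' e']) (simp add: Y'_def)
  then have "fsc u (diagv (W q)) \<in> frob 1 n Bd"
    using p V(2)[of "N - q"] unfolding W'_def by (simp add: diagv_add diagv_msc)
  then show ?thesis by (rule lsF(4)[OF lfrob u])
qed

text \<open>Squares of cycles placed at \<open>t^p\<close>, for \<open>p\<close> from 1 to
  \<open>m\<close>, filter part of the homology, and by \<open>mainkey\<close> each layer contains
  the twist of the homology of \<open>a\<close>. \<open>topend\<close> uses up \<open>2 n\<close>
  powers at the top and \<open>t^0\<close> is left out, whence the total
  \<open>m + 2 n + 1\<close>.\<close>

lemma lower_bound:
  assumes n: "0 < n"
  shows "of_nat m * len Q fsc (frob 1 n Bd) (frob 1 n Z) \<le> len Q ssc (bnd (m + 2 * n + 1)) (cyc (m + 2 * n + 1))"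
proof -
  define N where "N = m + 2 * n + 1"
  define Th where "Th p = {f. (\<forall>k. f k \<in> Sig) \<and> (\<forall>k. k < p \<or> N \<le> k + 2 * n \<longrightarrow> f k = 0)}" for p
  define P where "P p = lsum Q ssc (Th p) (bnd N)" for p
  have lP: "lsub Q ssc (P p)" for p unfolding P_def
  proof (rule lmod.lsub_lsum[OF VS _ _ _ lsS(1-3)[OF lbnd]])
    show "0 \<in> Th p" unfolding Th_def by (simp add: Sig_0)
    show "x + y \<in> Th p" if "x \<in> Th p" "y \<in> Th p" for x y using that Sig_add unfolding Th_def by auto
    show "ssc r x \<in> Th p" if "x \<in> Th p" for r x using that Sig_msc unfolding Th_def ssc_def by auto
  qed
  have Th0: "0 \<in> Th p" for p unfolding Th_def by (simp add: Sig_0)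
  have bP: "bnd N \<subseteq> P p" for p unfolding P_def by (rule lmod.lsum_upper2[OF VS Th0])
  have ThP: "Th p \<subseteq> P p" for p unfolding P_def by (rule lmod.lsum_upper1[OF VS lsS(1)[OF lbnd]])
  have ThC: "Th p \<subseteq> cyc N" for p
  proof
    fix f assume f: "f \<in> Th p"
    then have s: "f k \<in> Sig" for k unfolding Th_def by blast
    show "f \<in> cyc N" unfolding cyc_def ON_def del_def
      using Sig_D[OF s] Sig_sw[OF s] by (auto split: nat.split)
  qed
  have PC: "P p \<subseteq> cyc N" for p unfolding P_def by (rule lmod.lsum_least[OF VS lcyc ThC bnd_cyc])
  have PP: "P (Suc p) \<subseteq> P p" for p unfolding P_def
    by (rule lmod.lsum_mono[OF VS _ order_refl]) (auto simp: Th_def)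
  have step: "len Q fsc (frob 1 n Bd) (frob 1 n Z) \<le> len Q ssc (P (Suc p)) (P p)" if p: "0 < p" "p \<le> m" for p
  proof (rule len_rel[OF VF VS lfrob lP lP frob_mono[OF BdZ] PP,
        where \<Gamma>="\<lambda>z f. \<exists>W\<in>Sig. diagv W + z \<in> pw n K \<and> f = (\<lambda>k. if k = p then W else 0)"])
    show "\<exists>W\<in>Sig. diagv W + 0 \<in> pw n K \<and> (0::nat \<Rightarrow> 'a mat) = (\<lambda>k. if k = p then W else 0)"
      using lsF(1)[OF lO] by (intro bexI[OF _ Sig_0]) (auto simp: diagv_def fun_eq_iff pw_def kid(1))
    fix z w z' w'
    assume "\<exists>W\<in>Sig. diagv W + z \<in> pw n K \<and> w = (\<lambda>k. if k = p then W else 0)"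
      "\<exists>W\<in>Sig. diagv W + z' \<in> pw n K \<and> w' = (\<lambda>k. if k = p then W else 0)"
    then obtain W W' where h: "W \<in> Sig" "diagv W + z \<in> pw n K" "w = (\<lambda>k. if k = p then W else 0)"
      "W' \<in> Sig" "diagv W' + z' \<in> pw n K" "w' = (\<lambda>k. if k = p then W' else 0)" by blast
    show "\<exists>W\<in>Sig. diagv W + (z + z') \<in> pw n K \<and> w + w' = (\<lambda>k. if k = p then W else 0)"
    proof (rule bexI[OF _ Sig_add[OF h(1,4)]], intro conjI)
      show "diagv (W + W') + (z + z') \<in> pw n K"
        using lsF(2)[OF lO h(2,5)] by (simp add: diagv_add add_ac)
    qed (auto simp: h fun_eq_iff)
  next
    fix r z w assume "\<exists>W\<in>Sig. diagv W + z \<in> pw n K \<and> w = (\<lambda>k. if k = p then W else 0)"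
    then obtain W where h: "W \<in> Sig" "diagv W + z \<in> pw n K" "w = (\<lambda>k. if k = p then W else 0)" by blast
    show "\<exists>W\<in>Sig. diagv W + fsc r z \<in> pw n K \<and> ssc r w = (\<lambda>k. if k = p then W else 0)"
    proof (rule bexI[OF _ Sig_msc[OF h(1), of r]], intro conjI)
      have "diagv (msc r W) + fsc r z = fsc r (diagv W + z)"
        by (simp add: diagv_def msc_def fsc_def fun_eq_iff distrib_left)
      then show "diagv (msc r W) + fsc r z \<in> pw n K" using lsF(3)[OF lO h(2)] by simp
    qed (auto simp: h fun_eq_iff ssc_def)
  next
    fix z assume "z \<in> frob 1 n Z"
    then have "z \<in> frob 1 n {v. mv a n v \<in> pw n K}" unfolding Z_def .
    from Sig_lift[OF order_refl this] obtain u W where h: "u \<notin> Q" "W \<in> Sig"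
      "\<And>i. i < n \<Longrightarrow> W i i + u * z i \<in> K" by blast
    define f where "f = (\<lambda>k. if k = p then W else 0)"
    have "f \<in> Th p" unfolding Th_def f_def N_def using h(2) Sig_0 p by auto
    then have "f \<in> P p" using ThP by blast
    moreover have "diagv W + fsc u z \<in> pw n K" using h(3) unfolding pw_def diagv_def fsc_def by simp
    ultimately show "\<exists>u f. u \<notin> Q \<and> f \<in> P p \<and> (\<exists>W\<in>Sig. diagv W + fsc u z \<in> pw n K \<and> f = (\<lambda>k. if k = p then W else 0))"
      using h(1,2) unfolding f_def by blast
  next
    fix z f assume "\<exists>W\<in>Sig. diagv W + z \<in> pw n K \<and> f = (\<lambda>k. if k = p then W else 0)" and f: "f \<in> P (Suc p)"
    then obtain W where h: "W \<in> Sig" "diagv W + z \<in> pw n K" "f = (\<lambda>k. if k = p then W else 0)" by blast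
    from f obtain u th g where e: "u \<notin> Q" "th \<in> Th (Suc p)" "g \<in> bnd N" "ssc u f = th + g"
      unfolding P_def by (rule lsumE)
    from e(3) obtain u' o' Y where e': "u' \<notin> Q" "o' \<in> ON N" "ssc u' g = o' + del Y"
      unfolding bnd_def by (rule lsumE) blast
    \<comment> \<open>Up to units a member of \<open>P (Suc p)\<close> is a boundary plus squares in
      powers above \<open>p\<close>. Here \<open>V\<close> is the boundary itself, written with
      squares, and at index \<open>p\<close> it shows only the multiple of \<open>W\<close>.\<close>
    define V where "V = ssc u' (ssc u f) + ssc u' th"
    have V1: "V = ssc u' g" unfolding V_def e(4)
      using lmod_ssc[OF pQ] twoS two_leftS
      by (simp add: ssc_def msc_def fun_eq_iff algebra_simps two_left)
    have "del Y + V = o'" unfolding V1 e'(3) by (simp only: add.commute[of o'] two_leftS)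
    then have eq: "del Y + V \<in> ON N" using e'(2) by simp
    have th: "th k \<in> Sig" "k < Suc p \<or> N \<le> k + 2 * n \<Longrightarrow> th k = 0" for k using e(2) unfolding Th_def by auto
    have fk: "f k \<in> Sig" "N \<le> k + 2 * n \<Longrightarrow> f k = 0" for k unfolding h(3) using h(1) Sig_0 p by (auto simp: N_def)
    have "diagv (V p) \<in> frob 1 n Bd"
    proof (rule mainkey[OF _ _ n eq])
      show "V k \<in> Sig" for k unfolding V_def ssc_def using Sig_add[OF Sig_msc[OF Sig_msc[OF fk(1)]] Sig_msc[OF th(1)]] by simp
      show "V k = 0" if "N \<le> k + 2 * n" for k unfolding V_def ssc_def using fk(2)[OF that] th(2)[of k] that by simp
    qed (use p in \<open>auto simp: N_def\<close>)
    moreover have "diagv (V p) = fsc u' (fsc u (diagv W))" unfolding V_def ssc_def h(3) using th(2)[of p]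
      by (simp add: diagv_msc)
    ultimately have "diagv W \<in> frob 1 n Bd" using lsF(4)[OF lfrob e'(1)] lsF(4)[OF lfrob e(1)] by metis
    moreover have "diagv W + z \<in> frob 1 n Bd" using h(2) frob_O by blast
    ultimately have "diagv W + (diagv W + z) \<in> frob 1 n Bd" by (rule lsF(2)[OF lfrob])
    then show "z \<in> frob 1 n Bd" by (simp flip: add.assoc)
  qed
  have "of_nat m * len Q fsc (frob 1 n Bd) (frob 1 n Z) \<le> len Q ssc (P (Suc m - 0)) (P (Suc m - m))"
  proof (rule lmod.len_iter[OF VS, where D="\<lambda>i. P (Suc m - i)"])
    fix i assume i: "i < m"
    have s: "Suc m - i = Suc (Suc m - Suc i)" using i by simp
    show "P (Suc m - i) \<subseteq> P (Suc m - Suc i)" unfolding s by (rule PP)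
    show "len Q fsc (frob 1 n Bd) (frob 1 n Z) \<le> len Q ssc (P (Suc m - i)) (P (Suc m - Suc i))"
      unfolding s by (rule step) (use i in auto)
  qed (rule lP)
  also have "\<dots> \<le> len Q ssc (bnd N) (cyc N)" by (rule lmod.len_mono[OF VS bP PC])
  finally show ?thesis unfolding N_def .
qed

end

section \<open>The upper bound and the inequality for matrices\<close>

context dmod
begin

text \<open>Filter by the leading block, a block being one column of one coefficient. The leading
  block of a cycle is a cycle of \<open>a\<close>, and if it is a boundary, a boundary of the large
  complex cancels it. So each of the \<open>N * n\<close> layers has at most the length of
  \<open>Z/Bd\<close>.\<close>

lemma upper_bound:
  assumes n: "0 < n"
  shows "len Q ssc (bnd N) (cyc N) \<le> of_nat (N * n) * len Q fsc Bd Z"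
proof -
  \<comment> \<open>Low powers of \<open>t\<close> come first, and within a power the columns run
    from \<open>n - 1\<close> down to 0: by triangularity \<open>1 \<otimes> d\<close> feeds column
    \<open>j\<close> only from columns \<open>l > j\<close>.\<close>
  define blk where "blk b f = f (b div n) (n - 1 - b mod n)" for b and f :: "nat \<Rightarrow> 'a mat"
  define F where "F b = {f \<in> cyc N. \<forall>b'<b. blk b' f \<in> pw n K}" for b
  define KK where "KK b = lsum Q ssc (F b) (bnd N)" for b
  have blk: "blk b (f + g) = blk b f + blk b g" "blk b (ssc r f) = fsc r (blk b f)" "blk b 0 = 0" for b f g r
    unfolding blk_def ssc_def msc_def fsc_def by simp_all
  have lF: "lsub Q ssc (F b)" for b
  proof (rule lsubI)
    show "0 \<in> F b" unfolding F_def using lsS(1)[OF lcyc] lsF(1)[OF lO] by (simp add: blk)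
    show "x + y \<in> F b" if "x \<in> F b" "y \<in> F b" for x y
      using that lsS(2)[OF lcyc] lsF(2)[OF lO] unfolding F_def by (simp add: blk)
    show "ssc r x \<in> F b" if "x \<in> F b" for r x
      using that lsS(3)[OF lcyc] lsF(3)[OF lO] unfolding F_def by (simp add: blk)
    show "v \<in> F b" if "u \<notin> Q" "ssc u v \<in> F b" for u v
    proof -
      have "ssc u v \<in> cyc N" "\<forall>b'<b. fsc u (blk b' v) \<in> pw n K"
        using that(2) unfolding F_def by (simp_all add: blk)
      then show ?thesis using lsS(4)[OF lcyc that(1)] lsF(4)[OF lO that(1)] unfolding F_def by blast
    qed
  qed
  have lKK: "lsub Q ssc (KK b)" for b unfolding KK_def by (rule lmod.lsub_lsum'[OF VS lF lbnd])
  have dm: "(k * n + (n - 1 - j)) div n = k" "n - 1 - (k * n + (n - 1 - j)) mod n = j" if "j < n" for k j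
  proof -
    define r where "r = n - 1 - j"
    have "r < n" "n - 1 - r = j" unfolding r_def using that by auto
    then show "(k * n + (n - 1 - j)) div n = k" "n - 1 - (k * n + (n - 1 - j)) mod n = j"
      unfolding r_def[symmetric] by simp_all
  qed
  have lex: "f k' j' \<in> pw n K" if f: "f \<in> F b" and j': "j' < n" and lt: "k' < b div n \<or> k' = b div n \<and> n - 1 - b mod n < j'"
    for f b k' j'
  proof -
    let ?b = "k' * n + (n - 1 - j')"
    have "?b < b"
    proof (cases "k' < b div n")
      case True
      have "?b < Suc k' * n" using n by simp
      also have "\<dots> \<le> b div n * n" using True by (intro mult_right_mono) auto
      also have "\<dots> \<le> b" by simp
      finally show ?thesis .
    next
      case False
      then have e: "k' = b div n" "n - 1 - b mod n < j'" using lt by auto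
      have "b = b div n * n + b mod n" by simp
      moreover have "n - 1 - j' < b mod n" using e(2) j' by linarith
      ultimately show ?thesis unfolding e(1) by linarith
    qed
    then have "blk ?b f \<in> pw n K" using f unfolding F_def by blast
    then show ?thesis unfolding blk_def dm[OF j'] .
  qed
  have top: "KK (N * n) \<subseteq> bnd N" unfolding KK_def
  proof (rule lmod.lsum_least[OF VS lbnd _ order_refl])
    show "F (N * n) \<subseteq> bnd N"
    proof
      fix f assume f: "f \<in> F (N * n)"
      have "f k j i \<in> K" if "k < N" "j < n" "i < n" for k j i
        using lex[OF f that(2), of k] that n unfolding pw_def by auto
      then have "f \<in> ON N" unfolding ON_def OM_def by blast
      then show "f \<in> bnd N" using ON_bnd by blast
    qed
  qed
  have "cyc N \<subseteq> F 0" unfolding F_def by simp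
  also have "\<dots> \<subseteq> KK 0" unfolding KK_def by (rule lmod.lsum_upper1[OF VS lsS(1)[OF lbnd]])
  finally have bot: "cyc N \<subseteq> KK 0" .
  have mono: "KK (Suc b) \<subseteq> KK b" for b unfolding KK_def
    by (rule lmod.lsum_mono[OF VS _ order_refl]) (auto simp: F_def)
  have step: "len Q ssc (KK (Suc b)) (KK b) \<le> len Q fsc Bd Z" if b: "b < N * n" for b
  proof -
    define k where "k = b div n"
    define j where "j = n - 1 - b mod n"
    have j: "j < n" unfolding j_def using n by linarith
    have k: "k < N" unfolding k_def using b n by (simp add: less_mult_imp_div_less)
    \<comment> \<open>Apart from \<open>a\<close> applied to block \<open>(k, j)\<close> itself,
      every contribution to that block of the differential comes from earlier blocks, which vanish
      modulo \<open>K\<close>.\<close>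
    have cycZ: "e k j \<in> Z" if e: "e \<in> F b" for e
    proof -
      have "mv a n (e k j) i \<in> K" if i: "i < n" for i
      proof -
        define S where "S = (\<Sum>l<n. a j l * e k l i)"
        define C where "C = (case k of 0 \<Rightarrow> 0 | Suc k' \<Rightarrow> e k' j i + e k' i j)"
        have d: "del e k j i \<in> K" using e k j i unfolding F_def cyc_def ON_def OM_def by blast
        have dS: "del e k j i = mv a n (e k j) i + (S + C)"
          unfolding S_def C_def del_def D0_def mv_def sw_def by (simp add: add.assoc split: nat.split)
        have S: "S \<in> K" unfolding S_def
        proof (rule is_ideal_sum[OF lsub_ideal[OF lK]])
          fix l assume l: "l \<in> {..<n}"
          show "a j l * e k l i \<in> K"
          proof (cases "l \<le> j")
            case True then show ?thesis using tri kid(1) by simp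
          next
            case False
            then have "e k l \<in> pw n K" using lex[OF e, of l k] l unfolding k_def j_def by auto
            then show ?thesis using i kid(3) unfolding pw_def by blast
          qed
        qed
        have C: "C \<in> K"
        proof (cases k)
          case 0 then show ?thesis unfolding C_def using kid(1) by simp
        next
          case (Suc k')
          then have "k' < b div n" unfolding k_def[symmetric] by simp
          then have "e k' j \<in> pw n K" "e k' i \<in> pw n K" using lex[OF e j, of k'] lex[OF e i, of k'] by auto
          then show ?thesis unfolding C_def using i j kid(2) Suc unfolding pw_def by simp
        qed
        have "mv a n (e k j) i = del e k j i + (S + C)" unfolding dS by (simp add: add.assoc)
        also have "\<dots> \<in> K" by (intro kid(2) d S C)
        finally show ?thesis .
      qed
      then show ?thesis unfolding Z_def pw_def by blast
    qed
    show ?thesis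
    proof (rule len_rel[OF VS VF lKK lBd lZ mono BdZ,
          where \<Gamma>="\<lambda>f z. \<exists>e\<in>F b. \<exists>g\<in>bnd N. f = e + g \<and> z = e k j"])
      show "\<exists>e\<in>F b. \<exists>g\<in>bnd N. 0 = e + g \<and> 0 = e k j"
        by (intro bexI[OF _ lsS(1)[OF lF]] bexI[OF _ lsS(1)[OF lbnd]]) simp
      fix f z f' z'
      assume "\<exists>e\<in>F b. \<exists>g\<in>bnd N. f = e + g \<and> z = e k j" "\<exists>e\<in>F b. \<exists>g\<in>bnd N. f' = e + g \<and> z' = e k j"
      then obtain e g e' g' where h: "e \<in> F b" "g \<in> bnd N" "f = e + g" "z = e k j"
        "e' \<in> F b" "g' \<in> bnd N" "f' = e' + g'" "z' = e' k j" by blast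
      show "\<exists>e\<in>F b. \<exists>g\<in>bnd N. f + f' = e + g \<and> z + z' = e k j"
        by (intro bexI[OF _ lsS(2)[OF lF h(1,5)]] bexI[OF _ lsS(2)[OF lbnd h(2,6)]]) (simp add: h add_ac)
    next
      fix r f z assume "\<exists>e\<in>F b. \<exists>g\<in>bnd N. f = e + g \<and> z = e k j"
      then obtain e g where h: "e \<in> F b" "g \<in> bnd N" "f = e + g" "z = e k j" by blast
      show "\<exists>e\<in>F b. \<exists>g\<in>bnd N. ssc r f = e + g \<and> fsc r z = e k j"
        by (intro bexI[OF _ lsS(3)[OF lF h(1), of r]] bexI[OF _ lsS(3)[OF lbnd h(2), of r]])
          (simp add: h ssc_def msc_def fsc_def fun_eq_iff distrib_left)
    next
      fix f assume "f \<in> KK b"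
      then obtain u e g where h: "u \<notin> Q" "e \<in> F b" "g \<in> bnd N" "ssc u f = e + g" unfolding KK_def by (rule lsumE)
      then show "\<exists>u w. u \<notin> Q \<and> w \<in> Z \<and> (\<exists>e\<in>F b. \<exists>g\<in>bnd N. ssc u f = e + g \<and> w = e k j)"
        using cycZ[OF h(2)] by blast
    next
      fix f z assume "\<exists>e\<in>F b. \<exists>g\<in>bnd N. f = e + g \<and> z = e k j" and zB: "z \<in> Bd"
      then obtain e g where h: "e \<in> F b" "g \<in> bnd N" "f = e + g" "z = e k j" by blast
      from zB obtain u o' y where y: "u \<notin> Q" "o' \<in> pw n K" "fsc u z = o' + mv a n y" unfolding Bd_def by (rule lsumE) blast
      \<comment> \<open>\<open>y\<close> placed in the single block \<open>(k, j)\<close>. Its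
        differential is \<open>a\<close> applied to \<open>y\<close> in this block and zero in all
        earlier ones.\<close>
      define \<iota> where "\<iota> = (\<lambda>k' j'. if k' = k \<and> j' = j then y else (0 :: nat \<Rightarrow> 'a))"
      define e' where "e' = ssc u e + del \<iota>"
      have di: "del \<iota> k' j' i = (if k' = k \<and> j' = j then mv a n y i else 0)"
        if "k' < k \<or> k' = k \<and> j \<le> j'" for k' j' i
      proof -
        have 1: "(\<Sum>l<n. a j' l * \<iota> k' l i) = 0"
        proof (rule sum.neutral, rule ballI)
          fix l
          show "a j' l * \<iota> k' l i = 0"
          proof (cases "k' = k \<and> l = j")
            case True
            then have "a j' l = 0" using that by (intro tri) auto
            then show ?thesis by simp
          next
            case False then show ?thesis unfolding \<iota>_def by auto
          qed
        qed
        have 2: "(case k' of 0 \<Rightarrow> 0 | Suc k2 \<Rightarrow> sw (\<iota> k2)) j' i = 0"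
          using that by (auto simp: \<iota>_def sw_def split: nat.split)
        have "del \<iota> k' j' i = (\<Sum>l<n. a i l * \<iota> k' j' l)"
          unfolding del_def D0_def plus_fun_apply 1 2 by simp
        then show ?thesis unfolding \<iota>_def mv_def by auto
      qed
      have ecyc: "e \<in> cyc N" using h(1) unfolding F_def by blast
      have "e' \<in> F (Suc b)" unfolding F_def
      proof (intro CollectI conjI allI impI)
        show "e' \<in> cyc N" unfolding e'_def
          using lsS(2)[OF lcyc lsS(3)[OF lcyc ecyc]] del_bnd bnd_cyc by blast
        fix b' assume b': "b' < Suc b"
        let ?k = "b' div n" and ?j = "n - 1 - b' mod n"
        have jn: "?j < n" using n by linarith
        show "blk b' e' \<in> pw n K"
        proof (cases "b' = b")
          case True
          have "blk b' e' = o'"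
          proof
            fix i
            have "blk b' e' i = u * e k j i + mv a n y i"
              unfolding True blk_def e'_def k_def[symmetric] j_def[symmetric] using di[of k j i]
              by (simp add: ssc_def msc_def)
            also have "u * e k j i = o' i + mv a n y i" using fun_cong[OF y(3), of i] h(4) by (simp add: fsc_def)
            finally show "blk b' e' i = o' i" by (simp add: add.assoc)
          qed
          then show ?thesis using y(2) by simp
        next
          case False
          then have bb: "b' < b" using b' by simp
          have le: "?k \<le> k" unfolding k_def using bb by (intro div_le_mono) simp
          have c: "?k < k \<or> ?k = k \<and> j < ?j"
          proof (cases "?k = k")
            case True
            have "b' = k * n + b' mod n" "b = k * n + b mod n" using True unfolding k_def by (metis div_mult_mod_eq)+
            then have "b' mod n < b mod n" using bb by linarith
            moreover have "b mod n < n" using n by simp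
            ultimately show ?thesis using True unfolding j_def by linarith
          qed (use le in simp)
          have "blk b' e' i = u * blk b' e i" for i
            unfolding blk_def e'_def using di[of ?k ?j i] c by (auto simp: ssc_def msc_def)
          moreover have "blk b' e \<in> pw n K" using h(1) bb unfolding F_def by blast
          ultimately show ?thesis using kid(3) unfolding pw_def by simp
        qed
      qed
      moreover have "ssc u g + del \<iota> \<in> bnd N" using lsS(2)[OF lbnd lsS(3)[OF lbnd h(2)] del_bnd] .
      moreover have "ssc u f = e' + (ssc u g + del \<iota>)"
      proof -
        have "ssc u f = ssc u e + ssc u g" unfolding h(3) by (simp add: ssc_def msc_def fun_eq_iff distrib_left)
        moreover have "e' + (ssc u g + del \<iota>) = (ssc u e + ssc u g) + (del \<iota> + del \<iota>)" unfolding e'_def by (simp only: add_ac)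
        ultimately show ?thesis by (simp only: twoS add_0_right)
      qed
      ultimately show "f \<in> KK (Suc b)" unfolding KK_def using lsumI[OF y(1)] by blast
    qed
  qed
  have "len Q ssc (bnd N) (cyc N) \<le> len Q ssc (KK (N * n - 0)) (KK (N * n - N * n))"
    using lmod.len_mono[OF VS top bot] by simp
  also have "\<dots> \<le> of_nat (N * n) * len Q fsc Bd Z"
  proof (rule lmod.len_iter_le[OF VS, where D="\<lambda>i. KK (N * n - i)"])
    fix i assume i: "i < N * n"
    have s: "N * n - i = Suc (N * n - Suc i)" using i by simp
    show "KK (N * n - i) \<subseteq> KK (N * n - Suc i)" unfolding s by (rule mono)
    show "len Q ssc (KK (N * n - i)) (KK (N * n - Suc i)) \<le> len Q fsc Bd Z"
      unfolding s by (rule step) (use i in simp)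
  qed (rule lKK)
  finally show ?thesis .
qed

text \<open>With \<open>k\<close> the positive finite length of \<open>Z/Bd\<close>, the two bounds
  give \<open>m * 2^c * k \<le> (m + 2 n + 1) * n * k\<close> for every \<open>m\<close>.\<close>

theorem rank_bound:
  assumes tors: "\<And>t v. t \<in> Q \<Longrightarrow> v \<in> Z \<Longrightarrow> fsc (t ^ 2 ^ s) v \<in> Bd" and ne: "Bd \<noteq> Z"
  shows "2 ^ c \<le> n"
proof (rule ccontr)
  assume "\<not> ?thesis"
  then have lt: "n + 1 \<le> 2 ^ c" by simp
  have n: "0 < n"
  proof (rule ccontr)
    assume "\<not> 0 < n"
    then have "pw n K = UNIV" unfolding pw_def by simp
    then show False using O_Bd BdZ ne by auto
  qed
  obtain k where k: "len Q fsc Bd Z = enat k" "enat (2 ^ c * k) \<le> len Q fsc (frob 1 n Bd) (frob 1 n Z)"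
    using frob_ratio[OF lBd lZ O_Bd BdZ tors] by blast
  have "Bd \<subset> Z" using BdZ ne by blast
  from lmod.len_strict[OF VF lBd order_refl lZ this] have k1: "1 \<le> k"
    using k(1) lmod.len_self[OF VF lBd] by (simp add: one_enat_def)
  \<comment> \<open>Chosen so that \<open>m * (n + 1)\<close> exceeds
    \<open>(m + 2 n + 1) * n\<close> by exactly 1.\<close>
  define m where "m = (2 * n + 1) * n + 1"
  have "enat (m * (2 ^ c * k)) \<le> of_nat m * len Q fsc (frob 1 n Bd) (frob 1 n Z)"
    using mult_left_mono[OF k(2), of "enat m"] by (simp add: of_nat_eq_enat)
  also have "\<dots> \<le> len Q ssc (bnd (m + 2 * n + 1)) (cyc (m + 2 * n + 1))" by (rule lower_bound[OF n])
  also have "\<dots> \<le> of_nat ((m + 2 * n + 1) * n) * len Q fsc Bd Z" by (rule upper_bound[OF n])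
  also have "\<dots> = enat ((m + 2 * n + 1) * n * k)" using k(1) by (simp add: of_nat_eq_enat)
  finally have "m * 2 ^ c * k \<le> (m + 2 * n + 1) * n * k" by (simp add: mult.assoc)
  then have "m * 2 ^ c \<le> (m + 2 * n + 1) * n" using k1 by simp
  moreover have "m * (n + 1) \<le> m * 2 ^ c" using lt by (intro mult_left_mono) auto
  ultimately have "m * (n + 1) \<le> (m + 2 * n + 1) * n" by (rule order_trans[rotated])
  then have "m \<le> (2 * n + 1) * n" by (simp add: algebra_simps)
  then show False unfolding m_def by simp
qed

end

section \<open>Presenting a ring of characteristic 2 as a quotient of a polynomial ring\<close>

text \<open>Working with preimages in this polynomial ring makes type class arithmetic available for a ring
  given by a carrier set in \<open>'a\<close>.\<close>

type_synonym 'a fpoly = "'a multiset \<Rightarrow>\<^sub>0 bit"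

lemma fpoly_two: "p + p = (0::'a fpoly)"
proof (rule poly_mapping_eqI)
  fix m show "Poly_Mapping.lookup (p + p) m = Poly_Mapping.lookup 0 m"
    unfolding lookup_add lookup_zero by (cases "Poly_Mapping.lookup p m") simp_all
qed

lemma fpoly_keys: "m \<in> Poly_Mapping.keys (p::'a fpoly) \<longleftrightarrow> Poly_Mapping.lookup p m = 1"
  by (cases "Poly_Mapping.lookup p m") (auto simp: in_keys_iff)

lemma fpoly_keys_add: "Poly_Mapping.keys (p + q) = (Poly_Mapping.keys p - Poly_Mapping.keys q) \<union> (Poly_Mapping.keys q - Poly_Mapping.keys (p::'a fpoly))"
proof -
  have "m \<in> Poly_Mapping.keys (p + q) \<longleftrightarrow> m \<in> (Poly_Mapping.keys p - Poly_Mapping.keys q) \<union> (Poly_Mapping.keys q - Poly_Mapping.keys p)" for m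
    unfolding Un_iff Diff_iff fpoly_keys lookup_add by (cases "Poly_Mapping.lookup p m"; cases "Poly_Mapping.lookup q m") auto
  then show ?thesis by blast
qed

lemma fpoly_induct:
  assumes "P 0" "\<And>m p. P p \<Longrightarrow> P (Poly_Mapping.single m 1 + p)"
  shows "P (p::'a fpoly)"
proof (induction "card (Poly_Mapping.keys p)" arbitrary: p)
  case 0
  then have "p = 0" by simp
  then show ?case using assms(1) by simp
next
  case (Suc n)
  then obtain m where m: "m \<in> Poly_Mapping.keys p" by fastforce
  let ?q = "Poly_Mapping.single m 1 + p"
  have "Poly_Mapping.keys ?q = Poly_Mapping.keys p - {m}" unfolding fpoly_keys_add using m by auto
  then have "n = card (Poly_Mapping.keys ?q)" using Suc(2) m by simp
  then have "P (Poly_Mapping.single m 1 + ?q)" using Suc(1) assms(2) by blast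
  moreover have "Poly_Mapping.single m 1 + ?q = p" by (simp add: fpoly_two flip: add.assoc)
  ultimately show ?case by simp
qed

text \<open>The guard makes the folded function commute on the whole type; a monomial containing a
  variable outside the carrier is sent to zero.\<close>

definition mprod :: "('a, 'm) ring_scheme \<Rightarrow> 'a multiset \<Rightarrow> 'a"
  where "mprod R m = fold_mset (\<lambda>x y. if x \<in> carrier R \<and> y \<in> carrier R then x \<otimes>\<^bsub>R\<^esub> y else \<zero>\<^bsub>R\<^esub>) \<one>\<^bsub>R\<^esub> m"

text \<open>Coefficients are bits, so a polynomial is the finite set of its monomials, and
  evaluation sums over this set.\<close>

definition fev :: "('a, 'm) ring_scheme \<Rightarrow> 'a fpoly \<Rightarrow> 'a"
  where "fev R p = finsum R (mprod R) (Poly_Mapping.keys p)"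

locale presented = cring R for R (structure) +
  fixes \<theta> :: "'t::comm_ring_1 \<Rightarrow> 'a"
  assumes th_closed [simp]: "\<theta> t \<in> carrier R" and th_add: "\<theta> (s + t) = \<theta> s \<oplus> \<theta> t"
    and th_mult: "\<theta> (s * t) = \<theta> s \<otimes> \<theta> t" and th_one: "\<theta> 1 = \<one>"
    and th_surj: "x \<in> carrier R \<Longrightarrow> \<exists>t. \<theta> t = x" and th_c2: "(1::'t) + 1 = 0"

lemma (in cring) presented_fev:
  assumes c2: "\<one> \<oplus> \<one> = \<zero>"
  shows "presented R (fev R)"
proof -
  let ?f = "\<lambda>x y. if x \<in> carrier R \<and> y \<in> carrier R then x \<otimes> y else \<zero>"
  interpret cf: comp_fun_commute ?f
    by standard (auto simp: fun_eq_iff m_lcomm)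
  have mp0: "mprod R {#} = \<one>" unfolding mprod_def by simp
  have mpa: "mprod R (add_mset x m) = ?f x (mprod R m)" for x m unfolding mprod_def by simp
  have mpc [simp]: "mprod R m \<in> carrier R" for m by (induction m) (auto simp: mp0 mpa)
  have mpm: "mprod R (m + m') = mprod R m \<otimes> mprod R m'" for m m'
    by (induction m) (auto simp: mp0 mpa m_assoc)
  have two: "x \<oplus> x = \<zero>" if x: "x \<in> carrier R" for x
  proof -
    have "x \<oplus> x = (\<one> \<oplus> \<one>) \<otimes> x" using x by (simp add: l_distr)
    then show ?thesis using c2 x by simp
  qed
  have fc [simp]: "fev R p \<in> carrier R" for p unfolding fev_def by (rule finsum_closed) auto
  have fs: "fev R (Poly_Mapping.single m 1) = mprod R m" for m unfolding fev_def by simp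
  have add: "fev R (p + q) = fev R p \<oplus> fev R q" for p q
  proof -
    \<comment> \<open>The monomials of a sum form a symmetric difference; the common ones are
      counted twice and cancel in characteristic 2.\<close>
    let ?A = "Poly_Mapping.keys p - Poly_Mapping.keys q" and ?B = "Poly_Mapping.keys q - Poly_Mapping.keys p" and ?C = "Poly_Mapping.keys p \<inter> Poly_Mapping.keys q"
    let ?s = "finsum R (mprod R)"
    have 1: "?s (Poly_Mapping.keys p) = ?s ?A \<oplus> ?s ?C"
    proof -
      have "?s (?A \<union> ?C) = ?s ?A \<oplus> ?s ?C" by (rule finsum_Un_disjoint) auto
      moreover have "?A \<union> ?C = Poly_Mapping.keys p" by auto
      ultimately show ?thesis by simp
    qed
    have 2: "?s (Poly_Mapping.keys q) = ?s ?B \<oplus> ?s ?C"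
    proof -
      have "?s (?B \<union> ?C) = ?s ?B \<oplus> ?s ?C" by (rule finsum_Un_disjoint) auto
      moreover have "?B \<union> ?C = Poly_Mapping.keys q" by auto
      ultimately show ?thesis by simp
    qed
    have 3: "?s (Poly_Mapping.keys (p + q)) = ?s ?A \<oplus> ?s ?B" unfolding fpoly_keys_add by (rule finsum_Un_disjoint) auto
    have c: "?s ?A \<in> carrier R" "?s ?B \<in> carrier R" "?s ?C \<in> carrier R" by (auto intro: finsum_closed)
    have "(?s ?A \<oplus> ?s ?C) \<oplus> (?s ?B \<oplus> ?s ?C) = (?s ?A \<oplus> ?s ?B) \<oplus> (?s ?C \<oplus> ?s ?C)"
      using c by (simp add: a_ac)
    then show ?thesis unfolding fev_def 1 2 3 using c two by simp
  qed
  have f0: "fev R 0 = \<zero>" unfolding fev_def by simp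
  have m1: "fev R (Poly_Mapping.single m 1 * q) = mprod R m \<otimes> fev R q" for m q
    by (induction q rule: fpoly_induct) (simp_all add: f0 distrib_left mult_single add fs mpm r_distr)
  have mult: "fev R (p * q) = fev R p \<otimes> fev R q" for p q
    by (induction p rule: fpoly_induct) (simp_all add: f0 distrib_right add fs m1 l_distr)
  show ?thesis
  proof
    have "fev R (Poly_Mapping.single 0 1) = \<one>" unfolding fs by (simp add: mp0)
    then show "fev R 1 = \<one>" by simp
    show "\<exists>t. fev R t = x" if "x \<in> carrier R" for x
      by (rule exI[of _ "Poly_Mapping.single {#x#} 1"]) (use that in \<open>simp add: fs mpa mp0\<close>)
  qed (auto simp: add mult fpoly_two)
qed

section \<open>Ideals and primes under the presentation\<close>

context presented
begin

lemma th_zero [simp]: "\<theta> 0 = \<zero>"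
  using th_add[of 0 0] by (simp add: local.add.l_cancel_one)

lemma th_minus: "\<theta> (- t) = \<ominus> \<theta> t"
  using th_add[of "- t" t] by (intro minus_equality[symmetric]) (auto simp: a_comm)

lemma th_diff: "\<theta> (s - t) = \<theta> s \<ominus> \<theta> t"
  using th_add[of s "- t"] by (simp add: th_minus minus_eq)

definition ker :: "'t set" where "ker = {t. \<theta> t = \<zero>}"

lemma ker_ideal: "is_ideal ker"
  unfolding is_ideal_def ker_def by (auto simp: th_add th_mult)

lemma pre_ideal:
  assumes I: "ideal I R"
  shows "is_ideal (\<theta> -` I)" "ker \<subseteq> \<theta> -` I"
proof -
  interpret ideal I R by fact
  show "is_ideal (\<theta> -` I)" unfolding is_ideal_def using I_l_closed by (auto simp: th_add th_mult)
  show "ker \<subseteq> \<theta> -` I" unfolding ker_def by auto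
qed

lemma pre_prime:
  assumes p: "primeideal p R"
  shows "is_prime (\<theta> -` p)"
proof -
  interpret primeideal p R by fact
  have "\<one> \<notin> p" using I_notcarr one_imp_carrier by blast
  then show ?thesis unfolding is_prime_def
    using pre_ideal(1)[OF is_ideal] I_prime by (auto simp: th_one th_mult)
qed

lemma im_mem:
  assumes I: "is_ideal I" "ker \<subseteq> I"
  shows "\<theta> t \<in> \<theta> ` I \<longleftrightarrow> t \<in> I"
proof
  assume "\<theta> t \<in> \<theta> ` I"
  then obtain s where s: "s \<in> I" "\<theta> t = \<theta> s" by blast
  then have "\<theta> (t - s) = \<zero>" by (simp add: th_diff r_neg minus_eq)
  then have "t - s \<in> I" using I(2) unfolding ker_def by blast
  then have "(t - s) + s \<in> I" using s(1) is_idealD(2)[OF I(1)] by blast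
  then show "t \<in> I" by simp
qed simp

lemma im_ideal:
  assumes I: "is_ideal I"
  shows "ideal (\<theta> ` I) R"
proof (rule idealI)
  note d = is_idealD[OF I]
  show "ring R" by (rule ring_axioms)
  show "subgroup (\<theta> ` I) (add_monoid R)"
  proof (rule subgroup.intro)
    show "\<theta> ` I \<subseteq> carrier (add_monoid R)" by auto
    show "x \<otimes>\<^bsub>add_monoid R\<^esub> y \<in> \<theta> ` I" if "x \<in> \<theta> ` I" "y \<in> \<theta> ` I" for x y
      using that d(2) by (auto simp flip: th_add)
    show "\<one>\<^bsub>add_monoid R\<^esub> \<in> \<theta> ` I" using d(1) th_zero by (metis image_eqI monoid.simps(2))
    show "inv\<^bsub>add_monoid R\<^esub> x \<in> \<theta> ` I" if "x \<in> \<theta> ` I" for x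
      using that d(6) unfolding a_inv_def[symmetric] by (auto simp flip: th_minus)
  qed
  fix a x assume "a \<in> \<theta> ` I" "x \<in> carrier R"
  then obtain t s where "t \<in> I" "a = \<theta> t" "x = \<theta> s" using th_surj by blast
  then show "x \<otimes> a \<in> \<theta> ` I" "a \<otimes> x \<in> \<theta> ` I" using d(3,4) by (auto simp flip: th_mult)
qed

lemma im_prime:
  assumes p: "is_prime p" "ker \<subseteq> p"
  shows "primeideal (\<theta> ` p) R"
proof -
  have i: "is_ideal p" using p(1) unfolding is_prime_def by blast
  note m = im_mem[OF i p(2)]
  show ?thesis
  proof (rule primeidealI[OF im_ideal[OF i] cring_axioms])
    show "carrier R \<noteq> \<theta> ` p" using m[of 1] is_primeD(5)[OF p(1)] by (metis th_closed)
    fix a b assume ab: "a \<in> carrier R" "b \<in> carrier R" "a \<otimes> b \<in> \<theta> ` p"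
    then obtain s t where st: "a = \<theta> s" "b = \<theta> t" using th_surj by blast
    then have "s * t \<in> p" using ab(3) m by (simp flip: th_mult)
    then show "a \<in> \<theta> ` p \<or> b \<in> \<theta> ` p" using st m p(1) unfolding is_prime_def by blast
  qed
qed

lemma im_pre: "I \<subseteq> carrier R \<Longrightarrow> \<theta> ` (\<theta> -` I) = I"
  using th_surj by blast

lemma acc_ker:
  assumes "noetherian_ring R"
  shows "acc {I. is_ideal I \<and> ker \<subseteq> I}"
  unfolding acc_def
proof (intro allI impI)
  interpret N: noetherian_ring R by fact
  fix f :: "nat \<Rightarrow> 't set" assume "\<forall>i. f i \<in> {I. is_ideal I \<and> ker \<subseteq> I} \<and> f i \<subseteq> f (Suc i)"
  then have f: "\<And>i. is_ideal (f i)" "\<And>i. ker \<subseteq> f i" "\<And>i. f i \<subseteq> f (Suc i)" by auto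
  have mono: "i \<le> j \<Longrightarrow> f i \<subseteq> f j" for i j by (rule lift_Suc_mono_le[of f]) (use f(3) in auto)
  let ?C = "range (\<lambda>i. \<theta> ` f i)"
  have "\<theta> ` f i \<subseteq> \<theta> ` f j \<or> \<theta> ` f j \<subseteq> \<theta> ` f i" for i j
    using mono[of i j] mono[of j i] by (cases "i \<le> j") (auto intro: image_mono)
  then have "subset.chain {I. ideal I R} ?C"
    unfolding subset_chain_def using im_ideal[OF f(1)] by blast
  then have "\<Union>?C \<in> ?C" using N.ideal_chain_is_trivial by blast
  then obtain m where m: "\<Union>?C = \<theta> ` f m" by blast
  have "f i = f m" if "m \<le> i" for i
  proof
    show "f m \<subseteq> f i" by (rule mono[OF that])
    show "f i \<subseteq> f m" using m im_mem[OF f(1) f(2)] by blast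
  qed
  then show "\<exists>m. \<forall>i\<ge>m. f i = f m" by blast
qed

end

section \<open>Local bases\<close>

text \<open>Coefficients live in the presenting ring. Recursion on \<open>n\<close> keeps initial
  segments of a list of vectors accessible, as triangularity requires.\<close>

primrec lc :: "('a, 'b, 'n) module_scheme \<Rightarrow> ('t \<Rightarrow> 'a) \<Rightarrow> (nat \<Rightarrow> 'b) \<Rightarrow> (nat \<Rightarrow> 't) \<Rightarrow> nat \<Rightarrow> 'b"
  where "lc M \<theta> m c 0 = \<zero>\<^bsub>M\<^esub>"
  | "lc M \<theta> m c (Suc n) = lc M \<theta> m c n \<oplus>\<^bsub>M\<^esub> \<theta> (c n) \<odot>\<^bsub>M\<^esub> m n"

lemma lc_cong: "(\<And>i. i < n \<Longrightarrow> m i = m' i) \<Longrightarrow> (\<And>i. i < n \<Longrightarrow> c i = c' i) \<Longrightarrow> lc M \<theta> m c n = lc M \<theta> m' c' n"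
  by (induction n) auto

text \<open>Gaussian elimination modulo a prime, without division: the other equations are
  multiplied by a pivot outside \<open>K\<close>, and one unknown is eliminated by the last
  equation.\<close>

lemma nontrivial_solution:
  fixes K :: "'t::comm_ring_1 set" and A :: "nat \<Rightarrow> nat \<Rightarrow> 't"
  assumes K: "is_prime K" and "finite J" "n < card J"
  shows "\<exists>c. (\<exists>j\<in>J. c j \<notin> K) \<and> (\<forall>i<n. (\<Sum>j\<in>J. A i j * c j) \<in> K)"
  using assms(2,3)
proof (induction n arbitrary: J A)
  case 0
  then obtain j where "j \<in> J" by fastforce
  then show ?case using is_primeD(5)[OF K] by (intro exI[of _ "\<lambda>_. 1"]) auto
next
  case (Suc n)
  show ?case
  proof (cases "\<forall>j\<in>J. A n j \<in> K")
    case True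
    have "n < card J" using Suc.prems by simp
    from Suc.IH[OF Suc.prems(1) this, of A] obtain c where c: "\<exists>j\<in>J. c j \<notin> K" "\<forall>i<n. (\<Sum>j\<in>J. A i j * c j) \<in> K" by blast
    have "(\<Sum>j\<in>J. A n j * c j) \<in> K"
      using True is_primeD(4)[OF K] K unfolding is_prime_def by (intro is_ideal_sum) auto
    then show ?thesis using c by (intro exI[of _ c]) (auto simp: less_Suc_eq)
  next
    case False
    then obtain j0 where j0: "j0 \<in> J" "A n j0 \<notin> K" by blast
    let ?J = "J - {j0}"
    define B where "B i j = A n j0 * A i j - A n j * A i j0" for i j
    have "n < card ?J" using Suc.prems j0 by simp
    from Suc.IH[OF _ this, of B] Suc.prems(1)
    obtain c where c: "\<exists>j\<in>?J. c j \<notin> K" "\<forall>i<n. (\<Sum>j\<in>?J. B i j * c j) \<in> K" by auto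
    define S where "S = (\<Sum>j\<in>?J. A n j * c j)"
    define c' where "c' j = (if j = j0 then - S else A n j0 * c j)" for j
    have sum: "(\<Sum>j\<in>J. A i j * c' j) = (\<Sum>j\<in>?J. B i j * c j)" for i
    proof -
      have "(\<Sum>j\<in>J. A i j * c' j) = A i j0 * c' j0 + (\<Sum>j\<in>?J. A i j * c' j)"
        using Suc.prems(1) j0(1) by (simp add: sum.remove)
      also have "(\<Sum>j\<in>?J. A i j * c' j) = (\<Sum>j\<in>?J. A i j * (A n j0 * c j))"
        by (rule sum.cong) (auto simp: c'_def)
      also have "A i j0 * c' j0 = - (\<Sum>j\<in>?J. A i j0 * (A n j * c j))"
        unfolding c'_def S_def by (simp add: sum_distrib_left)
      finally show ?thesis
        unfolding B_def by (simp add: left_diff_distrib right_diff_distrib sum_subtractf ac_simps)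
    qed
    have "(\<Sum>j\<in>J. A n j * c' j) = 0" unfolding sum B_def by (simp add: mult.commute)
    then have "(\<Sum>j\<in>J. A i j * c' j) \<in> K" if "i < Suc n" for i
      using that c(2) is_primeD(1)[OF K] unfolding sum by (cases "i = n") (auto simp: less_Suc_eq)
    moreover obtain j where "j \<in> ?J" "c j \<notin> K" using c(1) by blast
    then have "c' j \<notin> K" unfolding c'_def using is_primeD(6)[OF K j0(2)] by auto
    ultimately show ?thesis using \<open>j \<in> ?J\<close> by blast
  qed
qed

text \<open>\<open>rlocb R M \<theta> q F F' e N I\<close> says that the \<open>e i\<close> with \<open>i \<in> I\<close>, \<open>i < N\<close> become a basis of
  \<open>F'/F\<close> after localization at \<open>q\<close>; the remaining \<open>e i\<close> are zero.\<close>

definition rlocb :: "('a, 'm) ring_scheme \<Rightarrow> ('a, 'b, 'n) module_scheme \<Rightarrow> ('t \<Rightarrow> 'a) \<Rightarrow> 'a set \<Rightarrow> 'b set \<Rightarrow> 'b set \<Rightarrow>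
    (nat \<Rightarrow> 'b) \<Rightarrow> nat \<Rightarrow> nat set \<Rightarrow> bool"
  where "rlocb R M \<theta> q F F' e N I \<longleftrightarrow> (\<forall>i<N. e i \<in> F') \<and> (\<forall>i<N. i \<notin> I \<longrightarrow> e i = \<zero>\<^bsub>M\<^esub>) \<and>
    (\<forall>c. lc M \<theta> e c N \<in> F \<longrightarrow> (\<forall>i<N. i \<in> I \<longrightarrow> \<theta> (c i) = \<zero>\<^bsub>R\<^esub>)) \<and>
    (\<forall>x\<in>F'. \<exists>u\<in>carrier R - q. \<exists>c. \<exists>f\<in>F. u \<odot>\<^bsub>M\<^esub> x = lc M \<theta> e c N \<oplus>\<^bsub>M\<^esub> f)"

text \<open>All that is kept of a flag is a local basis in which \<open>d\<close> is strictly
  triangular, each basis vector having a denominator of its own.\<close>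

definition adap :: "('a, 'm) ring_scheme \<Rightarrow> ('a, 'b, 'n) module_scheme \<Rightarrow> ('t \<Rightarrow> 'a) \<Rightarrow> ('b \<Rightarrow> 'b) \<Rightarrow> 'a set \<Rightarrow> 'b set \<Rightarrow>
    (nat \<Rightarrow> 'b) \<Rightarrow> nat \<Rightarrow> bool"
  where "adap R M \<theta> d q F m n \<longleftrightarrow> rlocb R M \<theta> q {\<zero>\<^bsub>M\<^esub>} F m n UNIV \<and>
    (\<forall>j<n. \<exists>u\<in>carrier R - q. \<exists>c. u \<odot>\<^bsub>M\<^esub> d (m j) = lc M \<theta> m c j)"

locale presented_module = presented R \<theta> + M: module R M
  for R :: "('a, 'm) ring_scheme" (structure) and \<theta> :: "'t::comm_ring_1 \<Rightarrow> 'a" and M :: "('a, 'b, 'n) module_scheme"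
begin

abbreviation l where "l \<equiv> lc M \<theta>"

lemma l_closed [simp]: "(\<And>i. i < n \<Longrightarrow> m i \<in> carrier M) \<Longrightarrow> l m c n \<in> carrier M"
  by (induction n) auto

lemma l_add: "(\<And>i. i < n \<Longrightarrow> m i \<in> carrier M) \<Longrightarrow> l m (\<lambda>i. c i + c' i) n = l m c n \<oplus>\<^bsub>M\<^esub> l m c' n"
proof (induction n)
  case (Suc n)
  then show ?case using l_closed[of n m c] l_closed[of n m c']
    by (simp add: th_add M.smult_l_distr M.a_ac)
qed simp

lemma l_smult: "(\<And>i. i < n \<Longrightarrow> m i \<in> carrier M) \<Longrightarrow> l m (\<lambda>i. t * c i) n = \<theta> t \<odot>\<^bsub>M\<^esub> l m c n"
proof (induction n)
  case (Suc n)
  then show ?case using l_closed[of n m c] by (simp add: th_mult M.smult_r_distr M.smult_assoc1)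
qed simp

lemma l_ker: "(\<And>i. i < n \<Longrightarrow> m i \<in> carrier M) \<Longrightarrow> (\<And>i. i < n \<Longrightarrow> \<theta> (c i) = \<zero> \<or> m i = \<zero>\<^bsub>M\<^esub>) \<Longrightarrow> l m c n = \<zero>\<^bsub>M\<^esub>"
proof (induction n)
  case (Suc n)
  then have "l m c n = \<zero>\<^bsub>M\<^esub>" by simp
  moreover have "\<theta> (c n) \<odot>\<^bsub>M\<^esub> m n = \<zero>\<^bsub>M\<^esub>" using Suc.prems(1)[of n] Suc.prems(2)[of n] by auto
  ultimately show ?case by simp
qed simp

lemma l_trunc:
  assumes "\<And>i. i < n \<Longrightarrow> m i \<in> carrier M" "k \<le> n"
  shows "l m (\<lambda>i. if i < k then c i else 0) n = l m c k"
  using assms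
proof (induction n)
  case (Suc n)
  show ?case
  proof (cases "k = Suc n")
    case True
    then show ?thesis using lc_cong[of n m m "\<lambda>i. if i < Suc n then c i else 0" c M \<theta>] by simp
  next
    case False
    then have "k \<le> n" using Suc.prems by simp
    then show ?thesis using Suc l_closed[of k m c] by simp
  qed
qed simp

lemma l_unit: "(\<And>i. i < n \<Longrightarrow> m i \<in> carrier M) \<Longrightarrow> j < n \<Longrightarrow> l m (unitv j) n = m j"
proof (induction n)
  case (Suc n)
  show ?case
  proof (cases "j = n")
    case True
    have "l m (unitv j) n = \<zero>\<^bsub>M\<^esub>" by (rule l_ker) (use Suc.prems True in \<open>auto simp: unitv_def\<close>)
    then show ?thesis using True Suc.prems by (simp add: unitv_def th_one)
  next
    case False
    then have "l m (unitv j) n = m j" using Suc by simp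
    moreover have "\<theta> (unitv j n) = \<zero>" using False by (simp add: unitv_def)
    ultimately show ?thesis using Suc.prems by simp
  qed
qed simp

lemma l_mem: "submodule F R M \<Longrightarrow> (\<And>i. i < n \<Longrightarrow> m i \<in> F) \<Longrightarrow> l m c n \<in> F"
proof (induction n)
  case 0
  then show ?case by (metis lc.simps(1) submodule_def subgroup.one_closed monoid.simps(2))
next
  case (Suc n)
  then show ?case using M.submoduleE(4,5)[OF Suc.prems(1)] by simp
qed

lemma submod:
  assumes "submodule F R M"
  shows "F \<subseteq> carrier M" "\<zero>\<^bsub>M\<^esub> \<in> F" "x \<in> F \<Longrightarrow> y \<in> F \<Longrightarrow> x \<oplus>\<^bsub>M\<^esub> y \<in> F" "r \<in> carrier R \<Longrightarrow> x \<in> F \<Longrightarrow> r \<odot>\<^bsub>M\<^esub> x \<in> F"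
    "x \<in> F \<Longrightarrow> \<ominus>\<^bsub>M\<^esub> x \<in> F"
  using M.submoduleE[OF assms] l_mem[OF assms, of 0] by auto

lemma l_hom:
  assumes "\<And>i. i < n \<Longrightarrow> m i \<in> carrier M" "h \<zero>\<^bsub>M\<^esub> = \<zero>\<^bsub>M'\<^esub>"
    "\<And>x y. x \<in> carrier M \<Longrightarrow> y \<in> carrier M \<Longrightarrow> h (x \<oplus>\<^bsub>M\<^esub> y) = h x \<oplus>\<^bsub>M'\<^esub> h y"
    "\<And>r x. r \<in> carrier R \<Longrightarrow> x \<in> carrier M \<Longrightarrow> h (r \<odot>\<^bsub>M\<^esub> x) = r \<odot>\<^bsub>M'\<^esub> h x"
  shows "h (l m c n) = lc M' \<theta> (\<lambda>i. h (m i)) c n"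
  using assms(1) by (induction n) (simp_all add: assms)

lemma rlocbD:
  assumes "rlocb R M \<theta> q F F' e N I"
  shows "i < N \<Longrightarrow> e i \<in> F'" "i < N \<Longrightarrow> i \<notin> I \<Longrightarrow> e i = \<zero>\<^bsub>M\<^esub>"
    "l e c N \<in> F \<Longrightarrow> i < N \<Longrightarrow> i \<in> I \<Longrightarrow> \<theta> (c i) = \<zero>"
    "x \<in> F' \<Longrightarrow> \<exists>u\<in>carrier R - q. \<exists>c. \<exists>f\<in>F. u \<odot>\<^bsub>M\<^esub> x = l e c N \<oplus>\<^bsub>M\<^esub> f"
  using assms unfolding rlocb_def by blast+

lemma rlocb0_span:
  assumes "rlocb R M \<theta> q {\<zero>\<^bsub>M\<^esub>} F m n I" "F \<subseteq> carrier M" "x \<in> F"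
  shows "\<exists>u\<in>carrier R - q. \<exists>c. u \<odot>\<^bsub>M\<^esub> x = l m c n"
proof -
  obtain u c where u: "u \<in> carrier R - q" "u \<odot>\<^bsub>M\<^esub> x = l m c n \<oplus>\<^bsub>M\<^esub> \<zero>\<^bsub>M\<^esub>"
    using rlocbD(4)[OF assms(1,3)] by blast
  have "l m c n \<in> carrier M" by (rule l_closed) (use rlocbD(1)[OF assms(1)] assms(2) in blast)
  then show ?thesis using u by auto
qed

text \<open>Vectors \<open>e i\<close> lifting a local basis of \<open>F'/F\<close> are appended to
  the basis of \<open>F\<close>; \<open>d\<close> maps them into \<open>F\<close>, hence to
  combinations of earlier vectors. Indices outside \<open>I\<close> carry zero vectors and are
  skipped.\<close>

lemma adap_step:
  assumes q: "primeideal q R" and F: "submodule F R M" and F': "submodule F' R M" "F \<subseteq> F'"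
    and ad: "adap R M \<theta> d q F m n" and rb: "rlocb R M \<theta> q F F' e N I"
    and d: "\<And>x. x \<in> F' \<Longrightarrow> d x \<in> F"
  shows "\<exists>m' n'. adap R M \<theta> d q F' m' n'"
proof -
  interpret q: primeideal q R by fact
  have S_mult: "u \<otimes> v \<in> carrier R - q" if "u \<in> carrier R - q" "v \<in> carrier R - q" for u v
    using that q.I_prime by blast
  have one: "\<one> \<in> carrier R - q" using q.I_notcarr q.one_imp_carrier by blast
  note sF = submod[OF F] and sF' = submod[OF F'(1)]
  have e: "e i \<in> F'" if "i < N" for i using rlocbD(1)[OF rb that] .
  have eM: "e i \<in> carrier M" if "i < N" for i using e[OF that] sF'(1) by blast
  have bas: "rlocb R M \<theta> q {\<zero>\<^bsub>M\<^esub>} F m n UNIV" using ad unfolding adap_def by blast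
  have mF: "m i \<in> F" if "i < n" for i using rlocbD(1)[OF bas that] .
  \<comment> \<open>The invariant after \<open>k\<close> of the \<open>e i\<close>: the list is
    independent, triangular, and spans up to denominators \<open>F\<close> together with the first
    \<open>k\<close> of them. The last clause locates its combinations, which is how independence of
    the next list is obtained.\<close>
  let ?P = "\<lambda>k m' n'. (\<forall>i<n'. m' i \<in> F') \<and> (\<forall>c. l m' c n' = \<zero>\<^bsub>M\<^esub> \<longrightarrow> (\<forall>i<n'. \<theta> (c i) = \<zero>)) \<and>
    (\<forall>j<n'. \<exists>u\<in>carrier R - q. \<exists>c. u \<odot>\<^bsub>M\<^esub> d (m' j) = l m' c j) \<and>
    (\<forall>f\<in>F. \<forall>c. \<exists>u\<in>carrier R - q. \<exists>c'. u \<odot>\<^bsub>M\<^esub> (f \<oplus>\<^bsub>M\<^esub> l e c k) = l m' c' n') \<and>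
    (\<forall>c'. \<exists>f\<in>F. \<exists>c. l m' c' n' = f \<oplus>\<^bsub>M\<^esub> l e c k)"
  have "k \<le> N \<Longrightarrow> \<exists>m' n'. ?P k m' n'" for k
  proof (induction k)
    case 0
    have "?P 0 m n"
    proof (intro conjI allI impI ballI)
      show "m i \<in> F'" if "i < n" for i using mF[OF that] F'(2) by blast
      show "\<theta> (c i) = \<zero>" if "l m c n = \<zero>\<^bsub>M\<^esub>" "i < n" for c i using rlocbD(3)[OF bas] that by simp
      show "\<exists>u\<in>carrier R - q. \<exists>c. u \<odot>\<^bsub>M\<^esub> d (m j) = l m c j" if "j < n" for j
        using ad that unfolding adap_def by blast
      show "\<exists>u\<in>carrier R - q. \<exists>c'. u \<odot>\<^bsub>M\<^esub> (f \<oplus>\<^bsub>M\<^esub> l e c 0) = l m c' n" if "f \<in> F" for f c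
        using rlocb0_span[OF bas sF(1) that] that sF(1) by (auto simp: subset_iff)
      show "\<exists>f\<in>F. \<exists>c. l m c' n = f \<oplus>\<^bsub>M\<^esub> l e c 0" for c'
      proof -
        have "l m c' n \<in> F" by (rule l_mem[OF F mF])
        then show ?thesis using sF(1) by (intro bexI[of _ "l m c' n"]) (auto simp: subset_iff)
      qed
    qed
    then show ?case by blast
  next
    case (Suc k)
    then obtain m' n' where P: "?P k m' n'" by auto
    have k: "k < N" using Suc.prems by simp
    have ek: "e k \<in> F'" "e k \<in> carrier M" using e eM k by auto
    have leM [simp]: "l e c k \<in> carrier M" for c by (rule l_closed) (use eM k in auto)
    have m'M: "m' i \<in> carrier M" if "i < n'" for i using P that sF'(1) by blast
    have lm'M [simp]: "l m' c n' \<in> carrier M" for c by (rule l_closed) (use m'M in auto)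
    show ?case
    proof (cases "k \<in> I")
      case False
      then have "e k = \<zero>\<^bsub>M\<^esub>" using rlocbD(2)[OF rb k] by blast
      then have "l e c (Suc k) = l e c k" for c by simp
      then show ?thesis using P by (intro exI[of _ m'] exI[of _ n']) presburger
    next
      case True
      define m2 where "m2 = m'(n' := e k)"
      have lm2: "l m2 c j = l m' c j" if "j \<le> n'" for c j
        by (rule lc_cong) (use that in \<open>auto simp: m2_def\<close>)
      have lm2S: "l m2 c (Suc n') = l m' c n' \<oplus>\<^bsub>M\<^esub> \<theta> (c n') \<odot>\<^bsub>M\<^esub> e k" for c
        using lm2[of n' c] by (simp add: m2_def)
      have B: "\<exists>f\<in>F. \<exists>c1. l m2 c (Suc n') = f \<oplus>\<^bsub>M\<^esub> l e c1 (Suc k) \<and> c1 k = c n'" for c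
      proof -
        obtain f c1 where f: "f \<in> F" "l m' c n' = f \<oplus>\<^bsub>M\<^esub> l e c1 k" using P by blast
        let ?c = "c1(k := c n')"
        have "l e ?c k = l e c1 k" by (rule lc_cong) auto
        then have "l m2 c (Suc n') = f \<oplus>\<^bsub>M\<^esub> l e ?c (Suc k)"
          unfolding lm2S f(2) using f(1) sF(1) ek by (simp add: M.a_assoc subset_iff)
        then show ?thesis using f(1) by (intro bexI[of _ f] exI[of _ ?c]) auto
      qed
      have "?P (Suc k) m2 (Suc n')"
      proof (intro conjI allI impI ballI)
        show "m2 i \<in> F'" if "i < Suc n'" for i using that P ek unfolding m2_def by auto
        fix c i assume z: "l m2 c (Suc n') = \<zero>\<^bsub>M\<^esub>" and i: "i < Suc n'"
        obtain f c1 where f: "f \<in> F" "l m2 c (Suc n') = f \<oplus>\<^bsub>M\<^esub> l e c1 (Suc k)" "c1 k = c n'" using B by blast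
        let ?c = "\<lambda>i. if i < Suc k then c1 i else 0"
        have tr: "l e ?c N = l e c1 (Suc k)" by (rule l_trunc) (use eM k in auto)
        have fM: "f \<in> carrier M" using f(1) sF(1) by blast
        have lM: "l e c1 (Suc k) \<in> carrier M" by (rule l_closed) (use eM k in auto)
        have "f \<oplus>\<^bsub>M\<^esub> l e c1 (Suc k) = \<zero>\<^bsub>M\<^esub>" using f(2) z by simp
        then have "l e c1 (Suc k) = \<ominus>\<^bsub>M\<^esub> f" using fM lM M.minus_equality M.a_comm by metis
        then have "l e ?c N \<in> F" unfolding tr using sF(5)[OF f(1)] by simp
        from rlocbD(3)[OF rb this k True] have tn: "\<theta> (c n') = \<zero>" using f(3) by simp
        then have "l m' c n' = \<zero>\<^bsub>M\<^esub>" using z ek unfolding lm2S by simp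
        then show "\<theta> (c i) = \<zero>" using P tn i by (auto simp: less_Suc_eq)
      next
        fix j assume j: "j < Suc n'"
        show "\<exists>u\<in>carrier R - q. \<exists>c. u \<odot>\<^bsub>M\<^esub> d (m2 j) = l m2 c j"
        proof (cases "j = n'")
          case True
          have dF: "d (e k) \<in> F" using d ek by blast
          have "l e (\<lambda>_. 0) k = \<zero>\<^bsub>M\<^esub>" by (rule l_ker) (use eM k in auto)
          then have "d (e k) \<oplus>\<^bsub>M\<^esub> l e (\<lambda>_. 0) k = d (e k)" using dF sF(1) by auto
          then obtain u c' where "u \<in> carrier R - q" "u \<odot>\<^bsub>M\<^esub> d (e k) = l m' c' n'" using P dF by metis
          then show ?thesis using True lm2[of n'] unfolding m2_def by auto
        next
          case False
          then have "j < n'" using j by simp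
          then obtain u c where "u \<in> carrier R - q" "u \<odot>\<^bsub>M\<^esub> d (m' j) = l m' c j" using P by blast
          then show ?thesis using lm2[of j c] \<open>j < n'\<close> unfolding m2_def by (intro bexI[of _ u] exI[of _ c]) auto
        qed
      next
        fix f c assume f: "f \<in> F"
        obtain u c' where u: "u \<in> carrier R - q" "u \<odot>\<^bsub>M\<^esub> (f \<oplus>\<^bsub>M\<^esub> l e c k) = l m' c' n'" using P f by blast
        obtain t where t: "\<theta> t = u" using th_surj u by blast
        have fM: "f \<in> carrier M" using f sF(1) by blast
        have "u \<odot>\<^bsub>M\<^esub> (f \<oplus>\<^bsub>M\<^esub> l e c (Suc k)) = u \<odot>\<^bsub>M\<^esub> (f \<oplus>\<^bsub>M\<^esub> l e c k) \<oplus>\<^bsub>M\<^esub> u \<odot>\<^bsub>M\<^esub> (\<theta> (c k) \<odot>\<^bsub>M\<^esub> e k)"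
          using fM ek u(1) by (simp add: M.smult_r_distr M.a_assoc)
        also have "\<dots> = l m2 (c'(n' := t * c k)) (Suc n')"
        proof -
          have "l m' (c'(n' := t * c k)) n' = l m' c' n'" by (rule lc_cong) auto
          then show ?thesis unfolding u(2) lm2S using u(1) ek t by (simp add: th_mult M.smult_assoc1)
        qed
        finally show "\<exists>u\<in>carrier R - q. \<exists>c'. u \<odot>\<^bsub>M\<^esub> (f \<oplus>\<^bsub>M\<^esub> l e c (Suc k)) = l m2 c' (Suc n')" using u(1) by blast
      next
        show "\<exists>f\<in>F. \<exists>c. l m2 c' (Suc n') = f \<oplus>\<^bsub>M\<^esub> l e c (Suc k)" for c' using B[of c'] by blast
      qed
      then show ?thesis by blast
    qed
  qed
  then obtain m' n' where P: "?P N m' n'" by blast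
  have "rlocb R M \<theta> q {\<zero>\<^bsub>M\<^esub>} F' m' n' UNIV" unfolding rlocb_def
  proof (intro conjI allI impI ballI)
    fix x assume x: "x \<in> F'"
    obtain u c f where u: "u \<in> carrier R - q" "f \<in> F" "u \<odot>\<^bsub>M\<^esub> x = l e c N \<oplus>\<^bsub>M\<^esub> f"
      using rlocbD(4)[OF rb x] by blast
    have leM: "l e c N \<in> carrier M" by (rule l_closed) (use eM in auto)
    obtain u' c' where u': "u' \<in> carrier R - q" "u' \<odot>\<^bsub>M\<^esub> (f \<oplus>\<^bsub>M\<^esub> l e c N) = l m' c' n'" using P u(2) by blast
    have "(u' \<otimes> u) \<odot>\<^bsub>M\<^esub> x = u' \<odot>\<^bsub>M\<^esub> (u \<odot>\<^bsub>M\<^esub> x)" using u(1) u'(1) x sF'(1) by (simp add: M.smult_assoc1 subset_iff)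
    also have "\<dots> = l m' c' n'" using u(2,3) u'(2) leM sF(1) by (simp add: M.a_comm subset_iff)
    finally have "(u' \<otimes> u) \<odot>\<^bsub>M\<^esub> x = l m' c' n'" .
    moreover have "l m' c' n' \<in> carrier M" by (rule l_closed) (use P sF'(1) in blast)
    ultimately show "\<exists>u\<in>carrier R - q. \<exists>c. \<exists>f\<in>{\<zero>\<^bsub>M\<^esub>}. u \<odot>\<^bsub>M\<^esub> x = l m' c n' \<oplus>\<^bsub>M\<^esub> f"
      using S_mult[OF u'(1) u(1)] by (intro bexI[of _ "u' \<otimes> u"] exI[of _ c']) auto
  qed (use P in auto)
  then have "adap R M \<theta> d q F' m' n'" using P unfolding adap_def by blast
  then show ?thesis by blast
qed

text \<open>In a domain all denominators are nonzero, so more than \<open>n\<close> vectors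
  expressed by \<open>n\<close> others are dependent, by \<open>nontrivial_solution\<close> modulo
  the kernel. The two bases may belong to different primes, which makes the rank constant.\<close>

lemma local_rank_le:
  assumes dom: "domain R" and q: "primeideal q R"
    and b: "rlocb R M \<theta> q {\<zero>\<^bsub>M\<^esub>} (carrier M) m n UNIV" and b': "rlocb R M \<theta> q' {\<zero>\<^bsub>M\<^esub>} (carrier M) m' n' UNIV"
  shows "n' \<le> n"
proof (rule ccontr)
  assume "\<not> n' \<le> n"
  then have lt: "n < card {..<n'}" by simp
  interpret dom: domain R by fact
  have z: "\<zero> \<in> q" using primeideal.axioms(1)[OF q] by (simp add: additive_subgroup.zero_closed ideal_def)
  have mM: "m i \<in> carrier M" if "i < n" for i using rlocbD(1)[OF b that] .
  have m'M: "m' i \<in> carrier M" if "i < n'" for i using rlocbD(1)[OF b' that] .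
  have pk: "is_prime ker"
    unfolding is_prime_def using ker_ideal dom.integral by (auto simp: ker_def th_one th_mult)
  have "\<exists>u A. \<theta> u \<noteq> \<zero> \<and> \<theta> u \<odot>\<^bsub>M\<^esub> m' j = l m A n" if "j < n'" for j
    using rlocb0_span[OF b order_refl m'M[OF that]] th_surj z by (metis Diff_iff)
  then have "\<forall>j. \<exists>u A. j < n' \<longrightarrow> \<theta> u \<noteq> \<zero> \<and> \<theta> u \<odot>\<^bsub>M\<^esub> m' j = l m A n" by blast
  then obtain u A where uA: "\<And>j. j < n' \<Longrightarrow> \<theta> (u j) \<noteq> \<zero>" "\<And>j. j < n' \<Longrightarrow> \<theta> (u j) \<odot>\<^bsub>M\<^esub> m' j = l m (A j) n"
    by metis
  obtain c where c: "\<exists>j\<in>{..<n'}. c j \<notin> ker" "\<forall>i<n. (\<Sum>j<n'. A j i * c j) \<in> ker"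
    using nontrivial_solution[OF pk finite_lessThan lt, of "\<lambda>i j. A j i"] by blast
  have "k \<le> n' \<Longrightarrow> l m' (\<lambda>j. c j * u j) k = l m (\<lambda>i. \<Sum>j<k. A j i * c j) n" for k
  proof (induction k)
    case 0
    then show ?case using l_ker[of n m "\<lambda>_. 0"] mM by simp
  next
    case (Suc k)
    have "\<theta> (c k * u k) \<odot>\<^bsub>M\<^esub> m' k = \<theta> (c k) \<odot>\<^bsub>M\<^esub> l m (A k) n"
      using Suc.prems m'M uA(2)[of k] by (simp add: th_mult M.smult_assoc1)
    also have "\<dots> = l m (\<lambda>i. A k i * c k) n" using l_smult[of n m "c k" "A k"] mM by (simp add: mult.commute)
    finally show ?case using Suc l_add[of n m "\<lambda>i. \<Sum>j<k. A j i * c j" "\<lambda>i. A k i * c k"] mM by simp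
  qed
  from this[of n'] have "l m' (\<lambda>j. c j * u j) n' = l m (\<lambda>i. \<Sum>j<n'. A j i * c j) n" by simp
  also have "\<dots> = \<zero>\<^bsub>M\<^esub>" by (rule l_ker) (use mM c(2) in \<open>auto simp: ker_def\<close>)
  finally have "\<theta> (c j * u j) = \<zero>" if "j < n'" for j using rlocbD(3)[OF b', of "\<lambda>j. c j * u j" j] that by simp
  then have "\<theta> (c j) = \<zero>" if "j < n'" for j using uA(1)[OF that] dom.integral[of "\<theta> (c j)" "\<theta> (u j)"] that by (auto simp: th_mult)
  then show False using c(1) unfolding ker_def by auto
qed

end

section \<open>Quotient modules\<close>

lemma module_by_surj:
  assumes M: "module R M" and surj: "\<pi> ` carrier M = carrier N"
    and z: "\<pi> \<zero>\<^bsub>M\<^esub> = \<zero>\<^bsub>N\<^esub>"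
    and add: "\<And>x y. x \<in> carrier M \<Longrightarrow> y \<in> carrier M \<Longrightarrow> \<pi> (x \<oplus>\<^bsub>M\<^esub> y) = \<pi> x \<oplus>\<^bsub>N\<^esub> \<pi> y"
    and sm: "\<And>r x. r \<in> carrier R \<Longrightarrow> x \<in> carrier M \<Longrightarrow> \<pi> (r \<odot>\<^bsub>M\<^esub> x) = r \<odot>\<^bsub>N\<^esub> \<pi> x"
  shows "module R N"
proof -
  interpret M: module R M by fact
  have pc: "\<pi> x \<in> carrier N" if "x \<in> carrier M" for x using that surj by blast
  have pre: "\<exists>x\<in>carrier M. y = \<pi> x" if "y \<in> carrier N" for y using that surj by blast
  have "abelian_group N"
  proof (rule abelian_groupI)
    show "\<zero>\<^bsub>N\<^esub> \<in> carrier N" using pc[of "\<zero>\<^bsub>M\<^esub>"] z by simp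
    fix x y assume "x \<in> carrier N" "y \<in> carrier N"
    then obtain a b where ab: "a \<in> carrier M" "b \<in> carrier M" "x = \<pi> a" "y = \<pi> b" using pre by blast
    show "x \<oplus>\<^bsub>N\<^esub> y \<in> carrier N" using ab pc by (simp flip: add)
    show "x \<oplus>\<^bsub>N\<^esub> y = y \<oplus>\<^bsub>N\<^esub> x" using ab by (simp add: M.a_comm flip: add)
    fix w assume "w \<in> carrier N"
    then obtain c where c: "c \<in> carrier M" "w = \<pi> c" using pre by blast
    show "x \<oplus>\<^bsub>N\<^esub> y \<oplus>\<^bsub>N\<^esub> w = x \<oplus>\<^bsub>N\<^esub> (y \<oplus>\<^bsub>N\<^esub> w)" using ab c by (simp add: M.a_assoc flip: add)
  next
    fix x assume "x \<in> carrier N"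
    then obtain a where a: "a \<in> carrier M" "x = \<pi> a" using pre by blast
    show "\<zero>\<^bsub>N\<^esub> \<oplus>\<^bsub>N\<^esub> x = x" using a by (simp flip: add z)
    show "\<exists>y\<in>carrier N. y \<oplus>\<^bsub>N\<^esub> x = \<zero>\<^bsub>N\<^esub>"
      by (rule bexI[of _ "\<pi> (\<ominus>\<^bsub>M\<^esub> a)"]) (use a pc in \<open>simp_all add: M.l_neg flip: add z\<close>)
  qed
  then show ?thesis
  proof (rule moduleI[OF M.R.is_cring])
    fix a b x y assume ab: "a \<in> carrier R" "b \<in> carrier R" and "x \<in> carrier N" "y \<in> carrier N"
    then obtain x' y' where x': "x' \<in> carrier M" "y' \<in> carrier M" "x = \<pi> x'" "y = \<pi> y'" using pre by blast
    show "a \<odot>\<^bsub>N\<^esub> x \<in> carrier N" using ab x' pc by (simp flip: sm)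
    show "(a \<oplus>\<^bsub>R\<^esub> b) \<odot>\<^bsub>N\<^esub> x = a \<odot>\<^bsub>N\<^esub> x \<oplus>\<^bsub>N\<^esub> b \<odot>\<^bsub>N\<^esub> x" using ab x' by (simp add: M.smult_l_distr flip: sm add)
    show "a \<odot>\<^bsub>N\<^esub> (x \<oplus>\<^bsub>N\<^esub> y) = a \<odot>\<^bsub>N\<^esub> x \<oplus>\<^bsub>N\<^esub> a \<odot>\<^bsub>N\<^esub> y" using ab x' by (simp add: M.smult_r_distr flip: sm add)
    show "(a \<otimes>\<^bsub>R\<^esub> b) \<odot>\<^bsub>N\<^esub> x = a \<odot>\<^bsub>N\<^esub> (b \<odot>\<^bsub>N\<^esub> x)" using ab x' by (simp add: M.smult_assoc1 flip: sm)
  next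
    fix x assume "x \<in> carrier N"
    then obtain x' where x': "x' \<in> carrier M" "x = \<pi> x'" using pre by blast
    show "\<one>\<^bsub>R\<^esub> \<odot>\<^bsub>N\<^esub> x = x" using x' by (simp flip: sm)
  qed
qed

lemma quot_module:
  assumes M: "module R M" and N: "submodule N R M"
  shows "module R (quot_module M N)"
    "(\<lambda>x. N +>\<^bsub>M\<^esub> x) ` carrier M = carrier (quot_module M N)"
    "N +>\<^bsub>M\<^esub> \<zero>\<^bsub>M\<^esub> = \<zero>\<^bsub>quot_module M N\<^esub>"
    "x \<in> carrier M \<Longrightarrow> y \<in> carrier M \<Longrightarrow> N +>\<^bsub>M\<^esub> (x \<oplus>\<^bsub>M\<^esub> y) = (N +>\<^bsub>M\<^esub> x) \<oplus>\<^bsub>quot_module M N\<^esub> (N +>\<^bsub>M\<^esub> y)"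
    "r \<in> carrier R \<Longrightarrow> x \<in> carrier M \<Longrightarrow> N +>\<^bsub>M\<^esub> (r \<odot>\<^bsub>M\<^esub> x) = r \<odot>\<^bsub>quot_module M N\<^esub> (N +>\<^bsub>M\<^esub> x)"
    "x \<in> carrier M \<Longrightarrow> N +>\<^bsub>M\<^esub> x = \<zero>\<^bsub>quot_module M N\<^esub> \<longleftrightarrow> x \<in> N"
proof -
  interpret M: module R M by fact
  have NM: "N \<subseteq> carrier M" using M.submoduleE(1)[OF N] .
  have "additive_subgroup N M" using N unfolding additive_subgroup_def submodule_def by blast
  then interpret N: abelian_subgroup N M by (rule abelian_subgroupI3) (rule M.abelian_group_axioms)
  show 2: "(\<lambda>x. N +>\<^bsub>M\<^esub> x) ` carrier M = carrier (quot_module M N)"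
    unfolding quot_module_def A_RCOSETS_def' by auto
  show 3: "N +>\<^bsub>M\<^esub> \<zero>\<^bsub>M\<^esub> = \<zero>\<^bsub>quot_module M N\<^esub>" unfolding quot_module_def using NM by simp
  show 4: "N +>\<^bsub>M\<^esub> (x \<oplus>\<^bsub>M\<^esub> y) = (N +>\<^bsub>M\<^esub> x) \<oplus>\<^bsub>quot_module M N\<^esub> (N +>\<^bsub>M\<^esub> y)"
    if "x \<in> carrier M" "y \<in> carrier M" for x y
    unfolding quot_module_def using N.a_rcos_sum that by simp
  have eqc: "N +>\<^bsub>M\<^esub> (h \<oplus>\<^bsub>M\<^esub> x) = N +>\<^bsub>M\<^esub> x" if "h \<in> N" "x \<in> carrier M" for h x
  proof -
    have "h \<oplus>\<^bsub>M\<^esub> x \<in> N +>\<^bsub>M\<^esub> x" using that unfolding a_r_coset_def' by blast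
    then show ?thesis using M.a_repr_independence[OF _ that(2) N.a_subgroup] by simp
  qed
  show 5: "N +>\<^bsub>M\<^esub> (r \<odot>\<^bsub>M\<^esub> x) = r \<odot>\<^bsub>quot_module M N\<^esub> (N +>\<^bsub>M\<^esub> x)"
    if r: "r \<in> carrier R" and x: "x \<in> carrier M" for r x
  proof -
    have "N +>\<^bsub>M\<^esub> (r \<odot>\<^bsub>M\<^esub> y) = N +>\<^bsub>M\<^esub> (r \<odot>\<^bsub>M\<^esub> x)" if y: "y \<in> N +>\<^bsub>M\<^esub> x" for y
    proof -
      obtain h where h: "h \<in> N" "y = h \<oplus>\<^bsub>M\<^esub> x" using y unfolding a_r_coset_def' by blast
      then have "r \<odot>\<^bsub>M\<^esub> y = r \<odot>\<^bsub>M\<^esub> h \<oplus>\<^bsub>M\<^esub> r \<odot>\<^bsub>M\<^esub> x" using r x NM by (auto simp: M.smult_r_distr)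
      then show ?thesis using eqc M.submoduleE(4)[OF N r h(1)] r x by simp
    qed
    moreover have "x \<in> N +>\<^bsub>M\<^esub> x" using N.a_rcos_self[OF x] .
    ultimately have "(\<Union>y\<in>N +>\<^bsub>M\<^esub> x. N +>\<^bsub>M\<^esub> (r \<odot>\<^bsub>M\<^esub> y)) = N +>\<^bsub>M\<^esub> (r \<odot>\<^bsub>M\<^esub> x)" by blast
    then show ?thesis unfolding quot_module_def by simp
  qed
  show "N +>\<^bsub>M\<^esub> x = \<zero>\<^bsub>quot_module M N\<^esub> \<longleftrightarrow> x \<in> N" if "x \<in> carrier M" for x
    unfolding quot_module_def using N.a_rcos_self[OF that] M.a_coset_join2[OF that N.a_subgroup] by auto
  show "module R (quot_module M N)" by (rule module_by_surj[OF M 2 3 4 5])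
qed

lemma lc_carrier [simp]: "lc (M\<lparr>carrier := A\<rparr>) \<theta> m c n = lc M \<theta> m c n"
  by (induction n) auto

section \<open>Exchange, and local bases of projective modules\<close>

context presented_module
begin

lemma lc_upd:
  assumes "\<And>i. i < n \<Longrightarrow> m i \<in> carrier M" "g \<in> carrier M" "k < n"
  shows "l (m(k := g)) c n = l m (c(k := 0)) n \<oplus>\<^bsub>M\<^esub> \<theta> (c k) \<odot>\<^bsub>M\<^esub> g"
  using assms
proof (induction n)
  case (Suc n)
  show ?case
  proof (cases "k = n")
    case True
    have e: "l (m(k := g)) c n = l m (c(k := 0)) n" by (rule lc_cong) (use True in auto)
    have c: "l m (c(k := 0)) n \<in> carrier M" by (rule l_closed) (use Suc.prems in auto)
    have "\<theta> ((c(k := 0)) n) \<odot>\<^bsub>M\<^esub> m n = \<zero>\<^bsub>M\<^esub>" "(m(k := g)) n = g" using True Suc.prems(1)[of n] by simp_all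
    then show ?thesis unfolding lc.simps e by (simp only: True M.r_zero[OF c[unfolded True]])
  next
    case False
    then have k: "k < n" using Suc.prems by simp
    have "l m (c(k := 0)) n \<in> carrier M" by (rule l_closed) (use Suc.prems in auto)
    then show ?thesis using Suc k False by (simp add: M.a_ac)
  qed
qed simp

text \<open>Steinitz exchange: \<gamma> may take the place of \<open>m k\<close> because its
  coefficient there is a unit at \<open>q\<close>.\<close>

lemma rlocb_replace:
  assumes dom: "domain R" and q: "primeideal q R" and rb: "rlocb R M \<theta> q {\<zero>\<^bsub>M\<^esub>} (carrier M) m n UNIV"
    and k: "k < n" and g: "\<gamma> \<in> carrier M" "w \<in> carrier R - q" "w \<odot>\<^bsub>M\<^esub> \<gamma> = l m g n" "\<theta> (g k) \<notin> q"
  shows "rlocb R M \<theta> q {\<zero>\<^bsub>M\<^esub>} (carrier M) (m(k := \<gamma>)) n UNIV"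
proof -
  interpret dom: domain R by fact
  interpret q: primeideal q R by fact
  have z: "\<zero> \<in> q" by (rule q.zero_closed)
  have mM: "m i \<in> carrier M" if "i < n" for i using rlocbD(1)[OF rb that] .
  have lM [simp]: "l m c n \<in> carrier M" for c by (rule l_closed) (rule mM)
  obtain t where t: "\<theta> t = w" using th_surj g(2) by blast
  have up: "l (m(k := \<gamma>)) c n = l m (c(k := 0)) n \<oplus>\<^bsub>M\<^esub> \<theta> (c k) \<odot>\<^bsub>M\<^esub> \<gamma>" for c
    by (rule lc_upd[OF _ g(1) k]) (rule mM)
  have ad: "l m (\<lambda>i. c i + c' i) n = l m c n \<oplus>\<^bsub>M\<^esub> l m c' n" for c c' by (rule l_add) (rule mM)
  have sm: "l m (\<lambda>i. r * c i) n = \<theta> r \<odot>\<^bsub>M\<^esub> l m c n" for r c by (rule l_smult) (rule mM)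
  show ?thesis unfolding rlocb_def
  proof (intro conjI allI impI ballI)
    show "(m(k := \<gamma>)) i \<in> carrier M" if "i < n" for i using mM that g by simp
  next
    fix c i assume l0: "l (m(k := \<gamma>)) c n \<in> {\<zero>\<^bsub>M\<^esub>}" and i: "i < n"
    define c0 where "c0 = c(k := 0)"
    have "l m c0 n \<oplus>\<^bsub>M\<^esub> \<theta> (c k) \<odot>\<^bsub>M\<^esub> \<gamma> = \<zero>\<^bsub>M\<^esub>" using l0 unfolding up c0_def by simp
    then have "w \<odot>\<^bsub>M\<^esub> (l m c0 n \<oplus>\<^bsub>M\<^esub> \<theta> (c k) \<odot>\<^bsub>M\<^esub> \<gamma>) = \<zero>\<^bsub>M\<^esub>" using g(2) by simp
    moreover have "w \<odot>\<^bsub>M\<^esub> (\<theta> (c k) \<odot>\<^bsub>M\<^esub> \<gamma>) = \<theta> (c k) \<odot>\<^bsub>M\<^esub> (w \<odot>\<^bsub>M\<^esub> \<gamma>)"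
      using g(1,2) by (simp add: m_comm flip: M.smult_assoc1)
    ultimately have "l m (\<lambda>i. t * c0 i) n \<oplus>\<^bsub>M\<^esub> l m (\<lambda>i. c k * g i) n = \<zero>\<^bsub>M\<^esub>"
      using g(1,2) unfolding sm t g(3)[symmetric] by (simp add: M.smult_r_distr)
    then have "l m (\<lambda>i. t * c0 i + c k * g i) n \<in> {\<zero>\<^bsub>M\<^esub>}" unfolding ad by simp
    note e = rlocbD(3)[OF rb this]
    have "\<theta> (c k) \<otimes> \<theta> (g k) = \<zero>" using e[OF k] by (simp add: th_mult c0_def)
    then have ck: "\<theta> (c k) = \<zero>" using dom.integral[of "\<theta> (c k)" "\<theta> (g k)"] g(4) z by auto
    show "\<theta> (c i) = \<zero>"
    proof (cases "i = k")
      case False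
      then have "w \<otimes> \<theta> (c i) = \<zero>" using e[OF i] ck g(2) by (simp add: th_mult th_add t c0_def)
      then show ?thesis using dom.integral[of w "\<theta> (c i)"] g(2) z by auto
    qed (use ck in simp)
  next
    fix x assume x: "x \<in> carrier M"
    obtain u c where u: "u \<in> carrier R - q" "u \<odot>\<^bsub>M\<^esub> x = l m c n" using rlocb0_span[OF rb order_refl x] by blast
    \<comment> \<open>Obtained by eliminating \<open>m k\<close> between the expansions of
      \<open>u\<close> times \<open>x\<close> and of \<open>w\<close> times \<gamma>.\<close>
    define c' where "c' = (\<lambda>i. g k * c i - c k * g i)(k := c k * t)"
    have "l (m(k := \<gamma>)) c' n = l m (c'(k := 0)) n \<oplus>\<^bsub>M\<^esub> \<theta> (c k) \<odot>\<^bsub>M\<^esub> (w \<odot>\<^bsub>M\<^esub> \<gamma>)"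
      unfolding up using g(1,2) by (simp add: c'_def th_mult t M.smult_assoc1)
    also have "\<dots> = l m (\<lambda>i. (c'(k := 0)) i + c k * g i) n" unfolding g(3) ad sm ..
    also have "\<dots> = l m (\<lambda>i. g k * c i) n" by (rule lc_cong) (auto simp: c'_def mult.commute)
    also have "\<dots> = (\<theta> (g k) \<otimes> u) \<odot>\<^bsub>M\<^esub> x" unfolding sm using u x by (simp add: M.smult_assoc1)
    finally have "(\<theta> (g k) \<otimes> u) \<odot>\<^bsub>M\<^esub> x = l (m(k := \<gamma>)) c' n" ..
    moreover have "\<theta> (g k) \<otimes> u \<in> carrier R - q" using g(4) u(1) q.I_prime[of "\<theta> (g k)" u] by auto
    moreover have "l (m(k := \<gamma>)) c' n \<in> carrier M" by (rule l_closed) (use mM g in auto)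
    ultimately show "\<exists>u\<in>carrier R - q. \<exists>c. \<exists>f\<in>{\<zero>\<^bsub>M\<^esub>}. u \<odot>\<^bsub>M\<^esub> x = l (m(k := \<gamma>)) c n \<oplus>\<^bsub>M\<^esub> f"
      by (intro bexI[of _ "\<theta> (g k) \<otimes> u"] exI[of _ c']) auto
  qed auto
qed

text \<open>Each basis vector is a sum of a vector of \<open>A\<close> and one of \<open>B\<close>, and can be exchanged for one of
  the two because a sum of two elements of \<open>q\<close> is not a unit at \<open>q\<close>.\<close>

lemma summand_rlocb:
  assumes dom: "domain R" and q: "primeideal q R" and rb: "rlocb R M \<theta> q {\<zero>\<^bsub>M\<^esub>} (carrier M) m n UNIV"
    and A: "direct_summand R M A"
  shows "\<exists>e I. rlocb R M \<theta> q {\<zero>\<^bsub>M\<^esub>} A e n I"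
proof -
  interpret q: primeideal q R by fact
  obtain B where sA: "submodule A R M" and sB: "submodule B R M" and AB: "A <+>\<^bsub>M\<^esub> B = carrier M" "A \<inter> B = {\<zero>\<^bsub>M\<^esub>}"
    using A unfolding direct_summand_def by blast
  note A = submod[OF sA] and B = submod[OF sB]
  have "k \<le> n \<Longrightarrow> \<exists>m. rlocb R M \<theta> q {\<zero>\<^bsub>M\<^esub>} (carrier M) m n UNIV \<and> (\<forall>i<k. m i \<in> A \<union> B)" for k
  proof (induction k)
    case 0 then show ?case using rb by blast
  next
    case (Suc k)
    then obtain m where m: "rlocb R M \<theta> q {\<zero>\<^bsub>M\<^esub>} (carrier M) m n UNIV" "\<And>i. i < k \<Longrightarrow> m i \<in> A \<union> B" by auto
    have k: "k < n" using Suc.prems by simp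
    have mM: "m i \<in> carrier M" if "i < n" for i using rlocbD(1)[OF m(1) that] .
    have ad: "l m (\<lambda>i. c i + c' i) n = l m c n \<oplus>\<^bsub>M\<^esub> l m c' n" for c c' by (rule l_add) (rule mM)
    have sm: "l m (\<lambda>i. r * c i) n = \<theta> r \<odot>\<^bsub>M\<^esub> l m c n" for r c by (rule l_smult) (rule mM)
    obtain \<alpha> \<beta> where ab: "\<alpha> \<in> A" "\<beta> \<in> B" "m k = \<alpha> \<oplus>\<^bsub>M\<^esub> \<beta>"
      using mM[OF k] AB(1) unfolding set_add_def' by blast
    have abM: "\<alpha> \<in> carrier M" "\<beta> \<in> carrier M" using ab A(1) B(1) by auto
    obtain s a where a: "\<theta> s \<in> carrier R - q" "\<theta> s \<odot>\<^bsub>M\<^esub> \<alpha> = l m a n"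
      using rlocb0_span[OF m(1) order_refl abM(1)] th_surj by (metis DiffD1)
    obtain t b where b: "\<theta> t \<in> carrier R - q" "\<theta> t \<odot>\<^bsub>M\<^esub> \<beta> = l m b n"
      using rlocb0_span[OF m(1) order_refl abM(2)] th_surj by (metis DiffD1)
    have st: "\<theta> (s * t) \<notin> q" using a b q.I_prime[of "\<theta> s" "\<theta> t"] by (auto simp: th_mult)
    have "\<theta> (s * t) \<odot>\<^bsub>M\<^esub> m k = \<theta> t \<odot>\<^bsub>M\<^esub> (\<theta> s \<odot>\<^bsub>M\<^esub> \<alpha>) \<oplus>\<^bsub>M\<^esub> \<theta> s \<odot>\<^bsub>M\<^esub> (\<theta> t \<odot>\<^bsub>M\<^esub> \<beta>)"
      unfolding ab(3) using abM by (simp add: th_mult M.smult_r_distr M.smult_assoc1[symmetric] m_comm)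
    also have "\<dots> = l m (\<lambda>i. t * a i + s * b i) n" unfolding a(2) b(2) ad sm ..
    finally have "\<theta> (- 1) \<odot>\<^bsub>M\<^esub> l m (\<lambda>i. (s * t) * unitv k i) n \<oplus>\<^bsub>M\<^esub> l m (\<lambda>i. t * a i + s * b i) n = \<zero>\<^bsub>M\<^esub>"
      using l_unit[of n m k] mM k unfolding sm
      by (simp add: th_minus th_one M.smult_l_minus M.l_neg)
    then have "l m (\<lambda>i. - 1 * ((s * t) * unitv k i) + (t * a i + s * b i)) n \<in> {\<zero>\<^bsub>M\<^esub>}"
      unfolding ad[of "\<lambda>i. - 1 * ((s * t) * unitv k i)"] sm[of "- 1"] by simp
    from rlocbD(3)[OF m(1) this k] have "\<theta> (t * a k + s * b k - s * t) = \<zero>"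
      by (simp add: unitv_def algebra_simps)
    then have sum: "\<theta> (t * a k) \<oplus> \<theta> (s * b k) = \<theta> (s * t)"
      by (simp add: th_diff flip: th_add)
    have "\<theta> (a k) \<notin> q \<or> \<theta> (b k) \<notin> q"
    proof (rule ccontr)
      assume "\<not> ?thesis"
      then have "\<theta> (t * a k) \<in> q" "\<theta> (s * b k) \<in> q" by (simp_all add: th_mult q.I_l_closed)
      then show False using sum st q.a_closed by metis
    qed
    then obtain \<gamma> w g where g: "\<gamma> \<in> A \<union> B" "\<gamma> \<in> carrier M" "w \<in> carrier R - q" "w \<odot>\<^bsub>M\<^esub> \<gamma> = l m g n" "\<theta> (g k) \<notin> q"
      using a b ab abM by blast
    have "rlocb R M \<theta> q {\<zero>\<^bsub>M\<^esub>} (carrier M) (m(k := \<gamma>)) n UNIV" by (rule rlocb_replace[OF dom q m(1) k g(2-5)])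
    moreover have "\<forall>i<Suc k. (m(k := \<gamma>)) i \<in> A \<union> B" using m(2) g(1) by (auto simp: less_Suc_eq)
    ultimately show ?case by blast
  qed
  then obtain m where m: "rlocb R M \<theta> q {\<zero>\<^bsub>M\<^esub>} (carrier M) m n UNIV" "\<And>i. i < n \<Longrightarrow> m i \<in> A \<union> B" by blast
  have mM: "m i \<in> carrier M" if "i < n" for i using rlocbD(1)[OF m(1) that] .
  have ad: "l m (\<lambda>i. c i + c' i) n = l m c n \<oplus>\<^bsub>M\<^esub> l m c' n" for c c' by (rule l_add) (rule mM)
  \<comment> \<open>The exchanged basis is kept where it lies in \<open>A\<close> and set to zero
    elsewhere. Keeping the length \<open>n\<close> avoids renumbering, and is the reason for the
    index set in \<open>rlocb\<close>.\<close>
  define I where "I = {i. m i \<in> A}"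
  define e where "e i = (if i \<in> I then m i else \<zero>\<^bsub>M\<^esub>)" for i
  have le: "k \<le> n \<Longrightarrow> l e c k = l m (\<lambda>i. if i \<in> I then c i else 0) k" for c k
    using mM by (induction k) (auto simp: e_def)
  have eA: "e i \<in> A" for i unfolding e_def I_def using A(2) by simp
  have "rlocb R M \<theta> q {\<zero>\<^bsub>M\<^esub>} A e n I" unfolding rlocb_def
  proof (intro conjI allI impI ballI)
    show "\<theta> (c i) = \<zero>" if "l e c n \<in> {\<zero>\<^bsub>M\<^esub>}" "i < n" "i \<in> I" for c i
      using rlocbD(3)[OF m(1), of "\<lambda>i. if i \<in> I then c i else 0" i] that le[of n c] by simp
    fix x assume x: "x \<in> A"
    then have xM: "x \<in> carrier M" using A(1) by blast
    obtain u c where u: "u \<in> carrier R - q" "u \<odot>\<^bsub>M\<^esub> x = l m c n"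
      using rlocb0_span[OF m(1) order_refl xM] by blast
    define y where "y = l m (\<lambda>i. if i \<in> I then c i else 0) n"
    define z where "z = l m (\<lambda>i. if i \<in> I then 0 else c i) n"
    have yA: "y \<in> A" unfolding y_def le[of n c, OF order_refl, symmetric] by (rule l_mem[OF sA eA])
    define e' where "e' i = (if i \<in> I then \<zero>\<^bsub>M\<^esub> else m i)" for i
    have "z = l e' c n"
    proof -
      have "k \<le> n \<Longrightarrow> l e' c k = l m (\<lambda>i. if i \<in> I then 0 else c i) k" for k
        using mM by (induction k) (auto simp: e'_def)
      then show ?thesis unfolding z_def by simp
    qed
    moreover have "e' i \<in> B" if "i < n" for i unfolding e'_def I_def using m(2)[OF that] B(2) by auto
    ultimately have zB: "z \<in> B" using l_mem[OF sB] by simp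
    have M: "y \<in> carrier M" "z \<in> carrier M" using yA zB A(1) B(1) by auto
    have "u \<odot>\<^bsub>M\<^esub> x = y \<oplus>\<^bsub>M\<^esub> z"
    proof -
      have "y \<oplus>\<^bsub>M\<^esub> z = l m (\<lambda>i. (if i \<in> I then c i else 0) + (if i \<in> I then 0 else c i)) n" unfolding y_def z_def ad ..
      also have "\<dots> = l m c n" by (rule lc_cong) auto
      finally show ?thesis using u(2) by simp
    qed
    moreover have "u \<odot>\<^bsub>M\<^esub> x \<in> A" using A(4)[OF _ x] u(1) by blast
    ultimately have "\<ominus>\<^bsub>M\<^esub> y \<oplus>\<^bsub>M\<^esub> (y \<oplus>\<^bsub>M\<^esub> z) \<in> A" using A(3)[OF A(5)[OF yA]] by simp
    moreover have "\<ominus>\<^bsub>M\<^esub> y \<oplus>\<^bsub>M\<^esub> (y \<oplus>\<^bsub>M\<^esub> z) = z" using M by (simp add: M.l_neg flip: M.a_assoc)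
    ultimately have "z = \<zero>\<^bsub>M\<^esub>" using zB AB(2) by auto
    then have "u \<odot>\<^bsub>M\<^esub> x = l e c n \<oplus>\<^bsub>M\<^esub> \<zero>\<^bsub>M\<^esub>" unfolding \<open>u \<odot>\<^bsub>M\<^esub> x = y \<oplus>\<^bsub>M\<^esub> z\<close> y_def le[of n c, OF order_refl] by simp
    then show "\<exists>u\<in>carrier R - q. \<exists>c. \<exists>f\<in>{\<zero>\<^bsub>M\<^esub>}. u \<odot>\<^bsub>M\<^esub> x = l e c n \<oplus>\<^bsub>M\<^esub> f" using u(1) by blast
  qed (use eA in \<open>auto simp: e_def\<close>)
  then show ?thesis by blast
qed

end

lemma power_module_module:
  assumes "cring R" shows "module R (power_module R N)"
proof -
  interpret cring R by fact
  have ag: "abelian_group (power_module R N)"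
  proof (rule abelian_groupI)
    fix x assume x: "x \<in> carrier (power_module R N)"
    show "\<exists>y\<in>carrier (power_module R N). y \<oplus>\<^bsub>power_module R N\<^esub> x = \<zero>\<^bsub>power_module R N\<^esub>"
      by (rule bexI[of _ "\<lambda>i\<in>{..<N}. \<ominus>\<^bsub>R\<^esub> x i"])
        (use x in \<open>auto simp: power_module_def PiE_def Pi_def restrict_def fun_eq_iff l_neg extensional_def\<close>)
  qed (auto simp: power_module_def PiE_def Pi_def restrict_def fun_eq_iff a_ac extensional_def)
  show ?thesis
    by (rule moduleI[OF is_cring ag])
      (auto simp: power_module_def PiE_def Pi_def restrict_def fun_eq_iff extensional_def l_distr r_distr m_assoc)
qed

context presented
begin

lemma power_rlocb:
  assumes q: "primeideal q R"
  shows "\<exists>m. rlocb R (power_module R N) \<theta> q {\<zero>\<^bsub>power_module R N\<^esub>} (carrier (power_module R N)) m N UNIV"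
proof -
  interpret q: primeideal q R by fact
  let ?M = "power_module R N"
  interpret pm: presented_module R \<theta> ?M
    by (intro presented_module.intro presented_axioms power_module_module is_cring)
  define m where "m j = (\<lambda>i\<in>{..<N}. if i = j then \<one> else \<zero>)" for j
  have lm: "n \<le> N \<Longrightarrow> lc ?M \<theta> m c n = (\<lambda>i\<in>{..<N}. if i < n then \<theta> (c i) else \<zero>)" for n c
    by (induction n) (auto simp: power_module_def m_def fun_eq_iff restrict_def less_Suc_eq)
  have z: "\<zero>\<^bsub>?M\<^esub> = (\<lambda>i\<in>{..<N}. \<zero>)" by (simp add: power_module_def)
  have "rlocb R ?M \<theta> q {\<zero>\<^bsub>?M\<^esub>} (carrier ?M) m N UNIV" unfolding rlocb_def
  proof (intro conjI allI impI ballI)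
    show "m i \<in> carrier ?M" for i by (auto simp: power_module_def m_def)
    show "\<theta> (c i) = \<zero>" if "lc ?M \<theta> m c N \<in> {\<zero>\<^bsub>?M\<^esub>}" "i < N" for c i
    proof -
      have "(\<lambda>i\<in>{..<N}. if i < N then \<theta> (c i) else \<zero>) i = (\<lambda>i\<in>{..<N}. \<zero>) i" using that(1) unfolding lm[OF order_refl] z by simp
      then show ?thesis using that(2) by simp
    qed
    fix x assume x: "x \<in> carrier ?M"
    then have "\<forall>i. \<exists>t. i < N \<longrightarrow> \<theta> t = x i" using th_surj by (auto simp: power_module_def)
    then obtain c where c: "\<And>i. i < N \<Longrightarrow> \<theta> (c i) = x i" by metis
    have "lc ?M \<theta> m c N = x" unfolding lm[OF order_refl] using x c
      by (auto simp: power_module_def fun_eq_iff restrict_def PiE_def extensional_def)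
    moreover have "\<one> \<in> carrier R - q" using q.I_notcarr q.one_imp_carrier by blast
    ultimately show "\<exists>u\<in>carrier R - q. \<exists>c. \<exists>f\<in>{\<zero>\<^bsub>?M\<^esub>}. u \<odot>\<^bsub>?M\<^esub> x = lc ?M \<theta> m c N \<oplus>\<^bsub>?M\<^esub> f"
      using x by (intro bexI[of _ \<one>] exI[of _ c] bexI[of _ "\<zero>\<^bsub>?M\<^esub>"]) auto
  qed auto
  then show ?thesis by blast
qed

lemma projective_rlocb:
  assumes dom: "domain R" and q: "primeideal q R" and E: "module R E" and pr: "fg_projective R E"
  shows "\<exists>e N I. rlocb R E \<theta> q {\<zero>\<^bsub>E\<^esub>} (carrier E) e N I"
proof -
  obtain N A f where A: "direct_summand R (power_module R N) A"
    and f: "module_iso R E ((power_module R N)\<lparr>carrier := A\<rparr>) f" using pr unfolding fg_projective_def by blast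
  let ?M = "power_module R N"
  interpret pm: presented_module R \<theta> ?M
    by (intro presented_module.intro presented_axioms power_module_module is_cring)
  interpret pe: presented_module R \<theta> E by (intro presented_module.intro presented_axioms E)
  obtain m where "rlocb R ?M \<theta> q {\<zero>\<^bsub>?M\<^esub>} (carrier ?M) m N UNIV" using power_rlocb[OF q] by blast
  from pm.summand_rlocb[OF dom q this A] obtain e I where rb: "rlocb R ?M \<theta> q {\<zero>\<^bsub>?M\<^esub>} A e N I" by blast
  have sA: "submodule A R ?M" using A unfolding direct_summand_def by blast
  have bij: "bij_betw f (carrier E) A"
    and fa: "\<And>x y. x \<in> carrier E \<Longrightarrow> y \<in> carrier E \<Longrightarrow> f (x \<oplus>\<^bsub>E\<^esub> y) = f x \<oplus>\<^bsub>?M\<^esub> f y"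
    and fs: "\<And>r x. r \<in> carrier R \<Longrightarrow> x \<in> carrier E \<Longrightarrow> f (r \<odot>\<^bsub>E\<^esub> x) = r \<odot>\<^bsub>?M\<^esub> f x"
    using f unfolding module_iso_def by auto
  have fA: "f x \<in> A" if "x \<in> carrier E" for x using bij that by (auto simp: bij_betw_def)
  then have fM: "f x \<in> carrier ?M" if "x \<in> carrier E" for x using pm.submod(1)[OF sA] that by blast
  have inj: "f x = f y \<Longrightarrow> x = y" if "x \<in> carrier E" "y \<in> carrier E" for x y
    using bij that by (auto simp: bij_betw_def inj_on_def)
  have f0: "f \<zero>\<^bsub>E\<^esub> = \<zero>\<^bsub>?M\<^esub>"
  proof -
    have "f \<zero>\<^bsub>E\<^esub> = f (\<zero> \<odot>\<^bsub>E\<^esub> \<zero>\<^bsub>E\<^esub>)" by simp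
    also have "\<dots> = \<zero> \<odot>\<^bsub>?M\<^esub> f \<zero>\<^bsub>E\<^esub>" by (rule fs) auto
    also have "\<dots> = \<zero>\<^bsub>?M\<^esub>" using fM by simp
    finally show ?thesis .
  qed
  define e' where "e' i = inv_into (carrier E) f (e i)" for i
  have e': "e' i \<in> carrier E" "f (e' i) = e i" if "i < N" for i
    using pm.rlocbD(1)[OF rb that] bij unfolding e'_def bij_betw_def by (auto intro: inv_into_into f_inv_into_f)
  have fl: "f (lc E \<theta> e' c N) = lc ?M \<theta> e c N" for c
  proof -
    have "f (lc E \<theta> e' c N) = lc ?M \<theta> (\<lambda>i. f (e' i)) c N" by (rule pe.l_hom) (auto simp: e' f0 fa fs)
    also have "\<dots> = lc ?M \<theta> e c N" by (rule lc_cong) (auto simp: e')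
    finally show ?thesis .
  qed
  have lE: "lc E \<theta> e' c N \<in> carrier E" for c by (rule pe.l_closed) (rule e')
  have "rlocb R E \<theta> q {\<zero>\<^bsub>E\<^esub>} (carrier E) e' N I" unfolding rlocb_def
  proof (intro conjI allI impI ballI)
    show "e' i \<in> carrier E" if "i < N" for i using e' that by blast
    show "e' i = \<zero>\<^bsub>E\<^esub>" if "i < N" "i \<notin> I" for i
      using inj[OF e'(1)[OF that(1)], of "\<zero>\<^bsub>E\<^esub>"] e'(2)[OF that(1)] pm.rlocbD(2)[OF rb that] f0 by simp
    show "\<theta> (c i) = \<zero>" if "lc E \<theta> e' c N \<in> {\<zero>\<^bsub>E\<^esub>}" "i < N" "i \<in> I" for c i
      using pm.rlocbD(3)[OF rb _ that(2,3), of c] that(1) fl[of c] f0 by simp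
    fix x assume x: "x \<in> carrier E"
    obtain u c where u: "u \<in> carrier R - q" "u \<odot>\<^bsub>?M\<^esub> f x = lc ?M \<theta> e c N"
      using pm.rlocb0_span[OF rb pm.submod(1)[OF sA] fA[OF x]] by blast
    then have "f (u \<odot>\<^bsub>E\<^esub> x) = f (lc E \<theta> e' c N)" using fs[of u x] x fl by simp
    then have "u \<odot>\<^bsub>E\<^esub> x = lc E \<theta> e' c N" using inj x u(1) lE by auto
    then show "\<exists>u\<in>carrier R - q. \<exists>c. \<exists>f\<in>{\<zero>\<^bsub>E\<^esub>}. u \<odot>\<^bsub>E\<^esub> x = lc E \<theta> e' c N \<oplus>\<^bsub>E\<^esub> f"
      using u(1) lE by (intro bexI[of _ u] exI[of _ c]) auto
  qed
  then show ?thesis by blast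
qed

end

section \<open>Adapted local bases from flags and from complexes\<close>

context presented_module
begin

lemma submodule_restrict:
  assumes F: "submodule F R M" and F': "submodule F' R M" "F \<subseteq> F'"
  shows "submodule F R (M\<lparr>carrier := F'\<rparr>)"
proof -
  interpret F': module R "M\<lparr>carrier := F'\<rparr>" by (rule submodule.submodule_is_module[OF F'(1) M.module_axioms])
  note s = submod[OF F]
  show ?thesis
  proof (rule F'.submoduleI)
    fix a assume a: "a \<in> F"
    \<comment> \<open>The inverse is formed in the record with the restricted carrier; it is
      rewritten as a multiple by minus one, an operation shared by both records.\<close>
    then have "\<ominus>\<^bsub>M\<lparr>carrier := F'\<rparr>\<^esub> a = (\<ominus> \<one>) \<odot>\<^bsub>M\<^esub> a" using F'.smult_l_minus[of \<one> a] F'(2) F'.smult_one[of a] by auto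
    then show "\<ominus>\<^bsub>M\<lparr>carrier := F'\<rparr>\<^esub> a \<in> F" using s(4)[OF _ a] by simp
  qed (use s F' in auto)
qed

lemma quot_rlocb:
  assumes dom: "domain R" and q: "primeideal q R"
    and F: "submodule F R M" and F': "submodule F' R M" "F \<subseteq> F'"
    and pr: "fg_projective R (quot_module (M\<lparr>carrier := F'\<rparr>) F)"
  shows "\<exists>e N I. rlocb R M \<theta> q F F' e N I"
proof -
  let ?M = "M\<lparr>carrier := F'\<rparr>"
  let ?E = "quot_module ?M F"
  have mM: "module R ?M" by (rule submodule.submodule_is_module[OF F'(1) M.module_axioms])
  note qm = quot_module[OF mM submodule_restrict[OF F F']]
  interpret pf: presented_module R \<theta> ?M by (intro presented_module.intro presented_axioms mM)
  interpret pe: presented_module R \<theta> ?E by (intro presented_module.intro presented_axioms qm(1))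
  obtain e N I where rb: "rlocb R ?E \<theta> q {\<zero>\<^bsub>?E\<^esub>} (carrier ?E) e N I"
    using projective_rlocb[OF dom q qm(1) pr] by blast
  let ?p = "\<lambda>x. F +>\<^bsub>?M\<^esub> x"
  \<comment> \<open>Representatives are chosen for the basis classes only; at the other indices the
    vector has to be exactly zero, as \<open>rlocb\<close> demands.\<close>
  define e' where "e' i = (if i \<in> I then (SOME x. x \<in> F' \<and> ?p x = e i) else \<zero>\<^bsub>M\<^esub>)" for i
  have z: "\<zero>\<^bsub>M\<^esub> \<in> F'" "\<zero>\<^bsub>M\<^esub> \<in> F" using submod(2)[OF F'(1)] submod(2)[OF F] by auto
  have e': "e' i \<in> F' \<and> ?p (e' i) = e i" if "i < N" for i
  proof (cases "i \<in> I")
    case True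
    have "e i \<in> ?p ` F'" using pe.rlocbD(1)[OF rb that] qm(2) by simp
    then have "\<exists>x. x \<in> F' \<and> ?p x = e i" by blast
    from someI_ex[OF this] show ?thesis unfolding e'_def using True by simp
  next
    case False
    then show ?thesis unfolding e'_def using pe.rlocbD(2)[OF rb that False] qm(3) z by simp
  qed
  have pl: "?p (l e' c N) = lc ?E \<theta> e c N" for c
  proof -
    have "?p (lc ?M \<theta> e' c N) = lc ?E \<theta> (\<lambda>i. ?p (e' i)) c N"
      by (rule pf.l_hom) (use e' qm in auto)
    also have "\<dots> = lc ?E \<theta> e c N" by (rule lc_cong) (use e' in auto)
    finally show ?thesis by simp
  qed
  have lF: "l e' c N \<in> F'" for c by (rule l_mem[OF F'(1)]) (use e' in blast)
  have mem: "x \<in> F \<longleftrightarrow> ?p x = \<zero>\<^bsub>?E\<^esub>" if "x \<in> F'" for x using qm(6)[of x] that by simp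
  have "rlocb R M \<theta> q F F' e' N I" unfolding rlocb_def
  proof (intro conjI allI impI ballI)
    show "\<theta> (c i) = \<zero>" if "l e' c N \<in> F" "i < N" "i \<in> I" for c i
      using pe.rlocbD(3)[OF rb _ that(2,3), of c] that(1) mem[OF lF] pl by simp
    fix x assume x: "x \<in> F'"
    then have "?p x \<in> carrier ?E" using qm(2) by auto
    then obtain u c where u: "u \<in> carrier R - q" "u \<odot>\<^bsub>?E\<^esub> ?p x = lc ?E \<theta> e c N"
      using pe.rlocb0_span[OF rb order_refl] by blast
    define y where "y = u \<odot>\<^bsub>M\<^esub> x"
    define z where "z = l e' c N"
    have yF: "y \<in> F'" "z \<in> F'" unfolding y_def z_def using submod(4)[OF F'(1)] u(1) x lF by auto
    then have M: "y \<in> carrier M" "z \<in> carrier M" using submod(1)[OF F'(1)] by auto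
    have py: "?p y = ?p z" unfolding y_def z_def pl using u(2) qm(5)[of u x] u(1) x by simp
    have "?p (y \<oplus>\<^bsub>M\<^esub> \<ominus>\<^bsub>M\<^esub> z) = \<zero>\<^bsub>?E\<^esub>"
    proof -
      have zz: "\<ominus>\<^bsub>M\<^esub> z \<in> F'" using submod(5)[OF F'(1) yF(2)] .
      have "?p (y \<oplus>\<^bsub>M\<^esub> \<ominus>\<^bsub>M\<^esub> z) = ?p y \<oplus>\<^bsub>?E\<^esub> ?p (\<ominus>\<^bsub>M\<^esub> z)" using qm(4)[of y "\<ominus>\<^bsub>M\<^esub> z"] yF zz by simp
      also have "\<dots> = ?p (z \<oplus>\<^bsub>M\<^esub> \<ominus>\<^bsub>M\<^esub> z)" unfolding py using qm(4)[of z "\<ominus>\<^bsub>M\<^esub> z"] yF zz by simp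
      also have "\<dots> = \<zero>\<^bsub>?E\<^esub>" using M qm(3) by (simp add: M.r_neg)
      finally show ?thesis .
    qed
    then have "y \<oplus>\<^bsub>M\<^esub> \<ominus>\<^bsub>M\<^esub> z \<in> F" using mem submod(3)[OF F'(1) yF(1) submod(5)[OF F'(1) yF(2)]] by blast
    moreover have "y = z \<oplus>\<^bsub>M\<^esub> (y \<oplus>\<^bsub>M\<^esub> \<ominus>\<^bsub>M\<^esub> z)" using M by (simp add: M.a_lcomm M.r_neg)
    ultimately show "\<exists>u\<in>carrier R - q. \<exists>c. \<exists>f\<in>F. u \<odot>\<^bsub>M\<^esub> x = l e' c N \<oplus>\<^bsub>M\<^esub> f"
      using u(1) unfolding y_def z_def by blast
  qed (use e' in \<open>auto simp: e'_def\<close>)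
  then show ?thesis by blast
qed

lemma adap_0:
  assumes q: "primeideal q R"
  shows "adap R M \<theta> d q {\<zero>\<^bsub>M\<^esub>} m 0"
proof -
  interpret q: primeideal q R by fact
  have "\<one> \<in> carrier R - q" using q.I_notcarr q.one_imp_carrier by blast
  then show ?thesis unfolding adap_def rlocb_def by auto
qed

lemma flag_adap:
  assumes dom: "domain R" and q: "primeideal q R" and fl: "has_projective_flag R M d"
  shows "\<exists>m n. adap R M \<theta> d q (carrier M) m n"
proof -
  from fl[unfolded has_projective_flag_def] obtain r F where "F 0 = {\<zero>\<^bsub>M\<^esub>} \<and> F r = carrier M \<and>
       (\<forall>i\<le>r. direct_summand R M (F i)) \<and>
       (\<forall>i<r. F i \<subseteq> F (Suc i) \<and> fg_projective R (quot_module (M\<lparr>carrier := F (Suc i)\<rparr>) (F i)) \<and>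
              d ` F (Suc i) \<subseteq> F i)" by (elim exE)
  then have F: "F 0 = {\<zero>\<^bsub>M\<^esub>}" "F r = carrier M" "\<And>i. i \<le> r \<Longrightarrow> direct_summand R M (F i)"
    "\<And>i. i < r \<Longrightarrow> F i \<subseteq> F (Suc i)" "\<And>i. i < r \<Longrightarrow> fg_projective R (quot_module (M\<lparr>carrier := F (Suc i)\<rparr>) (F i))"
    "\<And>i. i < r \<Longrightarrow> d ` F (Suc i) \<subseteq> F i"
    by simp_all
  have sF: "submodule (F i) R M" if "i \<le> r" for i using F(3)[OF that] unfolding direct_summand_def by blast
  have "i \<le> r \<Longrightarrow> \<exists>m n. adap R M \<theta> d q (F i) m n" for i
  proof (induction i)
    case 0 then show ?case unfolding F(1) using adap_0[OF q] by blast
  next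
    case (Suc i)
    then obtain m n where ad: "adap R M \<theta> d q (F i) m n" by auto
    have i: "i \<le> r" "i < r" "Suc i \<le> r" using Suc.prems by auto
    obtain e N I where rb: "rlocb R M \<theta> q (F i) (F (Suc i)) e N I"
      using quot_rlocb[OF dom q sF[OF i(1)] sF[OF i(3)] F(4)[OF i(2)] F(5)[OF i(2)]] by blast
    show ?case
      by (rule adap_step[OF q sF[OF i(1)] sF[OF i(3)] F(4)[OF i(2)] ad rb]) (use F(6)[OF i(2)] in blast)
  qed
  from this[of r] show ?thesis unfolding F(2) by simp
qed

end

lemma ex1_eqI: "\<exists>!x. P x \<Longrightarrow> P a \<Longrightarrow> P b \<Longrightarrow> a = b"
  by blast

context presented_module
begin

lemma finsum_l:
  "(\<And>i. i < n \<Longrightarrow> m i \<in> carrier M) \<Longrightarrow> finsum M (\<lambda>i. \<theta> (c i) \<odot>\<^bsub>M\<^esub> m i) {..<n} = l m c n"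
proof (induction n)
  case (Suc n)
  have "finsum M (\<lambda>i. \<theta> (c i) \<odot>\<^bsub>M\<^esub> m i) {..<Suc n} = \<theta> (c n) \<odot>\<^bsub>M\<^esub> m n \<oplus>\<^bsub>M\<^esub> finsum M (\<lambda>i. \<theta> (c i) \<odot>\<^bsub>M\<^esub> m i) {..<n}"
    unfolding lessThan_Suc by (rule M.finsum_insert) (use Suc.prems in auto)
  then show ?case using Suc l_closed[of n m c] by (simp add: M.a_comm)
qed simp

lemma finsum_submodule:
  assumes "submodule F R M" "finite A" "\<And>i. i \<in> A \<Longrightarrow> f i \<in> F"
  shows "finsum M f A \<in> F"
  using assms(2,3)
proof (induction A rule: finite_induct)
  case empty then show ?case using submod(2)[OF assms(1)] by simp
next
  case (insert a A)
  have "f \<in> A \<rightarrow> carrier M" "f a \<in> carrier M" using insert.prems submod(1)[OF assms(1)] by auto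
  then show ?case using insert submod(3)[OF assms(1)] by simp
qed

text \<open>The sums of the terms in degrees below \<open>a + k\<close> form a flag with free
  layers, and \<open>d\<close> maps each into the preceding one because it lowers the degree. Bases
  of the free terms serve as local bases of the layers in \<open>adap_step\<close>.\<close>

lemma complex_adap:
  assumes q: "primeideal q R" and df: "differential_module R M d" and bc: "is_bounded_free_complex R M d"
  shows "\<exists>m n. adap R M \<theta> d q (carrier M) m n"
proof -
  from bc[unfolded is_bounded_free_complex_def] obtain a b :: int and V where
    "(\<forall>i. submodule (V i) R M \<and> (\<exists>n. free_of_rank R (M\<lparr>carrier := V i\<rparr>) n)) \<and>
       (\<forall>i. i \<notin> {a..b} \<longrightarrow> V i = {\<zero>\<^bsub>M\<^esub>}) \<and>
       (\<forall>x\<in>carrier M. \<exists>!y. y \<in> (\<Pi>\<^sub>E i\<in>{a..b}. V i) \<and> x = (\<Oplus>\<^bsub>M\<^esub>i\<in>{a..b}. y i)) \<and>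
       (\<forall>i. d ` V i \<subseteq> V (i - 1))" by (elim exE)
  then have sV: "\<And>i. submodule (V i) R M" and free: "\<And>i. \<exists>n. free_of_rank R (M\<lparr>carrier := V i\<rparr>) n"
    and out: "\<And>i. i \<notin> {a..b} \<Longrightarrow> V i = {\<zero>\<^bsub>M\<^esub>}"
    and uniq: "\<And>x. x \<in> carrier M \<Longrightarrow> \<exists>!y. y \<in> (\<Pi>\<^sub>E i\<in>{a..b}. V i) \<and> x = (\<Oplus>\<^bsub>M\<^esub>i\<in>{a..b}. y i)"
    and dV: "\<And>i. d ` V i \<subseteq> V (i - 1)" by simp_all
  have VM: "V i \<subseteq> carrier M" for i by (rule submod(1)[OF sV])
  have V0: "\<zero>\<^bsub>M\<^esub> \<in> V i" for i by (rule submod(2)[OF sV])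
  have dadd: "d (x \<oplus>\<^bsub>M\<^esub> y) = d x \<oplus>\<^bsub>M\<^esub> d y" if "x \<in> carrier M" "y \<in> carrier M" for x y
    using df that unfolding differential_module_def by blast
  have dM: "d x \<in> carrier M" if "x \<in> carrier M" for x using df that unfolding differential_module_def by blast
  have d0: "d \<zero>\<^bsub>M\<^esub> = \<zero>\<^bsub>M\<^esub>" using dadd[of "\<zero>\<^bsub>M\<^esub>" "\<zero>\<^bsub>M\<^esub>"] dM[of "\<zero>\<^bsub>M\<^esub>"] by (simp add: M.add.l_cancel_one)
  \<comment> \<open>Tuples supported in degrees below \<open>a + k\<close>. They stay extensional on
    \<open>{a..b}\<close>, so that the uniqueness in the definition of a complex applies to
    them.\<close>
  define Y where "Y k = {y \<in> (\<Pi>\<^sub>E i\<in>{a..b}. V i). \<forall>j\<in>{a..b}. a + int k \<le> j \<longrightarrow> y j = \<zero>\<^bsub>M\<^esub>}" for k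
  define G where "G k = (\<lambda>y. \<Oplus>\<^bsub>M\<^esub>i\<in>{a..b}. y i) ` Y k" for k
  have YV: "y i \<in> V i" if "y \<in> Y k" "i \<in> {a..b}" for y k i using that unfolding Y_def by (auto simp: PiE_def)
  have YM: "y \<in> {a..b} \<rightarrow> carrier M" if "y \<in> Y k" for y k using YV[OF that] VM by blast
  have Yn: "y j = \<zero>\<^bsub>M\<^esub>" if "y \<in> Y k" "j \<in> {a..b}" "a + int k \<le> j" for y k j using that unfolding Y_def by blast
  have YI: "restrict y {a..b} \<in> Y k" if "\<And>i. i \<in> {a..b} \<Longrightarrow> y i \<in> V i" "\<And>j. j \<in> {a..b} \<Longrightarrow> a + int k \<le> j \<Longrightarrow> y j = \<zero>\<^bsub>M\<^esub>" for y k
    using that unfolding Y_def by auto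
  have res: "(\<Oplus>\<^bsub>M\<^esub>i\<in>{a..b}. restrict y {a..b} i) = (\<Oplus>\<^bsub>M\<^esub>i\<in>{a..b}. y i)" if "y \<in> {a..b} \<rightarrow> carrier M" for y
    by (rule M.finsum_cong') (use that in auto)
  have GI: "(\<Oplus>\<^bsub>M\<^esub>i\<in>{a..b}. y i) \<in> G k" if "\<And>i. i \<in> {a..b} \<Longrightarrow> y i \<in> V i" "\<And>j. j \<in> {a..b} \<Longrightarrow> a + int k \<le> j \<Longrightarrow> y j = \<zero>\<^bsub>M\<^esub>" for y k
  proof -
    have "y \<in> {a..b} \<rightarrow> carrier M" using that(1) VM by blast
    then show ?thesis unfolding G_def using imageI[OF YI[of y k], of "\<lambda>y. \<Oplus>\<^bsub>M\<^esub>i\<in>{a..b}. y i"] that res[of y] by simp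
  qed
  have sG: "submodule (G k) R M" for k
  proof (rule M.submoduleI)
    show "G k \<subseteq> carrier M" unfolding G_def using YM by (auto intro!: M.finsum_closed)
    have "(\<Oplus>\<^bsub>M\<^esub>i\<in>{a..b}. \<zero>\<^bsub>M\<^esub>) \<in> G k" by (rule GI) (use V0 in auto)
    then show "\<zero>\<^bsub>M\<^esub> \<in> G k" by simp
    show sm: "r \<odot>\<^bsub>M\<^esub> x \<in> G k" if r: "r \<in> carrier R" and x: "x \<in> G k" for r x
    proof -
      obtain y where y: "y \<in> Y k" "x = (\<Oplus>\<^bsub>M\<^esub>i\<in>{a..b}. y i)" using x unfolding G_def by blast
      have "r \<odot>\<^bsub>M\<^esub> x = (\<Oplus>\<^bsub>M\<^esub>i\<in>{a..b}. r \<odot>\<^bsub>M\<^esub> y i)" unfolding y(2)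
        by (rule M.finsum_smult_ldistr) (use r YM[OF y(1)] in auto)
      also have "\<dots> \<in> G k" by (rule GI) (use submod(4)[OF sV r] YV[OF y(1)] Yn[OF y(1)] r in auto)
      finally show ?thesis .
    qed
    show "x \<oplus>\<^bsub>M\<^esub> x' \<in> G k" if "x \<in> G k" "x' \<in> G k" for x x'
    proof -
      obtain y y' where y: "y \<in> Y k" "x = (\<Oplus>\<^bsub>M\<^esub>i\<in>{a..b}. y i)" "y' \<in> Y k" "x' = (\<Oplus>\<^bsub>M\<^esub>i\<in>{a..b}. y' i)"
        using \<open>x \<in> G k\<close> \<open>x' \<in> G k\<close> unfolding G_def by blast
      have "x \<oplus>\<^bsub>M\<^esub> x' = (\<Oplus>\<^bsub>M\<^esub>i\<in>{a..b}. y i \<oplus>\<^bsub>M\<^esub> y' i)" unfolding y(2,4)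
        by (rule M.finsum_addf[symmetric]) (use YM[OF y(1)] YM[OF y(3)] in auto)
      also have "\<dots> \<in> G k" by (rule GI) (use submod(3)[OF sV] YV[OF y(1)] YV[OF y(3)] Yn[OF y(1)] Yn[OF y(3)] in auto)
      finally show ?thesis .
    qed
    show "\<ominus>\<^bsub>M\<^esub> x \<in> G k" if x: "x \<in> G k" for x
    proof -
      have "x \<in> carrier M" using x YM unfolding G_def by (auto intro!: M.finsum_closed)
      then have "\<ominus>\<^bsub>M\<^esub> x = (\<ominus> \<one>) \<odot>\<^bsub>M\<^esub> x" using M.smult_l_minus[of \<one> x] by simp
      then show ?thesis using sm[OF _ x] by simp
    qed
  qed
  have sing: "(\<Oplus>\<^bsub>M\<^esub>i\<in>{a..b}. if j = i then z else \<zero>\<^bsub>M\<^esub>) = z" if "j \<in> {a..b}" "z \<in> carrier M" for j z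
    using M.add.finprod_singleton[of j "{a..b}" "\<lambda>_. z"] that by simp
  have VG: "V j \<subseteq> G k" if "j < a + int k" for j k
  proof (cases "j \<in> {a..b}")
    case True
    show ?thesis
    proof
      fix z assume z: "z \<in> V j"
      have "(\<Oplus>\<^bsub>M\<^esub>i\<in>{a..b}. if j = i then z else \<zero>\<^bsub>M\<^esub>) \<in> G k" by (rule GI) (use z V0 that in auto)
      moreover have "z \<in> carrier M" using z VM by blast
      ultimately show "z \<in> G k" using sing[OF True] by simp
    qed
  next
    case False then show ?thesis using out submod(2)[OF sG] by simp
  qed
  have GG: "G k \<subseteq> G (Suc k)" for k
  proof
    fix x assume "x \<in> G k"
    then obtain y where y: "y \<in> Y k" "x = (\<Oplus>\<^bsub>M\<^esub>i\<in>{a..b}. y i)" unfolding G_def by blast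
    show "x \<in> G (Suc k)" unfolding y(2) by (rule GI) (use YV[OF y(1)] Yn[OF y(1)] in auto)
  qed
  have dsum: "d (finsum M y A) = finsum M (\<lambda>i. d (y i)) A" if "finite A" "y \<in> A \<rightarrow> carrier M" for y A
    using that
  proof (induction A rule: finite_induct)
    case empty then show ?case using d0 by simp
  next
    case (insert i A)
    have "(\<lambda>i. d (y i)) \<in> A \<rightarrow> carrier M" "d (y i) \<in> carrier M" using insert.prems dM by auto
    then show ?case using insert by (simp add: dadd)
  qed
  have dG: "d x \<in> G k" if x: "x \<in> G (Suc k)" for x k
  proof -
    obtain y where y: "y \<in> Y (Suc k)" "x = (\<Oplus>\<^bsub>M\<^esub>i\<in>{a..b}. y i)" using x unfolding G_def by blast
    show ?thesis unfolding y(2) dsum[OF finite_atLeastAtMost_int YM[OF y(1)]]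
    proof (rule finsum_submodule[OF sG])
      fix i assume i: "i \<in> {a..b}"
      show "d (y i) \<in> G k"
      proof (cases "a + int (Suc k) \<le> i")
        case True then show ?thesis using Yn[OF y(1) i] d0 submod(2)[OF sG] by simp
      next
        case False
        then have "V (i - 1) \<subseteq> G k" by (intro VG) simp
        then show ?thesis using dV[of i] YV[OF y(1) i] by blast
      qed
    qed simp
  qed
  have step: "\<exists>e N I. rlocb R M \<theta> q (G k) (G (Suc k)) e N I" if j: "a + int k \<in> {a..b}" for k
  proof -
    let ?j = "a + int k"
    interpret q: primeideal q R by fact
    have one: "\<one> \<in> carrier R - q" using q.I_notcarr q.one_imp_carrier by blast
    \<comment> \<open>A vector of degree \<open>a + k\<close> that is also a sum of terms of lower
      degree has two decompositions unless it is zero.\<close>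
    have disj: "x = \<zero>\<^bsub>M\<^esub>" if x: "x \<in> V ?j" "x \<in> G k" for x
    proof -
      have xM: "x \<in> carrier M" using x VM by blast
      obtain y where y: "y \<in> Y k" "x = (\<Oplus>\<^bsub>M\<^esub>i\<in>{a..b}. y i)" using x(2) unfolding G_def by blast
      have yP: "y \<in> (\<Pi>\<^sub>E i\<in>{a..b}. V i)" using y(1) unfolding Y_def by blast
      let ?\<delta> = "restrict (\<lambda>i. if ?j = i then x else \<zero>\<^bsub>M\<^esub>) {a..b}"
      have dP: "?\<delta> \<in> (\<Pi>\<^sub>E i\<in>{a..b}. V i)" using x(1) V0 by auto
      have "(\<Oplus>\<^bsub>M\<^esub>i\<in>{a..b}. ?\<delta> i) = (\<Oplus>\<^bsub>M\<^esub>i\<in>{a..b}. if ?j = i then x else \<zero>\<^bsub>M\<^esub>)"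
        by (rule res) (use xM in auto)
      then have "x = (\<Oplus>\<^bsub>M\<^esub>i\<in>{a..b}. ?\<delta> i)" using sing[OF j xM] by simp
      then have "y = ?\<delta>" using uniq[OF xM] yP dP y(2) by blast
      then have "y ?j = x" using j by simp
      then show ?thesis using Yn[OF y(1) j] by simp
    qed
    obtain n where "free_of_rank R (M\<lparr>carrier := V ?j\<rparr>) n" using free by blast
    then obtain e where e: "e \<in> {..<n} \<rightarrow> V ?j" and ex: "\<And>x. x \<in> V ?j \<Longrightarrow>
       \<exists>!c. c \<in> {..<n} \<rightarrow>\<^sub>E carrier R \<and> x = (\<Oplus>\<^bsub>M\<lparr>carrier := V ?j\<rparr>\<^esub>i\<in>{..<n}. c i \<odot>\<^bsub>M\<^esub> e i)"
      unfolding free_of_rank_def by auto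
    interpret pv: presented_module R \<theta> "M\<lparr>carrier := V ?j\<rparr>"
      by (intro presented_module.intro presented_axioms submodule.submodule_is_module[OF sV M.module_axioms])
    have fl: "(\<Oplus>\<^bsub>M\<lparr>carrier := V ?j\<rparr>\<^esub>i\<in>{..<n}. \<theta> (c i) \<odot>\<^bsub>M\<^esub> e i) = l e c n" for c
      using pv.finsum_l[of n e c] e by (simp add: Pi_def)
    have lV: "l e c n \<in> V ?j" for c by (rule l_mem[OF sV]) (use e in auto)
    have rc: "(\<Oplus>\<^bsub>M\<lparr>carrier := V ?j\<rparr>\<^esub>i\<in>{..<n}. (\<lambda>i\<in>{..<n}. \<theta> (c i)) i \<odot>\<^bsub>M\<^esub> e i) = l e c n" for c
    proof -
      have "(\<Oplus>\<^bsub>M\<lparr>carrier := V ?j\<rparr>\<^esub>i\<in>{..<n}. (\<lambda>i\<in>{..<n}. \<theta> (c i)) i \<odot>\<^bsub>M\<^esub> e i) =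
        (\<Oplus>\<^bsub>M\<lparr>carrier := V ?j\<rparr>\<^esub>i\<in>{..<n}. \<theta> (c i) \<odot>\<^bsub>M\<^esub> e i)"
        by (rule pv.M.finsum_cong') (auto intro!: submod(4)[OF sV] funcset_mem[OF e])
      then show ?thesis unfolding fl .
    qed
    have "rlocb R M \<theta> q (G k) (G (Suc k)) e n UNIV" unfolding rlocb_def
    proof (intro conjI allI impI ballI)
      show "e i \<in> G (Suc k)" if "i < n" for i using e that VG[of ?j "Suc k"] by auto
    next
      fix c i assume lG: "l e c n \<in> G k" and i: "i < n"
      have "l e c n = \<zero>\<^bsub>M\<^esub>" by (rule disj[OF lV lG])
      moreover have "l e (\<lambda>_. 0) n = \<zero>\<^bsub>M\<^esub>" by (rule l_ker) (use e VM in auto)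
      ultimately have eq: "l e c n = l e (\<lambda>_. 0) n" by simp
      have "(\<lambda>i\<in>{..<n}. \<theta> (c i)) = (\<lambda>i\<in>{..<n}. \<theta> 0)"
      proof (rule ex1_eqI[OF ex[OF lV[of c]]])
        show "(\<lambda>i\<in>{..<n}. \<theta> (c i)) \<in> {..<n} \<rightarrow>\<^sub>E carrier R \<and>
          l e c n = (\<Oplus>\<^bsub>M\<lparr>carrier := V ?j\<rparr>\<^esub>i\<in>{..<n}. (\<lambda>i\<in>{..<n}. \<theta> (c i)) i \<odot>\<^bsub>M\<^esub> e i)"
          unfolding rc by simp
        show "(\<lambda>i\<in>{..<n}. \<theta> 0) \<in> {..<n} \<rightarrow>\<^sub>E carrier R \<and>
          l e c n = (\<Oplus>\<^bsub>M\<lparr>carrier := V ?j\<rparr>\<^esub>i\<in>{..<n}. (\<lambda>i\<in>{..<n}. \<theta> 0) i \<odot>\<^bsub>M\<^esub> e i)"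
          unfolding rc[of "\<lambda>_. 0"] eq by simp
      qed
      from fun_cong[OF this, of i] i show "\<theta> (c i) = \<zero>" by simp
    next
      fix x assume "x \<in> G (Suc k)"
      then obtain y where y: "y \<in> Y (Suc k)" "x = (\<Oplus>\<^bsub>M\<^esub>i\<in>{a..b}. y i)" unfolding G_def by blast
      define z where "z = y ?j"
      have zV: "z \<in> V ?j" unfolding z_def using YV[OF y(1) j] .
      define g where "g = (\<Oplus>\<^bsub>M\<^esub>i\<in>{a..b}. if ?j = i then \<zero>\<^bsub>M\<^esub> else y i)"
      have yi: "y i \<in> carrier M" if "i \<in> {a..b}" for i using YM[OF y(1)] that by auto
      have gG: "g \<in> G k" unfolding g_def by (rule GI) (use YV[OF y(1)] Yn[OF y(1)] V0 in auto)
      have gM: "g \<in> carrier M" "z \<in> carrier M" using gG submod(1)[OF sG] zV VM by auto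
      have "x = (\<Oplus>\<^bsub>M\<^esub>i\<in>{a..b}. (if ?j = i then z else \<zero>\<^bsub>M\<^esub>) \<oplus>\<^bsub>M\<^esub> (if ?j = i then \<zero>\<^bsub>M\<^esub> else y i))"
        unfolding y(2) by (rule M.finsum_cong') (use yi gM in \<open>auto simp: z_def\<close>)
      also have "\<dots> = z \<oplus>\<^bsub>M\<^esub> g" unfolding g_def
        by (subst M.finsum_addf) (use yi gM sing[OF j gM(2)] in auto)
      finally have x: "x = z \<oplus>\<^bsub>M\<^esub> g" .
      obtain c where c: "c \<in> {..<n} \<rightarrow>\<^sub>E carrier R" "z = (\<Oplus>\<^bsub>M\<lparr>carrier := V ?j\<rparr>\<^esub>i\<in>{..<n}. c i \<odot>\<^bsub>M\<^esub> e i)"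
        using ex[OF zV] by blast
      then have "\<forall>i. \<exists>t. i < n \<longrightarrow> \<theta> t = c i" using th_surj by (auto simp: PiE_def)
      then obtain t where t: "\<And>i. i < n \<Longrightarrow> \<theta> (t i) = c i" by metis
      have "z = l e t n" unfolding c(2) fl[symmetric]
        by (rule pv.M.finsum_cong') (use t in \<open>auto intro!: submod(4)[OF sV] funcset_mem[OF e] PiE_mem[OF c(1)]\<close>)
      then have "\<one> \<odot>\<^bsub>M\<^esub> x = l e t n \<oplus>\<^bsub>M\<^esub> g" using x gM by simp
      then show "\<exists>u\<in>carrier R - q. \<exists>c. \<exists>f\<in>G k. u \<odot>\<^bsub>M\<^esub> x = l e c n \<oplus>\<^bsub>M\<^esub> f" using one gG by blast
    qed auto
    then show ?thesis by blast
  qed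
  \<comment> \<open>The number of degrees in \<open>{a..b}\<close>; it is 0 when this interval is
    empty.\<close>
  define n where "n = nat (b + 1 - a)"
  have G0: "G 0 = {\<zero>\<^bsub>M\<^esub>}"
  proof -
    have "x = \<zero>\<^bsub>M\<^esub>" if x: "x \<in> G 0" for x
    proof -
      obtain y where y: "y \<in> Y 0" "x = (\<Oplus>\<^bsub>M\<^esub>i\<in>{a..b}. y i)" using x unfolding G_def by blast
      have "x = (\<Oplus>\<^bsub>M\<^esub>i\<in>{a..b}. \<zero>\<^bsub>M\<^esub>)" unfolding y(2) by (rule M.finsum_cong') (use Yn[OF y(1)] in auto)
      then show ?thesis by simp
    qed
    then show ?thesis using submod(2)[OF sG] by blast
  qed
  have Gn: "G n = carrier M"
  proof
    show "G n \<subseteq> carrier M" by (rule submod(1)[OF sG])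
    show "carrier M \<subseteq> G n"
    proof
      fix x assume "x \<in> carrier M"
      then obtain y where y: "y \<in> (\<Pi>\<^sub>E i\<in>{a..b}. V i)" "x = (\<Oplus>\<^bsub>M\<^esub>i\<in>{a..b}. y i)" using uniq by blast
      show "x \<in> G n" unfolding y(2) by (rule GI) (use y(1) in \<open>auto simp: n_def PiE_def split: if_splits\<close>)
    qed
  qed
  have "k \<le> n \<Longrightarrow> \<exists>m n. adap R M \<theta> d q (G k) m n" for k
  proof (induction k)
    case 0 then show ?case unfolding G0 using adap_0[OF q] by blast
  next
    case (Suc k)
    then obtain m n' where ad: "adap R M \<theta> d q (G k) m n'" by auto
    have "a + int k \<in> {a..b}" using Suc.prems unfolding n_def by auto
    from step[OF this] obtain e N I where rb: "rlocb R M \<theta> q (G k) (G (Suc k)) e N I" by blast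
    show ?case by (rule adap_step[OF q sG sG GG ad rb dG])
  qed
  from this[of n] show ?thesis unfolding Gn by simp
qed

end

section \<open>Localization\<close>

lemma (in cring) self_module: "module R (self_module R)"
proof (rule moduleI)
  show "cring R" by (rule is_cring)
  show "abelian_group (self_module R)"
  proof (rule abelian_groupI)
    show "\<exists>y\<in>carrier (self_module R). y \<oplus>\<^bsub>self_module R\<^esub> x = \<zero>\<^bsub>self_module R\<^esub>"
      if "x \<in> carrier (self_module R)" for x
      using that by (intro bexI[of _ "\<ominus> x"]) (auto simp: self_module_def l_neg)
  qed (auto simp: self_module_def a_ac)
qed (auto simp: self_module_def l_distr r_distr m_assoc)

locale loc_module = q: primeideal q R + M: module R M
  for q and R :: "('a, 'm) ring_scheme" (structure) and M :: "('a, 'b, 'n) module_scheme"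
begin

abbreviation fr where "fr \<equiv> loc_frac R q M"
abbreviation S where "S \<equiv> carrier R - q"
abbreviation Mq where "Mq \<equiv> module_at R q M"

lemma S_mult: "u \<in> S \<Longrightarrow> v \<in> S \<Longrightarrow> u \<otimes> v \<in> S"
  using q.I_prime by blast

lemma S_one: "\<one> \<in> S"
  using q.I_notcarr q.one_imp_carrier by blast

lemma fr_self: "m \<in> carrier M \<Longrightarrow> s \<in> S \<Longrightarrow> (m, s) \<in> fr m s"
  unfolding loc_frac_def using S_one by auto

lemma fr_mem: "(m', s') \<in> fr m s \<longleftrightarrow> m' \<in> carrier M \<and> s' \<in> S \<and> (\<exists>u\<in>S. u \<odot>\<^bsub>M\<^esub> (s' \<odot>\<^bsub>M\<^esub> m) = u \<odot>\<^bsub>M\<^esub> (s \<odot>\<^bsub>M\<^esub> m'))"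
  unfolding loc_frac_def by auto

lemma fr_sub:
  assumes m: "m \<in> carrier M" "m' \<in> carrier M" "s \<in> S" "s' \<in> S" and u: "u \<in> S" "u \<odot>\<^bsub>M\<^esub> (s' \<odot>\<^bsub>M\<^esub> m) = u \<odot>\<^bsub>M\<^esub> (s \<odot>\<^bsub>M\<^esub> m')"
  shows "fr m s \<subseteq> fr m' s'"
proof
  fix x assume "x \<in> fr m s"
  then obtain n t v where x: "x = (n, t)" "n \<in> carrier M" "t \<in> S" "v \<in> S" "v \<odot>\<^bsub>M\<^esub> (t \<odot>\<^bsub>M\<^esub> m) = v \<odot>\<^bsub>M\<^esub> (s \<odot>\<^bsub>M\<^esub> n)"
    unfolding loc_frac_def by auto
  let ?w = "v \<otimes> (u \<otimes> s)"
  have c: "s \<in> carrier R" "s' \<in> carrier R" "u \<in> carrier R" "t \<in> carrier R" "v \<in> carrier R" using assms x by auto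
  have "?w \<odot>\<^bsub>M\<^esub> (t \<odot>\<^bsub>M\<^esub> m') = (v \<otimes> t) \<odot>\<^bsub>M\<^esub> (u \<odot>\<^bsub>M\<^esub> (s \<odot>\<^bsub>M\<^esub> m'))"
    using c m by (simp add: q.m_ac flip: M.smult_assoc1)
  also have "\<dots> = (v \<otimes> t) \<odot>\<^bsub>M\<^esub> (u \<odot>\<^bsub>M\<^esub> (s' \<odot>\<^bsub>M\<^esub> m))" using u by simp
  also have "\<dots> = (u \<otimes> s') \<odot>\<^bsub>M\<^esub> (v \<odot>\<^bsub>M\<^esub> (t \<odot>\<^bsub>M\<^esub> m))" using c m by (simp add: q.m_ac flip: M.smult_assoc1)
  also have "\<dots> = (u \<otimes> s') \<odot>\<^bsub>M\<^esub> (v \<odot>\<^bsub>M\<^esub> (s \<odot>\<^bsub>M\<^esub> n))" using x by simp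
  also have "\<dots> = ?w \<odot>\<^bsub>M\<^esub> (s' \<odot>\<^bsub>M\<^esub> n)" using c x(2) by (simp add: q.m_ac flip: M.smult_assoc1)
  finally show "x \<in> fr m' s'" unfolding x(1) fr_mem using S_mult[OF x(4) S_mult[OF u(1) m(3)]] x by blast
qed

lemma fr_eq:
  assumes m: "m \<in> carrier M" "m' \<in> carrier M" "s \<in> S" "s' \<in> S"
  shows "fr m s = fr m' s' \<longleftrightarrow> (\<exists>u\<in>S. u \<odot>\<^bsub>M\<^esub> (s' \<odot>\<^bsub>M\<^esub> m) = u \<odot>\<^bsub>M\<^esub> (s \<odot>\<^bsub>M\<^esub> m'))"
proof
  assume "fr m s = fr m' s'"
  then have "(m', s') \<in> fr m s" using fr_self m by simp
  then show "\<exists>u\<in>S. u \<odot>\<^bsub>M\<^esub> (s' \<odot>\<^bsub>M\<^esub> m) = u \<odot>\<^bsub>M\<^esub> (s \<odot>\<^bsub>M\<^esub> m')" unfolding fr_mem by blast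
next
  assume "\<exists>u\<in>S. u \<odot>\<^bsub>M\<^esub> (s' \<odot>\<^bsub>M\<^esub> m) = u \<odot>\<^bsub>M\<^esub> (s \<odot>\<^bsub>M\<^esub> m')"
  then obtain u where "u \<in> S" "u \<odot>\<^bsub>M\<^esub> (s' \<odot>\<^bsub>M\<^esub> m) = u \<odot>\<^bsub>M\<^esub> (s \<odot>\<^bsub>M\<^esub> m')" by blast
  then show "fr m s = fr m' s'" using fr_sub[OF m] fr_sub[OF m(2,1,4,3)] by (metis subset_antisym)
qed

lemma fr_cancel:
  assumes "m \<in> carrier M" "s \<in> S" "t \<in> S"
  shows "fr (t \<odot>\<^bsub>M\<^esub> m) (t \<otimes> s) = fr m s"
proof -
  have "s \<odot>\<^bsub>M\<^esub> (t \<odot>\<^bsub>M\<^esub> m) = (t \<otimes> s) \<odot>\<^bsub>M\<^esub> m" using assms by (simp add: q.m_comm flip: M.smult_assoc1)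
  then show ?thesis using assms S_mult S_one by (subst fr_eq) auto
qed

lemma carrier_Mq: "carrier Mq = {fr m s |m s. m \<in> carrier M \<and> s \<in> S}"
  unfolding module_at_def by simp

lemma zero_Mq: "\<zero>\<^bsub>Mq\<^esub> = fr \<zero>\<^bsub>M\<^esub> \<one>"
  unfolding module_at_def by simp

lemma fr_Mq [simp]: "m \<in> carrier M \<Longrightarrow> s \<in> S \<Longrightarrow> fr m s \<in> carrier Mq"
  unfolding carrier_Mq by blast

text \<open>Equivalent representatives give equivalent results, so all sets in the defining union
  coincide, and the union collapses to the one for the given representatives.\<close>

lemma add_Mq:
  assumes "m \<in> carrier M" "s \<in> S" "n \<in> carrier M" "t \<in> S"
  shows "fr m s \<oplus>\<^bsub>Mq\<^esub> fr n t = fr (t \<odot>\<^bsub>M\<^esub> m \<oplus>\<^bsub>M\<^esub> s \<odot>\<^bsub>M\<^esub> n) (s \<otimes> t)"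
proof -
  have key: "fr (t' \<odot>\<^bsub>M\<^esub> m' \<oplus>\<^bsub>M\<^esub> s' \<odot>\<^bsub>M\<^esub> n') (s' \<otimes> t') = fr (t \<odot>\<^bsub>M\<^esub> m \<oplus>\<^bsub>M\<^esub> s \<odot>\<^bsub>M\<^esub> n) (s \<otimes> t)"
    if ms: "(m', s') \<in> fr m s" and nt: "(n', t') \<in> fr n t" for m' s' n' t'
  proof -
    from ms obtain u where u: "m' \<in> carrier M" "s' \<in> S" "u \<in> S" "u \<odot>\<^bsub>M\<^esub> (s' \<odot>\<^bsub>M\<^esub> m) = u \<odot>\<^bsub>M\<^esub> (s \<odot>\<^bsub>M\<^esub> m')" unfolding fr_mem by blast
    from nt obtain v where v: "n' \<in> carrier M" "t' \<in> S" "v \<in> S" "v \<odot>\<^bsub>M\<^esub> (t' \<odot>\<^bsub>M\<^esub> n) = v \<odot>\<^bsub>M\<^esub> (t \<odot>\<^bsub>M\<^esub> n')" unfolding fr_mem by blast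
    have c: "s \<in> carrier R" "t \<in> carrier R" "s' \<in> carrier R" "t' \<in> carrier R" "u \<in> carrier R" "v \<in> carrier R"
      using assms u v by auto
    let ?w = "u \<otimes> v"
    have "?w \<odot>\<^bsub>M\<^esub> ((s \<otimes> t) \<odot>\<^bsub>M\<^esub> (t' \<odot>\<^bsub>M\<^esub> m' \<oplus>\<^bsub>M\<^esub> s' \<odot>\<^bsub>M\<^esub> n')) =
      (v \<otimes> t \<otimes> t') \<odot>\<^bsub>M\<^esub> (u \<odot>\<^bsub>M\<^esub> (s \<odot>\<^bsub>M\<^esub> m')) \<oplus>\<^bsub>M\<^esub> (u \<otimes> s \<otimes> s') \<odot>\<^bsub>M\<^esub> (v \<odot>\<^bsub>M\<^esub> (t \<odot>\<^bsub>M\<^esub> n'))"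
      using c u(1) v(1) by (simp add: M.smult_r_distr q.m_ac flip: M.smult_assoc1)
    also have "\<dots> = (v \<otimes> t \<otimes> t') \<odot>\<^bsub>M\<^esub> (u \<odot>\<^bsub>M\<^esub> (s' \<odot>\<^bsub>M\<^esub> m)) \<oplus>\<^bsub>M\<^esub> (u \<otimes> s \<otimes> s') \<odot>\<^bsub>M\<^esub> (v \<odot>\<^bsub>M\<^esub> (t' \<odot>\<^bsub>M\<^esub> n))"
      unfolding u(4) v(4) ..
    also have "\<dots> = ?w \<odot>\<^bsub>M\<^esub> ((s' \<otimes> t') \<odot>\<^bsub>M\<^esub> (t \<odot>\<^bsub>M\<^esub> m \<oplus>\<^bsub>M\<^esub> s \<odot>\<^bsub>M\<^esub> n))"
      using c assms(1,3) by (simp add: M.smult_r_distr q.m_ac flip: M.smult_assoc1)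
    finally show ?thesis using assms u v c S_mult by (subst fr_eq) auto
  qed
  have "fr m s \<oplus>\<^bsub>Mq\<^esub> fr n t = (\<Union>(m', s')\<in>fr m s. \<Union>(n', t')\<in>fr n t. fr (t' \<odot>\<^bsub>M\<^esub> m' \<oplus>\<^bsub>M\<^esub> s' \<odot>\<^bsub>M\<^esub> n') (s' \<otimes> t'))"
    unfolding module_at_def by simp
  also have "\<dots> = (\<Union>x\<in>fr m s. \<Union>y\<in>fr n t. fr (t \<odot>\<^bsub>M\<^esub> m \<oplus>\<^bsub>M\<^esub> s \<odot>\<^bsub>M\<^esub> n) (s \<otimes> t))"
    by (intro SUP_cong refl) (auto simp: key)
  also have "\<dots> = fr (t \<odot>\<^bsub>M\<^esub> m \<oplus>\<^bsub>M\<^esub> s \<odot>\<^bsub>M\<^esub> n) (s \<otimes> t)"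
    using fr_self[OF assms(1,2)] fr_self[OF assms(3,4)] by blast
  finally show ?thesis .
qed

lemma add_Mq_same:
  assumes "m \<in> carrier M" "n \<in> carrier M" "s \<in> S"
  shows "fr m s \<oplus>\<^bsub>Mq\<^esub> fr n s = fr (m \<oplus>\<^bsub>M\<^esub> n) s"
  using add_Mq[of m s n s] fr_cancel[of "m \<oplus>\<^bsub>M\<^esub> n" s s] assms by (simp add: M.smult_r_distr)

abbreviation rf where "rf \<equiv> loc_frac R q (self_module R)"

lemma rf_mem: "(a', s') \<in> rf a s \<longleftrightarrow> a' \<in> carrier R \<and> s' \<in> S \<and> (\<exists>u\<in>S. u \<otimes> (s' \<otimes> a) = u \<otimes> (s \<otimes> a'))"
  unfolding loc_frac_def self_module_def by auto

lemma smult_Mq: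
  assumes "a \<in> carrier R" "s \<in> S" "n \<in> carrier M" "t \<in> S"
  shows "rf a s \<odot>\<^bsub>Mq\<^esub> fr n t = fr (a \<odot>\<^bsub>M\<^esub> n) (s \<otimes> t)"
proof -
  have key: "fr (a' \<odot>\<^bsub>M\<^esub> n') (s' \<otimes> t') = fr (a \<odot>\<^bsub>M\<^esub> n) (s \<otimes> t)"
    if as: "(a', s') \<in> rf a s" and nt: "(n', t') \<in> fr n t" for a' s' n' t'
  proof -
    from as obtain u where u: "a' \<in> carrier R" "s' \<in> S" "u \<in> S" "u \<otimes> (s' \<otimes> a) = u \<otimes> (s \<otimes> a')" unfolding rf_mem by blast
    from nt obtain v where v: "n' \<in> carrier M" "t' \<in> S" "v \<in> S" "v \<odot>\<^bsub>M\<^esub> (t' \<odot>\<^bsub>M\<^esub> n) = v \<odot>\<^bsub>M\<^esub> (t \<odot>\<^bsub>M\<^esub> n')" unfolding fr_mem by blast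
    have c: "s \<in> carrier R" "t \<in> carrier R" "s' \<in> carrier R" "t' \<in> carrier R" "u \<in> carrier R" "v \<in> carrier R"
      using assms u v by auto
    let ?w = "u \<otimes> v"
    have "?w \<odot>\<^bsub>M\<^esub> ((s \<otimes> t) \<odot>\<^bsub>M\<^esub> (a' \<odot>\<^bsub>M\<^esub> n')) = (u \<otimes> (s \<otimes> a')) \<odot>\<^bsub>M\<^esub> (v \<odot>\<^bsub>M\<^esub> (t \<odot>\<^bsub>M\<^esub> n'))"
      using c u(1) v(1) by (simp add: q.m_ac flip: M.smult_assoc1)
    also have "\<dots> = (u \<otimes> (s' \<otimes> a)) \<odot>\<^bsub>M\<^esub> (v \<odot>\<^bsub>M\<^esub> (t' \<odot>\<^bsub>M\<^esub> n))" unfolding u(4) v(4) ..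
    also have "\<dots> = ?w \<odot>\<^bsub>M\<^esub> ((s' \<otimes> t') \<odot>\<^bsub>M\<^esub> (a \<odot>\<^bsub>M\<^esub> n))"
      using c assms(1,3) by (simp add: q.m_ac flip: M.smult_assoc1)
    finally show ?thesis using assms u v c S_mult by (subst fr_eq) auto
  qed
  have ra: "(a, s) \<in> rf a s" unfolding rf_mem using assms S_one by auto
  have "rf a s \<odot>\<^bsub>Mq\<^esub> fr n t = (\<Union>(a', s')\<in>rf a s. \<Union>(n', t')\<in>fr n t. fr (a' \<odot>\<^bsub>M\<^esub> n') (s' \<otimes> t'))"
    unfolding module_at_def by simp
  also have "\<dots> = (\<Union>x\<in>rf a s. \<Union>y\<in>fr n t. fr (a \<odot>\<^bsub>M\<^esub> n) (s \<otimes> t))"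
    by (intro SUP_cong refl) (auto simp: key)
  also have "\<dots> = fr (a \<odot>\<^bsub>M\<^esub> n) (s \<otimes> t)"
    using ra fr_self[OF assms(3,4)] by blast
  finally show ?thesis .
qed

lemma abelian_monoid_Mq: "abelian_monoid Mq"
proof (rule abelian_monoidI)
  note cl = S_mult S_one
  show "\<zero>\<^bsub>Mq\<^esub> \<in> carrier Mq" unfolding zero_Mq using S_one by simp
  fix x y assume "x \<in> carrier Mq" "y \<in> carrier Mq"
  then obtain m s n t where xy: "x = fr m s" "m \<in> carrier M" "s \<in> S" "y = fr n t" "n \<in> carrier M" "t \<in> S"
    unfolding carrier_Mq by blast
  show "x \<oplus>\<^bsub>Mq\<^esub> y \<in> carrier Mq" unfolding xy(1,4) add_Mq[OF xy(2,3,5,6)] using xy S_mult by simp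
  show "x \<oplus>\<^bsub>Mq\<^esub> y = y \<oplus>\<^bsub>Mq\<^esub> x" unfolding xy(1,4) add_Mq[OF xy(2,3,5,6)] add_Mq[OF xy(5,6,2,3)]
    using xy by (simp add: M.a_comm q.m_comm)
  fix z assume "z \<in> carrier Mq"
  then obtain p r where z: "z = fr p r" "p \<in> carrier M" "r \<in> S" unfolding carrier_Mq by blast
  have 1: "t \<odot>\<^bsub>M\<^esub> m \<oplus>\<^bsub>M\<^esub> s \<odot>\<^bsub>M\<^esub> n \<in> carrier M" "s \<otimes> t \<in> S" using xy S_mult by auto
  have 2: "r \<odot>\<^bsub>M\<^esub> n \<oplus>\<^bsub>M\<^esub> t \<odot>\<^bsub>M\<^esub> p \<in> carrier M" "t \<otimes> r \<in> S" using xy z S_mult by auto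
  have c: "s \<in> carrier R" "t \<in> carrier R" "r \<in> carrier R" using xy z by auto
  show "x \<oplus>\<^bsub>Mq\<^esub> y \<oplus>\<^bsub>Mq\<^esub> z = x \<oplus>\<^bsub>Mq\<^esub> (y \<oplus>\<^bsub>Mq\<^esub> z)"
    unfolding xy(1,4) z(1) add_Mq[OF xy(2,3,5,6)] add_Mq[OF xy(5,6) z(2,3)] add_Mq[OF 1 z(2,3)] add_Mq[OF xy(2,3) 2]
    using c xy(2,5) z(2) by (simp add: M.smult_r_distr q.m_ac M.a_assoc flip: M.smult_assoc1)
next
  fix x assume "x \<in> carrier Mq"
  then obtain m s where x: "x = fr m s" "m \<in> carrier M" "s \<in> S" unfolding carrier_Mq by blast
  show "\<zero>\<^bsub>Mq\<^esub> \<oplus>\<^bsub>Mq\<^esub> x = x" unfolding zero_Mq x(1) using add_Mq[OF M.zero_closed S_one x(2,3)] x by simp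
qed

lemma support_iff: "carrier Mq \<noteq> {\<zero>\<^bsub>Mq\<^esub>} \<longleftrightarrow> (\<exists>m\<in>carrier M. \<forall>u\<in>S. u \<odot>\<^bsub>M\<^esub> m \<noteq> \<zero>\<^bsub>M\<^esub>)"
proof -
  have z: "fr m s = \<zero>\<^bsub>Mq\<^esub> \<longleftrightarrow> (\<exists>u\<in>S. u \<odot>\<^bsub>M\<^esub> m = \<zero>\<^bsub>M\<^esub>)" if "m \<in> carrier M" "s \<in> S" for m s
    unfolding zero_Mq using fr_eq[OF that(1) M.zero_closed that(2) S_one] that by auto
  have "\<zero>\<^bsub>Mq\<^esub> \<in> carrier Mq" unfolding zero_Mq using S_one by simp
  then have "carrier Mq \<noteq> {\<zero>\<^bsub>Mq\<^esub>} \<longleftrightarrow> (\<exists>x\<in>carrier Mq. x \<noteq> \<zero>\<^bsub>Mq\<^esub>)" by blast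
  also have "\<dots> \<longleftrightarrow> (\<exists>m\<in>carrier M. \<exists>s\<in>S. fr m s \<noteq> \<zero>\<^bsub>Mq\<^esub>)" unfolding carrier_Mq by blast
  also have "\<dots> \<longleftrightarrow> (\<exists>m\<in>carrier M. \<forall>u\<in>S. u \<odot>\<^bsub>M\<^esub> m \<noteq> \<zero>\<^bsub>M\<^esub>)" using z S_one by blast
  finally show ?thesis .
qed

end

section \<open>Common denominators\<close>

context loc_module
begin

text \<open>With one denominator for finitely many fractions, statements on sums over the localized
  ring turn into statements on combinations \<open>lc\<close>.\<close>

lemma fr_common:
  "(\<And>i. i < (n::nat) \<Longrightarrow> x i \<in> carrier Mq) \<Longrightarrow> \<exists>w m. w \<in> S \<and> (\<forall>i<n. m i \<in> carrier M \<and> x i = fr (m i) w)"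
proof (induction n)
  case 0 then show ?case using S_one by blast
next
  case (Suc n)
  have "\<exists>w m. w \<in> S \<and> (\<forall>i<n. m i \<in> carrier M \<and> x i = fr (m i) w)" by (rule Suc.IH) (use Suc.prems in simp)
  then obtain w m where w: "w \<in> S" "\<And>i. i < n \<Longrightarrow> m i \<in> carrier M" "\<And>i. i < n \<Longrightarrow> x i = fr (m i) w" by blast
  obtain y s where y: "y \<in> carrier M" "s \<in> S" "x n = fr y s" using Suc.prems[of n] unfolding carrier_Mq by auto
  define m' where "m' i = (if i < n then s \<odot>\<^bsub>M\<^esub> m i else w \<odot>\<^bsub>M\<^esub> y)" for i
  have "m' i \<in> carrier M \<and> x i = fr (m' i) (s \<otimes> w)" if "i < Suc n" for i
  proof (cases "i < n")
    case True
    then show ?thesis using w y fr_cancel[OF w(2)[OF True] w(1) y(2)] unfolding m'_def by auto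
  next
    case False
    then have "i = n" using that by simp
    moreover have "w \<otimes> s = s \<otimes> w" using w(1) y(2) by (simp add: q.m_comm)
    ultimately show ?thesis using w y fr_cancel[OF y(1,2) w(1)] unfolding m'_def by auto
  qed
  then show ?case using S_mult[OF y(2) w(1)] by blast
qed

lemma fr_zero: "s \<in> S \<Longrightarrow> fr \<zero>\<^bsub>M\<^esub> s = \<zero>\<^bsub>Mq\<^esub>"
  unfolding zero_Mq by (subst fr_eq) (use S_one in auto)

end

locale loc_ring = primeideal q R for q and R :: "('a, 'm) ring_scheme" (structure)

sublocale loc_ring \<subseteq> L: loc_module q R "self_module R"
  by (intro loc_module.intro self_module primeideal_axioms)

context loc_ring
begin

abbreviation rf where "rf \<equiv> loc_frac R q (self_module R)"
abbreviation A where "A \<equiv> ring_at R q"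

lemmas S_one = L.S_one and S_mult = L.S_mult

lemma self_simps [simp]: "carrier (self_module R) = carrier R" "a \<odot>\<^bsub>self_module R\<^esub> b = a \<otimes> b"
  "a \<oplus>\<^bsub>self_module R\<^esub> b = a \<oplus> b" "\<zero>\<^bsub>self_module R\<^esub> = \<zero>"
  unfolding self_module_def by simp_all

lemma carrier_A: "carrier A = {rf a s |a s. a \<in> carrier R \<and> s \<in> carrier R - q}"
  unfolding ring_at_def Let_def using L.carrier_Mq by simp

lemma rf_A [simp]: "a \<in> carrier R \<Longrightarrow> s \<in> carrier R - q \<Longrightarrow> rf a s \<in> carrier A"
  unfolding carrier_A by blast

lemma add_A: "a \<in> carrier R \<Longrightarrow> s \<in> carrier R - q \<Longrightarrow> b \<in> carrier R \<Longrightarrow> t \<in> carrier R - q \<Longrightarrow>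
    rf a s \<oplus>\<^bsub>A\<^esub> rf b t = rf (t \<otimes> a \<oplus> s \<otimes> b) (s \<otimes> t)"
  unfolding ring_at_def Let_def using L.add_Mq[of a s b t] by simp

lemma mult_A: "a \<in> carrier R \<Longrightarrow> s \<in> carrier R - q \<Longrightarrow> b \<in> carrier R \<Longrightarrow> t \<in> carrier R - q \<Longrightarrow>
    rf a s \<otimes>\<^bsub>A\<^esub> rf b t = rf (a \<otimes> b) (s \<otimes> t)"
  unfolding ring_at_def Let_def using L.smult_Mq[of a s b t] by simp

lemma zero_A: "\<zero>\<^bsub>A\<^esub> = rf \<zero> \<one>" and one_A: "\<one>\<^bsub>A\<^esub> = rf \<one> \<one>"
  unfolding ring_at_def Let_def using L.zero_Mq by simp_all

lemma rf_eq: "a \<in> carrier R \<Longrightarrow> s \<in> carrier R - q \<Longrightarrow> b \<in> carrier R \<Longrightarrow> t \<in> carrier R - q \<Longrightarrow>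
    rf a s = rf b t \<longleftrightarrow> (\<exists>u\<in>carrier R - q. u \<otimes> (t \<otimes> a) = u \<otimes> (s \<otimes> b))"
  using L.fr_eq[of a b s t] by simp

lemma rf_cancel: "a \<in> carrier R \<Longrightarrow> s \<in> carrier R - q \<Longrightarrow> t \<in> carrier R - q \<Longrightarrow> rf (t \<otimes> a) (t \<otimes> s) = rf a s"
  using L.fr_cancel[of a s t] by simp

end

section \<open>Free localizations and the rank\<close>

locale presented_loc = presented_module R \<theta> M + loc_module q R M
  for R :: "('a, 'm) ring_scheme" (structure) and \<theta> :: "'t::comm_ring_1 \<Rightarrow> 'a" and M :: "('a, 'b, 'n) module_scheme" and q
begin

sublocale A: loc_ring q R
  by (intro loc_ring.intro q.primeideal_axioms)

lemma sum_Mq: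
  assumes w: "w \<in> carrier R - q" "s \<in> carrier R - q"
  shows "(\<And>i. i < n \<Longrightarrow> m i \<in> carrier M) \<Longrightarrow>
    finsum Mq (\<lambda>i. rf (\<theta> (c i)) w \<odot>\<^bsub>Mq\<^esub> fr (m i) s) {..<n} = fr (l m c n) (w \<otimes> s)"
proof (induction n)
  case 0
  interpret Mq: abelian_monoid Mq by (rule abelian_monoid_Mq)
  show ?case using fr_zero[OF S_mult[OF w]] by simp
next
  case (Suc n)
  interpret Mq: abelian_monoid Mq by (rule abelian_monoid_Mq)
  have ws: "w \<otimes> s \<in> S" by (rule S_mult[OF w])
  have tm: "rf (\<theta> (c i)) w \<odot>\<^bsub>Mq\<^esub> fr (m i) s = fr (\<theta> (c i) \<odot>\<^bsub>M\<^esub> m i) (w \<otimes> s)" if "i < Suc n" for i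
    using smult_Mq[OF th_closed w(1) Suc.prems[OF that] w(2)] .
  have cl: "rf (\<theta> (c i)) w \<odot>\<^bsub>Mq\<^esub> fr (m i) s \<in> carrier Mq" if "i < Suc n" for i
    unfolding tm[OF that] using Suc.prems[OF that] ws by simp
  have "finsum Mq (\<lambda>i. rf (\<theta> (c i)) w \<odot>\<^bsub>Mq\<^esub> fr (m i) s) {..<Suc n} =
    rf (\<theta> (c n)) w \<odot>\<^bsub>Mq\<^esub> fr (m n) s \<oplus>\<^bsub>Mq\<^esub> finsum Mq (\<lambda>i. rf (\<theta> (c i)) w \<odot>\<^bsub>Mq\<^esub> fr (m i) s) {..<n}"
    unfolding lessThan_Suc by (rule Mq.finsum_insert) (auto intro!: cl)
  also have "\<dots> = fr (\<theta> (c n) \<odot>\<^bsub>M\<^esub> m n) (w \<otimes> s) \<oplus>\<^bsub>Mq\<^esub> fr (l m c n) (w \<otimes> s)"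
    using tm[of n] Suc by simp
  also have "\<dots> = fr (\<theta> (c n) \<odot>\<^bsub>M\<^esub> m n \<oplus>\<^bsub>M\<^esub> l m c n) (w \<otimes> s)"
    by (rule add_Mq_same) (use Suc.prems ws in auto)
  also have "\<theta> (c n) \<odot>\<^bsub>M\<^esub> m n \<oplus>\<^bsub>M\<^esub> l m c n = l m c (Suc n)"
    using Suc.prems l_closed[of n m c] by (simp add: M.a_comm)
  finally show ?case .
qed

lemma rf_common:
  assumes "c \<in> {..<n::nat} \<rightarrow> carrier (ring_at R q)"
  shows "\<exists>w t. w \<in> carrier R - q \<and> (\<forall>i<n. c i = rf (\<theta> (t i)) w)"
proof -
  have "c i \<in> carrier (module_at R q (self_module R))" if "i < n" for i
    using assms that unfolding ring_at_def by (auto simp: Let_def)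
  from A.L.fr_common[of n c, OF this] obtain w m where w: "w \<in> carrier R - q" "\<And>i. i < n \<Longrightarrow> m i \<in> carrier R \<and> c i = rf (m i) w"
    by auto
  have "\<forall>i. \<exists>t. i < n \<longrightarrow> \<theta> t = m i" using w(2) th_surj by blast
  then show ?thesis using w by metis
qed

lemma sum_Mq_cong:
  assumes "w \<in> carrier R - q" "s \<in> carrier R - q" "\<And>i. i < n \<Longrightarrow> m i \<in> carrier M"
    "\<And>i. i < n \<Longrightarrow> c i = rf (\<theta> (t i)) w" "\<And>i. i < n \<Longrightarrow> b i = fr (m i) s"
  shows "finsum Mq (\<lambda>i. c i \<odot>\<^bsub>Mq\<^esub> b i) {..<n} = fr (l m t n) (w \<otimes> s)"
proof -
  interpret Mq: abelian_monoid Mq by (rule abelian_monoid_Mq)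
  have "finsum Mq (\<lambda>i. c i \<odot>\<^bsub>Mq\<^esub> b i) {..<n} = finsum Mq (\<lambda>i. rf (\<theta> (t i)) w \<odot>\<^bsub>Mq\<^esub> fr (m i) s) {..<n}"
  proof (rule Mq.finsum_cong')
    show "(\<lambda>i. rf (\<theta> (t i)) w \<odot>\<^bsub>Mq\<^esub> fr (m i) s) \<in> {..<n} \<rightarrow> carrier Mq"
      using smult_Mq[OF th_closed assms(1,3,2)] S_mult[OF assms(1,2)] assms(3) by auto
  qed (use assms(4,5) in auto)
  then show ?thesis using sum_Mq[OF assms(1-3)] by simp
qed

text \<open>The fractions \<open>m i / 1\<close> form a basis. Coefficients arise by clearing
  denominators; two coefficient systems for the same element agree after multiplication by all
  denominators involved, by independence of \<open>m\<close>.\<close>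

lemma free_of_rank_at:
  assumes rb: "rlocb R M \<theta> q {\<zero>\<^bsub>M\<^esub>} (carrier M) m n UNIV"
  shows "free_of_rank (ring_at R q) Mq n"
  unfolding free_of_rank_def
proof (rule bexI[of _ "\<lambda>i. fr (m i) \<one>"], intro ballI)
  have mM: "m i \<in> carrier M" if "i < n" for i using rlocbD(1)[OF rb that] .
  show "(\<lambda>i. fr (m i) \<one>) \<in> {..<n} \<rightarrow> carrier Mq" using mM S_one by auto
  fix x assume "x \<in> carrier Mq"
  then obtain y s where x: "x = fr y s" "y \<in> carrier M" "s \<in> S" unfolding carrier_Mq by blast
  obtain u t where u: "u \<in> S" "u \<odot>\<^bsub>M\<^esub> y = l m t n" using rlocb0_span[OF rb order_refl x(2)] by blast
  have us: "u \<otimes> s \<in> S" "u \<otimes> s \<otimes> \<one> = u \<otimes> s" using S_mult[OF u(1) x(3)] by auto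
  define c where "c = (\<lambda>i\<in>{..<n}. rf (\<theta> (t i)) (u \<otimes> s))"
  have c: "c \<in> {..<n} \<rightarrow>\<^sub>E carrier (ring_at R q)" unfolding c_def using us by (auto intro!: A.rf_A)
  have "finsum Mq (\<lambda>i. c i \<odot>\<^bsub>Mq\<^esub> fr (m i) \<one>) {..<n} = fr (l m t n) (u \<otimes> s \<otimes> \<one>)"
    by (rule sum_Mq_cong) (use us S_one mM in \<open>auto simp: c_def\<close>)
  also have "\<dots> = x" unfolding us(2) x(1) u(2)[symmetric] by (rule fr_cancel[OF x(2,3) u(1)])
  finally have cx: "finsum Mq (\<lambda>i. c i \<odot>\<^bsub>Mq\<^esub> fr (m i) \<one>) {..<n} = x" .
  show "\<exists>!c. c \<in> {..<n} \<rightarrow>\<^sub>E carrier (ring_at R q) \<and> x = finsum Mq (\<lambda>i. c i \<odot>\<^bsub>Mq\<^esub> fr (m i) \<one>) {..<n}"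
  proof (rule ex1I[of _ c])
    show "c \<in> {..<n} \<rightarrow>\<^sub>E carrier (ring_at R q) \<and> x = finsum Mq (\<lambda>i. c i \<odot>\<^bsub>Mq\<^esub> fr (m i) \<one>) {..<n}" using c cx by simp
    fix c' assume c': "c' \<in> {..<n} \<rightarrow>\<^sub>E carrier (ring_at R q) \<and> x = finsum Mq (\<lambda>i. c' i \<odot>\<^bsub>Mq\<^esub> fr (m i) \<one>) {..<n}"
    obtain w t' where w: "w \<in> S" "\<And>i. i < n \<Longrightarrow> c' i = rf (\<theta> (t' i)) w" using rf_common[of c' n] c' by (auto simp: PiE_def)
    have "finsum Mq (\<lambda>i. c' i \<odot>\<^bsub>Mq\<^esub> fr (m i) \<one>) {..<n} = fr (l m t' n) (w \<otimes> \<one>)"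
      by (rule sum_Mq_cong) (use w S_one mM in auto)
    then have "fr (l m t' n) w = fr y s" using c' w x(1) by simp
    then obtain v where v: "v \<in> S" "v \<odot>\<^bsub>M\<^esub> (s \<odot>\<^bsub>M\<^esub> l m t' n) = v \<odot>\<^bsub>M\<^esub> (w \<odot>\<^bsub>M\<^esub> y)"
      using fr_eq[of "l m t' n" y w s] l_closed[of n m t'] mM w x by auto
    have lM: "l m t' n \<in> carrier M" "l m t n \<in> carrier M" using l_closed mM by auto
    obtain \<upsilon> \<sigma> \<omega> \<mu> where g: "\<theta> \<upsilon> = u" "\<theta> \<sigma> = s" "\<theta> \<omega> = w" "\<theta> \<mu> = v" using th_surj u(1) x(3) w(1) v(1) by (meson DiffD1)
    have cc: "u \<in> carrier R" "s \<in> carrier R" "w \<in> carrier R" "v \<in> carrier R" using u x w v by auto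
    have "l m (\<lambda>i. (\<mu> * \<upsilon> * \<sigma>) * t' i) n = (v \<otimes> u \<otimes> s) \<odot>\<^bsub>M\<^esub> l m t' n"
      using l_smult[of n m "\<mu> * \<upsilon> * \<sigma>" t'] mM by (simp add: th_mult g)
    also have "\<dots> = u \<odot>\<^bsub>M\<^esub> (v \<odot>\<^bsub>M\<^esub> (s \<odot>\<^bsub>M\<^esub> l m t' n))" using cc lM by (simp add: m_ac flip: M.smult_assoc1)
    also have "\<dots> = (v \<otimes> w) \<odot>\<^bsub>M\<^esub> (u \<odot>\<^bsub>M\<^esub> y)" unfolding v(2) using cc x(2) by (simp add: m_ac flip: M.smult_assoc1)
    also have "\<dots> = l m (\<lambda>i. (\<mu> * \<omega>) * t i) n" using u(2) l_smult[of n m "\<mu> * \<omega>" t] mM by (simp add: th_mult g)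
    finally have eq: "l m (\<lambda>i. (\<mu> * \<upsilon> * \<sigma>) * t' i) n = l m (\<lambda>i. (\<mu> * \<omega>) * t i) n" .
    have "l m (\<lambda>i. (\<mu> * \<upsilon> * \<sigma>) * t' i + (- 1) * ((\<mu> * \<omega>) * t i)) n =
      l m (\<lambda>i. (\<mu> * \<upsilon> * \<sigma>) * t' i) n \<oplus>\<^bsub>M\<^esub> l m (\<lambda>i. (- 1) * ((\<mu> * \<omega>) * t i)) n" by (rule l_add) (rule mM)
    also have "l m (\<lambda>i. (- 1) * ((\<mu> * \<omega>) * t i)) n = (\<ominus> \<one>) \<odot>\<^bsub>M\<^esub> l m (\<lambda>i. (\<mu> * \<omega>) * t i) n"
      using l_smult[of n m "- 1" "\<lambda>i. (\<mu> * \<omega>) * t i"] mM by (simp add: th_minus th_one)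
    also have "l m (\<lambda>i. (\<mu> * \<upsilon> * \<sigma>) * t' i) n \<oplus>\<^bsub>M\<^esub> \<dots> = \<zero>\<^bsub>M\<^esub>"
      unfolding eq using l_closed[of n m "\<lambda>i. (\<mu> * \<omega>) * t i"] mM by (simp add: M.smult_l_minus M.r_neg)
    finally have z: "\<theta> ((\<mu> * \<upsilon> * \<sigma>) * t' i + (- 1) * ((\<mu> * \<omega>) * t i)) = \<zero>" if "i < n" for i
      using rlocbD(3)[OF rb _ that] by simp
    have "c' i = c i" if i: "i < n" for i
    proof -
      have "\<theta> ((\<mu> * \<upsilon> * \<sigma>) * t' i) \<ominus> \<theta> ((\<mu> * \<omega>) * t i) = \<zero>" using z[OF i] by (simp add: th_diff)
      then have "\<theta> ((\<mu> * \<upsilon> * \<sigma>) * t' i) = \<theta> ((\<mu> * \<omega>) * t i)" by (subst (asm) r_right_minus_eq) simp_all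
      then have "v \<otimes> (u \<otimes> s \<otimes> \<theta> (t' i)) = v \<otimes> (w \<otimes> \<theta> (t i))" using cc by (simp add: th_mult g m_assoc)
      then have "rf (\<theta> (t' i)) w = rf (\<theta> (t i)) (u \<otimes> s)" using A.rf_eq[of "\<theta> (t' i)" w "\<theta> (t i)" "u \<otimes> s"] w(1) us(1) v(1) by auto
      then show ?thesis using w(2)[OF i] i unfolding c_def by simp
    qed
    then show "c' = c" using c c' by (intro PiE_ext[of c' "{..<n}" _ c]) auto
  qed
qed

text \<open>The converse translation, which makes the number in \<open>module_rank\<close> unique: a
  rank satisfying the definition is the size of a local basis.\<close>

lemma rlocb_of_free:
  assumes dom: "domain R" and fr: "free_of_rank (ring_at R q) Mq n"
  shows "\<exists>m. rlocb R M \<theta> q {\<zero>\<^bsub>M\<^esub>} (carrier M) m n UNIV"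
proof -
  interpret dom: domain R by fact
  interpret Mq: abelian_monoid Mq by (rule abelian_monoid_Mq)
  have zq: "\<zero> \<in> q" by (rule q.zero_closed)
  from fr[unfolded free_of_rank_def] obtain b where b: "b \<in> {..<n} \<rightarrow> carrier Mq" and
    ex0: "\<forall>x\<in>carrier Mq. \<exists>!c. c \<in> {..<n} \<rightarrow>\<^sub>E carrier (ring_at R q) \<and> x = finsum Mq (\<lambda>i. c i \<odot>\<^bsub>Mq\<^esub> b i) {..<n}" by (rule bexE)
  have ex: "\<And>x. x \<in> carrier Mq \<Longrightarrow> \<exists>!c. c \<in> {..<n} \<rightarrow>\<^sub>E carrier (ring_at R q) \<and> x = finsum Mq (\<lambda>i. c i \<odot>\<^bsub>Mq\<^esub> b i) {..<n}"
    using ex0 by (rule bspec)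
  obtain s m where s: "s \<in> S" and mM: "\<And>i. i < n \<Longrightarrow> m i \<in> carrier M" and bm: "\<And>i. i < n \<Longrightarrow> b i = fr (m i) s"
  proof -
    have "b i \<in> carrier Mq" if "i < n" for i using b that by blast
    from fr_common[of n b, OF this] obtain w m' where "w \<in> S \<and> (\<forall>i<n. m' i \<in> carrier M \<and> b i = fr (m' i) w)" by blast
    then show thesis using that by blast
  qed
  have "rlocb R M \<theta> q {\<zero>\<^bsub>M\<^esub>} (carrier M) m n UNIV" unfolding rlocb_def
  proof (intro conjI allI impI ballI)
    show "m i \<in> carrier M" if "i < n" for i by (rule mM[OF that])
  next
    fix c i assume lz: "l m c n \<in> {\<zero>\<^bsub>M\<^esub>}" and i: "i < n"
    let ?e = "\<lambda>c. \<lambda>i\<in>{..<n}. rf (\<theta> (c i)) \<one>"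
    have e: "?e c \<in> {..<n} \<rightarrow>\<^sub>E carrier (ring_at R q)" for c using S_one by (auto intro!: A.rf_A)
    have sum: "finsum Mq (\<lambda>i. ?e c i \<odot>\<^bsub>Mq\<^esub> b i) {..<n} = fr (l m c n) (\<one> \<otimes> s)" for c
      by (rule sum_Mq_cong) (use S_one s mM bm in auto)
    have "l m (\<lambda>_. 0) n = \<zero>\<^bsub>M\<^esub>" by (rule l_ker) (use mM in auto)
    then have eq: "fr (l m c n) (\<one> \<otimes> s) = \<zero>\<^bsub>Mq\<^esub>" "fr (l m (\<lambda>_. 0) n) (\<one> \<otimes> s) = \<zero>\<^bsub>Mq\<^esub>"
      using lz fr_zero s by auto
    have "?e c = ?e (\<lambda>_. 0)"
    proof (rule ex1_eqI[OF ex[OF Mq.zero_closed]])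
      show "?e c \<in> {..<n} \<rightarrow>\<^sub>E carrier (ring_at R q) \<and> \<zero>\<^bsub>Mq\<^esub> = finsum Mq (\<lambda>i. ?e c i \<odot>\<^bsub>Mq\<^esub> b i) {..<n}"
        unfolding sum eq using e by blast
      show "?e (\<lambda>_. 0) \<in> {..<n} \<rightarrow>\<^sub>E carrier (ring_at R q) \<and> \<zero>\<^bsub>Mq\<^esub> = finsum Mq (\<lambda>i. ?e (\<lambda>_. 0) i \<odot>\<^bsub>Mq\<^esub> b i) {..<n}"
        unfolding sum[of "\<lambda>_. 0"] eq(2) using e[of "\<lambda>_. 0"] by blast
    qed
    from fun_cong[OF this, of i] i have "rf (\<theta> (c i)) \<one> = rf (\<theta> 0) \<one>" by simp
    then obtain u where u: "u \<in> S" "u \<otimes> (\<one> \<otimes> \<theta> (c i)) = u \<otimes> (\<one> \<otimes> \<theta> 0)"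
      using A.rf_eq[of "\<theta> (c i)" \<one> "\<theta> 0" \<one>] S_one by auto
    then have "u \<otimes> \<theta> (c i) = \<zero>" "u \<noteq> \<zero>" using zq by auto
    then show "\<theta> (c i) = \<zero>" using dom.integral[of u "\<theta> (c i)"] u(1) by auto
  next
    fix y assume y: "y \<in> carrier M"
    then obtain c where c: "c \<in> {..<n} \<rightarrow>\<^sub>E carrier (ring_at R q)" "fr y \<one> = finsum Mq (\<lambda>i. c i \<odot>\<^bsub>Mq\<^esub> b i) {..<n}"
      using ex[OF fr_Mq[OF y S_one]] by blast
    obtain w t where w: "w \<in> S" "\<And>i. i < n \<Longrightarrow> c i = rf (\<theta> (t i)) w" using rf_common[of c n] c(1) by (auto simp: PiE_def)
    have lM: "l m t n \<in> carrier M" using l_closed mM by auto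
    have ws: "w \<otimes> s \<in> S" by (rule S_mult[OF w(1) s])
    have "fr y \<one> = fr (l m t n) (w \<otimes> s)" unfolding c(2) by (rule sum_Mq_cong) (use w s mM bm in auto)
    then obtain u where u: "u \<in> S" "u \<odot>\<^bsub>M\<^esub> ((w \<otimes> s) \<odot>\<^bsub>M\<^esub> y) = u \<odot>\<^bsub>M\<^esub> (\<one> \<odot>\<^bsub>M\<^esub> l m t n)"
      using fr_eq[OF y lM S_one ws] by blast
    obtain \<upsilon> where g: "\<theta> \<upsilon> = u" using th_surj u(1) by blast
    have "l m (\<lambda>i. \<upsilon> * t i) n = u \<odot>\<^bsub>M\<^esub> l m t n" using l_smult[of n m \<upsilon> t] mM g by simp
    moreover have "(u \<otimes> (w \<otimes> s)) \<odot>\<^bsub>M\<^esub> y = u \<odot>\<^bsub>M\<^esub> ((w \<otimes> s) \<odot>\<^bsub>M\<^esub> y)" using u(1) ws y by (simp add: M.smult_assoc1)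
    ultimately have "(u \<otimes> (w \<otimes> s)) \<odot>\<^bsub>M\<^esub> y = l m (\<lambda>i. \<upsilon> * t i) n \<oplus>\<^bsub>M\<^esub> \<zero>\<^bsub>M\<^esub>" using u lM by simp
    then show "\<exists>u\<in>carrier R - q. \<exists>c. \<exists>f\<in>{\<zero>\<^bsub>M\<^esub>}. u \<odot>\<^bsub>M\<^esub> y = l m c n \<oplus>\<^bsub>M\<^esub> f" using S_mult[OF u(1) ws] by blast
  qed auto
  then show ?thesis by blast
qed

end

text \<open>\<open>local_rank_le\<close>, used in both directions, compares the local bases at any
  two primes; this yields existence and uniqueness for the \<open>THE\<close> in the
  definition.\<close>

lemma (in presented_module) module_rank_eq:
  assumes dom: "domain R" and rb: "\<And>q. primeideal q R \<Longrightarrow> \<exists>m n. rlocb R M \<theta> q {\<zero>\<^bsub>M\<^esub>} (carrier M) m n UNIV"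
    and q: "primeideal q R" and n: "rlocb R M \<theta> q {\<zero>\<^bsub>M\<^esub>} (carrier M) m n UNIV"
  shows "module_rank R M = n"
  unfolding module_rank_def
proof (rule the_equality, intro allI impI)
  have loc: "presented_loc R \<theta> M p" if "primeideal p R" for p
    by (intro presented_loc.intro presented_module_axioms loc_module.intro that M.module_axioms)
  show "free_of_rank (ring_at R p) (module_at R p M) n" if p: "primeideal p R" for p
  proof -
    obtain m' n' where rb': "rlocb R M \<theta> p {\<zero>\<^bsub>M\<^esub>} (carrier M) m' n' UNIV" using rb[OF p] by blast
    have "n' = n" using local_rank_le[OF dom q n rb'] local_rank_le[OF dom p rb' n] by simp
    then show ?thesis using presented_loc.free_of_rank_at[OF loc[OF p] rb'] by simp
  qed
  fix k assume k: "\<forall>p. primeideal p R \<longrightarrow> free_of_rank (ring_at R p) (module_at R p M) k"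
  then obtain m' where rb': "rlocb R M \<theta> q {\<zero>\<^bsub>M\<^esub>} (carrier M) m' k UNIV"
    using presented_loc.rlocb_of_free[OF loc[OF q] dom] q by blast
  show "k = n" using local_rank_le[OF dom q n rb'] local_rank_le[OF dom q rb' n] by simp
qed

section \<open>Heights and generators\<close>

lemma prime_chain_le:
  assumes "prime_chain R c n" "i \<le> j" "j \<le> n"
  shows "c i \<subseteq> c j"
  using assms(2,3)
proof (induction j)
  case (Suc j)
  then show ?case using assms(1) unfolding prime_chain_def by (cases "i = Suc j") (auto simp: le_Suc_eq less_eq_Suc_le)
qed simp

lemma prime_chain_height: "prime_chain R c n \<Longrightarrow> c n = q \<Longrightarrow> enat n \<le> height R q"
  unfolding height_def by (rule Sup_upper) blast

text \<open>A finite supremum of a nonempty set in \<open>enat\<close> is a maximum, so it is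
  attained by a chain.\<close>

lemma height_chain:
  assumes q: "primeideal q R" and h: "height R q = enat n"
  shows "\<exists>c. prime_chain R c n \<and> c n = q"
proof -
  let ?H = "{enat n |n. \<exists>c. prime_chain R c n \<and> c n = q}"
  have "prime_chain R (\<lambda>_. q) 0" unfolding prime_chain_def using q by simp
  then have ne: "?H \<noteq> {}" by blast
  have S: "Sup ?H = enat n" using h unfolding height_def .
  then have fin: "finite ?H" using ne unfolding Sup_enat_def by (metis enat.distinct(1))
  have "Sup ?H = Max ?H" using ne fin by (simp only: Sup_enat_def if_True if_False)
  then have "Sup ?H \<in> ?H" using Max_in[OF fin ne] by (simp only:)
  then show ?thesis unfolding S by auto
qed

lemma height_less:
  assumes p: "primeideal p R" and q: "primeideal q R" and pq: "p \<subset> q" and h: "height R q = enat n"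
  shows "height R p < enat n"
proof -
  have Suc: "Suc k \<le> n" if c: "prime_chain R c k" "c k = p" for c k
  proof -
    have "prime_chain R (\<lambda>i. if i \<le> k then c i else q) (Suc k)"
      unfolding prime_chain_def
    proof (intro conjI allI impI)
      show "primeideal (if i \<le> k then c i else q) R" for i using c(1) q unfolding prime_chain_def by simp
      show "(if i \<le> k then c i else q) \<subset> (if Suc i \<le> k then c (Suc i) else q)" if "i < Suc k" for i
        using c pq that unfolding prime_chain_def by (cases "i = k") simp_all
    qed
    then have "enat (Suc k) \<le> height R q" by (rule prime_chain_height) simp
    then show ?thesis using h by simp
  qed
  have "prime_chain R (\<lambda>_. p) 0" unfolding prime_chain_def using p by simp
  then have "Suc 0 \<le> n" using Suc[of "\<lambda>_. p" 0] by simp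
  then have "enat (n - 1) < enat n" by simp
  moreover have "height R p \<le> enat (n - 1)" unfolding height_def
  proof (rule Sup_least)
    fix x assume "x \<in> {enat n |n. \<exists>c. prime_chain R c n \<and> c n = p}"
    then obtain k c where x: "x = enat k" "prime_chain R c k" "c k = p" by blast
    show "x \<le> enat (n - 1)" using Suc[OF x(2,3)] x(1) by simp
  qed
  ultimately show ?thesis by (rule le_less_trans[rotated])
qed

text \<open>A chain of primes of maximal length ending at \<open>q\<close> has no gaps, so
  \<open>growth_Suc\<close> applies to each of its \<open>n\<close> steps.\<close>

lemma (in presented) growth_height:
  assumes noeth: "noetherian_ring R" and q: "primeideal q R" and h: "height R q = enat n"
  shows "growth ker (\<theta> -` q) n"
proof -
  obtain c where c: "prime_chain R c n" "c n = q" using height_chain[OF q h] by blast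
  have pc: "primeideal (c i) R" if "i \<le> n" for i using c(1) that unfolding prime_chain_def by blast
  have sc: "c i \<subset> c (Suc i)" if "i < n" for i using c(1) that unfolding prime_chain_def by blast
  have cR: "c i \<subseteq> carrier R" if "i \<le> n" for i by (rule subsetI, rule ideal.Icarr[OF primeideal.axioms(1)[OF pc[OF that]]])
  have cK: "ker \<subseteq> \<theta> -` c i" if "i \<le> n" for i by (rule pre_ideal(2)[OF primeideal.axioms(1)[OF pc[OF that]]])
  have adj: "p = c (Suc i)" if i: "i < n" and p: "primeideal p R" "c i \<subset> p" "p \<subseteq> c (Suc i)" for i p
  proof (rule ccontr)
    assume "p \<noteq> c (Suc i)"
    then have pl: "p \<subset> c (Suc i)" using p by blast
    \<comment> \<open>Inserting \<open>p\<close> after position \<open>i\<close> would give a chain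
      longer than the height.\<close>
    define e where "e j = (if j \<le> i then c j else if j = Suc i then p else c (j - 1))" for j
    have "prime_chain R e (Suc n)" unfolding prime_chain_def
    proof (intro conjI allI impI)
      show "primeideal (e j) R" if "j \<le> Suc n" for j using that pc p(1) i unfolding e_def by auto
      fix j assume j: "j < Suc n"
      consider "j < i" | "j = i" | "j = Suc i" | "Suc i < j" by linarith
      then show "e j \<subset> e (Suc j)"
      proof cases
        case 1 then show ?thesis using sc[of j] i unfolding e_def by simp
      next
        case 2 then show ?thesis using p(2) unfolding e_def by simp
      next
        case 3 then show ?thesis using pl unfolding e_def by simp
      next
        case 4 then show ?thesis using sc[of "j - 1"] j unfolding e_def by simp
      qed
    qed
    moreover have "e (Suc n) = q" using i c(2) unfolding e_def by simp
    ultimately have "enat (Suc n) \<le> height R q" by (rule prime_chain_height)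
    then show False using h by simp
  qed
  have "i \<le> n \<Longrightarrow> growth ker (\<theta> -` c i) i" for i
  proof (induction i)
    case 0
    show ?case by (rule growth_0[OF pre_prime[OF pc] cK]) simp_all
  next
    case (Suc i)
    then have i: "i < n" "i \<le> n" "Suc i \<le> n" by auto
    have sub: "\<theta> -` c i \<subset> \<theta> -` c (Suc i)"
    proof -
      obtain x where x: "x \<in> c (Suc i)" "x \<notin> c i" using sc[OF i(1)] by blast
      obtain t where "\<theta> t = x" using th_surj[of x] cR[OF i(3)] x(1) by blast
      then have "t \<in> \<theta> -` c (Suc i)" "t \<notin> \<theta> -` c i" using x by auto
      moreover have "\<theta> -` c i \<subseteq> \<theta> -` c (Suc i)" using sc[OF i(1)] by (intro vimage_mono) blast
      ultimately show ?thesis by blast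
    qed
    show ?case
    proof (rule growth_Suc[OF th_c2 acc_ker[OF noeth] Suc.IH[OF i(2)] pre_prime[OF pc[OF i(2)]] pre_prime[OF pc[OF i(3)]] cK[OF i(2)] sub])
      fix p assume p: "is_prime p" "\<theta> -` c i \<subset> p" "p \<subseteq> \<theta> -` c (Suc i)"
      have kp: "ker \<subseteq> p" using cK[OF i(2)] p(2) by blast
      have "is_ideal p" using p(1) unfolding is_prime_def by blast
      note mem = im_mem[OF this kp]
      have "c i \<subset> \<theta> ` p"
      proof
        show "c i \<subseteq> \<theta> ` p" using im_pre[OF cR[OF i(2)]] p(2) by blast
        obtain t where "t \<in> p" "\<theta> t \<notin> c i" using p(2) by blast
        then show "c i \<noteq> \<theta> ` p" by blast
      qed
      then have "\<theta> ` p = c (Suc i)" using adj[OF i(1) im_prime[OF p(1) kp]] p(3) by blast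
      then show "p = \<theta> -` c (Suc i)" using mem by blast
    qed
  qed
  from this[of n] show ?thesis using c(2) by simp
qed

section \<open>Primes and the maximal ideal of the localized ring\<close>

context loc_ring
begin

text \<open>Extension of an ideal to the localized ring; \<open>con\<close> is the
  contraction.\<close>

definition ext :: "'a set \<Rightarrow> ('a \<times> 'a) set set"
  where "ext p = {rf a s |a s. a \<in> p \<and> s \<in> carrier R - q}"

definition con :: "('a \<times> 'a) set set \<Rightarrow> 'a set"
  where "con J = {a \<in> carrier R. rf a \<one> \<in> J}"

lemma rf_self: "s \<in> carrier R - q \<Longrightarrow> rf s s = \<one>\<^bsub>A\<^esub>"
  unfolding one_A using rf_cancel[of \<one> \<one> s] S_one by simp

lemma rf_zero: "s \<in> carrier R - q \<Longrightarrow> rf \<zero> s = \<zero>\<^bsub>A\<^esub>"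
  unfolding zero_A by (subst rf_eq) (use S_one in auto)

lemma ext_ideal:
  assumes A: "cring A" and p: "ideal p R"
  shows "ideal (ext p) A"
proof -
  interpret A: cring A by fact
  interpret p: ideal p R by fact
  have pR: "a \<in> carrier R" if "a \<in> p" for a using p.Icarr[OF that] .
  have sub: "ext p \<subseteq> carrier A" unfolding ext_def using pR by auto
  show ?thesis
  proof (rule idealI[OF A.ring_axioms])
    show "subgroup (ext p) (add_monoid A)"
    proof (rule subgroup.intro)
      show "ext p \<subseteq> carrier (add_monoid A)" using sub by simp
      show "x \<otimes>\<^bsub>add_monoid A\<^esub> y \<in> ext p" if xy: "x \<in> ext p" "y \<in> ext p" for x y
      proof -
        obtain a s b t where h: "x = rf a s" "a \<in> p" "s \<in> carrier R - q" "y = rf b t" "b \<in> p" "t \<in> carrier R - q"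
          using xy unfolding ext_def by blast
        have "t \<otimes> a \<oplus> s \<otimes> b \<in> p" using h by (intro p.a_closed p.I_l_closed) auto
        moreover have "x \<otimes>\<^bsub>add_monoid A\<^esub> y = rf (t \<otimes> a \<oplus> s \<otimes> b) (s \<otimes> t)"
          unfolding h(1,4) using add_A[OF pR[OF h(2)] h(3) pR[OF h(5)] h(6)] by simp
        ultimately show ?thesis unfolding ext_def using S_mult[OF h(3,6)] by blast
      qed
      have "rf \<zero> \<one> \<in> ext p" unfolding ext_def using p.zero_closed S_one by blast
      then show "\<one>\<^bsub>add_monoid A\<^esub> \<in> ext p" using zero_A by simp
      show "inv\<^bsub>add_monoid A\<^esub> x \<in> ext p" if x: "x \<in> ext p" for x
      proof -
        obtain a s where h: "x = rf a s" "a \<in> p" "s \<in> carrier R - q" using x unfolding ext_def by blast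
        have "rf (\<ominus> a) s \<oplus>\<^bsub>A\<^esub> rf a s = rf (s \<otimes> \<ominus> a \<oplus> s \<otimes> a) (s \<otimes> s)"
          by (rule add_A) (use h pR in auto)
        also have "s \<otimes> \<ominus> a \<oplus> s \<otimes> a = \<zero>" using h pR by (simp add: l_neg flip: r_distr)
        also have "rf \<zero> (s \<otimes> s) = \<zero>\<^bsub>A\<^esub>" by (rule rf_zero) (rule S_mult[OF h(3,3)])
        finally have "\<ominus>\<^bsub>A\<^esub> x = rf (\<ominus> a) s" unfolding h(1) by (rule A.minus_equality) (use h pR in auto)
        then show ?thesis unfolding a_inv_def[symmetric] ext_def using h by auto
      qed
    qed
    fix x y assume "x \<in> ext p" "y \<in> carrier A"
    then obtain a s b t where h: "x = rf a s" "a \<in> p" "s \<in> carrier R - q" "y = rf b t" "b \<in> carrier R" "t \<in> carrier R - q"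
      unfolding ext_def carrier_A by blast
    have "y \<otimes>\<^bsub>A\<^esub> x = rf (b \<otimes> a) (t \<otimes> s)" unfolding h(1,4) by (rule mult_A) (use h pR in auto)
    then show yx: "y \<otimes>\<^bsub>A\<^esub> x \<in> ext p" unfolding ext_def using p.I_l_closed[OF h(2,5)] S_mult[OF h(6,3)] by blast
    have "x \<otimes>\<^bsub>A\<^esub> y = y \<otimes>\<^bsub>A\<^esub> x" by (rule A.m_comm) (use h pR in auto)
    then show "x \<otimes>\<^bsub>A\<^esub> y \<in> ext p" using yx by simp
  qed
qed

lemma rf_ext:
  assumes p: "primeideal p R" "p \<subseteq> q" and a: "a \<in> carrier R" "s \<in> carrier R - q"
  shows "rf a s \<in> ext p \<longleftrightarrow> a \<in> p"
proof
  interpret p: primeideal p R by fact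
  assume "rf a s \<in> ext p"
  then obtain b t where b: "rf a s = rf b t" "b \<in> p" "t \<in> carrier R - q" unfolding ext_def by blast
  have bR: "b \<in> carrier R" using p.Icarr[OF b(2)] .
  from b(1) obtain u where u: "u \<in> carrier R - q" "u \<otimes> (t \<otimes> a) = u \<otimes> (s \<otimes> b)" using rf_eq[OF a bR b(3)] by blast
  have "u \<otimes> (s \<otimes> b) \<in> p" using u(1) a(2) b(2) by (intro p.I_l_closed) auto
  then have "(u \<otimes> t) \<otimes> a \<in> p" using u a b(3) by (simp add: m_assoc)
  moreover have "u \<otimes> t \<notin> p" using S_mult[OF u(1) b(3)] p(2) by blast
  ultimately show "a \<in> p" using p.I_prime[of "u \<otimes> t" a] u(1) b(3) a(1) by blast
next
  show "rf a s \<in> ext p" if "a \<in> p" unfolding ext_def using that a(2) by blast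
qed

lemma ext_prime:
  assumes A: "cring A" and p: "primeideal p R" "p \<subseteq> q"
  shows "primeideal (ext p) A"
proof -
  interpret p: primeideal p R by fact
  show ?thesis
  proof (rule primeidealI[OF ext_ideal[OF A p.is_ideal] A])
    have "\<one> \<notin> p" using p(2) S_one by blast
    then have "\<one>\<^bsub>A\<^esub> \<notin> ext p" unfolding one_A using rf_ext[OF p] S_one by simp
    then show "carrier A \<noteq> ext p" using cring.axioms(1)[OF A] by (metis ring.ring_simprules(6))
    fix x y assume xy: "x \<in> carrier A" "y \<in> carrier A" "x \<otimes>\<^bsub>A\<^esub> y \<in> ext p"
    then obtain a s b t where h: "x = rf a s" "a \<in> carrier R" "s \<in> carrier R - q" "y = rf b t" "b \<in> carrier R" "t \<in> carrier R - q"
      unfolding carrier_A by blast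
    have "rf (a \<otimes> b) (s \<otimes> t) \<in> ext p" using xy(3) unfolding h(1,4) mult_A[OF h(2,3,5,6)] .
    then have "a \<otimes> b \<in> p" using rf_ext[OF p _ S_mult[OF h(3,6)], of "a \<otimes> b"] h by simp
    then have "a \<in> p \<or> b \<in> p" using p.I_prime h by blast
    then show "x \<in> ext p \<or> y \<in> ext p" using rf_ext[OF p h(2,3)] rf_ext[OF p h(5,6)] h by blast
  qed
qed

lemma rf_con:
  assumes J: "ideal J A" and a: "a \<in> carrier R" "s \<in> carrier R - q"
  shows "rf a s \<in> J \<longleftrightarrow> rf a \<one> \<in> J"
proof
  interpret J: ideal J A by fact
  assume h: "rf a s \<in> J"
  have "rf s \<one> \<otimes>\<^bsub>A\<^esub> rf a s = rf (s \<otimes> a) (s \<otimes> \<one>)" using mult_A[OF _ S_one a, of s] a by simp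
  also have "\<dots> = rf a \<one>" by (rule rf_cancel[OF a(1) S_one a(2)])
  finally show "rf a \<one> \<in> J" using J.I_l_closed[OF h, of "rf s \<one>"] a S_one by simp
next
  interpret J: ideal J A by fact
  assume h: "rf a \<one> \<in> J"
  have "rf \<one> s \<otimes>\<^bsub>A\<^esub> rf a \<one> = rf a s" using mult_A[OF _ a(2) a(1) S_one, of \<one>] a by simp
  then show "rf a s \<in> J" using J.I_l_closed[OF h, of "rf \<one> s"] a by simp
qed

lemma proper_rf:
  assumes J: "ideal J A" "J \<noteq> carrier A" and a: "a \<in> carrier R" "s \<in> carrier R - q" "rf a s \<in> J"
  shows "a \<in> q"
proof (rule ccontr)
  interpret J: ideal J A by fact
  assume "a \<notin> q"
  then have aS: "a \<in> carrier R - q" using a by blast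
  have "rf a a \<in> J" using rf_con[OF J(1) a(1,2)] rf_con[OF J(1) a(1) aS] a(3) by blast
  then have "\<one>\<^bsub>A\<^esub> \<in> J" using rf_self[OF aS] by simp
  then show False using J.one_imp_carrier J(2) by blast
qed

lemma con_prime:
  assumes J: "primeideal J A"
  shows "primeideal (con J) R" "con J \<subseteq> q"
proof -
  interpret J: primeideal J A by fact
  have one: "\<one> \<in> carrier R - q" by (rule S_one)
  show sub: "con J \<subseteq> q" unfolding con_def
    using proper_rf[OF J.is_ideal J.I_notcarr[symmetric] _ one] by blast
  have m1: "rf a \<one> \<otimes>\<^bsub>A\<^esub> rf b \<one> = rf (a \<otimes> b) \<one>" if "a \<in> carrier R" "b \<in> carrier R" for a b
    using mult_A[OF that(1) one that(2) one] by simp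
  have p1: "rf a \<one> \<oplus>\<^bsub>A\<^esub> rf b \<one> = rf (a \<oplus> b) \<one>" if "a \<in> carrier R" "b \<in> carrier R" for a b
    using add_A[OF that(1) one that(2) one] that by simp
  have mc: "x \<otimes> a \<in> con J" if "a \<in> con J" "x \<in> carrier R" for a x
    using that J.I_l_closed[of "rf a \<one>" "rf x \<one>"] m1[of x a] one unfolding con_def by auto
  have id: "ideal (con J) R"
  proof (rule idealI[OF ring_axioms])
    show "subgroup (con J) (add_monoid R)"
    proof (rule subgroup.intro)
      show "con J \<subseteq> carrier (add_monoid R)" unfolding con_def by auto
      show "x \<otimes>\<^bsub>add_monoid R\<^esub> y \<in> con J" if "x \<in> con J" "y \<in> con J" for x y
      proof -
        have xy: "x \<in> carrier R" "y \<in> carrier R" "rf x \<one> \<in> J" "rf y \<one> \<in> J" using that unfolding con_def by auto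
        have "rf (x \<oplus> y) \<one> \<in> J" using additive_subgroup.a_closed[OF J.additive_subgroup_axioms xy(3,4)] unfolding p1[OF xy(1,2)] .
        then show ?thesis using xy unfolding con_def by simp
      qed
      have "rf \<zero> \<one> \<in> J" using additive_subgroup.zero_closed[OF J.additive_subgroup_axioms] unfolding zero_A by simp
      then show "\<one>\<^bsub>add_monoid R\<^esub> \<in> con J" unfolding con_def by simp
      show "inv\<^bsub>add_monoid R\<^esub> x \<in> con J" if x: "x \<in> con J" for x
      proof -
        have xR: "x \<in> carrier R" using x unfolding con_def by blast
        have "\<ominus> x = \<ominus> \<one> \<otimes> x" using xR by (simp add: l_minus)
        then show ?thesis using mc[OF x, of "\<ominus> \<one>"] unfolding a_inv_def[symmetric] by simp
      qed
    qed
    fix a x assume a: "a \<in> con J" "x \<in> carrier R"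
    show "x \<otimes> a \<in> con J" by (rule mc[OF a])
    then show "a \<otimes> x \<in> con J" using a m_comm[of a x] unfolding con_def by simp
  qed
  show "primeideal (con J) R"
  proof (rule primeidealI[OF id is_cring])
    show "carrier R \<noteq> con J" using sub S_one by blast
    fix a b assume ab: "a \<in> carrier R" "b \<in> carrier R" "a \<otimes> b \<in> con J"
    then have "rf a \<one> \<otimes>\<^bsub>A\<^esub> rf b \<one> \<in> J" using m1[OF ab(1,2)] unfolding con_def by simp
    then have "rf a \<one> \<in> J \<or> rf b \<one> \<in> J" using J.I_prime[of "rf a \<one>" "rf b \<one>"] ab one by simp
    then show "a \<in> con J \<or> b \<in> con J" using ab unfolding con_def by blast
  qed
qed

lemma con_strict:
  assumes "ideal I A" "ideal J A" "I \<subset> J"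
  shows "con I \<subset> con J"
proof
  show "con I \<subseteq> con J" using assms(3) unfolding con_def by blast
  obtain x where x: "x \<in> J" "x \<notin> I" using assms(3) by blast
  then have "x \<in> carrier A" using ideal.Icarr[OF assms(2)] by blast
  then obtain a s where a: "x = rf a s" "a \<in> carrier R" "s \<in> carrier R - q" unfolding carrier_A by blast
  then have "a \<in> con J" "a \<notin> con I" using rf_con[OF assms(1) a(2,3)] rf_con[OF assms(2) a(2,3)] x unfolding con_def by auto
  then show "con I \<noteq> con J" by blast
qed

lemma krull_dim_at:
  assumes A: "cring A"
  shows "krull_dim A = height R q"
proof (rule antisym)
  show "krull_dim A \<le> height R q" unfolding krull_dim_def
  proof (rule Sup_least)
    fix x assume "x \<in> {enat n |n. \<exists>c. prime_chain A c n}"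
    then obtain n c where x: "x = enat n" and c: "\<And>i. i \<le> n \<Longrightarrow> primeideal (c i) A" "\<And>i. i < n \<Longrightarrow> c i \<subset> c (Suc i)"
      unfolding prime_chain_def by blast
    have cs: "con (c i) \<subset> con (c (Suc i))" if "i < n" for i
      using con_strict c primeideal.axioms(1) that by (metis Suc_leI less_imp_le_nat)
    \<comment> \<open>Only chains that end at \<open>q\<close> count for the height, so the last
      contraction is replaced by \<open>q\<close>; the earlier ones lie strictly below it.\<close>
    define e where "e i = (if i < n then con (c i) else q)" for i
    have "prime_chain R e n" unfolding prime_chain_def
    proof (intro conjI allI impI)
      show "primeideal (e i) R" if "i \<le> n" for i
        using con_prime(1)[OF c(1)[OF that]] primeideal_axioms unfolding e_def by simp
      show "e i \<subset> e (Suc i)" if "i < n" for i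
        using cs[OF that] con_prime(2)[OF c(1)[of "Suc i"]] that unfolding e_def by auto
    qed
    then have "enat n \<le> height R q" by (rule prime_chain_height) (simp add: e_def)
    then show "x \<le> height R q" using x by simp
  qed
  show "height R q \<le> krull_dim A" unfolding height_def
  proof (rule Sup_least)
    fix x assume "x \<in> {enat n |n. \<exists>c. prime_chain R c n \<and> c n = q}"
    then obtain n c where x: "x = enat n" and pc: "prime_chain R c n" "c n = q" by blast
    have c: "primeideal (c i) R" "c i \<subseteq> q" if "i \<le> n" for i
      using pc prime_chain_le[OF pc(1) that] that unfolding prime_chain_def by auto
    have "prime_chain A (\<lambda>i. ext (c i)) n" unfolding prime_chain_def
    proof (intro conjI allI impI)
      show "primeideal (ext (c i)) A" if "i \<le> n" for i by (rule ext_prime[OF A c[OF that]])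
      fix i assume i: "i < n"
      then have s: "c i \<subset> c (Suc i)" using pc(1) unfolding prime_chain_def by blast
      then obtain a where a: "a \<in> c (Suc i)" "a \<notin> c i" by blast
      have "a \<in> carrier R" using Icarr c(2)[of "Suc i"] a(1) i by auto
      then have "rf a \<one> \<in> ext (c (Suc i))" "rf a \<one> \<notin> ext (c i)"
        using rf_ext[OF c[of "Suc i"] _ S_one, of a] rf_ext[OF c[of i] _ S_one, of a] a i by auto
      then show "ext (c i) \<subset> ext (c (Suc i))" using s unfolding ext_def by blast
    qed
    then show "x \<le> krull_dim A" unfolding x krull_dim_def by (intro Sup_upper) blast
  qed
qed

lemma ext_maximal:
  assumes A: "cring A"
  shows "maximalideal (ext q) A"
proof -
  interpret E: primeideal "ext q" A by (rule ext_prime[OF A primeideal_axioms order_refl])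
  show ?thesis
  proof (rule maximalidealI[OF E.is_ideal E.I_notcarr])
    fix J assume J: "ideal J A" "ext q \<subseteq> J" "J \<subseteq> carrier A"
    show "J = ext q \<or> J = carrier A"
    proof (rule disjCI)
      assume n: "J \<noteq> carrier A"
      have "x \<in> ext q" if x: "x \<in> J" for x
      proof -
        obtain a s where a: "x = rf a s" "a \<in> carrier R" "s \<in> carrier R - q" using x J(3) unfolding carrier_A by blast
        then have "a \<in> q" using proper_rf[OF J(1) n a(2,3)] x by simp
        then show ?thesis unfolding a(1) ext_def using a(3) by blast
      qed
      then show "J = ext q" using J(2) by blast
    qed
  qed
qed

end

text \<open>The maximal ideal of the localized ring is generated by as many elements as its
  dimension, which is the height of \<open>q\<close>. Numerators of these generators, lifted to the
  presenting ring, generate the preimage of \<open>q\<close> up to saturation and the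
  kernel.\<close>

lemma regular_generators:
  fixes R :: "('a, 'm) ring_scheme" (structure) and \<theta> :: "'t::comm_ring_1 \<Rightarrow> 'a"
  assumes pr: "presented R \<theta>" and dom: "primeideal q R" and reg: "regular_local_ring (ring_at R q)"
  shows "\<exists>c E. height R q = enat c \<and> finite E \<and> card E \<le> c \<and> E \<subseteq> \<theta> -` q \<and>
    \<theta> -` q \<subseteq> lhull (\<theta> -` q) (*) (E \<union> presented.ker R \<theta>)"
proof -
  interpret presented R \<theta> by fact
  interpret L: loc_ring q R by (rule loc_ring.intro) fact
  let ?A = "ring_at R q" and ?Q = "\<theta> -` q"
  have A: "cring ?A" using reg unfolding regular_local_ring_def by blast
  interpret A: cring ?A by (rule A)
  obtain mm S where mm: "\<And>I. maximalideal I ?A \<longleftrightarrow> I = mm" and S: "S \<subseteq> carrier ?A" "finite S" "enat (card S) = krull_dim ?A" "Idl\<^bsub>?A\<^esub> S = mm"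
    using reg unfolding regular_local_ring_def by blast
  have mq: "mm = L.ext q" using mm L.ext_maximal[OF A] by blast
  have Sm: "S \<subseteq> L.ext q" using A.genideal_self[OF S(1)] S(4) mq by simp
  have "\<exists>t s. x = loc_frac R q (self_module R) (\<theta> t) s \<and> \<theta> t \<in> q \<and> s \<in> carrier R - q" if x: "x \<in> S" for x
  proof -
    obtain a s where a: "x = loc_frac R q (self_module R) a s" "a \<in> q" "s \<in> carrier R - q" using Sm x unfolding L.ext_def by blast
    then show ?thesis using th_surj[OF L.Icarr[OF a(2)]] by blast
  qed
  then obtain \<tau> \<sigma> where ts: "\<And>x. x \<in> S \<Longrightarrow> x = loc_frac R q (self_module R) (\<theta> (\<tau> x)) (\<sigma> x)"
    "\<And>x. x \<in> S \<Longrightarrow> \<theta> (\<tau> x) \<in> q" "\<And>x. x \<in> S \<Longrightarrow> \<sigma> x \<in> carrier R - q" by metis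
  let ?E = "\<tau> ` S" and ?N = "lhull ?Q (*) (\<tau> ` S \<union> ker)"
  have lN: "lsub ?Q (*) ?N" by (rule lsub_lhull)
  have iN: "is_ideal ?N" by (rule lsub_ideal[OF lN])
  have EN: "\<tau> ` S \<union> ker \<subseteq> ?N" by (rule lhull_superset)
  have "S \<subseteq> L.ext (\<theta> ` ?N)"
  proof
    fix x assume x: "x \<in> S"
    have "\<theta> (\<tau> x) \<in> \<theta> ` ?N" using EN x by blast
    then show "x \<in> L.ext (\<theta> ` ?N)" unfolding L.ext_def using ts(1)[OF x] ts(3)[OF x] by blast
  qed
  then have "Idl\<^bsub>?A\<^esub> S \<subseteq> L.ext (\<theta> ` ?N)"
    by (rule A.genideal_minimal[OF L.ext_ideal[OF A im_ideal[OF iN]]])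
  then have "L.ext q \<subseteq> L.ext (\<theta> ` ?N)" unfolding S(4) mq .
  then have QN: "?Q \<subseteq> ?N"
  proof (intro subsetI)
    fix t assume sub: "L.ext q \<subseteq> L.ext (\<theta> ` ?N)" and t: "t \<in> ?Q"
    have "loc_frac R q (self_module R) (\<theta> t) \<one> \<in> L.ext q" unfolding L.ext_def using t L.S_one by blast
    then obtain t' s where t': "loc_frac R q (self_module R) (\<theta> t) \<one> = loc_frac R q (self_module R) (\<theta> t') s" "t' \<in> ?N" "s \<in> carrier R - q"
      using sub unfolding L.ext_def by blast
    then obtain u where u: "u \<in> carrier R - q" "u \<otimes> (s \<otimes> \<theta> t) = u \<otimes> (\<one> \<otimes> \<theta> t')"
      using L.rf_eq[OF th_closed L.S_one th_closed t'(3)] by blast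
    obtain \<upsilon> \<omega> where g: "\<theta> \<upsilon> = u" "\<theta> \<omega> = s" using th_surj u(1) t'(3) by (meson DiffD1)
    have "\<theta> ((\<upsilon> * \<omega>) * t) = \<theta> (\<upsilon> * t')" using u t'(3) by (simp add: th_mult g m_assoc)
    then have "\<theta> ((\<upsilon> * \<omega>) * t - \<upsilon> * t') = \<zero>" by (simp add: th_diff r_neg minus_eq)
    then have "(\<upsilon> * \<omega>) * t - \<upsilon> * t' \<in> ?N" using EN unfolding ker_def by blast
    then have "((\<upsilon> * \<omega>) * t - \<upsilon> * t') + \<upsilon> * t' \<in> ?N" by (rule lsubD(2)[OF lN]) (rule lsubD(3)[OF lN t'(2)])
    then have "(\<upsilon> * \<omega>) * t \<in> ?N" by simp
    moreover have "\<upsilon> * \<omega> \<notin> ?Q" using L.S_mult[OF u(1) t'(3)] by (simp add: th_mult g)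
    ultimately show "t \<in> ?N" using lsubD(4)[OF lN] by blast
  qed
  have "height R q = enat (card S)" using L.krull_dim_at[OF A] S(3) by simp
  moreover have "card ?E \<le> card S" "finite ?E" using S(2) card_image_le by auto
  moreover have "?E \<subseteq> ?Q" using ts(2) by auto
  ultimately show ?thesis using QN by blast
qed

section \<open>The rank inequality\<close>

lemma homology_module:
  assumes df: "differential_module R M d"
  shows "module R (homology M d)"
    "carrier (homology M d) = (\<lambda>z. d ` carrier M +>\<^bsub>M\<lparr>carrier := {x \<in> carrier M. d x = \<zero>\<^bsub>M\<^esub>}\<rparr>\<^esub> z) ` {x \<in> carrier M. d x = \<zero>\<^bsub>M\<^esub>}"
    "\<lbrakk>z \<in> carrier M; d z = \<zero>\<^bsub>M\<^esub>; r \<in> carrier R\<rbrakk> \<Longrightarrow>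
      r \<odot>\<^bsub>homology M d\<^esub> (d ` carrier M +>\<^bsub>M\<lparr>carrier := {x \<in> carrier M. d x = \<zero>\<^bsub>M\<^esub>}\<rparr>\<^esub> z) = \<zero>\<^bsub>homology M d\<^esub> \<longleftrightarrow>
      r \<odot>\<^bsub>M\<^esub> z \<in> d ` carrier M"
proof -
  interpret M: module R M using df unfolding differential_module_def by blast
  have dM: "d x \<in> carrier M" if "x \<in> carrier M" for x using df that unfolding differential_module_def by blast
  have dadd: "d (x \<oplus>\<^bsub>M\<^esub> y) = d x \<oplus>\<^bsub>M\<^esub> d y" if "x \<in> carrier M" "y \<in> carrier M" for x y
    using df that unfolding differential_module_def by blast
  have dsm: "d (r \<odot>\<^bsub>M\<^esub> x) = r \<odot>\<^bsub>M\<^esub> d x" if "r \<in> carrier R" "x \<in> carrier M" for r x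
    using df that unfolding differential_module_def by blast
  have dd: "d (d x) = \<zero>\<^bsub>M\<^esub>" if "x \<in> carrier M" for x using df that unfolding differential_module_def by blast
  have d0: "d \<zero>\<^bsub>M\<^esub> = \<zero>\<^bsub>M\<^esub>" using dadd[of "\<zero>\<^bsub>M\<^esub>" "\<zero>\<^bsub>M\<^esub>"] dM[of "\<zero>\<^bsub>M\<^esub>"] by (simp add: M.add.l_cancel_one)
  let ?Z = "{x \<in> carrier M. d x = \<zero>\<^bsub>M\<^esub>}" and ?B = "d ` carrier M"
  have neg: "\<ominus>\<^bsub>M\<^esub> x = (\<ominus>\<^bsub>R\<^esub> \<one>\<^bsub>R\<^esub>) \<odot>\<^bsub>M\<^esub> x" if "x \<in> carrier M" for x using M.smult_l_minus[of "\<one>\<^bsub>R\<^esub>" x] that by simp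
  have sZ: "submodule ?Z R M"
  proof (rule M.submoduleI)
    show "\<ominus>\<^bsub>M\<^esub> x \<in> ?Z" if "x \<in> ?Z" for x using that dsm[of "\<ominus>\<^bsub>R\<^esub> \<one>\<^bsub>R\<^esub>" x] neg[of x] by simp
  qed (auto simp: d0 dadd dsm)
  have zB: "\<zero>\<^bsub>M\<^esub> \<in> ?B" by (rule image_eqI[of _ _ "\<zero>\<^bsub>M\<^esub>"]) (simp_all add: d0)
  have sB: "submodule ?B R M"
  proof (rule M.submoduleI)
    show "?B \<subseteq> carrier M" using dM by blast
    show "\<zero>\<^bsub>M\<^esub> \<in> ?B" by (rule zB)
    show sm: "r \<odot>\<^bsub>M\<^esub> x \<in> ?B" if "r \<in> carrier R" "x \<in> ?B" for r x using that by (auto simp flip: dsm)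
    show "x \<oplus>\<^bsub>M\<^esub> y \<in> ?B" if "x \<in> ?B" "y \<in> ?B" for x y using that by (auto simp flip: dadd)
    show "\<ominus>\<^bsub>M\<^esub> x \<in> ?B" if "x \<in> ?B" for x
    proof -
      have "x \<in> carrier M" using that dM by blast
      then show ?thesis using sm[OF _ that, of "\<ominus>\<^bsub>R\<^esub> \<one>\<^bsub>R\<^esub>"] neg[of x] by simp
    qed
  qed
  let ?MZ = "M\<lparr>carrier := ?Z\<rparr>"
  have mZ: "module R ?MZ" by (rule submodule.submodule_is_module[OF sZ M.module_axioms])
  interpret MZ: module R ?MZ by (rule mZ)
  have BZ: "?B \<subseteq> ?Z" using dM dd by blast
  have sBZ: "submodule ?B R ?MZ"
  proof (rule MZ.submoduleI)
    show "?B \<subseteq> carrier ?MZ" using BZ by simp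
    show "\<zero>\<^bsub>?MZ\<^esub> \<in> ?B" using zB by simp
    show sm: "r \<odot>\<^bsub>?MZ\<^esub> x \<in> ?B" if "r \<in> carrier R" "x \<in> ?B" for r x using that by (auto simp flip: dsm)
    show "x \<oplus>\<^bsub>?MZ\<^esub> y \<in> ?B" if "x \<in> ?B" "y \<in> ?B" for x y using that by (auto simp flip: dadd)
    show "\<ominus>\<^bsub>?MZ\<^esub> x \<in> ?B" if "x \<in> ?B" for x
    proof -
      have "x \<in> carrier ?MZ" using that BZ by auto
      then have "\<ominus>\<^bsub>?MZ\<^esub> x = (\<ominus>\<^bsub>R\<^esub> \<one>\<^bsub>R\<^esub>) \<odot>\<^bsub>M\<^esub> x" using MZ.smult_l_minus[of "\<one>\<^bsub>R\<^esub>" x] by simp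
      then show ?thesis using sm[OF _ that, of "\<ominus>\<^bsub>R\<^esub> \<one>\<^bsub>R\<^esub>"] by simp
    qed
  qed
  note qm = quot_module[OF mZ sBZ]
  show "module R (homology M d)" unfolding homology_def by (rule qm(1))
  show "carrier (homology M d) = (\<lambda>z. ?B +>\<^bsub>?MZ\<^esub> z) ` ?Z" unfolding homology_def using qm(2) by simp
  show "r \<odot>\<^bsub>homology M d\<^esub> (?B +>\<^bsub>?MZ\<^esub> z) = \<zero>\<^bsub>homology M d\<^esub> \<longleftrightarrow> r \<odot>\<^bsub>M\<^esub> z \<in> ?B"
    if z: "z \<in> carrier M" "d z = \<zero>\<^bsub>M\<^esub>" and r: "r \<in> carrier R"
  proof -
    have zz: "z \<in> carrier ?MZ" using z by simp
    have "r \<odot>\<^bsub>?MZ\<^esub> z \<in> carrier ?MZ" by (rule MZ.smult_closed[OF r zz])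
    then show ?thesis unfolding homology_def qm(5)[OF r zz, symmetric] using qm(6) by simp
  qed
qed

lemma homology_support:
  assumes df: "differential_module R M d" and q: "primeideal q R"
  shows "q \<in> module_support R (homology M d) \<longleftrightarrow>
    (\<exists>z\<in>carrier M. d z = \<zero>\<^bsub>M\<^esub> \<and> (\<forall>u\<in>carrier R - q. u \<odot>\<^bsub>M\<^esub> z \<notin> d ` carrier M))"
proof -
  note hm = homology_module[OF df]
  interpret H: loc_module q R "homology M d" by (intro loc_module.intro q hm(1))
  show ?thesis unfolding module_support_def using q H.support_iff hm(3) unfolding hm(2) by auto
qed

lemma (in noetherian_ring) maximal_ideal_exists:
  assumes I: "ideal I R" "I \<noteq> carrier R"
  shows "\<exists>q. maximalideal q R \<and> I \<subseteq> q"
proof -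
  let ?A = "{J. ideal J R \<and> I \<subseteq> J \<and> J \<noteq> carrier R}"
  have "\<exists>M\<in>?A. \<forall>J\<in>?A. M \<subseteq> J \<longrightarrow> J = M"
  proof (rule subset_Zorn)
    fix C assume C: "subset.chain ?A C"
    show "\<exists>U\<in>?A. \<forall>J\<in>C. J \<subseteq> U"
    proof (cases "C = {}")
      case True then show ?thesis using I by blast
    next
      case False
      have "subset.chain {J. ideal J R} C" using C unfolding subset_chain_def by blast
      then have "\<Union>C \<in> C" by (rule ideal_chain_is_trivial[OF False])
      moreover have "C \<subseteq> ?A" using C unfolding subset_chain_def by blast
      ultimately have "\<Union>C \<in> ?A" by (rule rev_subsetD)
      then show ?thesis by (rule rev_bexI) (rule ballI, rule Union_upper)
    qed
  qed
  then obtain M where MA: "M \<in> ?A" and mx: "\<forall>J\<in>?A. M \<subseteq> J \<longrightarrow> J = M" by (rule bexE)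
  have M: "ideal M R" "I \<subseteq> M" "M \<noteq> carrier R" using MA by simp_all
  have max: "J = M" if "ideal J R" "I \<subseteq> J" "J \<noteq> carrier R" "M \<subseteq> J" for J
    using mx[rule_format, of J] that by simp
  have "maximalideal M R"
  proof (rule maximalidealI[OF M(1)])
    show "carrier R \<noteq> M" using M(3) by blast
    show "J = M \<or> J = carrier R" if "ideal J R" "M \<subseteq> J" for J
      using max[OF that(1) order_trans[OF M(2) that(2)] _ that(2)] by blast
  qed
  then show ?thesis using M(2) by blast
qed

text \<open>The annihilator of a nonzero class is a proper ideal, and a maximal ideal above it
  belongs to the support.\<close>

lemma homology_support_nonempty:
  assumes noeth: "noetherian_ring R" and df: "differential_module R M d" and ne: "carrier (homology M d) \<noteq> {\<zero>\<^bsub>homology M d\<^esub>}"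
  shows "module_support R (homology M d) \<noteq> {}"
proof -
  note hm = homology_module[OF df]
  interpret H: module R "homology M d" by (rule hm(1))
  have "\<exists>h\<in>carrier (homology M d). h \<noteq> \<zero>\<^bsub>homology M d\<^esub>" using ne H.zero_closed by blast
  then obtain h where h: "h \<in> carrier (homology M d)" "h \<noteq> \<zero>\<^bsub>homology M d\<^esub>" by blast
  define I where "I = {r \<in> carrier R. r \<odot>\<^bsub>homology M d\<^esub> h = \<zero>\<^bsub>homology M d\<^esub>}"
  have I: "ideal I R"
  proof (rule idealI)
    show "ring R" by (rule H.R.ring_axioms)
    show "subgroup I (add_monoid R)"
    proof (rule subgroup.intro)
      show "inv\<^bsub>add_monoid R\<^esub> x \<in> I" if "x \<in> I" for x
        using that h(1) unfolding a_inv_def[symmetric] I_def by (simp add: H.smult_l_minus)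
    qed (use h(1) in \<open>auto simp: I_def H.smult_l_distr\<close>)
    fix a x assume ax: "a \<in> I" "x \<in> carrier R"
    show "x \<otimes>\<^bsub>R\<^esub> a \<in> I" using ax h(1) unfolding I_def by (simp add: H.smult_assoc1)
    then show "a \<otimes>\<^bsub>R\<^esub> x \<in> I" using ax H.R.m_comm[of a x] unfolding I_def by simp
  qed
  have "\<one>\<^bsub>R\<^esub> \<notin> I" using h unfolding I_def by simp
  then have "I \<noteq> carrier R" by auto
  then obtain q where q: "maximalideal q R" "I \<subseteq> q" using noetherian_ring.maximal_ideal_exists[OF noeth I] by blast
  have p: "primeideal q R" by (rule H.R.maximalideal_prime[OF q(1)])
  interpret H': loc_module q R "homology M d" by (intro loc_module.intro p hm(1))
  have "q \<in> module_support R (homology M d)" unfolding module_support_def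
    using p h(1) q(2) unfolding H'.support_iff mem_Collect_eq I_def by blast
  then show ?thesis by blast
qed

section \<open>From an adapted local basis to the inequality for matrices\<close>

context presented_module
begin

text \<open>The localized differential module is put into the matrix form of \<open>dmod\<close>.
  Minimality of the height confines the homology, after localization, to \<open>q\<close> alone,
  which provides the torsion hypothesis of \<open>rank_bound\<close>.\<close>

theorem two_power_le:
  assumes dom: "domain R" and noeth: "noetherian_ring R" and df: "differential_module R M d"
    and q: "q \<in> module_support R (homology M d)" "primeideal q R" and reg: "regular_local_ring (ring_at R q)"
    and min: "\<And>p. p \<in> module_support R (homology M d) \<Longrightarrow> height R q \<le> height R p"
    and ad: "adap R M \<theta> d q (carrier M) m n"
  shows "\<exists>c. height R q = enat c \<and> 2 ^ c \<le> n"
proof -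
  interpret dom: domain R by (rule dom)
  interpret q: primeideal q R by (rule q(2))
  let ?Q = "\<theta> -` q"
  obtain c E where c: "height R q = enat c" and E: "finite E" "card E \<le> c" "E \<subseteq> ?Q" "?Q \<subseteq> lhull ?Q (*) (E \<union> ker)"
    using regular_generators[OF presented_axioms q(2) reg] by blast
  have pQ: "is_prime ?Q" by (rule pre_prime[OF q(2)])
  have KQ: "ker \<subseteq> ?Q" by (rule pre_ideal(2)[OF q.is_ideal])
  have prod_ker: "s * t \<in> ker \<longleftrightarrow> s \<in> ker \<or> t \<in> ker" for s t
    unfolding ker_def using dom.integral_iff[of "\<theta> s" "\<theta> t"] by (simp add: th_mult)
  have lK: "lsub ?Q (*) ker"
  proof (rule lsubI)
    note i = is_idealD[OF ker_ideal]
    show "0 \<in> ker" "\<And>x y. x \<in> ker \<Longrightarrow> y \<in> ker \<Longrightarrow> x + y \<in> ker" "\<And>c x. x \<in> ker \<Longrightarrow> c * x \<in> ker" by (fact i(1-3))+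
    show "v \<in> ker" if "u \<notin> ?Q" "u * v \<in> ker" for u v using that prod_ker KQ by blast
  qed
  have fc: "frob_core ker ?Q c E"
    by (intro frob_core.intro th_c2 lK KQ pQ acc_ker[OF noeth] E growth_height[OF noeth q(2) c])
  have dM: "d x \<in> carrier M" if "x \<in> carrier M" for x using df that unfolding differential_module_def by blast
  have dadd: "d (x \<oplus>\<^bsub>M\<^esub> y) = d x \<oplus>\<^bsub>M\<^esub> d y" if "x \<in> carrier M" "y \<in> carrier M" for x y
    using df that unfolding differential_module_def by blast
  have dsm: "d (r \<odot>\<^bsub>M\<^esub> x) = r \<odot>\<^bsub>M\<^esub> d x" if "r \<in> carrier R" "x \<in> carrier M" for r x
    using df that unfolding differential_module_def by blast
  have dd: "d (d x) = \<zero>\<^bsub>M\<^esub>" if "x \<in> carrier M" for x using df that unfolding differential_module_def by blast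
  have d0: "d \<zero>\<^bsub>M\<^esub> = \<zero>\<^bsub>M\<^esub>" using dadd[of "\<zero>\<^bsub>M\<^esub>" "\<zero>\<^bsub>M\<^esub>"] dM[of "\<zero>\<^bsub>M\<^esub>"] by (simp add: M.add.l_cancel_one)
  have rb: "rlocb R M \<theta> q {\<zero>\<^bsub>M\<^esub>} (carrier M) m n UNIV" using ad unfolding adap_def by blast
  have mM: "m i \<in> carrier M" if "i < n" for i using rlocbD(1)[OF rb that] .
  have lM: "l m v n \<in> carrier M" for v by (rule l_closed) (rule mM)
  have zero: "l m v n = \<zero>\<^bsub>M\<^esub> \<longleftrightarrow> v \<in> pw n ker" for v
  proof
    show "v \<in> pw n ker" if z: "l m v n = \<zero>\<^bsub>M\<^esub>" unfolding pw_def ker_def using rlocbD(3)[OF rb, of v] z by simp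
    show "l m v n = \<zero>\<^bsub>M\<^esub>" if "v \<in> pw n ker" by (rule l_ker) (use that mM in \<open>auto simp: pw_def ker_def\<close>)
  qed
  have ladd: "l m (v + w) n = l m v n \<oplus>\<^bsub>M\<^esub> l m w n" for v w
    using l_add[of n m v w, OF mM] unfolding plus_fun_def .
  have lsc: "l m (fsc t v) n = \<theta> t \<odot>\<^bsub>M\<^esub> l m v n" for t v
    using l_smult[of n m t v, OF mM] unfolding fsc_def .

  have "\<exists>\<upsilon> b. \<upsilon> \<notin> ?Q \<and> \<theta> \<upsilon> \<odot>\<^bsub>M\<^esub> d (m j) = l m b j" if j: "j < n" for j
  proof -
    obtain u b where u: "u \<in> carrier R - q" "u \<odot>\<^bsub>M\<^esub> d (m j) = l m b j" using ad j unfolding adap_def by blast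
    obtain \<upsilon> where "\<theta> \<upsilon> = u" using th_surj u(1) by blast
    then show ?thesis using u by blast
  qed
  then have "\<forall>j. \<exists>\<upsilon> b. j < n \<longrightarrow> \<upsilon> \<notin> ?Q \<and> \<theta> \<upsilon> \<odot>\<^bsub>M\<^esub> d (m j) = l m b j" by blast
  then obtain \<upsilon> b where ub: "\<And>j. j < n \<Longrightarrow> \<upsilon> j \<notin> ?Q" "\<And>j. j < n \<Longrightarrow> \<theta> (\<upsilon> j) \<odot>\<^bsub>M\<^esub> d (m j) = l m (b j) j" by metis
  \<comment> \<open>A common denominator of all \<open>d (m j)\<close>. The matrix \<open>a\<close>
    represents \<open>U\<close> times \<open>d\<close>; as \<open>U\<close> is a unit at
    \<open>q\<close>, cycles and boundaries are unchanged after saturation.\<close>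
  define U where "U = (\<Prod>k<n. \<upsilon> k)"
  define a where "a i j = (if i < j then (\<Prod>k\<in>{..<n} - {j}. \<upsilon> k) * b j i else 0)" for i j
  have UQ: "U \<notin> ?Q"
  proof -
    have "k \<le> n \<Longrightarrow> (\<Prod>k<k. \<upsilon> k) \<notin> ?Q" for k
    proof (induction k)
      case 0 then show ?case using is_primeD(5)[OF pQ] by simp
    next
      case (Suc k) then show ?case using is_primeD(6)[OF pQ, of "\<Prod>k<k. \<upsilon> k" "\<upsilon> k"] ub(1)[of k] by simp
    qed
    then show ?thesis unfolding U_def by blast
  qed
  have col: "\<theta> U \<odot>\<^bsub>M\<^esub> d (m j) = l m (\<lambda>i. a i j) n" if j: "j < n" for j
  proof -
    let ?P = "\<Prod>k\<in>{..<n} - {j}. \<upsilon> k"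
    have "U = \<upsilon> j * ?P" unfolding U_def using j by (intro prod.remove) auto
    then have "\<theta> U \<odot>\<^bsub>M\<^esub> d (m j) = \<theta> ?P \<odot>\<^bsub>M\<^esub> (\<theta> (\<upsilon> j) \<odot>\<^bsub>M\<^esub> d (m j))"
      using dM[OF mM[OF j]] by (simp add: th_mult m_comm flip: M.smult_assoc1)
    also have "\<dots> = l m (\<lambda>i. ?P * b j i) j" unfolding ub(2)[OF j] by (rule l_smult[symmetric]) (use mM j in auto)
    also have "\<dots> = l m (\<lambda>i. if i < j then ?P * b j i else 0) n" by (rule l_trunc[symmetric]) (use mM j in auto)
    finally show ?thesis unfolding a_def .
  qed
  have key: "l m (mv a n v) n = \<theta> U \<odot>\<^bsub>M\<^esub> d (l m v n)" for v
  proof -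
    have dm: "d (m i) \<in> carrier M" if "i < n" for i using dM mM that by blast
    have "k \<le> n \<Longrightarrow> \<theta> U \<odot>\<^bsub>M\<^esub> l (\<lambda>i. d (m i)) v k = l m (\<lambda>i. \<Sum>j<k. a i j * v j) n" for k
    proof (induction k)
      case 0
      then show ?case using l_ker[of n m "\<lambda>_. 0"] mM by simp
    next
      case (Suc k)
      have "\<theta> U \<odot>\<^bsub>M\<^esub> (\<theta> (v k) \<odot>\<^bsub>M\<^esub> d (m k)) = \<theta> (v k) \<odot>\<^bsub>M\<^esub> (\<theta> U \<odot>\<^bsub>M\<^esub> d (m k))"
        using Suc.prems dm by (simp add: m_comm flip: M.smult_assoc1)
      also have "\<dots> = l m (\<lambda>i. a i k * v k) n"
        using col[of k] Suc.prems l_smult[of n m "v k" "\<lambda>i. a i k"] mM by (simp add: mult.commute)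
      finally have t: "\<theta> U \<odot>\<^bsub>M\<^esub> (\<theta> (v k) \<odot>\<^bsub>M\<^esub> d (m k)) = l m (\<lambda>i. a i k * v k) n" .
      have "l (\<lambda>i. d (m i)) v k \<in> carrier M" by (rule l_closed) (use dm Suc.prems in auto)
      then have "\<theta> U \<odot>\<^bsub>M\<^esub> l (\<lambda>i. d (m i)) v (Suc k) = l m (\<lambda>i. \<Sum>j<k. a i j * v j) n \<oplus>\<^bsub>M\<^esub> l m (\<lambda>i. a i k * v k) n"
        using Suc t dm by (simp add: M.smult_r_distr)
      also have "\<dots> = l m (\<lambda>i. (\<Sum>j<k. a i j * v j) + a i k * v k) n" by (rule l_add[symmetric]) (rule mM)
      finally show ?case by simp
    qed
    from this[of n] have "\<theta> U \<odot>\<^bsub>M\<^esub> l (\<lambda>i. d (m i)) v n = l m (mv a n v) n" unfolding mv_def by simp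
    moreover have "d (l m v n) = l (\<lambda>i. d (m i)) v n" by (rule l_hom) (use mM d0 dadd dsm in auto)
    ultimately show ?thesis by simp
  qed
  have mvu: "mv a n (unitv j) = (\<lambda>i. a i j)" if "j < n" for j
    unfolding mv_def unitv_def using that by (simp add: if_distrib[of "\<lambda>x. _ * x"] cong: if_cong)
  have sq0: "(\<Sum>l<n. a i l * a l j) \<in> ker" if i: "i < n" and j: "j < n" for i j
  proof -
    have "l m (mv a n (mv a n (unitv j))) n = \<theta> U \<odot>\<^bsub>M\<^esub> d (\<theta> U \<odot>\<^bsub>M\<^esub> d (l m (unitv j) n))" unfolding key ..
    also have "\<dots> = \<zero>\<^bsub>M\<^esub>" using dsm[OF th_closed dM[OF lM]] dd[OF lM] by simp
    finally have "mv a n (mv a n (unitv j)) \<in> pw n ker" unfolding zero .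
    then show ?thesis using i unfolding mvu[OF j] by (simp add: mv_def pw_def)
  qed
  have neg: "\<theta> (- 1) \<odot>\<^bsub>M\<^esub> x = \<ominus>\<^bsub>M\<^esub> x" if "x \<in> carrier M" for x
    using that by (simp add: th_minus th_one M.smult_l_minus)
  interpret D: dmod ker ?Q c E a n
    by (intro dmod.intro dmod_axioms.intro fc sq0) (auto simp: a_def)

  have Zd: "v \<in> D.Z \<longleftrightarrow> \<theta> U \<odot>\<^bsub>M\<^esub> d (l m v n) = \<zero>\<^bsub>M\<^esub>" for v
    unfolding D.Z_def mem_Collect_eq zero[symmetric] key ..
  have Bd: "v \<in> D.Bd \<longleftrightarrow> (\<exists>u. u \<notin> ?Q \<and> \<theta> u \<odot>\<^bsub>M\<^esub> l m v n \<in> d ` carrier M)" for v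
  proof
    assume "v \<in> D.Bd"
    then obtain s x w where s: "s \<notin> ?Q" "x \<in> pw n ker" "fsc s v = x + mv a n w" unfolding D.Bd_def by (blast elim: lsumE)
    have x0: "l m x n = \<zero>\<^bsub>M\<^esub>" using zero s(2) by blast
    have "\<theta> s \<odot>\<^bsub>M\<^esub> l m v n = l m x n \<oplus>\<^bsub>M\<^esub> l m (mv a n w) n" unfolding lsc[symmetric] s(3) by (rule ladd)
    also have "\<dots> = d (\<theta> U \<odot>\<^bsub>M\<^esub> l m w n)" unfolding x0 key dsm[OF th_closed lM] using dM[OF lM] by simp
    finally have "\<theta> s \<odot>\<^bsub>M\<^esub> l m v n = d (\<theta> U \<odot>\<^bsub>M\<^esub> l m w n)" .
    moreover have "\<theta> U \<odot>\<^bsub>M\<^esub> l m w n \<in> carrier M" using lM by simp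
    ultimately have "\<theta> s \<odot>\<^bsub>M\<^esub> l m v n \<in> d ` carrier M" by (rule image_eqI)
    then show "\<exists>u. u \<notin> ?Q \<and> \<theta> u \<odot>\<^bsub>M\<^esub> l m v n \<in> d ` carrier M" using s(1) by blast
  next
    assume "\<exists>u. u \<notin> ?Q \<and> \<theta> u \<odot>\<^bsub>M\<^esub> l m v n \<in> d ` carrier M"
    then obtain u x where u: "u \<notin> ?Q" "x \<in> carrier M" "\<theta> u \<odot>\<^bsub>M\<^esub> l m v n = d x" by blast
    obtain w' w where w': "w' \<in> carrier R - q" "w' \<odot>\<^bsub>M\<^esub> x = l m w n" using rlocb0_span[OF rb order_refl u(2)] by blast
    obtain \<omega> where g: "\<theta> \<omega> = w'" using th_surj w'(1) by blast
    then have wQ: "\<omega> \<notin> ?Q" using w'(1) by blast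
    let ?s = "U * (\<omega> * u)"
    have sQ: "?s \<notin> ?Q" by (intro is_primeD(6)[OF pQ] UQ wQ u(1))
    have "l m (fsc ?s v) n = \<theta> U \<odot>\<^bsub>M\<^esub> (\<theta> \<omega> \<odot>\<^bsub>M\<^esub> (\<theta> u \<odot>\<^bsub>M\<^esub> l m v n))"
      unfolding lsc using lM by (simp add: th_mult M.smult_assoc1)
    also have "\<dots> = \<theta> U \<odot>\<^bsub>M\<^esub> d (l m w n)" unfolding u(3) using dsm[OF th_closed u(2), of \<omega>] w'(2) g by simp
    also have "\<dots> = l m (mv a n w) n" by (rule key[symmetric])
    finally have eq: "l m (fsc ?s v) n = l m (mv a n w) n" .
    let ?x = "fsc ?s v + fsc (- 1) (mv a n w)"
    have "l m ?x n = \<zero>\<^bsub>M\<^esub>" unfolding ladd eq lsc[of "- 1"] neg[OF lM] by (rule M.r_neg[OF lM])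
    then have "?x \<in> pw n ker" unfolding zero .
    moreover have "fsc ?s v = ?x + mv a n w" unfolding fsc_def by (simp add: fun_eq_iff)
    ultimately show "v \<in> D.Bd" unfolding D.Bd_def using lsumI[of ?s ?Q ?x "pw n ker" "mv a n w" "range (mv a n)" fsc v] sQ by blast
  qed

  have ne: "D.Bd \<noteq> D.Z"
  proof -
    obtain z where z: "z \<in> carrier M" "d z = \<zero>\<^bsub>M\<^esub>" "\<And>u. u \<in> carrier R - q \<Longrightarrow> u \<odot>\<^bsub>M\<^esub> z \<notin> d ` carrier M"
      using homology_support[OF df q(2)] q(1) by blast
    obtain w v where w: "w \<in> carrier R - q" "w \<odot>\<^bsub>M\<^esub> z = l m v n" using rlocb0_span[OF rb order_refl z(1)] by blast
    have "d (l m v n) = \<zero>\<^bsub>M\<^esub>" unfolding w(2)[symmetric] using dsm[of w z] w(1) z(1,2) by simp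
    then have "v \<in> D.Z" unfolding Zd by simp
    moreover have "v \<notin> D.Bd"
    proof
      assume "v \<in> D.Bd"
      then obtain u where u: "u \<notin> ?Q" "\<theta> u \<odot>\<^bsub>M\<^esub> l m v n \<in> d ` carrier M" unfolding Bd by blast
      have "(\<theta> u \<otimes> w) \<odot>\<^bsub>M\<^esub> z \<in> d ` carrier M" using u(2) w z(1) by (simp add: M.smult_assoc1)
      moreover have "\<theta> u \<otimes> w \<in> carrier R - q" using q.I_prime[of "\<theta> u" w] u(1) w(1) by auto
      ultimately show False using z(3) by blast
    qed
    ultimately show ?thesis by blast
  qed

  have lI: "lsub ?Q (*) {t. fsc t v \<in> D.Bd}" for v
  proof (rule lsubI)
    note s = lsubD[OF D.lBd]
    show "0 \<in> {t. fsc t v \<in> D.Bd}" using s(1) by (simp add: fsc_def zero_fun_def)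
    show "x + y \<in> {t. fsc t v \<in> D.Bd}" if "x \<in> {t. fsc t v \<in> D.Bd}" "y \<in> {t. fsc t v \<in> D.Bd}" for x y
      using s(2)[of "fsc x v" "fsc y v"] that by (simp add: fsc_def plus_fun_def distrib_right)
    show "r * x \<in> {t. fsc t v \<in> D.Bd}" if "x \<in> {t. fsc t v \<in> D.Bd}" for r x
      using s(3)[of "fsc x v" r] that by (simp add: fsc_def mult.assoc)
    show "w \<in> {t. fsc t v \<in> D.Bd}" if "u \<notin> ?Q" "u * w \<in> {t. fsc t v \<in> D.Bd}" for u w
      using s(4)[OF that(1), of "fsc w v"] that(2) by (simp add: fsc_def mult.assoc)
  qed
  have tor1: "\<exists>s. \<forall>t\<in>?Q. fsc (t ^ 2 ^ s) v \<in> D.Bd" if v: "v \<in> D.Z" for v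
  proof -
    let ?I = "{t. fsc t v \<in> D.Bd}"
    have kI: "ker \<subseteq> ?I"
    proof
      fix t assume "t \<in> ker"
      then have "fsc t v \<in> pw n ker" unfolding pw_def fsc_def using is_idealD(4)[OF ker_ideal] by blast
      then show "t \<in> ?I" using D.O_Bd by blast
    qed
    \<comment> \<open>Let a prime \<open>p\<close> between the annihilator of the class of
      \<open>v\<close> and \<open>Q\<close> be different from \<open>Q\<close>. Its image has
      smaller height, so it is outside the support and some element outside \<open>p\<close> kills
      the class, which contradicts the choice of \<open>p\<close>.\<close>
    have only: "p = ?Q" if p: "is_prime p" "?I \<subseteq> p" "p \<subseteq> ?Q" for p
    proof (rule ccontr)
      assume pn: "p \<noteq> ?Q"
      have kp: "ker \<subseteq> p" using kI p(2) by blast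
      have ip: "is_ideal p" using p(1) unfolding is_prime_def by blast
      note mem = im_mem[OF ip kp]
      have pp: "primeideal (\<theta> ` p) R" by (rule im_prime[OF p(1) kp])
      obtain t where t: "t \<in> ?Q" "t \<notin> p" using p(3) pn by blast
      have "\<theta> ` p \<subset> q" using p(3) t mem[of t] by blast
      from height_less[OF pp q(2) this c] have "\<not> height R q \<le> height R (\<theta> ` p)" unfolding c by simp
      then have ns: "\<theta> ` p \<notin> module_support R (homology M d)" using min by blast
      have z: "\<theta> U \<odot>\<^bsub>M\<^esub> l m v n \<in> carrier M" "d (\<theta> U \<odot>\<^bsub>M\<^esub> l m v n) = \<zero>\<^bsub>M\<^esub>"
        using lM v unfolding Zd dsm[OF th_closed lM] by auto
      obtain u where u: "u \<in> carrier R - \<theta> ` p" "u \<odot>\<^bsub>M\<^esub> (\<theta> U \<odot>\<^bsub>M\<^esub> l m v n) \<in> d ` carrier M"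
        using ns z unfolding homology_support[OF df pp] by blast
      obtain \<mu> where g: "\<theta> \<mu> = u" using th_surj u(1) by blast
      have "\<theta> 1 \<odot>\<^bsub>M\<^esub> l m (fsc (\<mu> * U) v) n \<in> d ` carrier M"
        using u(2) lM unfolding lsc by (simp add: th_one th_mult g M.smult_assoc1 flip: g)
      then have "fsc (\<mu> * U) v \<in> D.Bd" unfolding Bd using is_primeD(5)[OF pQ] by blast
      then have "\<mu> * U \<in> p" using p(2) by blast
      moreover have "\<mu> \<notin> p" "U \<notin> p" using u(1) g mem[of \<mu>] UQ p(3) by auto
      ultimately show False using is_primeD(6)[OF p(1)] by blast
    qed
    from radical_uniform[OF th_c2 acc_ker[OF noeth] pQ lI kI only] show ?thesis by simp
  qed
  \<comment> \<open>The exponent in \<open>tor1\<close> depends on \<open>v\<close>. The cycles for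
    which \<open>s\<close> suffices form increasing submodules, so the chain condition yields one
    exponent for all cycles.\<close>
  define W where "W s = {v \<in> D.Z. \<forall>t\<in>?Q. fsc (t ^ 2 ^ s) v \<in> D.Bd}" for s :: nat
  have lW: "lsub ?Q fsc (W s)" for s
  proof (rule lsubI)
    note B = lsubD[OF D.lBd] and Z = lsubD[OF D.lZ]
    have comm: "fsc r (fsc t v) = fsc t (fsc r v)" for r t and v :: "nat \<Rightarrow> 't" unfolding fsc_def by (simp add: mult.left_commute)
    have "fsc r (0 :: nat \<Rightarrow> 't) = 0" for r unfolding fsc_def by (simp add: zero_fun_def)
    then show "0 \<in> W s" unfolding W_def using B(1) Z(1) by simp
    have "fsc r (x + y) = fsc r x + fsc r y" for r and x y :: "nat \<Rightarrow> 't" unfolding fsc_def by (simp add: plus_fun_def distrib_left)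
    then show "x + y \<in> W s" if "x \<in> W s" "y \<in> W s" for x y using that B(2) Z(2) unfolding W_def by simp
    show "fsc r x \<in> W s" if "x \<in> W s" for r x using that B(3) Z(3) comm[of _ r x] unfolding W_def by simp
    show "v \<in> W s" if u: "u \<notin> ?Q" "fsc u v \<in> W s" for u v
    proof -
      have "v \<in> D.Z" using Z(4)[OF u(1)] u(2) unfolding W_def by blast
      moreover have "fsc (t ^ 2 ^ s) v \<in> D.Bd" if "t \<in> ?Q" for t
        using B(4)[OF u(1), of "fsc (t ^ 2 ^ s) v"] u(2) that unfolding comm[of u] W_def by blast
      ultimately show ?thesis unfolding W_def by blast
    qed
  qed
  have W1: "W s \<in> {N. lsub ?Q fsc N \<and> pw n ker \<subseteq> N}" for s
    using lW[of s] D.O_Bd D.BdZ lsubD(3)[OF D.lBd] unfolding W_def by blast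
  have W2: "W s \<subseteq> W (Suc s)" for s
  proof -
    have "fsc (t ^ 2 ^ Suc s) v = fsc (t ^ 2 ^ s) (fsc (t ^ 2 ^ s) v)" for t and v :: "nat \<Rightarrow> 't"
      unfolding fsc_def by (simp add: power_mult power2_eq_square mult.assoc mult.commute[of 2])
    then show ?thesis using lsubD(3)[OF D.lBd] unfolding W_def by auto
  qed
  obtain s where s: "(\<Union>i. W i) = W s" using acc_union[OF D.accV[of n], of W, OF W1 W2] by blast
  have "v \<in> W s" if "v \<in> D.Z" for v
  proof -
    have "v \<in> (\<Union>i. W i)" using tor1[OF that] that unfolding W_def by blast
    then show ?thesis unfolding s .
  qed
  then have tors: "fsc (t ^ 2 ^ s) v \<in> D.Bd" if "t \<in> ?Q" "v \<in> D.Z" for t v using that unfolding W_def by blast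
  show ?thesis using D.rank_bound[OF tors ne] c by blast
qed

end

theorem theorem1:
  fixes R :: "('a, 'm) ring_scheme" and P :: "('a, 'b, 'n) module_scheme" and d :: "'b \<Rightarrow> 'b"
  assumes "noetherian_domain R" and "regular_ring R" and "ring_char R = 2"
    and "differential_module R P d"
    and "is_bounded_free_complex R P d \<or> has_projective_flag R P d"
    and "carrier (homology P d) \<noteq> {\<zero>\<^bsub>homology P d\<^esub>}"
  shows "\<exists>c. codim R (homology P d) = enat c \<and> module_rank R P \<ge> 2 ^ c"
proof -
  interpret nd: noetherian_domain R by fact
  have P: "module R P" using assms(4) unfolding differential_module_def by blast
  \<comment> \<open>\<open>ring_char\<close> is the order of 1 in the additive group, so the value 2
    makes the double of 1 vanish.\<close>
  have "add_pow R (2::nat) \<one>\<^bsub>R\<^esub> = \<zero>\<^bsub>R\<^esub>"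
    using nd.add.pow_ord_eq_1[of "\<one>\<^bsub>R\<^esub>"] assms(3) unfolding ring_char_def by simp
  then have "\<one>\<^bsub>R\<^esub> \<oplus>\<^bsub>R\<^esub> \<one>\<^bsub>R\<^esub> = \<zero>\<^bsub>R\<^esub>" by (simp add: numeral_2_eq_2)
  then interpret pr: presented R "fev R" by (rule nd.presented_fev)
  interpret pm: presented_module R "fev R" P by (intro presented_module.intro pr.presented_axioms P)
  have dom: "domain R" by (rule nd.domain_axioms)
  have ad: "\<exists>m n. adap R P (fev R) d q (carrier P) m n" if "primeideal q R" for q
    using assms(5) pm.complex_adap[OF that assms(4)] pm.flag_adap[OF dom that] by blast
  let ?S = "module_support R (homology P d)"
  have "height R ` ?S \<noteq> {}" using homology_support_nonempty[OF nd.noetherian_ring_axioms assms(4,6)] by blast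
  \<comment> \<open>An infimum of a nonempty set in \<open>enat\<close> is attained, so the
    codimension is the height of some prime \<open>q\<close> in the support.\<close>
  then have "Inf (height R ` ?S) \<in> height R ` ?S" by (auto simp: Inf_enat_def intro: LeastI)
  then obtain q where q: "q \<in> ?S" "codim R (homology P d) = height R q" unfolding codim_def by auto
  have qp: "primeideal q R" using q(1) unfolding module_support_def by blast
  obtain m n where mn: "adap R P (fev R) d q (carrier P) m n" using ad[OF qp] by blast
  have "\<exists>c. height R q = enat c \<and> 2 ^ c \<le> n"
  proof (rule pm.two_power_le[OF dom nd.noetherian_ring_axioms assms(4) q(1) qp _ _ mn])
    show "regular_local_ring (ring_at R q)" using assms(2) qp unfolding regular_ring_def by blast
    show "height R q \<le> height R p" if "p \<in> ?S" for p unfolding q(2)[symmetric] codim_def using that by (rule INF_lower)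
  qed
  moreover have "module_rank R P = n"
  proof (rule pm.module_rank_eq[OF dom _ qp])
    show "\<exists>m n. rlocb R P (fev R) p {\<zero>\<^bsub>P\<^esub>} (carrier P) m n UNIV" if "primeideal p R" for p
      using ad[OF that] unfolding adap_def by blast
    show "rlocb R P (fev R) q {\<zero>\<^bsub>P\<^esub>} (carrier P) m n UNIV" using mn unfolding adap_def by blast
  qed
  ultimately show ?thesis using q(2) by auto
qed

end
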